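(* The modular curve attached to $\Gamma_0(2)\cap\Gamma(7)$ admits an affine model (in the coordinates $(\psi,\upsilon,t)$) \[ \left\{ \begin{aligned} &2\upsilon(\upsilon-1)t^3-(\upsilon^2-\upsilon-1)t^2-2\upsilon t+\upsilon=0,\\ &\psi^7=\upsilon^4(\upsilon-1). \end{aligned} \right. \] After the change of variable $T=1/t-1$, the first equation becomes \[ T^3+T^2-\frac{\upsilon^2-1}{\upsilon}T+\frac{(\upsilon-1)^2}{\upsilon}=0. \]
   Context: The modular curve attached to a congruence subgroup $G\subset\mathrm{SL}_2(\mathbf Z)$ is the compactified quotient of the upper half-plane by $G$, whose function field over $\mathbf C$ is the field $\mathcal A_0(G)$ of modular functions for $G$. "Affine model" means an affine curve over $\mathbf C$ birational to the modular curve. The coordinates $\psi,\upsilon$ correspond to the modular functions $\psi=-a_2a_3/a_1^2$, $\upsilon=a_2^2a_3/a_1^3$, where $a_k(\tau)=\sum_{n\in\mathbf Z}(-1)^{n+k+1}e^{2\pi i\tau(14n+7-2k)^2/56}$ for $k=1,2,3$; they satisfy $\psi^7=\upsilon^4(\upsilon-1)$ and generate $\mathcal A_0(\Gamma(7))$. *)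

theory Defs
  imports
    "HOL-Complex_Analysis.Complex_Analysis"
    "HOL-Algebra.QuotRing"
    "HOL-Number_Theory.Cong"
begin

definition SL2Z :: "(int^2^2) set" where
  "SL2Z = {A. det A = 1}"

definition principal_Gamma :: "int \<Rightarrow> (int^2^2) set" where
  "principal_Gamma N = {A \<in> SL2Z. [A$1$1 = 1] (mod N) \<and> [A$1$2 = 0] (mod N)
                       \<and> [A$2$1 = 0] (mod N) \<and> [A$2$2 = 1] (mod N)}"

definition Gamma0 :: "int \<Rightarrow> (int^2^2) set" where
  "Gamma0 N = {A \<in> SL2Z. [A$2$1 = 0] (mod N)}"

definition uhp :: "complex set" where
  "uhp = {\<tau>. Im \<tau> > 0}"

definition act :: "int^2^2 \<Rightarrow> complex \<Rightarrow> complex" where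
  "act A = moebius (of_int (A$1$1)) (of_int (A$1$2)) (of_int (A$2$1)) (of_int (A$2$2))"

text \<open>
  A meromorphic function on the upper half-plane is represented by the unique
  HOL function that has value 0 at the poles and off the upper half-plane, and is continuous
  at all other points of the upper half-plane; \<open>uhp_normal\<close> computes this representative.
  With it, equality of HOL functions is equality of meromorphic functions.
\<close>

definition uhp_normal :: "(complex \<Rightarrow> complex) \<Rightarrow> complex \<Rightarrow> complex" where
  "uhp_normal f = (\<lambda>\<tau>. if \<tau> \<in> uhp then remove_sings f \<tau> else 0)"

definition meromorphic_at_i_infinity :: "(complex \<Rightarrow> complex) \<Rightarrow> bool" where
  "meromorphic_at_i_infinity f \<longleftrightarrow>
     (\<exists>h::nat. \<exists>g c. h > 0 \<and> g meromorphic_on {0} \<and>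
        (\<forall>\<tau>\<in>uhp. Im \<tau> > c \<longrightarrow> f \<tau> = g (exp (2 * of_real pi * \<i> * \<tau> / of_nat h))))"

text \<open>Every cusp has the form \<open>\<alpha> \<infinity>\<close> with \<open>\<alpha>\<close> in \<open>SL2Z\<close>.\<close>

definition modular_functions :: "(int^2^2) set \<Rightarrow> (complex \<Rightarrow> complex) set" where
  "modular_functions G = {f. f nicely_meromorphic_on uhp \<and> (\<forall>\<tau>. \<tau> \<notin> uhp \<longrightarrow> f \<tau> = 0)
     \<and> (\<forall>A\<in>G. \<forall>\<tau>\<in>uhp. f (act A \<tau>) = f \<tau>)
     \<and> (\<forall>\<alpha>\<in>SL2Z. meromorphic_at_i_infinity (\<lambda>\<tau>. f (act \<alpha> \<tau>)))}"

definition modular_function_field :: "(int^2^2) set \<Rightarrow> (complex \<Rightarrow> complex) ring" where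
  "modular_function_field G =
     \<lparr>carrier = modular_functions G,
      mult = (\<lambda>f g. uhp_normal (\<lambda>\<tau>. f \<tau> * g \<tau>)),
      one = uhp_normal (\<lambda>_. 1),
      zero = uhp_normal (\<lambda>_. 0),
      add = (\<lambda>f g. uhp_normal (\<lambda>\<tau>. f \<tau> + g \<tau>))\<rparr>"

inductive polyfun :: "(complex^'n \<Rightarrow> complex) \<Rightarrow> bool" where
  const: "polyfun (\<lambda>_. c)"
| coord: "polyfun (\<lambda>x. x $ i)"
| add: "polyfun p \<Longrightarrow> polyfun q \<Longrightarrow> polyfun (\<lambda>x. p x + q x)"
| mult: "polyfun p \<Longrightarrow> polyfun q \<Longrightarrow> polyfun (\<lambda>x. p x * q x)"

definition algebraic_set :: "(complex^'n) set \<Rightarrow> bool" where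
  "algebraic_set V \<longleftrightarrow> (\<exists>S. (\<forall>p\<in>S. polyfun p) \<and> V = {x. \<forall>p\<in>S. p x = 0})"

definition affine_variety :: "(complex^'n) set \<Rightarrow> bool" where
  "affine_variety V \<longleftrightarrow> algebraic_set V \<and> V \<noteq> {} \<and>
     (\<forall>A B. algebraic_set A \<and> algebraic_set B \<and> V = A \<union> B \<longrightarrow> V = A \<or> V = B)"

text \<open>
  The last two conditions say that the maximal length of a chain of irreducible closed subsets
  of \<open>V\<close> is 1.
\<close>

definition affine_curve :: "(complex^'n) set \<Rightarrow> bool" where
  "affine_curve V \<longleftrightarrow> affine_variety V
     \<and> (\<exists>W. affine_variety W \<and> W \<subset> V)
     \<and> \<not> (\<exists>W\<^sub>0 W\<^sub>1. affine_variety W\<^sub>0 \<and> affine_variety W\<^sub>1 \<and> W\<^sub>0 \<subset> W\<^sub>1 \<and> W\<^sub>1 \<subset> V)"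

text \<open>
  The polynomial functions on \<open>V\<close>, that is, polynomials modulo the vanishing ideal of \<open>V\<close>.
\<close>

definition coordinate_ring :: "(complex^'n) set \<Rightarrow> (complex^'n \<Rightarrow> complex) ring" where
  "coordinate_ring V =
     \<lparr>carrier = {restrict p V |p. polyfun p},
      mult = (\<lambda>f g. \<lambda>x\<in>V. f x * g x),
      one = (\<lambda>x\<in>V. 1),
      zero = (\<lambda>x\<in>V. 0),
      add = (\<lambda>f g. \<lambda>x\<in>V. f x + g x)\<rparr>"

text \<open>The field of fractions of an integral domain; \<open>(a, b)\<close> represents \<open>a / b\<close>.\<close>

definition frac_carrier :: "('a, 'm) ring_scheme \<Rightarrow> ('a \<times> 'a) set" where
  "frac_carrier R = carrier R \<times> (carrier R - {\<zero>\<^bsub>R\<^esub>})"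

definition frac_rel :: "('a, 'm) ring_scheme \<Rightarrow> (('a \<times> 'a) \<times> ('a \<times> 'a)) set" where
  "frac_rel R = {((a, b), (c, d)). (a, b) \<in> frac_carrier R \<and> (c, d) \<in> frac_carrier R
                   \<and> a \<otimes>\<^bsub>R\<^esub> d = c \<otimes>\<^bsub>R\<^esub> b}"

definition frac_class :: "('a, 'm) ring_scheme \<Rightarrow> 'a \<Rightarrow> 'a \<Rightarrow> ('a \<times> 'a) set" where
  "frac_class R a b = frac_rel R `` {(a, b)}"

definition fraction_field :: "('a, 'm) ring_scheme \<Rightarrow> ('a \<times> 'a) set ring" where
  "fraction_field R =
     \<lparr>carrier = frac_carrier R // frac_rel R,
      mult = (\<lambda>X Y. \<Union>(a, b)\<in>X. \<Union>(c, d)\<in>Y. frac_class R (a \<otimes>\<^bsub>R\<^esub> c) (b \<otimes>\<^bsub>R\<^esub> d)),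
      one = frac_class R \<one>\<^bsub>R\<^esub> \<one>\<^bsub>R\<^esub>,
      zero = frac_class R \<zero>\<^bsub>R\<^esub> \<one>\<^bsub>R\<^esub>,
      add = (\<lambda>X Y. \<Union>(a, b)\<in>X. \<Union>(c, d)\<in>Y.
               frac_class R (a \<otimes>\<^bsub>R\<^esub> d \<oplus>\<^bsub>R\<^esub> c \<otimes>\<^bsub>R\<^esub> b) (b \<otimes>\<^bsub>R\<^esub> d))\<rparr>"

definition function_field ::
  "(complex^'n) set \<Rightarrow> ((complex^'n \<Rightarrow> complex) \<times> (complex^'n \<Rightarrow> complex)) set ring" where
  "function_field V = fraction_field (coordinate_ring V)"

definition regular_function :: "(complex^'n) set \<Rightarrow> (complex^'n \<Rightarrow> complex) \<Rightarrow>
    ((complex^'n \<Rightarrow> complex) \<times> (complex^'n \<Rightarrow> complex)) set" where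
  "regular_function V p = frac_class (coordinate_ring V) (restrict p V) \<one>\<^bsub>coordinate_ring V\<^esub>"

text \<open>
  \<open>V\<close> is an affine curve birational to the modular curve attached to \<open>G\<close>, that is,
  its function field is isomorphic over the complex numbers to the field of modular functions for
  \<open>G\<close>; the isomorphism takes the \<open>i\<close>-th coordinate function on \<open>V\<close> to the modular function
  \<open>f i\<close>.
\<close>

definition affine_model ::
  "(int^2^2) set \<Rightarrow> ('n \<Rightarrow> complex \<Rightarrow> complex) \<Rightarrow> (complex^'n) set \<Rightarrow> bool" where
  "affine_model G f V \<longleftrightarrow> affine_curve V \<and>
     (\<exists>\<Phi> \<in> ring_iso (function_field V) (modular_function_field G).
        (\<forall>c. \<Phi> (regular_function V (\<lambda>_. c)) = uhp_normal (\<lambda>_. c)) \<and>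
        (\<forall>i. \<Phi> (regular_function V (\<lambda>x. x $ i)) = f i))"

definition theta7 :: "nat \<Rightarrow> complex \<Rightarrow> complex" where
  "theta7 k \<tau> = (\<Sum>\<^sub>\<infinity>n\<in>(UNIV :: int set). (-1) powi (n + int k + 1) *
     exp (2 * of_real pi * \<i> * \<tau> * (of_int (14 * n + 7 - 2 * int k))\<^sup>2 / 56))"

definition psi :: "complex \<Rightarrow> complex" where
  "psi = uhp_normal (\<lambda>\<tau>. - theta7 2 \<tau> * theta7 3 \<tau> / (theta7 1 \<tau>)\<^sup>2)"

definition upsilon :: "complex \<Rightarrow> complex" where
  "upsilon = uhp_normal (\<lambda>\<tau>. (theta7 2 \<tau>)\<^sup>2 * theta7 3 \<tau> / (theta7 1 \<tau>) ^ 3)"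

end

theory Submission
  imports Defs "HOL-Computational_Algebra.Fundamental_Theorem_Algebra"
begin

text \<open>
  The third coordinate is \<open>t = - a\<^sub>1 b\<^sub>1 / (a\<^sub>3 b\<^sub>0)\<close>, where \<open>b\<^sub>k\<close> is \<open>a\<^sub>k\<close> with the argument of the theta function
  shifted by a half-period. A function with the quasi-periods of the odd theta function that vanishes
  at 0 is a multiple of it. This yields Weierstrass' three-term identity, hence both equations of the
  curve, and also the transformation law under \<open>SL2Z\<close>, hence the invariance of \<open>\<psi>\<close>, \<open>\<upsilon>\<close> and \<open>t\<close> and
  their behaviour at the cusps.

  A modular function holomorphic on the upper half-plane and bounded at all cusps is constant. As
  \<open>\<upsilon>\<close> is a function for \<open>\<Gamma>\<^sub>1(7)\<close> with a single simple pole, at \<open>\<infinity>\<close>, every modular function for \<open>\<Gamma>\<^sub>1(7)\<close> is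
  rational in \<open>\<upsilon>\<close>. One descends from \<open>\<Gamma>(7)\<close> to \<open>\<Gamma>\<^sub>1(7)\<close> by splitting into eigenfunctions of \<open>\<tau> \<mapsto> \<tau> + 1\<close>
  and dividing by powers of \<open>\<psi>\<close>, and from \<open>\<Gamma>\<^sub>0(2) \<inter> \<Gamma>(7)\<close> to \<open>\<Gamma>(7)\<close> by traces over the three cosets,
  using that the conjugates of \<open>t\<close> are the three distinct roots of the cubic. Poles in the upper
  half-plane are cleared beforehand by a polynomial in \<open>\<upsilon>\<close>.

  The same boundedness argument shows that \<open>\<upsilon>\<close> omits only finitely many values, so
  \<open>(\<psi>, \<upsilon>, t)\<close> maps the upper half-plane onto the curve up to finitely many points. The curve has no
  isolated points, so a polynomial vanishes on it as soon as it vanishes along this map. This gives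
  irreducibility and identifies the function field with the field of modular functions.
\<close>

subsection \<open>The theta function\<close>

text \<open>All coordinates are quotients of Klein forms \<open>kf\<close>, theta functions
  multiplied by an exponential that makes the modular group act linearly on the characteristic (r,
  s). The automorphy factor is then the same for all characteristics and cancels in every quotient
  with equally many factors above and below, so neither weights nor eta multipliers are computed.
  The roots of unity that remain are awkward for the third coordinate and are avoided there: its
  multiplier is a constant of modulus 1, both t and that multiple of t solve the same cubic, and the
  cubic has only one root of limiting modulus 1/2 at \<infinity>. The same asymptotics separate the
  conjugates of t, with limit 1/2 for t itself and 0 after a matrix of \<Gamma>(7) with odd lower
  left entry. The cubic has leading coefficient 2\<upsilon>(\<upsilon> - 1), so a root escapes over
  \<upsilon> = 0 and \<upsilon> = 1, and nearby points of the curve cannot be found there from a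
  monic equation in t. The substitution T = 1/t - 1 of the statement, and 1/T, supply monic
  equations at these two values.\<close>

lemma summable_on_int_power_abs:
  fixes x :: real
  assumes "0 \<le> x" "x < 1"
  shows "(\<lambda>n::int. x ^ nat \<bar>n\<bar>) summable_on UNIV"
proof -
  have geo: "(\<lambda>n::nat. x ^ n) summable_on UNIV"
    using assms by (intro norm_summable_imp_summable_on) (simp add: summable_geometric)
  have U: "(UNIV::int set) = range int \<union> range (\<lambda>n. - int (Suc n))"
  proof -
    have "n \<in> range int \<union> range (\<lambda>n. - int (Suc n))" for n :: int
      by (cases n) (auto simp del: of_nat_Suc)
    thus ?thesis by auto
  qed
  have 1: "(\<lambda>n::int. x ^ nat \<bar>n\<bar>) summable_on range int"
    by (subst summable_on_reindex) (use geo in \<open>auto simp: o_def\<close>)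
  have "(\<lambda>n::nat. x * x ^ n) summable_on UNIV"
    using geo by (rule summable_on_cmult_right)
  hence 2: "(\<lambda>n::int. x ^ nat \<bar>n\<bar>) summable_on range (\<lambda>n. - int (Suc n))"
    by (subst summable_on_reindex) (auto simp: o_def inj_on_def nat_add_distrib add.commute)
  show ?thesis
    unfolding U by (rule summable_on_union[OF 1 2])
qed

lemma summable_on_int_gauss:
  fixes \<delta> B :: real
  assumes "\<delta> > 0"
  shows "(\<lambda>n::int. exp (B * \<bar>of_int n\<bar> - \<delta> * (of_int n)\<^sup>2)) summable_on UNIV"
proof (rule summable_on_comparison_test)
  \<comment> \<open>Completing the square bounds (B + 1) x - \<delta> x^2 by (B + 1)^2 / (4
    \<delta>), which leaves the geometric factor exp (- x).\<close>
  define C where "C = exp ((B + 1)\<^sup>2 / (4 * \<delta>))"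
  show "(\<lambda>n::int. C * exp (-1) ^ nat \<bar>n\<bar>) summable_on UNIV"
    by (intro summable_on_cmult_right summable_on_int_power_abs) auto
  fix n :: int
  define x where "x = \<bar>real_of_int n\<bar>"
  have "\<delta> * (x - (B + 1) / (2 * \<delta>))\<^sup>2 \<ge> 0" using assms by simp
  also have "\<delta> * (x - (B + 1) / (2 * \<delta>))\<^sup>2 = \<delta> * x\<^sup>2 - (B + 1) * x + (B + 1)\<^sup>2 / (4 * \<delta>)"
    using assms by (simp add: power2_eq_square field_simps)
  finally have "B * x - \<delta> * x\<^sup>2 \<le> (B + 1)\<^sup>2 / (4 * \<delta>) - x" by (simp add: algebra_simps)
  hence "exp (B * x - \<delta> * x\<^sup>2) \<le> C * exp (- x)"
    by (simp add: C_def flip: exp_add)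
  also have "exp (-x) = exp (-1) ^ nat \<bar>n\<bar>"
    by (simp add: x_def flip: exp_of_nat_mult)
  finally show "exp (B * \<bar>of_int n\<bar> - \<delta> * (of_int n)\<^sup>2) \<le> C * exp (-1) ^ nat \<bar>n\<bar>"
    by (simp add: x_def)
qed auto

text \<open>Sums over the integers are unordered, so the limit runs over the net of finite subsets.
  On each small disc the M-test gives uniform convergence, and a uniform limit of holomorphic
  partial sums is holomorphic. The majorant may depend on the disc.\<close>

lemma holomorphic_on_infsum:
  fixes f :: "'a \<Rightarrow> complex \<Rightarrow> complex"
  assumes S: "open S" and hol: "\<And>n. n \<in> I \<Longrightarrow> f n holomorphic_on S"
    and bound: "\<And>z. z \<in> S \<Longrightarrow> \<exists>r>0. \<exists>M. cball z r \<subseteq> S \<and> M summable_on I \<and>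
                 (\<forall>n\<in>I. \<forall>w\<in>cball z r. norm (f n w) \<le> M n)"
  shows "(\<lambda>z. \<Sum>\<^sub>\<infinity>n\<in>I. f n z) holomorphic_on S"
proof -
  have "(\<lambda>z. \<Sum>\<^sub>\<infinity>n\<in>I. f n z) field_differentiable at z" if "z \<in> S" for z
  proof -
    from bound[OF that] obtain r M where r: "r > 0" "cball z r \<subseteq> S" "M summable_on I"
      and M: "\<And>n w. n \<in> I \<Longrightarrow> w \<in> cball z r \<Longrightarrow> norm (f n w) \<le> M n" by blast
    have ul: "uniform_limit (cball z r) (\<lambda>X y. \<Sum>x\<in>X. f x y) (\<lambda>y. \<Sum>\<^sub>\<infinity>x\<in>I. f x y)
                 (finite_subsets_at_top I)"
      by (rule Weierstrass_m_test_general[of I "cball z r" f M]) (use M r in auto)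
    have ev: "eventually (\<lambda>X. continuous_on (cball z r) (\<lambda>y. \<Sum>x\<in>X. f x y) \<and>
                (\<lambda>y. \<Sum>x\<in>X. f x y) holomorphic_on ball z r) (finite_subsets_at_top I)"
    proof (rule eventually_finite_subsets_at_top_weakI)
      fix X assume X: "finite X" "X \<subseteq> I"
      have "(\<lambda>y. \<Sum>x\<in>X. f x y) holomorphic_on cball z r"
        by (intro holomorphic_on_sum holomorphic_on_subset[OF hol r(2)]) (use X in auto)
      thus "continuous_on (cball z r) (\<lambda>y. \<Sum>x\<in>X. f x y) \<and>
             (\<lambda>y. \<Sum>x\<in>X. f x y) holomorphic_on ball z r"
        using holomorphic_on_imp_continuous_on holomorphic_on_subset ball_subset_cball by blast
    qed
    have "(\<lambda>y. \<Sum>\<^sub>\<infinity>x\<in>I. f x y) holomorphic_on ball z r"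
      by (rule holomorphic_uniform_limit[OF ev ul]) auto
    thus ?thesis using r(1)
      by (meson centre_in_ball holomorphic_on_imp_differentiable_at open_ball)
  qed
  thus ?thesis
    by (simp add: field_differentiable_at_within holomorphic_on_def)
qed

section \<open>Jacobi's odd theta function\<close>

text \<open>Jacobi's theta_1 up to the factor \<i>, with the argument scaled so that the zeros are
  the points of the lattice generated by 1 and \<tau>.\<close>

definition jtheta :: "complex \<Rightarrow> complex \<Rightarrow> complex" where
  "jtheta z \<tau> = (\<Sum>\<^sub>\<infinity>n\<in>(UNIV :: int set). (-1) powi n *
     exp (pi * \<i> * \<tau> * (of_int n + 1/2)\<^sup>2 + 2 * pi * \<i> * (of_int n + 1/2) * z))"

lemma norm_minus_one_powi [simp]: "norm ((-1 :: complex) powi n) = 1"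
  by (simp add: norm_power_int)

text \<open>The majorant depends on z and \<tau> only through R and y. It serves for uniform
  convergence on discs and, with z = 0, for the size of the Laurent coefficients.\<close>

lemma jtheta_term_bound:
  assumes \<tau>: "Im \<tau> \<ge> y" "y > 0" and z: "norm z \<le> R"
  shows "norm ((-1) powi n * exp (pi * \<i> * \<tau> * (of_int n + 1/2)\<^sup>2 + 2 * pi * \<i> * (of_int n + 1/2) * z))
         \<le> exp (pi * R) * exp ((2 * pi * R + pi * y) * \<bar>of_int n\<bar> - pi * y * (of_int n)\<^sup>2)"
proof -
  define m where "m = real_of_int n + 1/2"
  have m: "(complex_of_int n + 1/2) = complex_of_real m" by (simp add: m_def)
  have "norm ((-1) powi n * exp (pi * \<i> * \<tau> * (of_int n + 1/2)\<^sup>2 + 2 * pi * \<i> * (of_int n + 1/2) * z))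
        = exp (- pi * Im \<tau> * m\<^sup>2 - 2 * pi * m * Im z)"
    by (simp add: norm_mult m norm_exp_eq_Re flip: of_real_power)
  also have "- pi * Im \<tau> * m\<^sup>2 - 2 * pi * m * Im z \<le> pi * R + ((2 * pi * R + pi * y) * \<bar>of_int n\<bar> - pi * y * (of_int n)\<^sup>2)"
  proof -
    have R: "R \<ge> 0" using z norm_ge_zero order_trans by blast
    have "- (m * Im z) \<le> \<bar>m\<bar> * \<bar>Im z\<bar>" by (metis abs_mult abs_ge_minus_self)
    also have "\<dots> \<le> \<bar>m\<bar> * R"
      by (intro mult_left_mono) (use z abs_Im_le_cmod[of z] in auto)
    also have "\<dots> \<le> (\<bar>of_int n\<bar> + 1/2) * R"
      by (intro mult_right_mono) (use R in \<open>auto simp: m_def\<close>)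
    finally have 1: "- (m * Im z) \<le> (\<bar>of_int n\<bar> + 1/2) * R" .
    have "m\<^sup>2 = (of_int n)\<^sup>2 + of_int n + 1/4" by (simp add: m_def power2_eq_square algebra_simps)
    also have "\<dots> \<ge> (of_int n)\<^sup>2 - \<bar>of_int n\<bar>" by linarith
    finally have "y * m\<^sup>2 \<ge> y * ((of_int n)\<^sup>2 - \<bar>of_int n\<bar>)" using \<tau> by (intro mult_left_mono) auto
    moreover have "Im \<tau> * m\<^sup>2 \<ge> y * m\<^sup>2" using \<tau> by (intro mult_right_mono) auto
    ultimately have "- (Im \<tau> * m\<^sup>2) - 2 * (m * Im z) \<le>
        R + ((2 * R + y) * \<bar>of_int n\<bar> - y * (of_int n)\<^sup>2)"
      using 1 by (simp add: algebra_simps)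
    hence "pi * (- (Im \<tau> * m\<^sup>2) - 2 * (m * Im z)) \<le> pi * (R + ((2 * R + y) * \<bar>of_int n\<bar> - y * (of_int n)\<^sup>2))"
      by (intro mult_left_mono) auto
    thus ?thesis by (simp add: algebra_simps)
  qed
  finally show ?thesis by (simp add: exp_add)
qed

lemma jtheta_majorant:
  assumes "y > (0::real)"
  shows "(\<lambda>n::int. exp (pi * R) * exp ((2 * pi * R + pi * y) * \<bar>of_int n\<bar> - pi * y * (of_int n)\<^sup>2)) summable_on UNIV"
  by (intro summable_on_cmult_right summable_on_int_gauss) (use assms in auto)

lemma jtheta_summable:
  assumes "Im \<tau> > 0"
  shows "(\<lambda>n::int. (-1) powi n * exp (pi * \<i> * \<tau> * (of_int n + 1/2)\<^sup>2 + 2 * pi * \<i> * (of_int n + 1/2) * z)) summable_on UNIV"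
proof (rule abs_summable_summable, rule summable_on_comparison_test)
  show "(\<lambda>n::int. exp (pi * norm z) * exp ((2 * pi * norm z + pi * Im \<tau>) * \<bar>of_int n\<bar> - pi * Im \<tau> * (of_int n)\<^sup>2)) summable_on UNIV"
    by (rule jtheta_majorant[OF assms])
qed (rule jtheta_term_bound, use assms in auto)

lemma jtheta_holomorphic:
  assumes "Im \<tau> > 0"
  shows "(\<lambda>z. jtheta z \<tau>) holomorphic_on A"
proof -
  have "(\<lambda>z. jtheta z \<tau>) holomorphic_on UNIV"
    unfolding jtheta_def
  proof (rule holomorphic_on_infsum)
    fix z :: complex
    have "\<forall>n::int. \<forall>w\<in>cball z 1. norm ((-1) powi n * exp (pi * \<i> * \<tau> * (of_int n + 1/2)\<^sup>2 + 2 * pi * \<i> * (of_int n + 1/2) * w))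
         \<le> exp (pi * (norm z + 1)) * exp ((2 * pi * (norm z + 1) + pi * Im \<tau>) * \<bar>of_int n\<bar> - pi * Im \<tau> * (of_int n)\<^sup>2)"
    proof (intro allI ballI jtheta_term_bound)
      fix w assume "w \<in> cball z 1"
      thus "norm w \<le> norm z + 1"
        using norm_triangle_ineq2[of w z] by (simp add: dist_norm norm_minus_commute)
    qed (use assms in auto)
    with jtheta_majorant[OF assms]
    show "\<exists>r>0. \<exists>M. cball z r \<subseteq> UNIV \<and> M summable_on UNIV \<and>
         (\<forall>n\<in>(UNIV::int set). \<forall>w\<in>cball z r. norm ((-1) powi n * exp (pi * \<i> * \<tau> * (of_int n + 1/2)\<^sup>2 + 2 * pi * \<i> * (of_int n + 1/2) * w)) \<le> M n)"
      by (intro exI[of _ 1] conjI exI) (auto intro: zero_less_one)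
  qed (auto intro!: holomorphic_intros)
  thus ?thesis using holomorphic_on_subset by blast
qed

lemma jtheta_uminus: "jtheta (-z) \<tau> = - jtheta z \<tau>"
proof -
  define f where "f = (\<lambda>n::int. (-1) powi n * exp (pi * \<i> * \<tau> * (of_int n + 1/2)\<^sup>2 + 2 * pi * \<i> * (of_int n + 1/2) * z))"
  have "jtheta (-z) \<tau> = (\<Sum>\<^sub>\<infinity>n. - f n)"
    unfolding jtheta_def
  \<comment> \<open>The reflection n -> -1 - n negates n + 1/2 and changes the parity of n.\<close>
  proof (rule infsum_reindex_bij_witness[of _ "\<lambda>n. -1 - n" "\<lambda>n. -1 - n"])
    fix n :: int
    have "(-1 :: complex) powi (-1 - n) = - ((-1) powi n)"
      by (simp add: power_int_diff power_int_minus field_simps flip: power_int_minus_one_mult_self)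
    moreover have "(complex_of_int (- 1 - n) + 1 / 2) = - (of_int n + 1/2)" by simp
    ultimately show "- f (-1 - n) = (-1) powi n * exp (pi * \<i> * \<tau> * (of_int n + 1/2)\<^sup>2 + 2 * pi * \<i> * (of_int n + 1/2) * (-z))"
      by (simp only: f_def power2_minus) (simp add: algebra_simps)
  qed auto
  also have "\<dots> = - jtheta z \<tau>"
    by (simp add: infsum_uminus jtheta_def f_def)
  finally show ?thesis .
qed

lemma jtheta_0 [simp]: "jtheta 0 \<tau> = 0"
  using jtheta_uminus[of 0 \<tau>] by simp

lemma exp_pi_i_int: "exp (pi * \<i> * of_int n) = (-1) powi n"
  by (metis exp_pi_i exp_power_int mult.commute)

text \<open>Shifting the summation index by n completes the square in the exponent; what is left
  over is independent of the index, apart from signs.\<close>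

lemma jtheta_add_lattice:
  "jtheta (z + of_int m + of_int n * \<tau>) \<tau> =
     (-1) powi (m + n) * exp (- pi * \<i> * of_int n ^ 2 * \<tau> - 2 * pi * \<i> * of_int n * z) * jtheta z \<tau>"
proof -
  define c where "c = (-1) powi (m + n) * exp (- pi * \<i> * of_int n ^ 2 * \<tau> - 2 * pi * \<i> * of_int n * z)"
  define f where "f = (\<lambda>k::int. (-1) powi k * exp (pi * \<i> * \<tau> * (of_int k + 1/2)\<^sup>2 + 2 * pi * \<i> * (of_int k + 1/2) * z))"
  have "jtheta (z + of_int m + of_int n * \<tau>) \<tau> = (\<Sum>\<^sub>\<infinity>k. c * f k)"
    unfolding jtheta_def
  proof (rule infsum_reindex_bij_witness[of _ "\<lambda>k. k - n" "\<lambda>k. k + n"])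
    fix k :: int
    have "c * f (k + n) = ((-1) powi (m + n) * (-1) powi (k + n)) *
        exp (- pi * \<i> * of_int n ^ 2 * \<tau> - 2 * pi * \<i> * of_int n * z + 
             (pi * \<i> * \<tau> * (of_int (k + n) + 1/2)\<^sup>2 + 2 * pi * \<i> * (of_int (k + n) + 1/2) * z))"
      by (simp add: c_def f_def exp_add)
    also have "((-1) powi (m + n) * (-1) powi (k + n)) = (-1 :: complex) powi k * (-1) powi m"
    proof -
      have "(-1 :: complex) powi (m + n) * (-1) powi (k + n) = (-1) powi k * (-1) powi m * ((-1) powi n * (-1) powi n)"
        by (simp add: power_int_add)
      thus ?thesis by (simp add: power_int_minus_one_mult_self)
    qed
    also have "(- pi * \<i> * of_int n ^ 2 * \<tau> - 2 * pi * \<i> * of_int n * z + 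
             (pi * \<i> * \<tau> * (of_int (k + n) + 1/2)\<^sup>2 + 2 * pi * \<i> * (of_int (k + n) + 1/2) * z)) =
          pi * \<i> * \<tau> * (of_int k + 1/2)\<^sup>2 + 2 * pi * \<i> * (of_int k + 1/2) * (z + of_int m + of_int n * \<tau>)
          + pi * \<i> * of_int (- (2 * k * m)) + pi * \<i> * of_int (- m)"
      by (simp add: power2_eq_square field_simps)
    also have "exp \<dots> = exp (pi * \<i> * \<tau> * (of_int k + 1/2)\<^sup>2 + 2 * pi * \<i> * (of_int k + 1/2) * (z + of_int m + of_int n * \<tau>))
         * (-1) powi (- (2 * k * m)) * (-1) powi (- m)"
      by (simp only: exp_add exp_pi_i_int)
    also have "(-1 :: complex) powi (- (2 * k * m)) = 1"
      by (simp add: power_int_minus power_int_mult mult.assoc)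
    also have "(-1 :: complex) powi (- m) = (-1) powi m"
      by (simp add: power_int_minus_one_minus)
    finally show "c * f (k + n) = (-1) powi k * exp (pi * \<i> * \<tau> * (of_int k + 1/2)\<^sup>2 + 2 * pi * \<i> * (of_int k + 1/2) * (z + of_int m + of_int n * \<tau>))"
      by (simp add: mult_ac power_int_minus_one_mult_self)
  qed auto
  also have "\<dots> = c * jtheta z \<tau>"
    by (simp add: infsum_cmult_right' jtheta_def f_def)
  finally show ?thesis by (simp add: c_def)
qed

section \<open>Entire functions with the quasi-periods of theta\<close>

text \<open>These are the multipliers of \<open>jtheta\<close>, so the quotient of two such
  functions is elliptic.\<close>

definition theta_like :: "complex \<Rightarrow> (complex \<Rightarrow> complex) \<Rightarrow> bool" where
  "theta_like \<tau> f \<longleftrightarrow> f holomorphic_on UNIV \<and> (\<forall>z. f (z + 1) = - f z) \<and>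
     (\<forall>z. f (z + \<tau>) = - exp (- pi * \<i> * \<tau> - 2 * pi * \<i> * z) * f z)"

text \<open>The codomain is arbitrary so that F may be a predicate: where the multipliers have no
  zeros, the property of vanishing is periodic although the function is only quasi-periodic.\<close>

lemma periodic_int_multiple:
  fixes F :: "complex \<Rightarrow> 'a"
  assumes "\<And>z. F (z + w) = F z"
  shows "F (z + of_int m * w) = F z"
proof -
  have nat: "F (z + of_nat k * w) = F z" for k z
  proof (induction k)
    case (Suc k)
    have "F (z + of_nat (Suc k) * w) = F ((z + of_nat k * w) + w)" by (simp add: algebra_simps)
    thus ?case using Suc assms by simp
  qed auto
  show ?thesis
  proof (cases "m \<ge> 0")
    case True
    then obtain k where "m = int k" using nonneg_int_cases by blast
    thus ?thesis using nat by simp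
  next
    case False
    then obtain k where k: "m = - int k" by (metis int_cases2 nat_le_linear of_nat_0_le_iff)
    have "F (z + of_int m * w) = F ((z + of_int m * w) + of_nat k * w)" by (rule nat[symmetric])
    thus ?thesis using k by simp
  qed
qed

lemma periodic_lattice:
  fixes F :: "complex \<Rightarrow> 'a"
  assumes "\<And>z. F (z + 1) = F z" "\<And>z. F (z + \<tau>) = F z"
  shows "F (z + of_int m + of_int n * \<tau>) = F z"
  using periodic_int_multiple[of F 1 z m] periodic_int_multiple[of F \<tau> "z + of_int m" n] assms by simp

lemma theta_like_zero_lattice:
  assumes "theta_like \<tau> f" "f 0 = 0"
  shows "f (of_int m + of_int n * \<tau>) = 0"
  using periodic_lattice[of "\<lambda>z. f z = 0" \<tau> 0 m n] assms unfolding theta_like_def by simp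

lemma lattice_reduce:
  assumes "Im \<tau> > 0"
  obtains m n :: int and s t :: real where "z = of_real s + of_real t * \<tau> + of_int m + of_int n * \<tau>"
    "s \<in> {0..1}" "t \<in> {0..1}"
proof -
  define t0 where "t0 = Im z / Im \<tau>"
  define s0 where "s0 = Re z - t0 * Re \<tau>"
  have "z = of_real s0 + of_real t0 * \<tau>"
    using assms by (simp add: complex_eq_iff s0_def t0_def)
  hence "z = of_real (frac s0) + of_real (frac t0) * \<tau> + of_int \<lfloor>s0\<rfloor> + of_int \<lfloor>t0\<rfloor> * \<tau>"
    by (simp add: frac_def algebra_simps)
  thus ?thesis
    by (rule that) (auto simp: frac_lt_1 less_imp_le)
qed

lemma entire_elliptic_constant:
  assumes \<tau>: "Im \<tau> > 0" and h: "h holomorphic_on UNIV"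
    and per: "\<And>z. h (z + 1) = h z" "\<And>z. h (z + \<tau>) = h z"
  shows "\<exists>c. \<forall>z. h z = c"
proof -
  define K where "K = (\<lambda>(s, t). complex_of_real s + of_real t * \<tau>) ` ({0..1} \<times> {0..1})"
  have "compact K"
    unfolding K_def case_prod_unfold
    by (intro compact_continuous_image compact_Times continuous_intros) auto
  moreover have "continuous_on K h"
    using h holomorphic_on_imp_continuous_on continuous_on_subset by blast
  ultimately have "bounded (h ` K)"
    by (intro compact_imp_bounded compact_continuous_image)
  moreover have "range h \<subseteq> h ` K"
  proof safe
    fix z
    obtain m n s t where z: "z = of_real s + of_real t * \<tau> + of_int m + of_int n * \<tau>"
      "s \<in> {0..1}" "t \<in> {0..1}" by (rule lattice_reduce[OF \<tau>])
    have "h z = h (of_real s + of_real t * \<tau>)"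
      unfolding z(1) using per by (rule periodic_lattice)
    moreover have "of_real s + of_real t * \<tau> \<in> K" using z by (auto simp: K_def)
    ultimately show "h z \<in> h ` K" by auto
  qed
  ultimately have "bounded (range h)" using bounded_subset by blast
  hence "h constant_on UNIV" using Liouville_theorem[OF h] by blast
  thus ?thesis by (auto simp: constant_on_def)
qed

text \<open>Removing the singularities yields an entire elliptic function. The conclusion is
  restricted to points of analyticity because at a removable singularity a quotient has the default
  value of division by zero, not its limit.\<close>

lemma elliptic_limits_constant:
  assumes \<tau>: "Im \<tau> > 0" and mero: "F meromorphic_on UNIV"
    and per: "\<And>z. F (z + 1) = F z" "\<And>z. F (z + \<tau>) = F z"
    and lim: "\<And>z. \<exists>c. F \<midarrow>z\<rightarrow> c"
  shows "\<exists>c. \<forall>z. F analytic_on {z} \<longrightarrow> F z = c"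
proof -
  define h where "h = remove_sings F"
  have "h analytic_on {z}" for z
  proof -
    have "isolated_singularity_at F z"
      using meromorphic_on_isolated_singularity meromorphic_on_subset[OF mero] by blast
    with lim[of z] show ?thesis
      using remove_sings_analytic_at unfolding h_def by blast
  qed
  hence "h analytic_on UNIV" using analytic_on_analytic_at by blast
  hence hol: "h holomorphic_on UNIV" by (rule analytic_imp_holomorphic)
  have shift: "h (z + w) = h z" if "\<And>z. F (z + w) = F z" for z w
  proof -
    have "filtermap (\<lambda>x. x + w) (at z) = at (z + w)" by (rule filtermap_at_shift[of "-w" z, simplified])
    from remove_sings_compose[OF this, of F] show ?thesis
      using that by (simp add: o_def h_def)
  qed
  obtain c where "\<And>z. h z = c"
    using entire_elliptic_constant[OF \<tau> hol shift shift] per by metis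
  thus ?thesis unfolding h_def by (metis remove_sings_at_analytic)
qed

lemma limit_at_lattice:
  fixes F :: "complex \<Rightarrow> complex"
  assumes per: "\<And>z. F (z + 1) = F z" "\<And>z. F (z + \<tau>) = F z" and lim0: "F \<midarrow>0\<rightarrow> L"
  shows "F \<midarrow>of_int m + of_int n * \<tau>\<rightarrow> L"
proof -
  define z where "z = of_int m + of_int n * \<tau>"
  have "F = (\<lambda>w. F (w + (- z)))"
    using periodic_lattice[of F \<tau>, OF per, of _ "-m" "-n"] by (auto simp: z_def algebra_simps)
  moreover have "(\<lambda>w. F (w + (- z))) \<midarrow>0 - (- z)\<rightarrow> L"
    by (rule LIM_offset[OF lim0])
  ultimately show ?thesis unfolding z_def by (simp add: add.commute)
qed

lemma analytic_at_has_limit: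
  assumes "F analytic_on {z}"
  shows "\<exists>c. F \<midarrow>z\<rightarrow> c"
  using assms analytic_at_imp_isCont isCont_def by blast

text \<open>The quotient f / p is elliptic. Its only possible singularities are lattice points,
  where the zero of f cancels the simple zero of p and the limit is the quotient of the
  derivatives.\<close>

lemma theta_like_unique:
  assumes \<tau>: "Im \<tau> > 0" and f: "theta_like \<tau> f" "f 0 = 0"
    and p: "theta_like \<tau> p" "p 0 = 0" "deriv p 0 \<noteq> 0"
    and zeros: "\<And>z. p z = 0 \<Longrightarrow> \<exists>m n :: int. z = of_int m + of_int n * \<tau>"
  shows "\<exists>c. \<forall>z. f z = c * p z"
proof -
  define F where "F = (\<lambda>z. f z / p z)"
  have hf: "f holomorphic_on UNIV" and hp: "p holomorphic_on UNIV"
    using f p by (auto simp: theta_like_def)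
  have ana: "f analytic_on A" "p analytic_on A" for A
    using hf hp analytic_on_subset[of _ UNIV A] by (auto simp: analytic_on_open)
  have per: "F (z + 1) = F z" "F (z + \<tau>) = F z" for z
    using f p by (auto simp: F_def theta_like_def)
  have mero: "F meromorphic_on UNIV"
    unfolding F_def by (intro meromorphic_intros analytic_on_imp_meromorphic_on ana)
  have lim0: "F \<midarrow>0\<rightarrow> deriv f 0 / deriv p 0"
  proof -
    have "(\<lambda>z. (f z / z) / (p z / z)) \<midarrow>0\<rightarrow> deriv f 0 / deriv p 0"
    proof (intro tendsto_divide)
      have "(f has_field_derivative deriv f 0) (at 0)" "(p has_field_derivative deriv p 0) (at 0)"
        using hf hp by (auto intro!: holomorphic_derivI[of _ UNIV])
      thus "(\<lambda>z. f z / z) \<midarrow>0\<rightarrow> deriv f 0" "(\<lambda>z. p z / z) \<midarrow>0\<rightarrow> deriv p 0"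
        using f p by (simp_all add: DERIV_def)
    qed (use p in auto)
    moreover have "eventually (\<lambda>z. (f z / z) / (p z / z) = F z) (at 0)"
      by (auto simp: F_def eventually_at intro!: exI[of _ 1])
    ultimately show ?thesis using tendsto_cong by force
  qed
  have ana': "F analytic_on {z}" if "p z \<noteq> 0" for z
    unfolding F_def by (intro analytic_on_divide ana) (use that in auto)
  have lim: "\<exists>c. F \<midarrow>z\<rightarrow> c" for z
    using zeros[of z] limit_at_lattice[of F, OF per lim0] analytic_at_has_limit[OF ana'] by blast
  obtain c where c: "\<And>z. F analytic_on {z} \<Longrightarrow> F z = c"
    using elliptic_limits_constant[OF \<tau> mero per lim] by blast
  have "f z = c * p z" for z
  proof (cases "p z = 0")
    case True
    then obtain m n :: int where "z = of_int m + of_int n * \<tau>" using zeros by blast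
    thus ?thesis using theta_like_zero_lattice[OF f, of m n] True by simp
  next
    case False
    thus ?thesis using c[OF ana'[OF False]] by (simp add: F_def field_simps)
  qed
  thus ?thesis by blast
qed

text \<open>Euler's expansion of \<open>\<Prod>n\<ge>1. (1 - q ^ n * w)\<close>; only its functional equation is needed.\<close>

primrec euler_coeff :: "complex \<Rightarrow> nat \<Rightarrow> complex" where
  "euler_coeff q 0 = 1"
| "euler_coeff q (Suc n) = - (q ^ Suc n) / (1 - q ^ Suc n) * euler_coeff q n"

definition euler_series :: "complex \<Rightarrow> complex \<Rightarrow> complex" where
  "euler_series q w = (\<Sum>n. euler_coeff q n * w ^ n)"

lemma one_minus_power_nz:
  assumes "norm (q::complex) < 1" "n > 0"
  shows "1 - q ^ n \<noteq> 0"
proof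
  assume "1 - q ^ n = 0"
  hence "norm q ^ n = 1" by (metis eq_iff_diff_eq_0 norm_one norm_power)
  thus False using assms
    by (metis norm_ge_zero power_less_one_iff less_irrefl)
qed

text \<open>Successive coefficients differ by a factor that tends to 0 like q ^ n, so the ratio test
  gives convergence for every w.\<close>

lemma euler_series_summable:
  assumes "norm q < 1"
  shows "summable (\<lambda>n. euler_coeff q n * w ^ n)"
proof -
  have "(\<lambda>n. norm q ^ Suc n * (norm w / (1 - norm q))) \<longlonglongrightarrow> 0 * (norm w / (1 - norm q))"
    by (intro tendsto_mult tendsto_const LIMSEQ_Suc LIMSEQ_power_zero) (use assms in auto)
  hence "eventually (\<lambda>n. norm q ^ Suc n * (norm w / (1 - norm q)) < 1/2) sequentially"
    by (rule order_tendstoD) auto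
  then obtain N where N: "\<And>n. n \<ge> N \<Longrightarrow> norm q ^ Suc n * (norm w / (1 - norm q)) < 1/2"
    by (auto simp: eventually_sequentially)
  show ?thesis
  proof (rule summable_ratio_test)
    fix n assume n: "n \<ge> N"
    have "norm q ^ Suc n \<le> norm q" using assms by (simp add: mult_left_le power_le_one)
    moreover have "1 - norm (q ^ Suc n) \<le> norm (1 - q ^ Suc n)"
      using norm_triangle_ineq2[of 1 "q ^ Suc n"] by simp
    ultimately have le: "1 - norm q \<le> norm (1 - q ^ Suc n)" by (simp add: norm_power norm_mult)
    have "norm (euler_coeff q (Suc n) * w ^ Suc n)
        = norm q ^ Suc n * norm w / norm (1 - q ^ Suc n) * norm (euler_coeff q n * w ^ n)"
      by (simp add: norm_mult norm_divide norm_power del: power_Suc) (simp add: mult_ac)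
    also have "\<dots> \<le> norm q ^ Suc n * norm w / (1 - norm q) * norm (euler_coeff q n * w ^ n)"
      by (intro mult_right_mono divide_left_mono le mult_pos_pos)
         (use assms le in \<open>auto simp del: power_Suc\<close>)
    also have "\<dots> \<le> 1/2 * norm (euler_coeff q n * w ^ n)"
      by (intro mult_right_mono) (use N[OF n] in auto)
    finally show "norm (euler_coeff q (Suc n) * w ^ Suc n) \<le> 1/2 * norm (euler_coeff q n * w ^ n)" .
  qed auto
qed

lemma euler_series_holomorphic:
  assumes "norm q < 1"
  shows "euler_series q holomorphic_on UNIV"
proof -
  have "euler_series q = (\<lambda>w. \<Sum>n. euler_coeff q n * w ^ n)" by (auto simp: euler_series_def)
  moreover have "((\<lambda>w. \<Sum>n. euler_coeff q n * w ^ n) has_field_derivative (\<Sum>n. diffs (euler_coeff q) n * w ^ n)) (at w)" for w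
    by (rule termdiffs_strong_converges_everywhere) (rule euler_series_summable[OF assms])
  ultimately show ?thesis
    by (auto simp: holomorphic_on_def field_differentiable_def)
qed

lemma euler_series_0 [simp]: "euler_series q 0 = 1"
  unfolding euler_series_def by (subst powser_zero) auto

text \<open>The recursion for \<open>euler_coeff\<close> is this equation compared at each power of
  w; the head terms cancel in the difference of the two series.\<close>

lemma euler_series_rec:
  assumes "norm q < 1"
  shows "euler_series q w = (1 - q * w) * euler_series q (q * w)"
proof -
  let ?c = "euler_coeff q"
  have s: "summable (\<lambda>n. ?c n * w ^ n)" for w by (rule euler_series_summable[OF assms])
  have "euler_series q w - euler_series q (q * w) = (\<Sum>n. ?c n * w ^ n - ?c n * (q * w) ^ n)"
    unfolding euler_series_def by (rule suminf_diff[OF s s])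
  also have "\<dots> = (\<Sum>n. ?c (Suc n) * w ^ Suc n - ?c (Suc n) * (q * w) ^ Suc n)"
    by (subst suminf_split_head[OF summable_diff[OF s s]]) auto
  also have "\<dots> = (\<Sum>n. (- (q * w)) * (?c n * (q * w) ^ n))"
  proof (rule suminf_cong)
    fix n
    have "?c (Suc n) * (1 - q ^ Suc n) = - (q ^ Suc n) * ?c n"
      using one_minus_power_nz[OF assms, of "Suc n"] by (simp del: power_Suc)
    hence "?c (Suc n) * (1 - q ^ Suc n) * w ^ Suc n = - (q ^ Suc n) * ?c n * w ^ Suc n" by simp
    thus "?c (Suc n) * w ^ Suc n - ?c (Suc n) * (q * w) ^ Suc n = (- (q * w)) * (?c n * (q * w) ^ n)"
      by (simp add: power_mult_distrib algebra_simps del: euler_coeff.simps)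
  qed
  also have "\<dots> = - (q * w) * euler_series q (q * w)"
    unfolding euler_series_def by (rule suminf_mult[OF s])
  finally show ?thesis by (simp add: algebra_simps)
qed

text \<open>As long as no factor of the functional equation vanishes, a zero w is carried to q ^ n *
  w. These points tend to 0, where the series equals 1.\<close>

lemma euler_series_zeros:
  assumes q: "norm q < 1" and "euler_series q w = 0"
  shows "\<exists>n. q ^ Suc n * w = 1"
proof (rule ccontr)
  assume neg: "\<not> ?thesis"
  have "euler_series q (q ^ n * w) = 0" for n
  proof (induction n)
    case (Suc n)
    have "(1 - q * (q ^ n * w)) * euler_series q (q * (q ^ n * w)) = 0"
      using euler_series_rec[OF q, of "q ^ n * w"] Suc by simp
    moreover have "1 - q * (q ^ n * w) \<noteq> 0" using neg by (auto simp: mult.assoc)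
    ultimately show ?case by (simp add: mult.assoc)
  qed (use assms in auto)
  moreover have "(\<lambda>n. euler_series q (q ^ n * w)) \<longlonglongrightarrow> euler_series q 0"
  proof (rule isCont_tendsto_compose[of 0 "euler_series q"])
    show "isCont (euler_series q) 0"
      using euler_series_holomorphic[OF q] field_differentiable_imp_continuous_at
        holomorphic_on_imp_differentiable_at open_UNIV UNIV_I by blast
    show "(\<lambda>n. q ^ n * w) \<longlonglongrightarrow> 0"
      using tendsto_mult[OF LIMSEQ_power_zero[OF q] tendsto_const[of w]] by simp
  qed
  ultimately show False by (simp add: LIMSEQ_const_iff)
qed

text \<open>The function p is, up to a constant, the product side of Jacobi's triple product. It is
  set beside the series because its factors show the zeros: 1 - w gives the integers, and the two
  Euler series give their translates by nonzero multiples of \<tau>.\<close>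

lemma theta_like_simple_zeros_exists:
  assumes \<tau>: "Im \<tau> > 0"
  obtains p where "theta_like \<tau> p" "p 0 = 0" "deriv p 0 \<noteq> 0"
    "\<And>z. p z = 0 \<Longrightarrow> \<exists>m n :: int. z = of_int m + of_int n * \<tau>"
proof -
  define q where "q = exp (2 * pi * \<i> * \<tau>)"
  define E where "E = euler_series q"
  define w where "w = (\<lambda>z. exp (2 * pi * \<i> * z))"
  define B where "B = (\<lambda>z. exp (- pi * \<i> * z) * E (w z) * E (inverse (w z)))"
  define p where "p = (\<lambda>z. (1 - w z) * B z)"
  have q: "norm q < 1" using \<tau> by (simp add: q_def norm_exp_eq_Re)
  have q0: "q \<noteq> 0" by (simp add: q_def)
  have hE: "E holomorphic_on UNIV" unfolding E_def by (rule euler_series_holomorphic[OF q])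
  have hE': "(\<lambda>z. E (g z)) holomorphic_on UNIV" if "g holomorphic_on UNIV" for g
    using holomorphic_on_compose_gen[OF that hE] by (simp add: o_def)
  have w0: "w z \<noteq> 0" for z by (simp add: w_def)
  have hB: "B holomorphic_on UNIV"
    unfolding B_def by (intro holomorphic_intros hE') (auto simp: w_def intro!: holomorphic_intros)
  have hp: "p holomorphic_on UNIV"
    unfolding p_def by (intro holomorphic_intros hB) (auto simp: w_def intro!: holomorphic_intros)
  have E1: "E v = (1 - q * v) * E (q * v)" for v
    unfolding E_def by (rule euler_series_rec[OF q])
  have w1: "w (z + 1) = w z" for z
    by (simp add: w_def ring_distribs exp_add)
  have wt: "w (z + \<tau>) = q * w z" for z by (simp add: w_def q_def ring_distribs exp_add)
  have tl: "theta_like \<tau> p"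
    unfolding theta_like_def
  proof (intro conjI allI hp)
    fix z
    have "exp (- pi * \<i> * (z + 1)) = - exp (- pi * \<i> * z)"
      by (simp add: ring_distribs exp_diff) 
    thus "p (z + 1) = - p z" by (simp add: p_def B_def w1)
    have ex: "exp (- (pi * \<i> * (z + \<tau>))) = exp (- (pi * \<i> * \<tau>) - pi * \<i> * z)"
      by (simp add: algebra_simps)
    have "p (z + \<tau>) = exp (- pi * \<i> * \<tau> - pi * \<i> * z) * ((1 - q * w z) * E (q * w z)) * E (inverse (q * w z))"
      by (simp add: p_def B_def wt ex)
    also have "(1 - q * w z) * E (q * w z) = E (w z)" by (rule E1[symmetric])
    also have "E (inverse (q * w z)) = (1 - inverse (w z)) * E (inverse (w z))"
      using E1[of "inverse (q * w z)"] q0 by (simp add: field_simps)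
    also have "1 - inverse (w z) = - (1 - w z) * exp (- 2 * pi * \<i> * z)"
      by (simp add: w_def exp_minus field_simps)
    finally have "p (z + \<tau>) = - (exp (- pi * \<i> * \<tau> - pi * \<i> * z) * exp (- 2 * pi * \<i> * z)) * (1 - w z) * E (w z) * E (inverse (w z))"
      by (simp add: algebra_simps)
    also have "exp (- pi * \<i> * \<tau> - pi * \<i> * z) * exp (- 2 * pi * \<i> * z) = 
               exp (- pi * \<i> * \<tau> - 2 * pi * \<i> * z) * exp (- pi * \<i> * z)"
      by (simp flip: exp_add)
    finally show "p (z + \<tau>) = - exp (- pi * \<i> * \<tau> - 2 * pi * \<i> * z) * p z"
      by (simp add: p_def B_def mult_ac)
  qed
  have p0: "p 0 = 0" by (simp add: p_def w_def)
  have "E 1 \<noteq> 0"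
  proof
    assume "E 1 = 0"
    then obtain n where "q ^ Suc n * 1 = 1" using euler_series_zeros[OF q] unfolding E_def by blast
    thus False using one_minus_power_nz[OF q, of "Suc n"] by simp
  qed
  hence B0: "B 0 \<noteq> 0" by (simp add: B_def w_def)
  have "(p has_field_derivative (- (2 * pi * \<i>)) * B 0) (at 0)"
  proof -
    have dB: "(B has_field_derivative deriv B 0) (at 0)"
      using hB by (intro holomorphic_derivI[of _ UNIV]) auto
    show ?thesis
      unfolding p_def w_def by (rule derivative_eq_intros dB refl | simp)+
  qed
  hence d0: "deriv p 0 \<noteq> 0" using B0 by (simp add: DERIV_imp_deriv)
  show ?thesis
  proof (rule that[OF tl p0 d0])
    fix z assume "p z = 0"
    hence "w z = 1 \<or> (\<exists>n. q ^ Suc n * w z = 1) \<or> (\<exists>n. q ^ Suc n * inverse (w z) = 1)"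
      using euler_series_zeros[OF q] by (auto simp: p_def B_def E_def)
    hence "\<exists>n::int. exp (2 * pi * \<i> * (z + of_int n * \<tau>)) = 1"
    proof (elim disjE exE)
      assume "w z = 1" thus ?thesis by (intro exI[of _ 0]) (simp add: w_def)
    next
      fix n assume *: "q ^ Suc n * w z = 1"
      have "exp (2 * pi * \<i> * (z + of_int (int (Suc n)) * \<tau>)) = exp (of_nat (Suc n) * (2 * pi * \<i> * \<tau>)) * w z"
        unfolding w_def by (subst exp_add[symmetric]) (simp add: algebra_simps)
      also have "exp (of_nat (Suc n) * (2 * pi * \<i> * \<tau>)) = q ^ Suc n"
        unfolding q_def by (rule exp_of_nat_mult)
      finally show ?thesis using * by metis
    next
      fix n assume *: "q ^ Suc n * inverse (w z) = 1"
      have "exp (2 * pi * \<i> * (z + of_int (- int (Suc n)) * \<tau>)) = inverse (exp (of_nat (Suc n) * (2 * pi * \<i> * \<tau>))) * w z"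
        unfolding w_def by (simp only: exp_minus[symmetric] exp_add[symmetric]) (simp add: algebra_simps)
      also have "exp (of_nat (Suc n) * (2 * pi * \<i> * \<tau>)) = q ^ Suc n"
        unfolding q_def by (rule exp_of_nat_mult)
      also have "inverse (q ^ Suc n) * w z = 1"
        using * w0[of z] q0 by (simp add: field_simps)
      finally show ?thesis by metis
    qed
    then obtain n :: int where "exp (2 * pi * \<i> * (z + of_int n * \<tau>)) = 1" by blast
    then obtain m :: int where "2 * pi * \<i> * (z + of_int n * \<tau>) = 2 * pi * \<i> * of_int m"
      unfolding exp_eq_1 by (auto simp: complex_eq_iff)
    hence "z + of_int n * \<tau> = of_int m" by simp
    hence "z = of_int m + of_int (-n) * \<tau>" by (simp add: algebra_simps)
    thus "\<exists>m n :: int. z = of_int m + of_int n * \<tau>" by blast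
  qed
qed

lemma jtheta_theta_like:
  assumes "Im \<tau> > 0"
  shows "theta_like \<tau> (\<lambda>z. jtheta z \<tau>)"
  unfolding theta_like_def
  using jtheta_holomorphic[OF assms] jtheta_add_lattice[of _ 1 0 \<tau>] jtheta_add_lattice[of _ 0 1 \<tau>]
  by (simp add: mult_ac)

text \<open>If the Laurent series in \<open>w = exp (2 * pi * \<i> * z)\<close> vanished identically, its part with
  nonnegative exponents would be an entire function vanishing at infinity.\<close>

lemma jtheta_not_identically_zero:
  assumes \<tau>: "Im \<tau> > 0"
  shows "\<exists>z. jtheta z \<tau> \<noteq> 0"
proof (rule ccontr)
  assume "\<not> ?thesis"
  hence zero: "jtheta z \<tau> = 0" for z by blast
  define d where "d = (\<lambda>n::int. (-1) powi n * exp (pi * \<i> * \<tau> * (of_int n + 1/2)\<^sup>2))"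
  define y where "y = Im \<tau>"
  have y: "y > 0" using \<tau> by (simp add: y_def)
  have d_bound: "norm (d n) * R ^ nat \<bar>n\<bar> \<le> exp ((pi * y + ln R) * \<bar>of_int n\<bar> - pi * y * (of_int n)\<^sup>2)"
    if "R > 0" for n :: int and R :: real
  proof -
    have "norm (d n) \<le> exp (pi * y * \<bar>of_int n\<bar> - pi * y * (of_int n)\<^sup>2)"
      using jtheta_term_bound[of y \<tau> 0 0 n] \<tau> by (simp add: d_def y_def)
    moreover have Rp: "R ^ nat \<bar>n\<bar> = exp (ln R * \<bar>of_int n\<bar>)"
    proof -
      have "R ^ nat \<bar>n\<bar> = exp (ln R) ^ nat \<bar>n\<bar>" using that by simp
      also have "\<dots> = exp (of_nat (nat \<bar>n\<bar>) * ln R)" by (rule exp_of_nat_mult[symmetric])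
      finally show ?thesis by (simp add: mult.commute)
    qed
    ultimately have "norm (d n) * R ^ nat \<bar>n\<bar> \<le>
        exp (pi * y * \<bar>of_int n\<bar> - pi * y * (of_int n)\<^sup>2) * exp (ln R * \<bar>of_int n\<bar>)"
      by simp
    thus ?thesis by (simp only: exp_add[symmetric]) (simp add: algebra_simps)
  qed
  have hol: "(\<lambda>w. \<Sum>\<^sub>\<infinity>n\<in>I. d n * w ^ nat \<bar>n\<bar>) holomorphic_on UNIV" for I
  proof (rule holomorphic_on_infsum)
    fix z :: complex
    define R where "R = norm z + 1"
    have R: "R > 0" by (simp add: R_def add_nonneg_pos)
    show "\<exists>r>0. \<exists>M. cball z r \<subseteq> UNIV \<and> M summable_on I \<and>
            (\<forall>n\<in>I. \<forall>w\<in>cball z r. norm (d n * w ^ nat \<bar>n\<bar>) \<le> M n)"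
    proof (intro exI[of _ 1] exI[of _ "\<lambda>n. exp ((pi * y + ln R) * \<bar>of_int n\<bar> - pi * y * (of_int n)\<^sup>2)"] conjI ballI)
      show "(\<lambda>n::int. exp ((pi * y + ln R) * \<bar>of_int n\<bar> - pi * y * (of_int n)\<^sup>2)) summable_on I"
        by (rule summable_on_subset_banach[OF summable_on_int_gauss]) (use y in auto)
      fix n w assume "w \<in> cball z 1"
      hence "norm w \<le> R"
        using norm_triangle_ineq2[of w z] by (simp add: dist_norm norm_minus_commute R_def)
      hence "norm (d n * w ^ nat \<bar>n\<bar>) \<le> norm (d n) * R ^ nat \<bar>n\<bar>"
        by (auto simp: norm_mult norm_power intro!: mult_left_mono power_mono)
      also note d_bound[OF R]
      finally show "norm (d n * w ^ nat \<bar>n\<bar>) \<le> exp ((pi * y + ln R) * \<bar>of_int n\<bar> - pi * y * (of_int n)\<^sup>2)" .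
    qed auto
  qed (auto intro!: holomorphic_intros)
  define A where "A = (\<lambda>w. \<Sum>\<^sub>\<infinity>n\<in>{0..}. d n * w ^ nat \<bar>n\<bar>)"
  define B where "B = (\<lambda>w. \<Sum>\<^sub>\<infinity>n\<in>{..<0}. d n * w ^ nat \<bar>n\<bar>)"
  have AB: "A w = - B (inverse w)" if w: "w \<noteq> 0" for w
  proof -
    define z where "z = Ln w / (2 * pi * \<i>)"
    have z: "w = exp (2 * pi * \<i> * z)" using w by (simp add: z_def)
    have powi: "w powi n = exp (2 * pi * \<i> * of_int n * z)" for n
      unfolding z by (simp add: mult_ac exp_power_int)
    have t: "(-1) powi n * exp (pi * \<i> * \<tau> * (of_int n + 1/2)\<^sup>2 + 2 * pi * \<i> * (of_int n + 1/2) * z)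
          = exp (pi * \<i> * z) * (d n * w powi n)" for n :: int
      by (simp add: d_def powi exp_add ring_distribs)
    have sm: "(\<lambda>n. d n * w powi n) summable_on (UNIV :: int set)"
      using jtheta_summable[OF \<tau>, of z] unfolding t by (subst (asm) summable_on_cmult_right') auto
    have "0 = exp (pi * \<i> * z) * (\<Sum>\<^sub>\<infinity>n. d n * w powi n)"
      using zero[of z] unfolding jtheta_def t by (simp add: infsum_cmult_right')
    hence "(\<Sum>\<^sub>\<infinity>n. d n * w powi n) = 0" by simp
    moreover have "(\<Sum>\<^sub>\<infinity>n\<in>{0..}\<union>{..<0}. d n * w powi n) =
         (\<Sum>\<^sub>\<infinity>n\<in>{0..}. d n * w powi n) + (\<Sum>\<^sub>\<infinity>n\<in>{..<0}. d n * w powi n)"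
      by (intro infsum_Un_disjoint summable_on_subset_banach[OF sm]) auto
    moreover have "{0..} \<union> {..<0} = (UNIV :: int set)" by auto
    moreover have "(\<Sum>\<^sub>\<infinity>n\<in>{0..}. d n * w powi n) = A w"
      unfolding A_def by (intro infsum_cong) (auto simp: power_int_def)
    moreover have "(\<Sum>\<^sub>\<infinity>n\<in>{..<0}. d n * w powi n) = B (inverse w)"
      unfolding B_def by (intro infsum_cong) (auto simp: power_int_def)
    ultimately show ?thesis by (simp add: eq_neg_iff_add_eq_0)
  qed
  have B0: "B 0 = 0" unfolding B_def by (subst infsum_0) auto
  have "(A \<longlongrightarrow> 0) at_infinity"
  proof -
    have "isCont B 0"
      using hol[of "{..<0}"] unfolding B_def
      using field_differentiable_imp_continuous_at holomorphic_on_imp_differentiable_at open_UNIV UNIV_I by blast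
    hence "((\<lambda>w. - B (inverse w)) \<longlongrightarrow> - B 0) at_infinity"
      by (intro tendsto_minus isCont_tendsto_compose[of 0 B] tendsto_inverse_0)
    moreover have "eventually (\<lambda>w. - B (inverse w) = A w) at_infinity"
    proof (unfold eventually_at_infinity, intro exI[of _ 1] allI impI)
      fix w :: complex assume "norm w \<ge> 1"
      hence "w \<noteq> 0" by auto
      thus "- B (inverse w) = A w" using AB by simp
    qed
    ultimately show ?thesis using B0 tendsto_cong by force
  qed
  hence "A 0 = 0"
    using Liouville_weak_0[of A 0] hol[of "{0..}"] unfolding A_def by blast
  moreover have "A 0 = (\<Sum>\<^sub>\<infinity>n\<in>{0}. d n)"
    unfolding A_def by (rule infsum_cong_neutral) (auto simp: power_0_left)
  ultimately show False by (simp add: d_def)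
qed

text \<open>By \<open>theta_like_unique\<close> the series is a multiple of the product p, and the
  factor is not 0 because the series does not vanish identically. Zeros, the simple zero at 0 and
  uniqueness all pass from p to the series.\<close>

lemma jtheta_structure:
  assumes \<tau>: "Im \<tau> > 0"
  shows jtheta_zero_iff: "jtheta z \<tau> = 0 \<longleftrightarrow> (\<exists>m n :: int. z = of_int m + of_int n * \<tau>)"
    and jtheta_deriv_0: "deriv (\<lambda>z. jtheta z \<tau>) 0 \<noteq> 0"
    and jtheta_unique: "theta_like \<tau> f \<Longrightarrow> f 0 = 0 \<Longrightarrow> \<exists>c. \<forall>z. f z = c * jtheta z \<tau>"
proof -
  obtain p where p: "theta_like \<tau> p" "p 0 = 0" "deriv p 0 \<noteq> 0"
    "\<And>z. p z = 0 \<Longrightarrow> \<exists>m n :: int. z = of_int m + of_int n * \<tau>"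
    using theta_like_simple_zeros_exists[OF \<tau>] by blast
  obtain c where c: "\<And>z. jtheta z \<tau> = c * p z"
    using theta_like_unique[OF \<tau> jtheta_theta_like[OF \<tau>] jtheta_0 p] by blast
  have c0: "c \<noteq> 0" using c jtheta_not_identically_zero[OF \<tau>] by auto
  show "jtheta z \<tau> = 0 \<longleftrightarrow> (\<exists>m n :: int. z = of_int m + of_int n * \<tau>)"
    (is "?l \<longleftrightarrow> ?r")
  proof
    assume ?l
    hence "p z = 0" using c[of z] c0 by simp
    thus ?r by (rule p(4))
  next
    assume ?r
    then obtain m n :: int where "z = of_int m + of_int n * \<tau>" by blast
    thus ?l using c[of z] theta_like_zero_lattice[OF p(1,2), of m n] by simp
  qed
  have "p field_differentiable at 0"
    using p(1) unfolding theta_like_def using holomorphic_on_imp_differentiable_at by blast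
  hence "deriv (\<lambda>z. c * p z) 0 = c * deriv p 0" by (rule deriv_cmult)
  thus "deriv (\<lambda>z. jtheta z \<tau>) 0 \<noteq> 0" using c c0 p(3) by simp
  assume "theta_like \<tau> f" "f 0 = 0"
  then obtain c' where c': "\<And>z. f z = c' * p z" using theta_like_unique[OF \<tau> _ _ p] by blast
  show "\<exists>c. \<forall>z. f z = c * jtheta z \<tau>"
    by (rule exI[of _ "c' / c"]) (use c c' c0 in auto)
qed

section \<open>Weierstrass' three-term identity\<close>

text \<open>An even function has derivative 0 at 0, so its zero there is at least double. This
  cancels the double pole created by dividing by the square of theta.\<close>

lemma even_quotient_square_limit:
  assumes f: "f holomorphic_on UNIV" and f0: "f 0 = 0" and even: "\<And>x. f (- x) = f x"
  shows "\<exists>L. (\<lambda>x. f x / x\<^sup>2) \<midarrow>0\<rightarrow> (L::complex)"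
proof -
  define h where "h = (\<lambda>z. if z = 0 then deriv f 0 else (f z - f 0) / (z - 0))"
  have h: "h holomorphic_on UNIV" unfolding h_def by (rule pole_lemma) (use f in auto)
  have df: "(f has_field_derivative deriv f 0) (at 0)"
    using f by (intro holomorphic_derivI[of _ UNIV]) auto
  have "((\<lambda>x. f (- x)) has_field_derivative deriv f 0 * (-1)) (at 0)"
    by (rule DERIV_chain2[of f _ "\<lambda>x. - x"]) (use df in \<open>auto intro!: derivative_eq_intros\<close>)
  hence "(f has_field_derivative - deriv f 0) (at 0)" using even by simp
  from DERIV_unique[OF df this] have "deriv f 0 + deriv f 0 = 0" by (simp only: eq_neg_iff_add_eq_0)
  hence "deriv f 0 = 0" by (simp flip: mult_2)
  hence h0: "h 0 = 0" by (simp add: h_def)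
  have "(h has_field_derivative deriv h 0) (at 0)"
    using h by (intro holomorphic_derivI[of _ UNIV]) auto
  hence "(\<lambda>x. h x / x) \<midarrow>0\<rightarrow> deriv h 0" using h0 by (simp add: DERIV_def)
  moreover have "eventually (\<lambda>x. h x / x = f x / x\<^sup>2) (at 0)"
    by (auto simp: h_def f0 eventually_at power2_eq_square intro!: exI[of _ 1])
  ultimately show ?thesis using tendsto_cong by force
qed

text \<open>As functions of x, f and the square of \<theta> have the same multipliers; f is even and
  vanishes at 0, so the quotient has no poles and is constant. Setting x = y determines the
  constant, because the second product in f then vanishes.\<close>

theorem jtheta_three_term:
  assumes \<tau>: "Im \<tau> > 0"
  defines "\<theta> \<equiv> \<lambda>z. jtheta z \<tau>"
  shows "\<theta> (x + y) * \<theta> (x - y) * \<theta> z ^ 2 + \<theta> (y + z) * \<theta> (y - z) * \<theta> x ^ 2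
          + \<theta> (z + x) * \<theta> (z - x) * \<theta> y ^ 2 = 0"
proof -
  define f where "f = (\<lambda>x. \<theta> (x + z) * \<theta> (x - z) * \<theta> y ^ 2 - \<theta> (x + y) * \<theta> (x - y) * \<theta> z ^ 2)"
  have odd: "\<theta> (- x) = - \<theta> x" for x by (simp add: \<theta>_def jtheta_uminus)
  have th: "theta_like \<tau> \<theta>" unfolding \<theta>_def by (rule jtheta_theta_like[OF \<tau>])
  have h\<theta>: "\<theta> holomorphic_on UNIV" using th by (simp add: theta_like_def)
  have h\<theta>': "(\<lambda>x. \<theta> (x + c)) holomorphic_on UNIV" "(\<lambda>x. \<theta> (x - c)) holomorphic_on UNIV" for c
    unfolding \<theta>_def by (rule holomorphic_on_compose_gen[of _ UNIV, unfolded o_def, OF _ jtheta_holomorphic[OF \<tau>, of UNIV]],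
       auto intro!: holomorphic_intros)+
  have hf: "f holomorphic_on UNIV" unfolding f_def by (intro holomorphic_intros h\<theta>')
  define M where "M = (\<lambda>x. exp (- pi * \<i> * \<tau> - 2 * pi * \<i> * x))"
  have s1: "\<theta> (x + 1) = - \<theta> x" and st: "\<theta> (x + \<tau>) = - M x * \<theta> x" for x
    using th by (auto simp: theta_like_def M_def)
  have MM: "M (x + c) * M (x - c) = M x ^ 2" for x c
    by (simp only: M_def power2_eq_square exp_add[symmetric]) (rule arg_cong[of _ _ exp], simp add: algebra_simps)
  have M0: "M x \<noteq> 0" for x by (simp add: M_def)
  have pp1: "\<theta> (x + 1 + c) * \<theta> (x + 1 - c) = \<theta> (x + c) * \<theta> (x - c)" for x c
    using s1[of "x + c"] s1[of "x - c"] by (simp add: algebra_simps)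
  have ppt: "\<theta> (x + \<tau> + c) * \<theta> (x + \<tau> - c) = M x ^ 2 * (\<theta> (x + c) * \<theta> (x - c))" for x c
    using st[of "x + c"] st[of "x - c"] MM[of x c] by (simp add: algebra_simps flip: MM)
  have f1: "f (x + 1) = f x" and ft: "f (x + \<tau>) = M x ^ 2 * f x" for x
    unfolding f_def pp1 ppt by (simp_all add: right_diff_distrib mult_ac)
  have f_even: "f (- x) = f x" for x
    using odd[of "x + z"] odd[of "x - z"] odd[of "x + y"] odd[of "x - y"] by (simp add: f_def algebra_simps)
  have f0: "f 0 = 0" by (simp add: f_def odd power2_eq_square)
  define F where "F = (\<lambda>x. f x / \<theta> x ^ 2)"
  have ana: "f analytic_on A" "\<theta> analytic_on A" for A
    using hf h\<theta> analytic_on_subset[of _ UNIV A] by (auto simp: analytic_on_open)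
  have per: "F (x + 1) = F x" "F (x + \<tau>) = F x" for x
    using M0 by (auto simp: F_def f1 ft s1 st power_mult_distrib)
  have mero: "F meromorphic_on UNIV"
    unfolding F_def by (intro meromorphic_intros analytic_on_imp_meromorphic_on ana)
  obtain L where L: "(\<lambda>x. f x / x\<^sup>2) \<midarrow>0\<rightarrow> L" using even_quotient_square_limit[OF hf f0 f_even] by blast
  have dt: "deriv \<theta> 0 \<noteq> 0" unfolding \<theta>_def by (rule jtheta_deriv_0[OF \<tau>])
  have lim0: "F \<midarrow>0\<rightarrow> L / deriv \<theta> 0 ^ 2"
  proof -
    have "(\<theta> has_field_derivative deriv \<theta> 0) (at 0)"
      using h\<theta> by (auto intro!: holomorphic_derivI[of _ UNIV])
    hence "(\<lambda>x. \<theta> x / x) \<midarrow>0\<rightarrow> deriv \<theta> 0" by (simp add: DERIV_def \<theta>_def)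
    hence "(\<lambda>x. (f x / x\<^sup>2) / (\<theta> x / x) ^ 2) \<midarrow>0\<rightarrow> L / deriv \<theta> 0 ^ 2"
      by (intro tendsto_divide L tendsto_power) (use dt in auto)
    moreover have "eventually (\<lambda>x. (f x / x\<^sup>2) / (\<theta> x / x) ^ 2 = F x) (at 0)"
      by (auto simp: F_def eventually_at power2_eq_square intro!: exI[of _ 1])
    ultimately show ?thesis using tendsto_cong by force
  qed
  have ana': "F analytic_on {x}" if "\<theta> x \<noteq> 0" for x
    unfolding F_def by (intro analytic_on_divide analytic_on_power ana) (use that in auto)
  have lim: "\<exists>c. F \<midarrow>x\<rightarrow> c" for x
    using jtheta_zero_iff[OF \<tau>, of x] limit_at_lattice[of F, OF per lim0]
      analytic_at_has_limit[OF ana'] unfolding \<theta>_def by blast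
  obtain c where c: "\<And>x. \<theta> x \<noteq> 0 \<Longrightarrow> F x = c"
    using elliptic_limits_constant[OF \<tau> mero per lim] ana' by blast
  have fc: "f x = c * \<theta> x ^ 2" for x
  proof (cases "\<theta> x = 0")
    case True
    then obtain m n :: int where x: "x = 0 + of_int m + of_int n * \<tau>"
      using jtheta_zero_iff[OF \<tau>] unfolding \<theta>_def by auto
    have "(f x = 0) = (f 0 = 0)"
      unfolding x by (rule periodic_lattice) (use f1 ft M0 in auto)
    thus ?thesis using f0 True by simp
  qed (use c in \<open>auto simp: F_def field_simps\<close>)
  show ?thesis
  proof (cases "\<theta> y = 0")
    \<comment> \<open>For a lattice point y the constant cannot be solved for. The whole left side,
      as a function of y, is quasi-periodic with multipliers that never vanish, and at y = 0 it is 0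
      by oddness.\<close>
    case True
    then obtain m n :: int where y: "y = 0 + of_int m + of_int n * \<tau>"
      using jtheta_zero_iff[OF \<tau>] unfolding \<theta>_def by auto
    define G where "G = (\<lambda>y. \<theta> (x + y) * \<theta> (x - y) * \<theta> z ^ 2 + \<theta> (y + z) * \<theta> (y - z) * \<theta> x ^ 2
          + \<theta> (z + x) * \<theta> (z - x) * \<theta> y ^ 2)"
    have "\<theta> (x + u) * \<theta> (x - u) = - (\<theta> (u + x) * \<theta> (u - x))" for u
      using odd[of "u - x"] by (simp add: algebra_simps)
    hence G: "G u = - (\<theta> (u + x) * \<theta> (u - x)) * \<theta> z ^ 2 + \<theta> (u + z) * \<theta> (u - z) * \<theta> x ^ 2
          + \<theta> (z + x) * \<theta> (z - x) * \<theta> u ^ 2" for u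
      unfolding G_def by simp
    have "G (u + 1) = G u" for u unfolding G pp1 s1 by simp
    moreover have "G (u + \<tau>) = M u ^ 2 * G u" for u
      unfolding G ppt st by (simp add: power_mult_distrib algebra_simps)
    ultimately have "(G y = 0) = (G 0 = 0)"
      unfolding y by (intro periodic_lattice) (use M0 in auto)
    moreover have "G 0 = 0" using odd[of z] odd[of 0] unfolding G_def by (simp add: power2_eq_square)
    ultimately show ?thesis unfolding G_def by simp
  next
    case False
    have "\<theta> (y + z) * \<theta> (y - z) * \<theta> y ^ 2 = c * \<theta> y ^ 2"
      using fc[of y] odd[of 0] by (simp add: f_def)
    hence "c = \<theta> (y + z) * \<theta> (y - z)" using False by simp
    with fc[of x] odd[of "x - z"] show ?thesis by (simp add: f_def algebra_simps)
  qed
qed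

subsection \<open>Modular transformation\<close>

no_notation fps_nth (infixl \<open>$\<close> 75)

lemma SL2Z_det: "A \<in> SL2Z \<Longrightarrow> A$1$1 * A$2$2 - A$1$2 * A$2$1 = 1"
  by (simp add: SL2Z_def det_2)

definition autf :: "int^2^2 \<Rightarrow> complex \<Rightarrow> complex" where
  "autf A \<tau> = of_int (A$2$1) * \<tau> + of_int (A$2$2)"

lemma act_eq: "act A \<tau> = (of_int (A$1$1) * \<tau> + of_int (A$1$2)) / autf A \<tau>"
  by (simp add: act_def moebius_def autf_def)

lemma SL2Z_det_complex:
  assumes "A \<in> SL2Z"
  shows "of_int (A$1$1) * of_int (A$2$2) - of_int (A$1$2) * of_int (A$2$1) = (1::complex)"
  using arg_cong[OF SL2Z_det[OF assms], of "of_int :: int \<Rightarrow> complex"] by simp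

lemma autf_nz:
  assumes "A \<in> SL2Z" "Im \<tau> > 0"
  shows "autf A \<tau> \<noteq> 0"
proof
  assume *: "autf A \<tau> = 0"
  hence "A$2$1 = 0" using assms(2) by (auto simp: autf_def complex_eq_iff)
  moreover from this have "A$2$2 = 0" using * by (simp add: autf_def)
  ultimately show False using SL2Z_det[OF assms(1)] by simp
qed

lemma Im_act:
  assumes "A \<in> SL2Z" "Im \<tau> > 0"
  shows "Im (act A \<tau>) = Im \<tau> / (norm (autf A \<tau>))\<^sup>2"
proof -
  have "Im (act A \<tau>) = Im \<tau> * (of_int (A$1$1) * of_int (A$2$2) - of_int (A$1$2) * of_int (A$2$1)) / (norm (autf A \<tau>))\<^sup>2"
    by (simp add: act_eq Im_divide cmod_power2 autf_def) (simp add: algebra_simps)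
  also have "of_int (A$1$1) * of_int (A$2$2) - of_int (A$1$2) * of_int (A$2$1) = (1::real)"
    using arg_cong[OF SL2Z_det[OF assms(1)], of "of_int :: int \<Rightarrow> real"] by simp
  finally show ?thesis by simp
qed

lemma Im_act_pos:
  assumes "A \<in> SL2Z" "Im \<tau> > 0"
  shows "Im (act A \<tau>) > 0"
  using assms autf_nz[OF assms] by (simp add: Im_act)

text \<open>The function \<open>exp (- pi * \<i> * c * z\<^sup>2 / J) * jtheta (z / J) (act A \<tau>)\<close> has the same
  multipliers as \<open>jtheta z \<tau>\<close>, because \<open>1 / J = a - c * act A \<tau>\<close> and \<open>\<tau> / J = d * act A \<tau> - b\<close>.\<close>

theorem jtheta_transform:
  assumes A: "A \<in> SL2Z" and \<tau>: "Im \<tau> > 0"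
  shows "\<exists>\<kappa>. \<kappa> \<noteq> 0 \<and> (\<forall>z. jtheta (z / autf A \<tau>) (act A \<tau>) =
            \<kappa> * exp (pi * \<i> * of_int (A$2$1) * z\<^sup>2 / autf A \<tau>) * jtheta z \<tau>)"
proof -
  define a b c d where "a = A$1$1" and "b = A$1$2" and "c = A$2$1" and "d = A$2$2"
  define J where "J = autf A \<tau>"
  define \<tau>1 where "\<tau>1 = act A \<tau>"
  have det: "a * d - b * c = 1" using SL2Z_det[OF A] by (simp add: a_def b_def c_def d_def)
  have det': "of_int a * of_int d - of_int b * of_int c = (1::complex)"
    using SL2Z_det_complex[OF A] by (simp add: a_def b_def c_def d_def)
  have J0: "J \<noteq> 0" unfolding J_def by (rule autf_nz[OF A \<tau>])
  have Jeq: "J = of_int c * \<tau> + of_int d" by (simp add: J_def autf_def c_def d_def)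
  have \<tau>1: "\<tau>1 = (of_int a * \<tau> + of_int b) / J" by (simp add: \<tau>1_def act_eq J_def a_def b_def)
  have im1: "Im \<tau>1 > 0" unfolding \<tau>1_def by (rule Im_act_pos[OF A \<tau>])
  have e1: "1 / J = of_int a - of_int c * \<tau>1"
  proof -
    have "J * of_int a - of_int c * (of_int a * \<tau> + of_int b) = 1"
      using det' by (simp add: Jeq algebra_simps)
    thus ?thesis using J0 by (simp add: \<tau>1 field_simps)
  qed
  have e2: "\<tau> / J = of_int d * \<tau>1 - of_int b"
  proof -
    have "of_int d * (of_int a * \<tau> + of_int b) - of_int b * J = \<tau> * (of_int a * of_int d - of_int b * of_int c)"
      by (simp add: Jeq algebra_simps)
    thus ?thesis using J0 det' by (simp add: \<tau>1 field_simps)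
  qed
  define f where "f = (\<lambda>z. exp (- pi * \<i> * of_int c * z\<^sup>2 / J) * jtheta (z / J) \<tau>1)"
  have hf: "f holomorphic_on UNIV"
  proof -
    have "(\<lambda>z. jtheta (z / J) \<tau>1) holomorphic_on UNIV"
      by (rule holomorphic_on_compose_gen[of _ UNIV, unfolded o_def, OF _ jtheta_holomorphic[OF im1, of UNIV]])
         (use J0 in \<open>auto intro!: holomorphic_intros\<close>)
    thus ?thesis unfolding f_def by (intro holomorphic_intros) (use J0 in auto)
  qed
  \<comment> \<open>Each column of a matrix of determinant 1 contains an odd entry. The signs
    produced by the two lattice shifts both have this form, so both are -1, as
    \<open>theta_like\<close> demands.\<close>
  have sgn: "(-1 :: complex) powi (x + y + x * y) = -1" if "odd x \<or> odd y" for x y :: int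
    using that by (auto simp: power_int_minus_left)
  have par: "odd a \<or> odd c" "odd d \<or> odd b"
    using det by (metis dvd_diff dvd_mult2 dvd_mult odd_one)+
  have f1: "f (z + 1) = - f z" for z
  proof -
    have "(z + 1) / J = z / J + of_int a + of_int (- c) * \<tau>1"
      using e1 by (simp add: add_divide_distrib)
    hence "f (z + 1) = exp (- pi * \<i> * of_int c * (z + 1)\<^sup>2 / J) * ((-1) powi (a - c) *
        exp (- pi * \<i> * of_int (- c) ^ 2 * \<tau>1 - 2 * pi * \<i> * of_int (- c) * (z / J)) * jtheta (z / J) \<tau>1)"
      unfolding f_def by (simp only: jtheta_add_lattice) simp
    also have "\<dots> = (-1) powi (a - c) * exp (- pi * \<i> * of_int c * (z + 1)\<^sup>2 / J +
         (- pi * \<i> * of_int (- c) ^ 2 * \<tau>1 - 2 * pi * \<i> * of_int (- c) * (z / J))) * jtheta (z / J) \<tau>1"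
      by (simp only: exp_add mult_ac)
    also have "- pi * \<i> * of_int c * (z + 1)\<^sup>2 / J +
         (- pi * \<i> * of_int (- c) ^ 2 * \<tau>1 - 2 * pi * \<i> * of_int (- c) * (z / J)) =
         - pi * \<i> * of_int c * z\<^sup>2 / J - pi * \<i> * of_int c * (1 / J + of_int c * \<tau>1)"
      using J0 by (simp add: power2_eq_square field_simps)
    also have "1 / J + of_int c * \<tau>1 = of_int a" using e1 by simp
    also have "- pi * \<i> * of_int c * z\<^sup>2 / J - pi * \<i> * of_int c * of_int a =
        - pi * \<i> * of_int c * z\<^sup>2 / J + pi * \<i> * of_int (- (a * c))" by simp
    also have "exp \<dots> = exp (- pi * \<i> * of_int c * z\<^sup>2 / J) * (-1) powi (- (a * c))"
      by (simp only: exp_add exp_pi_i_int)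
    finally have "f (z + 1) = ((-1) powi (a - c) * (-1) powi (- (a * c))) * f z"
      by (simp add: f_def)
    also have "(-1 :: complex) powi (a - c) * (-1) powi (- (a * c)) = (-1) powi (a + c + a * c)"
      by (auto simp: power_int_minus_left)
    also have "\<dots> = -1" by (rule sgn[OF par(1)])
    finally show ?thesis by simp
  qed
  have ft: "f (z + \<tau>) = - exp (- pi * \<i> * \<tau> - 2 * pi * \<i> * z) * f z" for z
  proof -
    have "(z + \<tau>) / J = z / J + of_int (- b) + of_int d * \<tau>1"
      using e2 by (simp add: add_divide_distrib)
    hence "f (z + \<tau>) = exp (- pi * \<i> * of_int c * (z + \<tau>)\<^sup>2 / J) * ((-1) powi (d - b) *
        exp (- pi * \<i> * of_int d ^ 2 * \<tau>1 - 2 * pi * \<i> * of_int d * (z / J)) * jtheta (z / J) \<tau>1)"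
      unfolding f_def by (simp only: jtheta_add_lattice) simp
    also have "\<dots> = (-1) powi (d - b) * exp (- pi * \<i> * of_int c * (z + \<tau>)\<^sup>2 / J +
         (- pi * \<i> * of_int d ^ 2 * \<tau>1 - 2 * pi * \<i> * of_int d * (z / J))) * jtheta (z / J) \<tau>1"
      by (simp only: exp_add mult_ac)
    also have "- pi * \<i> * of_int c * (z + \<tau>)\<^sup>2 / J + (- pi * \<i> * of_int d ^ 2 * \<tau>1 - 2 * pi * \<i> * of_int d * (z / J)) =
         - pi * \<i> * of_int c * z\<^sup>2 / J - 2 * pi * \<i> * z * ((of_int c * \<tau> + of_int d) / J)
         - pi * \<i> * (of_int c * \<tau> * (\<tau> / J) + of_int d ^ 2 * \<tau>1)"
      using J0 by (simp add: power2_eq_square field_simps)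
    also have "(of_int c * \<tau> + of_int d) / J = 1" using J0 by (simp add: Jeq)
    also have "of_int c * \<tau> * (\<tau> / J) + of_int d ^ 2 * \<tau>1 = \<tau> + of_int b * of_int d"
    proof -
      have "of_int c * \<tau> * (\<tau> / J) + of_int d ^ 2 * \<tau>1 = of_int d * (\<tau>1 * J) - of_int b * of_int c * \<tau>"
        unfolding e2 by (simp add: Jeq power2_eq_square algebra_simps)
      also have "\<tau>1 * J = of_int a * \<tau> + of_int b" using J0 by (simp add: \<tau>1)
      also have "of_int d * (of_int a * \<tau> + of_int b) - of_int b * of_int c * \<tau> =
          (of_int a * of_int d - of_int b * of_int c) * \<tau> + of_int b * of_int d" by (simp add: algebra_simps)
      finally show ?thesis using det' by simp
    qed
    also have "- pi * \<i> * of_int c * z\<^sup>2 / J - 2 * pi * \<i> * z * 1 - pi * \<i> * (\<tau> + of_int b * of_int d) =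
        - pi * \<i> * of_int c * z\<^sup>2 / J + (- pi * \<i> * \<tau> - 2 * pi * \<i> * z) + pi * \<i> * of_int (- (b * d))"
      by (simp add: algebra_simps)
    also have "exp \<dots> = exp (- pi * \<i> * of_int c * z\<^sup>2 / J) * exp (- pi * \<i> * \<tau> - 2 * pi * \<i> * z) * (-1) powi (- (b * d))"
      by (simp only: exp_add exp_pi_i_int)
    finally have "f (z + \<tau>) = ((-1) powi (d - b) * (-1) powi (- (b * d))) * exp (- pi * \<i> * \<tau> - 2 * pi * \<i> * z) * f z"
      by (simp add: f_def)
    also have "(-1 :: complex) powi (d - b) * (-1) powi (- (b * d)) = (-1) powi (d + b + d * b)"
      by (auto simp: power_int_minus_left)
    also have "\<dots> = -1" by (rule sgn[OF par(2)])
    finally show ?thesis by simp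
  qed
  have "theta_like \<tau> f" using hf f1 ft by (simp add: theta_like_def)
  moreover have "f 0 = 0" by (simp add: f_def)
  ultimately obtain \<kappa> where \<kappa>: "\<And>z. f z = \<kappa> * jtheta z \<tau>" using jtheta_unique[OF \<tau>] by blast
  have inv: "jtheta (z / J) \<tau>1 = \<kappa> * exp (pi * \<i> * of_int c * z\<^sup>2 / J) * jtheta z \<tau>" for z
  proof -
    have "\<kappa> * exp (pi * \<i> * of_int c * z\<^sup>2 / J) * jtheta z \<tau> = exp (pi * \<i> * of_int c * z\<^sup>2 / J) * f z"
      by (simp add: \<kappa>)
    also have "\<dots> = (exp (pi * \<i> * of_int c * z\<^sup>2 / J) * exp (- pi * \<i> * of_int c * z\<^sup>2 / J)) * jtheta (z / J) \<tau>1"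
      by (simp add: f_def)
    finally show ?thesis by (simp flip: exp_add)
  qed
  have "\<kappa> \<noteq> 0"
  proof
    assume "\<kappa> = 0"
    hence "jtheta w \<tau>1 = 0" for w using inv[of "w * J"] J0 by simp
    thus False using jtheta_not_identically_zero[OF im1] by blast
  qed
  thus ?thesis using inv unfolding J_def \<tau>1_def c_def by blast
qed

section \<open>Klein forms\<close>

text \<open>The Klein form of characteristic (r, s), up to a factor that depends on \<tau> alone.
  The exponential is chosen so that modular transformations act on (r, s) by a matrix.\<close>

definition kf :: "real \<Rightarrow> real \<Rightarrow> complex \<Rightarrow> complex" where
  "kf r s \<tau> = exp (pi * \<i> * r * (r * \<tau> + s)) * jtheta (r * \<tau> + s) \<tau>"

text \<open>The Gaussian factor of \<open>jtheta_transform\<close> is absorbed by the exponentials.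
  What remains is \<kappa>, the same for every characteristic.\<close>

lemma kf_transform:
  assumes A: "A \<in> SL2Z" and \<tau>: "Im \<tau> > 0"
  shows "\<exists>\<kappa>. \<kappa> \<noteq> 0 \<and> (\<forall>r s. kf r s (act A \<tau>) = 
     \<kappa> * kf (r * of_int (A$1$1) + s * of_int (A$2$1)) (r * of_int (A$1$2) + s * of_int (A$2$2)) \<tau>)"
proof -
  define a b c d where "a = A$1$1" and "b = A$1$2" and "c = A$2$1" and "d = A$2$2"
  define J where "J = autf A \<tau>"
  define \<tau>1 where "\<tau>1 = act A \<tau>"
  have det': "of_int a * of_int d - of_int b * of_int c = (1::complex)"
    using SL2Z_det_complex[OF A] by (simp add: a_def b_def c_def d_def)
  have J0: "J \<noteq> 0" unfolding J_def by (rule autf_nz[OF A \<tau>])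
  have Jeq: "J = of_int c * \<tau> + of_int d" by (simp add: J_def autf_def c_def d_def)
  have \<tau>1: "\<tau>1 * J = of_int a * \<tau> + of_int b" using J0 by (simp add: \<tau>1_def act_eq J_def a_def b_def)
  obtain \<kappa> where \<kappa>: "\<kappa> \<noteq> 0" and tr: "\<And>z. jtheta (z / J) \<tau>1 = \<kappa> * exp (pi * \<i> * of_int c * z\<^sup>2 / J) * jtheta z \<tau>"
    using jtheta_transform[OF A \<tau>] unfolding J_def \<tau>1_def c_def by blast
  have "kf r s \<tau>1 = \<kappa> * kf (r * a + s * c) (r * b + s * d) \<tau>" for r s
  proof -
    define r' s' where "r' = r * a + s * c" and "s' = r * b + s * d"
    define z where "z = r' * \<tau> + s'"
    have z: "z = (r * \<tau>1 + s) * J"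
    proof -
      have "(r * \<tau>1 + s) * J = r * (\<tau>1 * J) + s * J" by (simp add: algebra_simps)
      also have "\<dots> = z" unfolding \<tau>1 by (simp add: z_def r'_def s'_def Jeq algebra_simps)
      finally show ?thesis by simp
    qed
    hence zJ: "r * \<tau>1 + s = z / J" using J0 by simp
    \<comment> \<open>The exponents match because the determinant is 1: it turns r + c z into r'
      J.\<close>
    have ex: "r * (z / J) + of_int c * z\<^sup>2 / J = r' * z"
    proof -
      have "r + of_int c * z = r' * J + r * (1 - (of_int a * of_int d - of_int b * of_int c))"
        by (simp add: z_def r'_def s'_def Jeq algebra_simps)
      hence "r + of_int c * z = r' * J" using det' by simp
      hence "(r + of_int c * z) * (z / J) = r' * z" using J0 by simp
      thus ?thesis by (simp add: algebra_simps power2_eq_square)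
    qed
    have "kf r s \<tau>1 = exp (pi * \<i> * r * (z / J)) * (\<kappa> * exp (pi * \<i> * of_int c * z\<^sup>2 / J) * jtheta z \<tau>)"
      unfolding kf_def zJ tr ..
    also have "\<dots> = \<kappa> * exp (pi * \<i> * (r * (z / J) + of_int c * z\<^sup>2 / J)) * jtheta z \<tau>"
      by (simp add: ring_distribs exp_add mult_ac)
    also have "\<dots> = \<kappa> * kf r' s' \<tau>"
      unfolding ex by (simp add: kf_def z_def mult_ac)
    finally show ?thesis by (simp add: r'_def s'_def)
  qed
  thus ?thesis using \<kappa> unfolding \<tau>1_def a_def b_def c_def d_def by blast
qed

lemma kf_uminus: "kf (- r) (- s) \<tau> = - kf r s \<tau>"
proof -
  have "complex_of_real (- r) * \<tau> + of_real (- s) = - (r * \<tau> + s)" by simp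
  thus ?thesis unfolding kf_def by (simp only: jtheta_uminus) (simp add: algebra_simps)
qed

lemma kf_shift:
  "kf (r + of_int m) (s + of_int n) \<tau> = (-1) powi (m + n + m * n) * exp (pi * \<i> * (r * n - m * s)) * kf r s \<tau>"
proof -
  define z where "z = r * \<tau> + s"
  have "complex_of_real (r + of_int m) * \<tau> + of_real (s + of_int n) = z + of_int n + of_int m * \<tau>"
    by (simp add: z_def algebra_simps)
  hence "kf (r + of_int m) (s + of_int n) \<tau> = exp (pi * \<i> * (r + of_int m) * (z + of_int n + of_int m * \<tau>)) *
      ((-1) powi (n + m) * exp (- pi * \<i> * of_int m ^ 2 * \<tau> - 2 * pi * \<i> * of_int m * z) * jtheta z \<tau>)"
    unfolding kf_def by (simp only: jtheta_add_lattice of_real_add of_real_of_int_eq)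
  also have "\<dots> = (-1) powi (m + n) * exp (pi * \<i> * (r + of_int m) * (z + of_int n + of_int m * \<tau>) + 
      (- pi * \<i> * of_int m ^ 2 * \<tau> - 2 * pi * \<i> * of_int m * z)) * jtheta z \<tau>"
    by (simp add: exp_add add.commute)
  also have "pi * \<i> * (r + of_int m) * (z + of_int n + of_int m * \<tau>) + 
      (- pi * \<i> * of_int m ^ 2 * \<tau> - 2 * pi * \<i> * of_int m * z) =
      pi * \<i> * of_int (m * n) + pi * \<i> * (r * n - m * s) + pi * \<i> * r * z"
    by (simp add: z_def power2_eq_square algebra_simps)
  also have "exp \<dots> = (-1) powi (m * n) * exp (pi * \<i> * (r * n - m * s)) * exp (pi * \<i> * r * z)"
    by (simp only: exp_add exp_pi_i_int)
  finally show ?thesis by (simp add: kf_def z_def power_int_add mult_ac)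
qed

text \<open>Estimates at the cusps use moduli only, so characteristics may be reduced modulo 1 there
  without tracking roots of unity.\<close>

lemma norm_kf_shift: "norm (kf (r + of_int m) (s + of_int n) \<tau>) = norm (kf r s \<tau>)"
proof -
  have "norm (exp (complex_of_real pi * \<i> * (r * n - m * s))) = 1"
    by (simp add: norm_exp_eq_Re)
  thus ?thesis by (simp add: kf_shift norm_mult)
qed

lemma kf_zero_iff:
  assumes "Im \<tau> > 0"
  shows "kf r s \<tau> = 0 \<longleftrightarrow> r \<in> \<int> \<and> s \<in> \<int>"
proof -
  have "kf r s \<tau> = 0 \<longleftrightarrow> (\<exists>m n :: int. r * \<tau> + s = of_int m + of_int n * \<tau>)"
    by (simp add: kf_def jtheta_zero_iff[OF assms])
  also have "\<dots> \<longleftrightarrow> (\<exists>(m::int) (n::int). r = n \<and> s = m)"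
  proof (intro iffI; elim exE)
    fix m n :: int assume *: "r * \<tau> + s = of_int m + of_int n * \<tau>"
    from arg_cong[OF *, of Im] have "r = n" using assms by simp
    moreover from arg_cong[OF *, of Re] this have "s = m" by simp
    ultimately show "\<exists>(m::int) (n::int). r = n \<and> s = m" by blast
  qed (auto simp: add.commute)
  also have "\<dots> \<longleftrightarrow> r \<in> \<int> \<and> s \<in> \<int>" by (auto elim!: Ints_cases)
  finally show ?thesis .
qed

text \<open>The exponential completes the square: in powers of exp (2 pi i \<tau>) the exponents
  become (n + 1/2 + r)^2 / 2, so orders at the cusp can be read off.\<close>

lemma kf_series:
  "kf r s \<tau> = (\<Sum>\<^sub>\<infinity>n\<in>(UNIV :: int set). (-1) powi n * exp (pi * \<i> * (r + 2 * of_int n + 1) * s) *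
      exp (pi * \<i> * \<tau> * (of_int n + 1/2 + r)\<^sup>2))"
proof -
  have "kf r s \<tau> = (\<Sum>\<^sub>\<infinity>n. exp (pi * \<i> * r * (r * \<tau> + s)) * ((-1) powi n *
      exp (pi * \<i> * \<tau> * (of_int n + 1/2)\<^sup>2 + 2 * pi * \<i> * (of_int n + 1/2) * (r * \<tau> + s))))"
    by (simp add: kf_def jtheta_def infsum_cmult_right')
  also have "\<dots> = (\<Sum>\<^sub>\<infinity>n. (-1) powi n * exp (pi * \<i> * (r + 2 * of_int n + 1) * s) *
      exp (pi * \<i> * \<tau> * (of_int n + 1/2 + r)\<^sup>2))"
  proof (rule infsum_cong)
  fix n :: int
  have "exp (pi * \<i> * r * (r * \<tau> + s)) * exp (pi * \<i> * \<tau> * (of_int n + 1/2)\<^sup>2 + 2 * pi * \<i> * (of_int n + 1/2) * (r * \<tau> + s))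
     = exp (pi * \<i> * (r + 2 * of_int n + 1) * s) * exp (pi * \<i> * \<tau> * (of_int n + 1/2 + r)\<^sup>2)"
    unfolding exp_add[symmetric]
    by (rule arg_cong[of _ _ exp]) (simp add: power2_eq_square field_simps)
  thus "exp (pi * \<i> * r * (r * \<tau> + s)) * ((-1) powi n * exp (pi * \<i> * \<tau> * (of_int n + 1/2)\<^sup>2 + 2 * pi * \<i> * (of_int n + 1/2) * (r * \<tau> + s)))
      = (-1) powi n * exp (pi * \<i> * (r + 2 * of_int n + 1) * s) * exp (pi * \<i> * \<tau> * (of_int n + 1/2 + r)\<^sup>2)"
    by (simp add: mult_ac)
  qed
  finally show ?thesis by simp
qed

subsection \<open>Behaviour at the cusps\<close>

text \<open>The half-planes Im \<tau> > c form a base, so convergence is uniform in the real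
  part.\<close>

abbreviation at_ii_inf :: "complex filter" where
  "at_ii_inf \<equiv> filtercomap Im at_top"

definition qpar :: "nat \<Rightarrow> complex \<Rightarrow> complex" where
  "qpar h \<tau> = exp (2 * of_real pi * \<i> * \<tau> / of_nat h)"

lemma qpar_nz [simp]: "qpar h \<tau> \<noteq> 0" by (simp add: qpar_def)

lemma norm_qpar: "norm (qpar h \<tau>) = exp (- 2 * pi * Im \<tau> / h)"
  by (simp add: qpar_def norm_exp_eq_Re)

lemma qpar_in_ball: "h > 0 \<Longrightarrow> Im \<tau> > 0 \<Longrightarrow> qpar h \<tau> \<in> ball 0 1"
  by (simp add: norm_qpar)

lemma qpar_mult_power: "h' > 0 \<Longrightarrow> qpar (h * h') \<tau> ^ h' = qpar h \<tau>"
  by (simp add: qpar_def flip: exp_of_nat_mult)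

lemma eventually_at_ii_inf: "eventually P at_ii_inf \<longleftrightarrow> (\<exists>c. \<forall>\<tau>. Im \<tau> > c \<longrightarrow> P \<tau>)"
  unfolding eventually_filtercomap eventually_at_top_dense by (metis)

lemma eventually_uhp_at_ii_inf: "eventually (\<lambda>\<tau>. \<tau> \<in> uhp) at_ii_inf"
  unfolding eventually_at_ii_inf uhp_def by auto

lemma at_ii_inf_neq_bot [simp]: "at_ii_inf \<noteq> bot"
  unfolding trivial_limit_def eventually_at_ii_inf by (metis complex.sel(2) gt_ex)

lemma filterlim_Im_at_ii_inf: "filterlim Im at_top at_ii_inf"
  by (rule filterlim_filtercomap)

lemma filterlim_qpar_0:
  assumes "h > 0"
  shows "filterlim (qpar h) (at 0) at_ii_inf"
proof -
  have "((\<lambda>\<tau>. exp (- 2 * pi * Im \<tau> / h)) \<longlongrightarrow> 0) at_ii_inf"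
  proof -
    have "((\<lambda>y. exp (- 2 * pi * y / h)) \<longlongrightarrow> (0::real)) at_top"
      using assms by real_asymp
    thus ?thesis by (rule filterlim_compose[OF _ filterlim_Im_at_ii_inf])
  qed
  hence "(qpar h \<longlongrightarrow> 0) at_ii_inf"
    by (subst tendsto_norm_zero_iff[symmetric]) (simp add: norm_qpar)
  thus ?thesis by (simp add: filterlim_at)
qed

lemma eventually_qpar_at_0:
  assumes "h > 0" "eventually P (at 0)"
  shows "eventually (\<lambda>\<tau>. P (qpar h \<tau>)) at_ii_inf"
  using filterlim_qpar_0[OF assms(1)] assms(2) by (simp add: filterlim_iff)

section \<open>Arithmetic of functions meromorphic at the cusp\<close>

text \<open>In the filter form, conditions at the cusp are combined by
  \<open>eventually_elim\<close> without carrying explicit heights.\<close>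

lemma mero_inf_altdef:
  "meromorphic_at_i_infinity f \<longleftrightarrow>
     (\<exists>h g. h > 0 \<and> g meromorphic_on {0} \<and> eventually (\<lambda>\<tau>. f \<tau> = g (qpar h \<tau>)) at_ii_inf)"
proof -
  have ev: "(\<exists>c. \<forall>\<tau>\<in>uhp. Im \<tau> > c \<longrightarrow> P \<tau>) \<longleftrightarrow> eventually P at_ii_inf" for P
  proof -
    have "(\<exists>c. \<forall>\<tau>\<in>uhp. Im \<tau> > c \<longrightarrow> P \<tau>) \<longleftrightarrow> eventually (\<lambda>\<tau>. \<tau> \<in> uhp \<longrightarrow> P \<tau>) at_ii_inf"
      unfolding eventually_at_ii_inf by blast
    also have "\<dots> \<longleftrightarrow> eventually P at_ii_inf"
      by (intro eventually_subst eventually_mono[OF eventually_uhp_at_ii_inf]) auto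
    finally show ?thesis .
  qed
  show ?thesis
    by (simp only: meromorphic_at_i_infinity_def qpar_def[symmetric] ev[symmetric]) blast
qed

lemma mero_infI:
  assumes "h > 0" "g meromorphic_on {0}" "eventually (\<lambda>\<tau>. f \<tau> = g (qpar h \<tau>)) at_ii_inf"
  shows "meromorphic_at_i_infinity f"
  using assms unfolding mero_inf_altdef by blast

lemma mero_inf_cong:
  assumes "meromorphic_at_i_infinity f" "eventually (\<lambda>\<tau>. f \<tau> = f' \<tau>) at_ii_inf"
  shows "meromorphic_at_i_infinity f'"
proof -
  obtain h g where "h > 0" "g meromorphic_on {0}" and ev: "eventually (\<lambda>\<tau>. f \<tau> = g (qpar h \<tau>)) at_ii_inf"
    using assms unfolding mero_inf_altdef by blast
  moreover have "eventually (\<lambda>\<tau>. f' \<tau> = g (qpar h \<tau>)) at_ii_inf"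
    using ev assms(2) by eventually_elim auto
  ultimately show ?thesis using mero_infI by blast
qed

lemma meromorphic_compose_power:
  assumes "g meromorphic_on {0}" "h > 0"
  shows "(\<lambda>w. g (w ^ h)) meromorphic_on {0}"
proof -
  show ?thesis
    by (rule meromorphic_on_compose[of g "{0}" "\<lambda>w. w ^ h" "{0}"])
       (use assms in \<open>auto intro!: analytic_intros simp: zero_power\<close>)
qed

text \<open>The two expansions may use different widths. Both are rewritten in the parameter of
  width h1 * h2 by substituting powers.\<close>

lemma mero_inf_common:
  assumes "meromorphic_at_i_infinity f1" "meromorphic_at_i_infinity f2"
  obtains h g1 g2 where "h > 0" "g1 meromorphic_on {0}" "g2 meromorphic_on {0}"
    "eventually (\<lambda>\<tau>. f1 \<tau> = g1 (qpar h \<tau>) \<and> f2 \<tau> = g2 (qpar h \<tau>)) at_ii_inf"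
proof -
  obtain h1 g1 where 1: "h1 > 0" "g1 meromorphic_on {0}" "eventually (\<lambda>\<tau>. f1 \<tau> = g1 (qpar h1 \<tau>)) at_ii_inf"
    using assms unfolding mero_inf_altdef by blast
  obtain h2 g2 where 2: "h2 > 0" "g2 meromorphic_on {0}" "eventually (\<lambda>\<tau>. f2 \<tau> = g2 (qpar h2 \<tau>)) at_ii_inf"
    using assms unfolding mero_inf_altdef by blast
  show ?thesis
  proof (rule that[of "h1 * h2" "\<lambda>w. g1 (w ^ h2)" "\<lambda>w. g2 (w ^ h1)"])
    show "eventually (\<lambda>\<tau>. f1 \<tau> = g1 (qpar (h1 * h2) \<tau> ^ h2) \<and> f2 \<tau> = g2 (qpar (h1 * h2) \<tau> ^ h1)) at_ii_inf"
      using 1(3) 2(3)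
      by eventually_elim (use qpar_mult_power[OF 2(1), of h1] qpar_mult_power[OF 1(1), of h2] in \<open>simp add: mult.commute\<close>)
  qed (use 1 2 in \<open>auto intro!: meromorphic_compose_power\<close>)
qed

lemma mero_inf_const [simp, intro]: "meromorphic_at_i_infinity (\<lambda>_. c)"
  by (rule mero_infI[of 1 "\<lambda>_. c"]) auto

lemma mero_inf_add:
  assumes "meromorphic_at_i_infinity f1" "meromorphic_at_i_infinity f2"
  shows "meromorphic_at_i_infinity (\<lambda>\<tau>. f1 \<tau> + f2 \<tau>)"
proof -
  obtain h g1 g2 where *: "h > 0" "g1 meromorphic_on {0}" "g2 meromorphic_on {0}"
    "eventually (\<lambda>\<tau>. f1 \<tau> = g1 (qpar h \<tau>) \<and> f2 \<tau> = g2 (qpar h \<tau>)) at_ii_inf"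
    by (rule mero_inf_common[OF assms])
  show ?thesis
    by (rule mero_infI[of h "\<lambda>w. g1 w + g2 w"])
       (use * in \<open>auto intro!: meromorphic_intros elim!: eventually_mono\<close>)
qed

lemma mero_inf_mult:
  assumes "meromorphic_at_i_infinity f1" "meromorphic_at_i_infinity f2"
  shows "meromorphic_at_i_infinity (\<lambda>\<tau>. f1 \<tau> * f2 \<tau>)"
proof -
  obtain h g1 g2 where *: "h > 0" "g1 meromorphic_on {0}" "g2 meromorphic_on {0}"
    "eventually (\<lambda>\<tau>. f1 \<tau> = g1 (qpar h \<tau>) \<and> f2 \<tau> = g2 (qpar h \<tau>)) at_ii_inf"
    by (rule mero_inf_common[OF assms])
  show ?thesis
    by (rule mero_infI[of h "\<lambda>w. g1 w * g2 w"])
       (use * in \<open>auto intro!: meromorphic_intros elim!: eventually_mono\<close>)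
qed

lemma mero_inf_divide:
  assumes "meromorphic_at_i_infinity f1" "meromorphic_at_i_infinity f2"
  shows "meromorphic_at_i_infinity (\<lambda>\<tau>. f1 \<tau> / f2 \<tau>)"
proof -
  obtain h g1 g2 where *: "h > 0" "g1 meromorphic_on {0}" "g2 meromorphic_on {0}"
    "eventually (\<lambda>\<tau>. f1 \<tau> = g1 (qpar h \<tau>) \<and> f2 \<tau> = g2 (qpar h \<tau>)) at_ii_inf"
    by (rule mero_inf_common[OF assms])
  show ?thesis
    by (rule mero_infI[of h "\<lambda>w. g1 w / g2 w"])
       (use * in \<open>auto intro!: meromorphic_intros elim!: eventually_mono\<close>)
qed

lemma mero_inf_power:
  assumes "meromorphic_at_i_infinity f"
  shows "meromorphic_at_i_infinity (\<lambda>\<tau>. f \<tau> ^ n)"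
  by (induction n) (auto intro!: mero_inf_mult assms)

text \<open>The leading term of the Laurent expansion in \<open>qpar h\<close>. The first
  alternative stands apart because the zero function has no order.\<close>

lemma mero_inf_normal_form:
  assumes "meromorphic_at_i_infinity f"
  shows "eventually (\<lambda>\<tau>. f \<tau> = 0) at_ii_inf \<or>
    (\<exists>h k u. h > 0 \<and> u analytic_on {0} \<and> u 0 \<noteq> 0 \<and>
       eventually (\<lambda>\<tau>. f \<tau> = qpar h \<tau> powi k * u (qpar h \<tau>)) at_ii_inf)"
proof -
  obtain h g where h: "h > 0" and g: "g meromorphic_on {0}"
    and ev: "eventually (\<lambda>\<tau>. f \<tau> = g (qpar h \<tau>)) at_ii_inf"
    using assms unfolding mero_inf_altdef by blast
  have iso: "isolated_singularity_at g 0" "not_essential g 0" using g by (auto simp: meromorphic_at_iff)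
  show ?thesis
  proof (cases "frequently (\<lambda>w. g w \<noteq> 0) (at 0)")
    case False
    hence "eventually (\<lambda>w. g w = 0) (at 0)" by (simp add: frequently_def)
    from eventually_qpar_at_0[OF h this] ev
    have "eventually (\<lambda>\<tau>. f \<tau> = 0) at_ii_inf" by eventually_elim auto
    thus ?thesis ..
  next
    case True
    define u k where "u = zor_poly g 0" and "k = zorder g 0"
    obtain r where r: "u 0 \<noteq> 0" "r > 0" "u holomorphic_on cball 0 r"
      "\<And>w. w \<in> cball 0 r - {0} \<Longrightarrow> g w = u w * (w - 0) powi k \<and> u w \<noteq> 0"
      using zorder_exist[OF iso True] unfolding u_def k_def by blast
    have "u analytic_on {0}" using r(2,3) 
      by (meson analytic_at ball_subset_cball centre_in_ball holomorphic_on_subset open_ball)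
    moreover have "eventually (\<lambda>w. g w = w powi k * u w) (at 0)"
      using r(4) r(2) by (auto simp: eventually_at dist_norm intro!: exI[of _ r])
    from eventually_qpar_at_0[OF h this] ev
    have "eventually (\<lambda>\<tau>. f \<tau> = qpar h \<tau> powi k * u (qpar h \<tau>)) at_ii_inf" by eventually_elim auto
    ultimately show ?thesis using h r(1) by blast
  qed
qed

section \<open>Expansions and leading terms of Klein forms\<close>

text \<open>The exponents grow at least like the absolute value of n, up to the constant K, so on a
  disc of radius \<rho> < 1 a geometric series dominates.\<close>

lemma holomorphic_on_theta_series:
  fixes c :: "int \<Rightarrow> complex" and N :: "int \<Rightarrow> nat"
  assumes c: "\<And>n. norm (c n) \<le> 1" and N: "\<And>n. nat \<bar>n\<bar> \<le> N n + K"
  shows "(\<lambda>w. \<Sum>\<^sub>\<infinity>n. c n * w ^ N n) holomorphic_on ball 0 1"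
proof (rule holomorphic_on_infsum)
  fix z :: complex assume z: "z \<in> ball 0 1"
  define \<rho> r where "\<rho> = (1 + norm z) / 2" and "r = (1 - norm z) / 2"
  have r: "r > 0" "\<rho> > 0" "\<rho> < 1" using z by (auto simp: \<rho>_def r_def add_pos_nonneg)
  have w: "norm w \<le> \<rho>" if "w \<in> cball z r" for w
    using that norm_triangle_ineq2[of w z]
    by (simp add: dist_norm norm_minus_commute \<rho>_def r_def field_simps)
  show "\<exists>r>0. \<exists>M. cball z r \<subseteq> ball 0 1 \<and> M summable_on UNIV \<and>
          (\<forall>n\<in>UNIV. \<forall>w\<in>cball z r. norm (c n * w ^ N n) \<le> M n)"
  proof (intro exI[of _ r] exI[of _ "\<lambda>n. (1 / \<rho> ^ K) * \<rho> ^ nat \<bar>n\<bar>"] conjI ballI)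
    show "(\<lambda>n::int. (1 / \<rho> ^ K) * \<rho> ^ nat \<bar>n\<bar>) summable_on UNIV"
      by (intro summable_on_cmult_right summable_on_int_power_abs) (use r in auto)
    show "cball z r \<subseteq> ball 0 1" using w r by force
    fix n :: int and w assume "w \<in> cball z r"
    hence "norm (c n * w ^ N n) \<le> 1 * \<rho> ^ N n"
      unfolding norm_mult norm_power using c w r by (intro mult_mono power_mono) auto
    also have "\<dots> = (1 / \<rho> ^ K) * \<rho> ^ (N n + K)" using r by (simp add: power_add)
    also have "\<dots> \<le> (1 / \<rho> ^ K) * \<rho> ^ nat \<bar>n\<bar>"
      using r N[of n] by (intro mult_left_mono power_decreasing) auto
    finally show "norm (c n * w ^ N n) \<le> (1 / \<rho> ^ K) * \<rho> ^ nat \<bar>n\<bar>" .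
  qed (use r in auto)
qed (auto intro!: holomorphic_intros)

lemma norm_exp_i_real: "norm (exp (pi * \<i> * complex_of_real x)) = 1"
  by (simp add: norm_exp_eq_Re)

lemma int_abs_le_affine_square:
  fixes n A B :: int
  assumes "A > 0"
  shows "nat \<bar>n\<bar> \<le> nat ((A * n + B)\<^sup>2) + nat \<bar>B\<bar>"
proof -
  have "\<bar>n\<bar> \<le> A * \<bar>n\<bar>" using assms by (simp add: mult_le_cancel_right1)
  also have "\<dots> = \<bar>A * n\<bar>" using assms by (simp add: abs_mult)
  also have "\<dots> \<le> \<bar>A * n + B\<bar> + \<bar>B\<bar>" by linarith
  also have "\<bar>A * n + B\<bar> \<le> (A * n + B)\<^sup>2"
  proof (cases "A * n + B = 0")
    case False
    hence "\<bar>A * n + B\<bar> * 1 \<le> \<bar>A * n + B\<bar> * \<bar>A * n + B\<bar>" by (intro mult_left_mono) auto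
    thus ?thesis by (simp add: power2_eq_square)
  qed auto
  finally show ?thesis by linarith
qed

text \<open>For r = i / j the exponents (n + 1/2 + r)^2 have the common denominator 4 j^2. The
  affine argument is the form that \<open>7 * act A \<tau>\<close> takes after reduction; m
  contributes only constants of modulus 1.\<close>

lemma kf_q_expansion:
  fixes i m :: int and j p l :: nat
  assumes pos: "j > 0" "p > 0" "l > 0"
  obtains h g where "h > 0" "g holomorphic_on ball 0 1"
    "\<And>\<tau>::complex. kf (i / j) s ((p * \<tau> + m) / l) = g (qpar h \<tau>)"
proof -
  define r where "r = real_of_int i / j"
  define e where "e = (\<lambda>n::int. 2 * int j * n + (int j + 2 * i))"
  \<comment> \<open>Since \<open>e n\<close> is 2 j (n + 1/2 + i / j), the denominator is 4 j^2; a
    further 2 passes from pi i to 2 pi i, and l clears the denominator of the argument.\<close>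
  define h where "h = 8 * j\<^sup>2 * l"
  define c where "c = (\<lambda>n::int. (-1) powi n * exp (pi * \<i> * complex_of_real ((r + 2 * n + 1) * s)) *
       exp (pi * \<i> * complex_of_real (m * (e n)\<^sup>2 / (4 * j\<^sup>2 * l))))"
  define g where "g = (\<lambda>w. \<Sum>\<^sub>\<infinity>n. c n * w ^ (p * nat ((e n)\<^sup>2)))"
  show ?thesis
  proof (rule that)
    show "h > 0" using pos by (simp add: h_def)
    have "nat \<bar>n\<bar> \<le> p * nat ((e n)\<^sup>2) + nat \<bar>int j + 2 * i\<bar>" for n
    proof -
      have "nat \<bar>n\<bar> \<le> nat ((e n)\<^sup>2) + nat \<bar>int j + 2 * i\<bar>"
        unfolding e_def by (rule int_abs_le_affine_square) (use pos in auto)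
      also have "nat ((e n)\<^sup>2) \<le> p * nat ((e n)\<^sup>2)" using pos by simp
      finally show ?thesis by simp
    qed
    moreover have "norm (c n) \<le> 1" for n by (simp only: c_def norm_mult norm_exp_i_real) simp
    ultimately show "g holomorphic_on ball 0 1"
      unfolding g_def by (intro holomorphic_on_theta_series)
    fix \<tau> :: complex
    define \<tau>' where "\<tau>' = (p * \<tau> + m) / l"
    have "kf r s \<tau>' = g (qpar h \<tau>)"
      unfolding kf_series g_def
    proof (rule infsum_cong)
      fix n :: int
      have sq: "(of_int n + 1/2 + complex_of_real r)\<^sup>2 = complex_of_int ((e n)\<^sup>2) / (4 * of_nat j ^ 2)"
      proof -
        have "of_int n + 1/2 + complex_of_real r = complex_of_int (e n) / (2 * of_nat j)"
          using pos by (simp add: e_def r_def field_simps)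
        thus ?thesis by (simp add: power_divide power_mult_distrib)
      qed
      have "pi * \<i> * \<tau>' * (complex_of_int ((e n)\<^sup>2) / (4 * of_nat j ^ 2)) =
          of_nat (p * nat ((e n)\<^sup>2)) * (2 * of_real pi * \<i> * \<tau> / of_nat h) +
          pi * \<i> * complex_of_real (m * (e n)\<^sup>2 / (4 * j\<^sup>2 * l))"
        using pos by (simp add: h_def \<tau>'_def field_simps power2_eq_square)
      hence "exp (pi * \<i> * \<tau>' * (of_int n + 1/2 + complex_of_real r)\<^sup>2) =
          qpar h \<tau> ^ (p * nat ((e n)\<^sup>2)) * exp (pi * \<i> * complex_of_real (m * (e n)\<^sup>2 / (4 * j\<^sup>2 * l)))"
        unfolding sq by (simp only: exp_add exp_of_nat_mult qpar_def)
      thus "(-1) powi n * exp (pi * \<i> * (complex_of_real r + 2 * of_int n + 1) * s) * exp (pi * \<i> * \<tau>' * (of_int n + 1/2 + complex_of_real r)\<^sup>2)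
          = c n * qpar h \<tau> ^ (p * nat ((e n)\<^sup>2))"
        by (simp add: c_def mult_ac)
    qed
    thus "kf (i / j) s ((p * \<tau> + m) / l) = g (qpar h \<tau>)" by (simp add: r_def \<tau>'_def)
  qed
qed

text \<open>For |r| at most 1/2 the least value of (n + 1/2 + r)^2 is \<mu>^2. It is attained once,
  at n = 0 or n = -1, except for r = 0, where both terms contribute and combine to a sine.\<close>

lemma kf_leading_term:
  fixes i :: int and j :: nat
  assumes j: "j > 0" and ij: "2 * \<bar>i\<bar> \<le> int j"
  defines "\<mu> \<equiv> 1/2 - \<bar>i / j\<bar>"
  shows "((\<lambda>\<tau>. norm (kf (i / j) s \<tau>) * exp (pi * \<mu>\<^sup>2 * Im \<tau>)) \<longlongrightarrow>
            (if i = 0 then 2 * \<bar>sin (pi * s)\<bar> else 1)) at_ii_inf"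
proof -
  define r where "r = real_of_int i / j"
  define E where "E = int j - 2 * \<bar>i\<bar>"
  define e where "e = (\<lambda>n::int. 2 * int j * n + (int j + 2 * i))"
  \<comment> \<open>The exponent left after division by the dominant power; it is 0 exactly for the
    dominant terms.\<close>
  define N where "N = (\<lambda>n. nat ((e n)\<^sup>2 - E\<^sup>2))"
  define h where "h = 8 * j\<^sup>2"
  define c where "c = (\<lambda>n::int. (-1) powi n * exp (pi * \<i> * complex_of_real ((r + 2 * n + 1) * s)))"
  define g where "g = (\<lambda>w. \<Sum>\<^sub>\<infinity>n. c n * w ^ N n)"
  have E0: "E \<ge> 0" using ij by (simp add: E_def)
  have far: "\<bar>e n\<bar> > E" if "n \<ge> 1 \<or> n \<le> -2" for n
  proof -
    have "3 * int j \<le> \<bar>2 * n + 1\<bar> * int j" using that by (intro mult_right_mono) auto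
    also have "\<dots> = \<bar>int j * (2 * n + 1)\<bar>" by (simp add: abs_mult mult.commute)
    also have "int j * (2 * n + 1) = e n - 2 * i" by (simp add: e_def algebra_simps)
    finally show ?thesis using j unfolding E_def by linarith
  qed
  have near: "e 0 = int j + 2 * i" "e (-1) = 2 * i - int j" by (auto simp: e_def)
  have ge: "\<bar>e n\<bar> \<ge> E" and zero: "\<bar>e n\<bar> = E \<longleftrightarrow> (n = 0 \<and> i \<le> 0) \<or> (n = -1 \<and> i \<ge> 0)" for n
  proof -
    consider "n \<ge> 1 \<or> n \<le> -2" | "n = 0" | "n = -1" by linarith
    hence "\<bar>e n\<bar> \<ge> E \<and> (\<bar>e n\<bar> = E \<longleftrightarrow> (n = 0 \<and> i \<le> 0) \<or> (n = -1 \<and> i \<ge> 0))"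
      using far[of n] ij j by cases (auto simp: near E_def)
    thus "\<bar>e n\<bar> \<ge> E" "\<bar>e n\<bar> = E \<longleftrightarrow> (n = 0 \<and> i \<le> 0) \<or> (n = -1 \<and> i \<ge> 0)" by auto
  qed
  have sqge: "(e n)\<^sup>2 \<ge> E\<^sup>2" for n using ge[of n] E0 by (metis abs_le_square_iff abs_of_nonneg)
  have N0: "N n = 0 \<longleftrightarrow> (n = 0 \<and> i \<le> 0) \<or> (n = -1 \<and> i \<ge> 0)" for n
  proof -
    have "N n = 0 \<longleftrightarrow> (e n)\<^sup>2 = E\<^sup>2" using sqge[of n] by (auto simp: N_def)
    also have "\<dots> \<longleftrightarrow> \<bar>e n\<bar> = E" using E0 by (metis abs_of_nonneg power2_abs power2_eq_iff_nonneg abs_ge_zero)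
    finally show ?thesis using zero by simp
  qed
  have hol: "g holomorphic_on ball 0 1"
    unfolding g_def
  proof (rule holomorphic_on_theta_series)
    show "norm (c n) \<le> 1" for n by (simp only: c_def norm_mult norm_exp_i_real) simp
    fix n
    have "nat \<bar>n\<bar> \<le> nat ((e n)\<^sup>2) + nat \<bar>int j + 2 * i\<bar>"
      unfolding e_def by (rule int_abs_le_affine_square) (use j in auto)
    thus "nat \<bar>n\<bar> \<le> N n + (nat \<bar>int j + 2 * i\<bar> + nat (E\<^sup>2))" unfolding N_def by linarith
  qed
  have h: "h > 0" using j by (simp add: h_def)
  have "isCont g 0"
    using hol by (meson centre_in_ball continuous_on_eq_continuous_at holomorphic_on_imp_continuous_on open_ball zero_less_one)
  hence "((\<lambda>\<tau>. norm (g (qpar h \<tau>))) \<longlongrightarrow> norm (g 0)) at_ii_inf"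
    using filterlim_qpar_0[OF h] by (intro tendsto_norm isCont_tendsto_compose[of 0 g]) (auto simp: filterlim_at)
  moreover have "norm (g (qpar h \<tau>)) = norm (kf (i / j) s \<tau>) * exp (pi * \<mu>\<^sup>2 * Im \<tau>)" for \<tau>
  proof -
    have \<mu>: "\<mu> = E / (2 * j)" using j by (simp add: \<mu>_def E_def field_simps)
    have "kf r s \<tau> * exp (- (pi * \<i> * \<tau> * (complex_of_real \<mu>)\<^sup>2)) = g (qpar h \<tau>)"
      unfolding kf_series g_def infsum_cmult_left'[symmetric]
    proof (rule infsum_cong)
      fix n :: int
      have sq: "(of_int n + 1/2 + complex_of_real r)\<^sup>2 = complex_of_int ((e n)\<^sup>2) / (4 * of_nat j ^ 2)"
      proof -
        have "of_int n + 1/2 + complex_of_real r = complex_of_int (e n) / (2 * of_nat j)"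
          using j by (simp add: e_def r_def field_simps)
        thus ?thesis by (simp add: power_divide power_mult_distrib)
      qed
      have Nn: "complex_of_nat (N n) = of_int ((e n)\<^sup>2) - of_int (E\<^sup>2)"
        using sqge[of n] by (simp add: N_def of_nat_nat)
      have mu2: "(complex_of_real \<mu>)\<^sup>2 = of_int (E\<^sup>2) / (4 * of_nat j ^ 2)"
        by (simp add: \<mu> power_divide power_mult_distrib)
      have "pi * \<i> * \<tau> * (complex_of_int ((e n)\<^sup>2) / (4 * of_nat j ^ 2)) + - (pi * \<i> * \<tau> * (complex_of_real \<mu>)\<^sup>2) =
          of_nat (N n) * (2 * of_real pi * \<i> * \<tau> / of_nat h)"
        unfolding Nn mu2 h_def using j by (simp add: field_simps)
      hence "exp (pi * \<i> * \<tau> * (of_int n + 1/2 + complex_of_real r)\<^sup>2) * exp (- (pi * \<i> * \<tau> * (complex_of_real \<mu>)\<^sup>2)) = qpar h \<tau> ^ N n"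
        unfolding sq exp_add[symmetric] by (simp only: exp_of_nat_mult qpar_def)
      thus "(-1) powi n * exp (pi * \<i> * (complex_of_real r + 2 * of_int n + 1) * s) * exp (pi * \<i> * \<tau> * (of_int n + 1/2 + complex_of_real r)\<^sup>2)
          * exp (- (pi * \<i> * \<tau> * (complex_of_real \<mu>)\<^sup>2)) = c n * qpar h \<tau> ^ N n"
        by (simp add: c_def mult_ac)
    qed
    from arg_cong[OF this, of norm] show ?thesis
      by (simp add: norm_mult norm_exp_eq_Re r_def mult_ac flip: of_real_power)
  qed
  moreover have "norm (g 0) = (if i = 0 then 2 * \<bar>sin (pi * s)\<bar> else 1)"
  proof -
    have "g 0 = (\<Sum>\<^sub>\<infinity>n\<in>{n. N n = 0}. c n)"
      unfolding g_def by (rule infsum_cong_neutral) (auto simp: power_0_left)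
    also have "{n. N n = 0} = (if i = 0 then {0, -1} else if i > 0 then {-1} else {0})"
      by (auto simp: N0)
    finally have g0: "g 0 = (if i = 0 then c 0 + c (-1) else if i > 0 then c (-1) else c 0)" by simp
    have c1: "norm (c n) = 1" for n by (simp only: c_def norm_mult norm_exp_i_real) simp
    show ?thesis
    proof (cases "i = 0")
      case True
      hence "c 0 + c (-1) = exp (\<i> * (pi * s)) - exp (- (\<i> * (pi * s)))"
        by (simp add: c_def r_def mult_ac)
      also have "\<dots> = 2 * \<i> * sin (complex_of_real (pi * s))"
        by (simp add: sin_exp_eq)
      also have "norm \<dots> = 2 * \<bar>sin (pi * s)\<bar>"
        by (simp only: norm_mult sin_of_real norm_of_real) simp
      finally show ?thesis using g0 True by simp
    qed (use g0 c1 in auto)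
  qed
  ultimately show ?thesis by simp
qed

subsection \<open>The action of the modular group\<close>

definition mk :: "int \<Rightarrow> int \<Rightarrow> int \<Rightarrow> int \<Rightarrow> int^2^2" where
  "mk a b c d = vector [vector [a, b], vector [c, d]]"

lemma mk_entries [simp]:
  "mk a b c d $ 1 $ 1 = a" "mk a b c d $ 1 $ 2 = b" "mk a b c d $ 2 $ 1 = c" "mk a b c d $ 2 $ 2 = d"
  by (simp_all add: mk_def)

lemma mk_in_SL2Z [simp]: "mk a b c d \<in> SL2Z \<longleftrightarrow> a * d - b * c = 1"
  by (simp add: SL2Z_def det_2)

lemma mult_entries:
  fixes A B :: "int^2^2"
  shows "(A ** B) $ i $ j = A $ i $ 1 * B $ 1 $ j + A $ i $ 2 * B $ 2 $ j"
  by (simp add: matrix_matrix_mult_def sum_2)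

lemma SL2Z_mult: "A \<in> SL2Z \<Longrightarrow> B \<in> SL2Z \<Longrightarrow> A ** B \<in> SL2Z"
  by (simp add: SL2Z_def det_mul)

lemma uhp_iff: "\<tau> \<in> uhp \<longleftrightarrow> Im \<tau> > 0" by (simp add: uhp_def)

lemma act_in_uhp: "A \<in> SL2Z \<Longrightarrow> \<tau> \<in> uhp \<Longrightarrow> act A \<tau> \<in> uhp"
  by (simp add: uhp_iff Im_act_pos)

lemma act_mult:
  assumes "B \<in> SL2Z" "\<tau> \<in> uhp"
  shows "act (A ** B) \<tau> = act A (act B \<tau>)"
proof -
  have nz: "autf B \<tau> \<noteq> 0" using assms by (simp add: uhp_iff autf_nz)
  have 1: "of_int (A$1$1) * act B \<tau> + of_int (A$1$2) =
      (of_int ((A ** B)$1$1) * \<tau> + of_int ((A ** B)$1$2)) / autf B \<tau>"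
    using nz by (simp add: act_eq mult_entries autf_def field_simps)
  have 2: "autf A (act B \<tau>) = autf (A ** B) \<tau> / autf B \<tau>"
    using nz by (simp add: act_eq mult_entries autf_def field_simps)
  show ?thesis
    unfolding act_eq[of A] 1 2 act_eq[of "A ** B"] using nz by simp
qed

definition minv :: "int^2^2 \<Rightarrow> int^2^2" where
  "minv A = mk (A$2$2) (- (A$1$2)) (- (A$2$1)) (A$1$1)"

lemma minv_SL2Z [simp]: "A \<in> SL2Z \<Longrightarrow> minv A \<in> SL2Z"
  using SL2Z_det[of A] by (simp add: minv_def algebra_simps)

lemma act_minv:
  assumes "A \<in> SL2Z" "\<tau> \<in> uhp"
  shows "act (minv A) (act A \<tau>) = \<tau>"
proof -
  have "act (minv A ** A) \<tau> = \<tau>"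
    using SL2Z_det_complex[OF assms(1)]
    by (simp add: act_eq autf_def mult_entries minv_def algebra_simps flip: of_int_mult)
  thus ?thesis using act_mult[OF assms] by simp
qed

lemma minv_minv [simp]: "minv (minv A) = A"
proof -
  have "minv (minv A) $ i $ j = A $ i $ j" for i j
    using exhaust_2[of i] exhaust_2[of j] by (auto simp: minv_def)
  thus ?thesis by (simp add: vec_eq_iff)
qed

lemma act_minv':
  assumes "A \<in> SL2Z" "\<tau> \<in> uhp"
  shows "act A (act (minv A) \<tau>) = \<tau>"
  using act_minv[of "minv A" \<tau>] assms by simp

lemma open_uhp: "open uhp"
  unfolding uhp_def by (rule open_halfspace_Im_gt)

lemma connected_uhp: "connected uhp"
  unfolding uhp_def by (intro convex_connected convex_halfspace_Im_gt)

lemma act_holomorphic: "A \<in> SL2Z \<Longrightarrow> act A holomorphic_on uhp"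
  unfolding act_eq[abs_def] autf_def[abs_def]
  using autf_nz by (auto intro!: holomorphic_intros simp: uhp_iff autf_def)

lemma holomorphic_compose_act:
  assumes "A \<in> SL2Z" "f holomorphic_on uhp"
  shows "(\<lambda>\<tau>. f (act A \<tau>)) holomorphic_on uhp"
  using holomorphic_on_compose_gen[OF act_holomorphic[OF assms(1)] assms(2)] act_in_uhp[OF assms(1)]
  by (auto simp: o_def)

lemma act_translation: "act (mk 1 n 0 1) \<tau> = \<tau> + of_int n"
  by (simp add: act_eq autf_def)

section \<open>Reduction to a strip and to finitely many cosets\<close>

lemma finite_small_autf:
  assumes "\<tau> \<in> uhp"
  shows "finite {(c::int, d::int). norm (of_int c * \<tau> + of_int d) \<le> 1}"
proof -
  have y: "Im \<tau> > 0" using assms by (simp add: uhp_iff)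
  define C where "C = \<lceil>1 / Im \<tau>\<rceil>"
  define D where "D = \<lceil>1 + of_int C * norm \<tau>\<rceil>"
  have "{(c::int, d::int). norm (of_int c * \<tau> + of_int d) \<le> 1} \<subseteq> {-C..C} \<times> {-D..D}"
  proof safe
    fix c d :: int assume *: "norm (of_int c * \<tau> + of_int d) \<le> 1"
    have "\<bar>Im (of_int c * \<tau> + of_int d)\<bar> \<le> 1" using abs_Im_le_cmod * order_trans by blast
    hence "\<bar>real_of_int c\<bar> * Im \<tau> \<le> 1" using y by (simp add: abs_mult)
    hence "\<bar>real_of_int c\<bar> \<le> 1 / Im \<tau>" using y by (simp add: field_simps)
    hence c: "\<bar>c\<bar> \<le> C" unfolding C_def by linarith
    have "real_of_int \<bar>d\<bar> = norm (complex_of_int d)" by simp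
    also have "\<dots> \<le> norm (of_int c * \<tau> + of_int d) + norm (of_int c * \<tau>)"
      using norm_triangle_ineq4[of "of_int c * \<tau> + of_int d" "of_int c * \<tau>"] by simp
    also have "\<dots> \<le> 1 + of_int C * norm \<tau>"
      using * c by (intro add_mono) (auto simp: norm_mult intro!: mult_right_mono)
    finally have "\<bar>d\<bar> \<le> D" unfolding D_def by linarith
    thus "c \<in> {-C..C}" "d \<in> {-D..D}" using c by auto
  qed
  thus ?thesis by (rule finite_subset) auto
qed

text \<open>A minimal |c \<tau> + d| means a maximal imaginary part. After the real part is
  translated into [-1/2, 1/2], the inversion in \<open>A2\<close> cannot raise the imaginary part,
  so the point has modulus at least 1 and its imaginary part is bounded below.\<close>

lemma fundamental_strip:
  assumes \<tau>: "\<tau> \<in> uhp"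
  obtains A where "A \<in> SL2Z" "\<bar>Re (act A \<tau>)\<bar> \<le> 1/2" "Im (act A \<tau>) \<ge> 1/2"
proof -
  \<comment> \<open>Values above 1 are discarded, which keeps S finite; the identity matrix
    contributes 1, so S is not empty.\<close>
  define S where "S = (\<lambda>(c::int, d::int). norm (of_int c * \<tau> + of_int d)) `
      {(c, d). norm (of_int c * \<tau> + of_int d) \<le> 1 \<and> (\<exists>A\<in>SL2Z. A$2$1 = c \<and> A$2$2 = d)}"
  have finS: "finite S"
    unfolding S_def by (intro finite_imageI finite_subset[OF _ finite_small_autf[OF \<tau>]]) auto
  have "mk 1 0 0 1 \<in> SL2Z" by simp
  hence "1 \<in> S" unfolding S_def by (intro image_eqI[of _ _ "(0, 1)"]) (auto intro!: bexI[of _ "mk 1 0 0 1"])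
  hence "Min S \<in> S" using finS by (intro Min_in) auto
  then obtain A0 where A0: "A0 \<in> SL2Z" "norm (autf A0 \<tau>) = Min S"
    unfolding S_def by (auto simp: autf_def)
  have min: "norm (autf A0 \<tau>) \<le> norm (autf A \<tau>)" if "A \<in> SL2Z" for A
  proof (cases "norm (autf A \<tau>) \<le> 1")
    case True
    hence "norm (autf A \<tau>) \<in> S"
      unfolding S_def using that by (intro image_eqI[of _ _ "(A$2$1, A$2$2)"]) (auto simp: autf_def)
    thus ?thesis using A0(2) finS by simp
  next
    case False
    have "Min S \<le> 1" using \<open>1 \<in> S\<close> finS by simp
    thus ?thesis using False A0 by simp
  qed
  define k where "k = round (Re (act A0 \<tau>))"
  define A1 where "A1 = mk 1 (-k) 0 1 ** A0"
  have A1: "A1 \<in> SL2Z" unfolding A1_def by (intro SL2Z_mult A0) simp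
  have act1: "act A1 \<tau> = act A0 \<tau> - of_int k"
    unfolding A1_def using act_mult[OF A0(1) \<tau>] act_translation[of "-k"] by simp
  have "autf A1 \<tau> = autf A0 \<tau>" by (simp add: autf_def A1_def mult_entries)
  define \<tau>' where "\<tau>' = act A1 \<tau>"
  have \<tau>': "\<tau>' \<in> uhp" unfolding \<tau>'_def by (rule act_in_uhp[OF A1 \<tau>])
  have re: "\<bar>Re \<tau>'\<bar> \<le> 1/2"
    unfolding \<tau>'_def act1 k_def using of_int_round_abs_le[of "Re (act A0 \<tau>)"] by (simp add: abs_minus_commute)
  define A2 where "A2 = mk 0 (-1) 1 0 ** A1"
  have A2: "A2 \<in> SL2Z" unfolding A2_def by (intro SL2Z_mult A1) simp
  have "act A2 \<tau> = act (mk 0 (-1) 1 0) \<tau>'"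
    unfolding A2_def \<tau>'_def using act_mult[OF A1 \<tau>] by simp
  hence "Im (act A2 \<tau>) = Im \<tau>' / (norm \<tau>')\<^sup>2"
    using Im_act[of "mk 0 (-1) 1 0" \<tau>'] \<tau>' by (simp add: uhp_iff autf_def)
  moreover have "Im (act A2 \<tau>) \<le> Im \<tau>'"
  proof -
    have "(norm (autf A1 \<tau>))\<^sup>2 \<le> (norm (autf A2 \<tau>))\<^sup>2"
      using min[OF A2] \<open>autf A1 \<tau> = autf A0 \<tau>\<close> by simp
    moreover have "norm (autf A1 \<tau>) > 0" using autf_nz[OF A1] \<tau> by (simp add: uhp_iff)
    ultimately show ?thesis
      using Im_act[OF A1] Im_act[OF A2] \<tau> by (simp add: \<tau>'_def uhp_iff frac_le)
  qed
  ultimately have "1 \<le> (norm \<tau>')\<^sup>2"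
    using \<tau>' by (auto simp: uhp_iff divide_le_eq split: if_splits)
  hence "1 \<le> (Re \<tau>')\<^sup>2 + (Im \<tau>')\<^sup>2" by (simp add: cmod_power2)
  moreover have "(Re \<tau>')\<^sup>2 \<le> (1/2)\<^sup>2" using re abs_le_square_iff[of "Re \<tau>'" "1/2"] by simp
  ultimately have "(1/2)\<^sup>2 \<le> (Im \<tau>')\<^sup>2" by (simp add: power2_eq_square)
  hence "1/2 \<le> Im \<tau>'" using \<tau>' by (intro power2_le_imp_le[of "1/2"]) (auto simp: uhp_iff)
  thus ?thesis using that[OF A1] re unfolding \<tau>'_def by blast
qed

lemma principal_Gamma_subset: "principal_Gamma N \<subseteq> SL2Z"
  by (auto simp: principal_Gamma_def)

text \<open>One matrix is kept for each residue class modulo N. If A and \<rho> agree modulo N, then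
  A times the inverse of \<rho> lies in the principal subgroup.\<close>

lemma coset_representatives:
  assumes N: "N > 0"
  obtains R where "finite R" "R \<subseteq> SL2Z"
    "\<And>A. A \<in> SL2Z \<Longrightarrow> \<exists>\<rho>\<in>R. \<exists>\<gamma>\<in>principal_Gamma N. \<forall>\<tau>\<in>uhp. act A \<tau> = act \<gamma> (act \<rho> \<tau>)"
proof -
  define red where "red = (\<lambda>A::int^2^2. (A$1$1 mod N, A$1$2 mod N, A$2$1 mod N, A$2$2 mod N))"
  have "red ` SL2Z \<subseteq> {0..<N} \<times> {0..<N} \<times> {0..<N} \<times> {0..<N}" using N by (auto simp: red_def)
  hence fin: "finite (red ` SL2Z)" by (rule finite_subset) auto
  define R where "R = inv_into SL2Z red ` (red ` SL2Z)"
  show ?thesis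
  proof (rule that[of R])
    show "finite R" unfolding R_def using fin by simp
    show "R \<subseteq> SL2Z" unfolding R_def by (auto intro: inv_into_into)
    fix A assume A: "A \<in> SL2Z"
    define \<rho> where "\<rho> = inv_into SL2Z red (red A)"
    have \<rho>: "\<rho> \<in> SL2Z" "red \<rho> = red A"
      unfolding \<rho>_def using A by (auto intro!: inv_into_into f_inv_into_f)
    hence cong: "[A$1$1 = \<rho>$1$1] (mod N)" "[A$1$2 = \<rho>$1$2] (mod N)" "[A$2$1 = \<rho>$2$1] (mod N)" "[A$2$2 = \<rho>$2$2] (mod N)"
      by (auto simp: red_def cong_def)
    define \<gamma> where "\<gamma> = A ** minv \<rho>"
    have "\<gamma> \<in> SL2Z" unfolding \<gamma>_def by (intro SL2Z_mult A minv_SL2Z \<rho>)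
    moreover have "[\<gamma>$1$1 = 1] (mod N)"
    proof -
      have "[A$1$1 * \<rho>$2$2 + A$1$2 * (- (\<rho>$2$1)) = \<rho>$1$1 * \<rho>$2$2 + \<rho>$1$2 * (- (\<rho>$2$1))] (mod N)"
        by (intro cong_add cong_mult cong_refl cong)
      thus ?thesis using SL2Z_det[OF \<rho>(1)] by (simp add: \<gamma>_def mult_entries minv_def)
    qed
    moreover have "[\<gamma>$1$2 = 0] (mod N)"
    proof -
      have "[A$1$1 * (- (\<rho>$1$2)) + A$1$2 * \<rho>$1$1 = \<rho>$1$1 * (- (\<rho>$1$2)) + \<rho>$1$2 * \<rho>$1$1] (mod N)"
        by (intro cong_add cong_mult cong_refl cong)
      thus ?thesis by (simp add: \<gamma>_def mult_entries minv_def mult.commute)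
    qed
    moreover have "[\<gamma>$2$1 = 0] (mod N)"
    proof -
      have "[A$2$1 * \<rho>$2$2 + A$2$2 * (- (\<rho>$2$1)) = \<rho>$2$1 * \<rho>$2$2 + \<rho>$2$2 * (- (\<rho>$2$1))] (mod N)"
        by (intro cong_add cong_mult cong_refl cong)
      thus ?thesis by (simp add: \<gamma>_def mult_entries minv_def mult.commute)
    qed
    moreover have "[\<gamma>$2$2 = 1] (mod N)"
    proof -
      have "[A$2$1 * (- (\<rho>$1$2)) + A$2$2 * \<rho>$1$1 = \<rho>$2$1 * (- (\<rho>$1$2)) + \<rho>$2$2 * \<rho>$1$1] (mod N)"
        by (intro cong_add cong_mult cong_refl cong)
      thus ?thesis using SL2Z_det[OF \<rho>(1)] by (simp add: \<gamma>_def mult_entries minv_def mult.commute)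
    qed
    ultimately have "\<gamma> \<in> principal_Gamma N" by (simp add: principal_Gamma_def)
    moreover have "act A \<tau> = act \<gamma> (act \<rho> \<tau>)" if "\<tau> \<in> uhp" for \<tau>
      unfolding \<gamma>_def using act_mult[of "minv \<rho>" "act \<rho> \<tau>" A] \<rho>(1) that
      by (simp add: act_in_uhp act_minv)
    moreover have "\<rho> \<in> R" unfolding R_def \<rho>_def using A by auto
    ultimately show "\<exists>\<rho>\<in>R. \<exists>\<gamma>\<in>principal_Gamma N. \<forall>\<tau>\<in>uhp. act A \<tau> = act \<gamma> (act \<rho> \<tau>)" by blast
  qed
qed

lemma compact_box:
  "compact {\<tau>. \<bar>Re \<tau>\<bar> \<le> 1/2 \<and> 1/2 \<le> Im \<tau> \<and> Im \<tau> \<le> c}"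
proof -
  have "{\<tau>. \<bar>Re \<tau>\<bar> \<le> 1/2 \<and> 1/2 \<le> Im \<tau> \<and> Im \<tau> \<le> c} = cbox (Complex (-1/2) (1/2)) (Complex (1/2) c)"
    by (auto simp: in_cbox_complex_iff abs_le_iff)
  thus ?thesis by simp
qed

section \<open>Holomorphic modular functions and the maximum principle\<close>

text \<open>Poles are allowed only at the cusps, and values off the upper half-plane are left free.
  Such functions are added and multiplied pointwise, without the normalisation that
  \<open>modular_functions\<close> carries.\<close>

definition hol_modular :: "(int^2^2) set \<Rightarrow> (complex \<Rightarrow> complex) \<Rightarrow> bool" where
  "hol_modular G f \<longleftrightarrow> f holomorphic_on uhp \<and> (\<forall>A\<in>G. \<forall>\<tau>\<in>uhp. f (act A \<tau>) = f \<tau>) \<and>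
     (\<forall>A\<in>SL2Z. meromorphic_at_i_infinity (\<lambda>\<tau>. f (act A \<tau>)))"

lemma hol_modularD:
  assumes "hol_modular G f"
  shows "f holomorphic_on uhp" "\<And>A \<tau>. A \<in> G \<Longrightarrow> \<tau> \<in> uhp \<Longrightarrow> f (act A \<tau>) = f \<tau>"
    "\<And>A. A \<in> SL2Z \<Longrightarrow> meromorphic_at_i_infinity (\<lambda>\<tau>. f (act A \<tau>))"
  using assms by (auto simp: hol_modular_def)

lemma hol_modular_const [simp]: "hol_modular G (\<lambda>_. c)"
  by (auto simp: hol_modular_def)

lemma hol_modular_add: "hol_modular G f \<Longrightarrow> hol_modular G g \<Longrightarrow> hol_modular G (\<lambda>\<tau>. f \<tau> + g \<tau>)"
  by (auto simp: hol_modular_def intro!: holomorphic_intros mero_inf_add)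

lemma hol_modular_mult: "hol_modular G f \<Longrightarrow> hol_modular G g \<Longrightarrow> hol_modular G (\<lambda>\<tau>. f \<tau> * g \<tau>)"
  by (auto simp: hol_modular_def intro!: holomorphic_intros mero_inf_mult)

lemma hol_modular_diff:
  assumes "hol_modular G f" "hol_modular G g" shows "hol_modular G (\<lambda>\<tau>. f \<tau> - g \<tau>)"
  using hol_modular_add[OF assms(1) hol_modular_mult[OF hol_modular_const[of G "-1"] assms(2)]] by simp

lemma hol_modular_divide:
  "hol_modular G f \<Longrightarrow> hol_modular G g \<Longrightarrow> (\<And>\<tau>. \<tau> \<in> uhp \<Longrightarrow> g \<tau> \<noteq> 0) \<Longrightarrow> hol_modular G (\<lambda>\<tau>. f \<tau> / g \<tau>)"
  by (auto simp: hol_modular_def intro!: holomorphic_intros mero_inf_divide)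

lemma hol_modular_power: "hol_modular G f \<Longrightarrow> hol_modular G (\<lambda>\<tau>. f \<tau> ^ n)"
  by (induction n) (auto intro: hol_modular_mult)

lemma hol_modular_sum:
  "(\<And>i. i \<in> I \<Longrightarrow> hol_modular G (f i)) \<Longrightarrow> hol_modular G (\<lambda>\<tau>. \<Sum>i\<in>I. f i \<tau>)"
  by (induction I rule: infinite_finite_induct) (auto intro: hol_modular_add)

lemma hol_modular_poly: "hol_modular G f \<Longrightarrow> hol_modular G (\<lambda>\<tau>. poly p (f \<tau>))"
  unfolding poly_altdef by (intro hol_modular_sum hol_modular_mult hol_modular_power hol_modular_const)

lemma hol_modular_subgroup: "hol_modular G f \<Longrightarrow> H \<subseteq> G \<Longrightarrow> hol_modular H f"
  by (auto simp: hol_modular_def)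

lemma hol_modular_cong:
  assumes "hol_modular G f" "G \<subseteq> SL2Z" "\<And>\<tau>. \<tau> \<in> uhp \<Longrightarrow> f \<tau> = g \<tau>"
  shows "hol_modular G g"
  unfolding hol_modular_def
proof (intro conjI ballI)
  show "g holomorphic_on uhp"
    using hol_modularD(1)[OF assms(1)] by (rule holomorphic_transform) (rule assms(3))
  show "g (act A \<tau>) = g \<tau>" if "A \<in> G" "\<tau> \<in> uhp" for A \<tau>
  proof -
    have "act A \<tau> \<in> uhp" using that assms(2) act_in_uhp by blast
    thus ?thesis using hol_modularD(2)[OF assms(1) that] assms(3) that by simp
  qed
  fix A assume A: "A \<in> SL2Z"
  have "eventually (\<lambda>\<tau>. f (act A \<tau>) = g (act A \<tau>)) at_ii_inf"
    using eventually_uhp_at_ii_inf by eventually_elim (use A assms(3) act_in_uhp in auto)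
  thus "meromorphic_at_i_infinity (\<lambda>\<tau>. g (act A \<tau>))"
    by (rule mero_inf_cong[OF hol_modularD(3)[OF assms(1) A]])
qed

lemma hol_eventually_const_imp_const:
  assumes f: "f holomorphic_on uhp" and ev: "eventually (\<lambda>\<tau>. f \<tau> = c) at_ii_inf" and "\<tau> \<in> uhp"
  shows "f \<tau> = c"
proof -
  obtain y where y: "\<And>\<tau>. Im \<tau> > y \<Longrightarrow> f \<tau> = c" using ev unfolding eventually_at_ii_inf by blast
  define U where "U = {\<tau>. Im \<tau> > max y 0}"
  show ?thesis
  proof (rule analytic_continuation_open[of U uhp f "\<lambda>_. c"])
    show "open U" unfolding U_def by (rule open_halfspace_Im_gt)
    have "Complex 0 (\<bar>y\<bar> + 1) \<in> U" by (auto simp: U_def)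
    thus "U \<noteq> {}" by blast
    show "U \<subseteq> uhp" by (auto simp: U_def uhp_iff)
  qed (use assms open_uhp connected_uhp y in \<open>auto simp: U_def\<close>)
qed

text \<open>In the normal form a negative order would make the modulus tend to infinity.\<close>

lemma mero_inf_bounded_analytic:
  assumes "meromorphic_at_i_infinity f" "eventually (\<lambda>\<tau>. norm (f \<tau>) \<le> B) at_ii_inf"
  obtains h u where "h > 0" "u analytic_on {0}" "eventually (\<lambda>\<tau>. f \<tau> = u (qpar h \<tau>)) at_ii_inf"
proof (cases "eventually (\<lambda>\<tau>. f \<tau> = 0) at_ii_inf")
  case True
  show ?thesis by (rule that[of 1 "\<lambda>_. 0"]) (use True in auto)
next
  case False
  then obtain h k u where h: "h > 0" and u: "u analytic_on {0}" "u 0 \<noteq> 0"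
    and ev: "eventually (\<lambda>\<tau>. f \<tau> = qpar h \<tau> powi k * u (qpar h \<tau>)) at_ii_inf"
    using mero_inf_normal_form[OF assms(1)] by blast
  have "k \<ge> 0"
  proof (rule ccontr)
    assume "\<not> k \<ge> 0"
    hence n: "k = - int (nat (- k))" "nat (- k) > 0" by auto
    define n where "n = nat (- k)"
    have n: "k = - int n" "n > 0" using n by (simp_all add: n_def)
    have "filterlim (\<lambda>w. u w / w ^ n) at_infinity (at 0)"
    proof (rule filterlim_divide_at_infinity)
      show "(u \<longlongrightarrow> u 0) (at 0)" using analytic_at_imp_isCont[OF u(1)] by (simp add: isCont_def)
      show "filterlim (\<lambda>w. w ^ n) (at 0) (at (0::complex))"
        using n(2) by (auto simp: filterlim_at eventually_at intro!: tendsto_eq_intros exI[of _ 1] simp: zero_power)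
    qed (use u in auto)
    from filterlim_compose[OF this filterlim_qpar_0[OF h]]
    have "eventually (\<lambda>\<tau>. norm (u (qpar h \<tau>) / qpar h \<tau> ^ n) \<ge> B + 1) at_ii_inf"
      unfolding filterlim_at_infinity_conv_norm_at_top by (simp add: filterlim_at_top)
    hence big: "eventually (\<lambda>\<tau>. norm (qpar h \<tau> powi k * u (qpar h \<tau>)) \<ge> B + 1) at_ii_inf"
      by (simp add: n(1) power_int_minus field_simps)
    have "eventually (\<lambda>\<tau>. False) at_ii_inf"
      using big ev assms(2) by eventually_elim simp
    thus False by simp
  qed
  then obtain n where n: "k = int n" using nonneg_int_cases by blast
  show ?thesis
    by (rule that[of h "\<lambda>w. w ^ n * u w"]) (use h u ev n in \<open>auto intro!: analytic_intros\<close>)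
qed

lemma qpar_surj:
  assumes h: "h > 0" and w: "w \<noteq> 0" "norm w < exp (- 2 * pi * c / h)"
  obtains \<tau> where "qpar h \<tau> = w" "Im \<tau> > c"
proof -
  define \<tau> where "\<tau> = of_nat h * Ln w / (2 * pi * \<i>)"
  have q: "qpar h \<tau> = w" using h w(1) by (simp add: qpar_def \<tau>_def)
  have "exp (- 2 * pi * Im \<tau> / h) < exp (- 2 * pi * c / h)" using q w(2) norm_qpar[of h \<tau>] by simp
  hence "Im \<tau> > c" using h by (simp add: field_simps)
  with q show ?thesis by (rule that)
qed

lemma max_modulus_uhp:
  assumes f: "f holomorphic_on uhp" and \<tau>0: "\<tau>0 \<in> uhp" and max: "\<And>\<tau>. \<tau> \<in> uhp \<Longrightarrow> norm (f \<tau>) \<le> norm (f \<tau>0)"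
  shows "\<exists>c. \<forall>\<tau>\<in>uhp. f \<tau> = c"
  using maximum_modulus_principle[OF f open_uhp connected_uhp open_uhp order_refl \<tau>0 max]
  by (auto simp: constant_on_def)

text \<open>W collects the moduli on a compact box and those of u on a closed disc about the cusp,
  so a maximum exists even if it is only approached at the cusp. In that case the maximum principle
  is applied to u instead of F.\<close>

lemma cusp_values_compact:
  assumes F: "F holomorphic_on uhp" "meromorphic_at_i_infinity F"
    and bd: "eventually (\<lambda>\<tau>. norm (F \<tau>) \<le> B) at_ii_inf"
  obtains W :: "real set" where "compact W"
    "\<And>\<tau>. \<bar>Re \<tau>\<bar> \<le> 1/2 \<Longrightarrow> Im \<tau> \<ge> 1/2 \<Longrightarrow> norm (F \<tau>) \<in> W"
    "\<And>M. M \<in> W \<Longrightarrow> (\<And>\<tau>. \<tau> \<in> uhp \<Longrightarrow> norm (F \<tau>) \<le> M) \<Longrightarrow> \<exists>c. \<forall>\<tau>\<in>uhp. F \<tau> = c"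
proof -
  obtain h u where h: "h > 0" and u: "u analytic_on {0}" and ev: "eventually (\<lambda>\<tau>. F \<tau> = u (qpar h \<tau>)) at_ii_inf"
    by (rule mero_inf_bounded_analytic[OF F(2) bd])
  obtain c0 where c0: "\<And>\<tau>. Im \<tau> > c0 \<Longrightarrow> F \<tau> = u (qpar h \<tau>)" using ev unfolding eventually_at_ii_inf by blast
  obtain r where r: "r > 0" "u holomorphic_on ball 0 r" using u by (auto simp: analytic_on_def)
  define c1 where "c1 = max c0 0"
  \<comment> \<open>On this disc u is holomorphic, and every nonzero point of it is
    \<open>qpar h\<close> of a point where the expansion of F holds.\<close>
  define \<epsilon> where "\<epsilon> = min (r / 2) (exp (- 2 * pi * c1 / h) / 2)"
  have \<epsilon>: "\<epsilon> > 0" "\<epsilon> < r" "\<epsilon> < exp (- 2 * pi * c1 / h)" using r exp_gt_zero[of "- 2 * pi * c1 / h"] unfolding \<epsilon>_def by linarith+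
  define c where "c = - real h * ln \<epsilon> / (2 * pi)"
  have qc: "norm (qpar h \<tau>) \<le> \<epsilon> \<longleftrightarrow> Im \<tau> \<ge> c" for \<tau>
  proof -
    have "norm (qpar h \<tau>) \<le> \<epsilon> \<longleftrightarrow> - 2 * pi * Im \<tau> / h \<le> ln \<epsilon>"
      using \<epsilon>(1) by (simp add: norm_qpar ln_ge_iff)
    also have "\<dots> \<longleftrightarrow> Im \<tau> \<ge> c" using h by (auto simp: c_def field_simps)
    finally show ?thesis .
  qed
  have small: "\<exists>\<tau>\<in>uhp. F \<tau> = u w" if "w \<noteq> 0" "norm w \<le> \<epsilon>" for w
  proof -
    have "norm w < exp (- 2 * pi * c1 / h)" using that \<epsilon>(3) by linarith
    then obtain \<tau> where "qpar h \<tau> = w" "Im \<tau> > c1" by (rule qpar_surj[OF h \<open>w \<noteq> 0\<close>])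
    thus ?thesis using c0[of \<tau>] by (intro bexI[of _ \<tau>]) (auto simp: c1_def uhp_iff)
  qed
  have cont: "continuous_on (cball 0 \<epsilon>) u"
    using holomorphic_on_imp_continuous_on[OF r(2)] by (rule continuous_on_subset) (use \<epsilon> in auto)
  define K where "K = {\<tau>. \<bar>Re \<tau>\<bar> \<le> 1/2 \<and> 1/2 \<le> Im \<tau> \<and> Im \<tau> \<le> c}"
  have K: "compact K" "K \<subseteq> uhp" unfolding K_def using compact_box by (auto simp: uhp_iff)
  define W where "W = (\<lambda>\<tau>. norm (F \<tau>)) ` K \<union> (\<lambda>w. norm (u w)) ` cball 0 \<epsilon>"
  show ?thesis
  proof (rule that[of W])
    show "compact W"
      unfolding W_def
      by (intro compact_Un compact_continuous_image continuous_on_norm cont K compact_cball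
            continuous_on_subset[OF holomorphic_on_imp_continuous_on[OF F(1)] K(2)])
    show "norm (F \<tau>) \<in> W" if "\<bar>Re \<tau>\<bar> \<le> 1/2" "Im \<tau> \<ge> 1/2" for \<tau>
    proof (cases "Im \<tau> \<le> c")
      case True
      thus ?thesis using that unfolding W_def K_def by blast
    next
      case False
      hence n: "norm (qpar h \<tau>) \<le> \<epsilon>" using qc by simp
      hence "exp (- 2 * pi * Im \<tau> / h) < exp (- 2 * pi * c1 / h)" using \<epsilon>(3) unfolding norm_qpar by linarith
      hence "Im \<tau> > c1" using h by (simp add: field_simps)
      hence "F \<tau> = u (qpar h \<tau>)" using c0 by (simp add: c1_def)
      thus ?thesis using n unfolding W_def by auto
    qed
    fix M assume M: "M \<in> W" and max: "\<And>\<tau>. \<tau> \<in> uhp \<Longrightarrow> norm (F \<tau>) \<le> M"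
    show "\<exists>c. \<forall>\<tau>\<in>uhp. F \<tau> = c"
    proof (cases "\<exists>\<tau>0\<in>uhp. M = norm (F \<tau>0)")
      case True
      thus ?thesis using max_modulus_uhp[OF F(1)] max by blast
    next
      case False
      with M K obtain w0 where w0: "norm w0 \<le> \<epsilon>" "M = norm (u w0)" unfolding W_def by auto
      \<comment> \<open>Every nonzero w in the disc gives a value of F, so a maximum that F misses
        sits at the centre, the cusp itself.\<close>
      have [simp]: "w0 = 0" using w0 False small[of w0] by metis
      have "u constant_on ball 0 \<epsilon>"
      proof (rule maximum_modulus_principle[of u "ball 0 \<epsilon>" "ball 0 \<epsilon>" 0])
        show "u holomorphic_on ball 0 \<epsilon>" using r(2) by (rule holomorphic_on_subset) (use \<epsilon> in auto)
        show "norm (u z) \<le> norm (u 0)" if z: "z \<in> ball 0 \<epsilon>" for z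
        proof (cases "z = 0")
          case False
          then obtain \<tau> where "\<tau> \<in> uhp" "F \<tau> = u z" using small[of z] z by auto
          thus ?thesis using max[of \<tau>] w0 by simp
        qed auto
      qed (use \<epsilon> in auto)
      then obtain v where v: "\<And>z. z \<in> ball 0 \<epsilon> \<Longrightarrow> u z = v" by (auto simp: constant_on_def)
      have "eventually (\<lambda>z. u z = v) (at 0)"
        using v \<epsilon>(1) by (auto simp: eventually_at dist_norm intro!: exI[of _ \<epsilon>])
      from eventually_qpar_at_0[OF h this] ev have "eventually (\<lambda>\<tau>. F \<tau> = v) at_ii_inf" by eventually_elim auto
      thus ?thesis using hol_eventually_const_imp_const[OF F(1)] by blast
    qed
  qed
qed

text \<open>Finitely many translates of the strip cover the upper half-plane up to G, so the compact
  sets of \<open>cusp_values_compact\<close> contain all moduli of f and their largest element M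
  bounds f. For the coset \<rho> that provides M, the maximum principle makes f composed with \<rho>
  constant.\<close>

theorem modular_Liouville:
  assumes N: "N > 0" "principal_Gamma N \<subseteq> G" and f: "hol_modular G f"
    and bd: "\<And>A. A \<in> SL2Z \<Longrightarrow> \<exists>B. eventually (\<lambda>\<tau>. norm (f (act A \<tau>)) \<le> B) at_ii_inf"
  shows "\<exists>c. \<forall>\<tau>\<in>uhp. f \<tau> = c"
proof -
  obtain R where R: "finite R" "R \<subseteq> SL2Z"
    "\<And>A. A \<in> SL2Z \<Longrightarrow> \<exists>\<rho>\<in>R. \<exists>\<gamma>\<in>principal_Gamma N. \<forall>\<tau>\<in>uhp. act A \<tau> = act \<gamma> (act \<rho> \<tau>)"
    using coset_representatives[OF N(1)] by blast
  have "\<exists>W. compact W \<and> (\<forall>\<tau>. \<bar>Re \<tau>\<bar> \<le> 1/2 \<longrightarrow> Im \<tau> \<ge> 1/2 \<longrightarrow> norm (f (act \<rho> \<tau>)) \<in> W) \<and>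
      (\<forall>M\<in>W. (\<forall>\<tau>\<in>uhp. norm (f (act \<rho> \<tau>)) \<le> M) \<longrightarrow> (\<exists>c. \<forall>\<tau>\<in>uhp. f (act \<rho> \<tau>) = c))" if "\<rho> \<in> R" for \<rho>
  proof -
    have \<rho>: "\<rho> \<in> SL2Z" using that R by blast
    obtain B where B: "eventually (\<lambda>\<tau>. norm (f (act \<rho> \<tau>)) \<le> B) at_ii_inf" using bd[OF \<rho>] by blast
    show ?thesis
    proof (rule cusp_values_compact[OF holomorphic_compose_act[OF \<rho> hol_modularD(1)[OF f]] hol_modularD(3)[OF f \<rho>] B])
      fix W assume W: "compact W" "\<And>\<tau>. \<bar>Re \<tau>\<bar> \<le> 1/2 \<Longrightarrow> Im \<tau> \<ge> 1/2 \<Longrightarrow> norm (f (act \<rho> \<tau>)) \<in> W"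
        "\<And>M. M \<in> W \<Longrightarrow> (\<And>\<tau>. \<tau> \<in> uhp \<Longrightarrow> norm (f (act \<rho> \<tau>)) \<le> M) \<Longrightarrow> \<exists>c. \<forall>\<tau>\<in>uhp. f (act \<rho> \<tau>) = c"
      show ?thesis by (intro exI[of _ W] conjI allI impI ballI W) auto
    qed
  qed
  hence "\<forall>\<rho>\<in>R. \<exists>W. compact W \<and> (\<forall>\<tau>. \<bar>Re \<tau>\<bar> \<le> 1/2 \<longrightarrow> Im \<tau> \<ge> 1/2 \<longrightarrow> norm (f (act \<rho> \<tau>)) \<in> W) \<and>
      (\<forall>M\<in>W. (\<forall>\<tau>\<in>uhp. norm (f (act \<rho> \<tau>)) \<le> M) \<longrightarrow> (\<exists>c. \<forall>\<tau>\<in>uhp. f (act \<rho> \<tau>) = c))" by blast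
  from bchoice[OF this] obtain W where W0: "\<forall>\<rho>\<in>R. compact (W \<rho>) \<and>
      (\<forall>\<tau>. \<bar>Re \<tau>\<bar> \<le> 1/2 \<longrightarrow> Im \<tau> \<ge> 1/2 \<longrightarrow> norm (f (act \<rho> \<tau>)) \<in> W \<rho>) \<and>
      (\<forall>M\<in>W \<rho>. (\<forall>\<tau>\<in>uhp. norm (f (act \<rho> \<tau>)) \<le> M) \<longrightarrow> (\<exists>c. \<forall>\<tau>\<in>uhp. f (act \<rho> \<tau>) = c))" by blast
  have W: "\<And>\<rho>. \<rho> \<in> R \<Longrightarrow> compact (W \<rho>)"
    "\<And>\<rho> \<tau>. \<rho> \<in> R \<Longrightarrow> \<bar>Re \<tau>\<bar> \<le> 1/2 \<Longrightarrow> Im \<tau> \<ge> 1/2 \<Longrightarrow> norm (f (act \<rho> \<tau>)) \<in> W \<rho>"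
    "\<And>\<rho> M. \<rho> \<in> R \<Longrightarrow> M \<in> W \<rho> \<Longrightarrow> (\<forall>\<tau>\<in>uhp. norm (f (act \<rho> \<tau>)) \<le> M) \<Longrightarrow> (\<exists>c. \<forall>\<tau>\<in>uhp. f (act \<rho> \<tau>) = c)"
    using W0 by blast+
  define V where "V = (\<Union>\<rho>\<in>R. W \<rho>)"
  have V: "compact V" unfolding V_def using R(1) W(1) by (intro compact_UN) auto
  have inV: "norm (f \<tau>) \<in> V" if \<tau>: "\<tau> \<in> uhp" for \<tau>
  proof -
    obtain A where A: "A \<in> SL2Z" "\<bar>Re (act A \<tau>)\<bar> \<le> 1/2" "Im (act A \<tau>) \<ge> 1/2" by (rule fundamental_strip[OF \<tau>])
    define \<tau>' where "\<tau>' = act A \<tau>"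
    have \<tau>': "\<tau>' \<in> uhp" unfolding \<tau>'_def using A(1) \<tau> by (rule act_in_uhp)
    obtain \<rho> \<gamma> where \<rho>: "\<rho> \<in> R" "\<gamma> \<in> principal_Gamma N" "act (minv A) \<tau>' = act \<gamma> (act \<rho> \<tau>')"
      using R(3)[of "minv A"] A(1) \<tau>' by auto
    have "\<tau> = act \<gamma> (act \<rho> \<tau>')" using \<rho>(3) act_minv[OF A(1) \<tau>] by (simp add: \<tau>'_def)
    hence "f \<tau> = f (act \<rho> \<tau>')"
      using hol_modularD(2)[OF f, of \<gamma> "act \<rho> \<tau>'"] N(2) \<rho> R(2) act_in_uhp[of \<rho> \<tau>'] \<tau>' by auto
    thus ?thesis using W(2)[OF \<rho>(1)] A unfolding V_def \<tau>'_def using \<rho>(1) by auto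
  qed
  have "\<i> \<in> uhp" by (simp add: uhp_iff)
  hence "V \<noteq> {}" using inV by blast
  then obtain M where M: "M \<in> V" "\<And>x. x \<in> V \<Longrightarrow> x \<le> M" using compact_attains_sup[OF V] by blast
  then obtain \<rho> where \<rho>: "\<rho> \<in> R" "M \<in> W \<rho>" unfolding V_def by blast
  have \<rho>': "\<rho> \<in> SL2Z" using \<rho> R by blast
  obtain c where c: "\<And>\<tau>. \<tau> \<in> uhp \<Longrightarrow> f (act \<rho> \<tau>) = c"
    using W(3)[OF \<rho>] M(2) inV act_in_uhp[OF \<rho>'] by blast
  have "f \<tau> = c" if "\<tau> \<in> uhp" for \<tau>
    using c[of "act (minv \<rho>) \<tau>"] act_minv'[OF \<rho>' that] act_in_uhp[OF minv_SL2Z[OF \<rho>'] that] by simp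
  thus ?thesis by blast
qed

text \<open>A set that stays away from all cusps meets each translated strip only inside a compact
  box. This is applied to zeros and to poles.\<close>

lemma finite_orbits:
  assumes N: "N > 0" and S: "S \<subseteq> uhp"
    and inv: "\<And>\<gamma> \<tau>. \<gamma> \<in> principal_Gamma N \<Longrightarrow> \<tau> \<in> uhp \<Longrightarrow> act \<gamma> \<tau> \<in> S \<Longrightarrow> \<tau> \<in> S"
    and cusp: "\<And>A. A \<in> SL2Z \<Longrightarrow> eventually (\<lambda>\<tau>. act A \<tau> \<notin> S) at_ii_inf"
    and fin: "\<And>K. compact K \<Longrightarrow> K \<subseteq> uhp \<Longrightarrow> finite (K \<inter> S)"
  obtains Z where "finite Z" "Z \<subseteq> S" "\<And>\<tau>. \<tau> \<in> S \<Longrightarrow> \<exists>z\<in>Z. \<exists>\<gamma>\<in>principal_Gamma N. \<tau> = act \<gamma> z"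
proof -
  obtain R where R: "finite R" "R \<subseteq> SL2Z"
    "\<And>A. A \<in> SL2Z \<Longrightarrow> \<exists>\<rho>\<in>R. \<exists>\<gamma>\<in>principal_Gamma N. \<forall>\<tau>\<in>uhp. act A \<tau> = act \<gamma> (act \<rho> \<tau>)"
    using coset_representatives[OF N(1)] by blast
  have "\<exists>c. \<forall>\<tau>. Im \<tau> > c \<longrightarrow> act \<rho> \<tau> \<notin> S" if "\<rho> \<in> R" for \<rho>
    using cusp[of \<rho>] R(2) that unfolding eventually_at_ii_inf by blast
  then obtain c where c: "\<And>\<rho> \<tau>. \<rho> \<in> R \<Longrightarrow> Im \<tau> > c \<rho> \<Longrightarrow> act \<rho> \<tau> \<notin> S" by metis
  define K where "K = (\<lambda>\<rho>. {\<tau>. \<bar>Re \<tau>\<bar> \<le> 1/2 \<and> 1/2 \<le> Im \<tau> \<and> Im \<tau> \<le> c \<rho>})"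
  have K: "compact (K \<rho>)" "K \<rho> \<subseteq> uhp" for \<rho> unfolding K_def using compact_box by (auto simp: uhp_iff)
  define Z where "Z = (\<Union>\<rho>\<in>R. act \<rho> ` K \<rho> \<inter> S)"
  show ?thesis
  proof (rule that[of Z])
    show "finite Z"
      unfolding Z_def
    proof (intro finite_UN_I R(1) fin)
      fix \<rho> assume "\<rho> \<in> R"
      hence \<rho>: "\<rho> \<in> SL2Z" using R by blast
      show "act \<rho> ` K \<rho> \<subseteq> uhp" using K(2) act_in_uhp[OF \<rho>] by blast
      show "compact (act \<rho> ` K \<rho>)"
        by (intro compact_continuous_image K continuous_on_subset[OF holomorphic_on_imp_continuous_on[OF act_holomorphic[OF \<rho>]]])
    qed
    show "Z \<subseteq> S" by (auto simp: Z_def)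
    fix \<tau> assume \<tau>S: "\<tau> \<in> S"
    hence \<tau>: "\<tau> \<in> uhp" using S by blast
    obtain A where A: "A \<in> SL2Z" "\<bar>Re (act A \<tau>)\<bar> \<le> 1/2" "Im (act A \<tau>) \<ge> 1/2" by (rule fundamental_strip[OF \<tau>])
    define \<tau>' where "\<tau>' = act A \<tau>"
    have \<tau>': "\<tau>' \<in> uhp" unfolding \<tau>'_def using A(1) \<tau> by (rule act_in_uhp)
    obtain \<rho> \<gamma> where \<rho>: "\<rho> \<in> R" "\<gamma> \<in> principal_Gamma N" "act (minv A) \<tau>' = act \<gamma> (act \<rho> \<tau>')"
      using R(3)[of "minv A"] A(1) \<tau>' by auto
    have eq: "\<tau> = act \<gamma> (act \<rho> \<tau>')" using \<rho>(3) act_minv[OF A(1) \<tau>] by (simp add: \<tau>'_def)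
    have S': "act \<rho> \<tau>' \<in> S"
      by (rule inv[OF \<rho>(2)]) (use eq \<tau>S \<tau>' \<rho> R(2) act_in_uhp in auto)
    hence "Im \<tau>' \<le> c \<rho>" using c[OF \<rho>(1), of \<tau>'] by (meson not_le)
    hence "\<tau>' \<in> K \<rho>" using A by (simp add: K_def \<tau>'_def)
    hence "act \<rho> \<tau>' \<in> Z" using S' \<rho>(1) by (auto simp: Z_def)
    thus "\<exists>z\<in>Z. \<exists>\<gamma>\<in>principal_Gamma N. \<tau> = act \<gamma> z" using eq \<rho>(2) by blast
  qed
qed

subsection \<open>The equations between the coordinates\<close>

text \<open>By the parallelogram law the exponentials in each of the three terms multiply to the
  same square, so the identity for theta carries over.\<close>

lemma kf_three_term:
  assumes "Im \<tau> > 0"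
  shows "kf (r1 + r2) (s1 + s2) \<tau> * kf (r1 - r2) (s1 - s2) \<tau> * kf r3 s3 \<tau> ^ 2
       + kf (r2 + r3) (s2 + s3) \<tau> * kf (r2 - r3) (s2 - s3) \<tau> * kf r1 s1 \<tau> ^ 2
       + kf (r3 + r1) (s3 + s1) \<tau> * kf (r3 - r1) (s3 - s1) \<tau> * kf r2 s2 \<tau> ^ 2 = 0"
proof -
  define P where "P = (\<lambda>r s. complex_of_real r * \<tau> + of_real s)"
  define e where "e = (\<lambda>r s. exp (pi * \<i> * complex_of_real r * P r s))"
  define \<theta> where "\<theta> = (\<lambda>z. jtheta z \<tau>)"
  have kf: "kf r s \<tau> = e r s * \<theta> (P r s)" for r s by (simp add: kf_def e_def P_def \<theta>_def)
  have P: "P (r + r') (s + s') = P r s + P r' s'" "P (r - r') (s - s') = P r s - P r' s'" for r r' s s'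
    by (simp_all add: P_def algebra_simps)
  have ee: "e (r + r') (s + s') * e (r - r') (s - s') * e r'' s'' ^ 2 = (e r s * e r' s' * e r'' s'') ^ 2"
    for r r' r'' s s' s''
    unfolding e_def P power2_eq_square exp_add[symmetric]
    by (rule arg_cong[of _ _ exp]) (simp add: P_def algebra_simps)
  define X where "X = (e r1 s1 * e r2 s2 * e r3 s3) ^ 2"
  have t: "kf (r + r') (s + s') \<tau> * kf (r - r') (s - s') \<tau> * kf r'' s'' \<tau> ^ 2 =
       (e r s * e r' s' * e r'' s'') ^ 2 * (\<theta> (P r s + P r' s') * \<theta> (P r s - P r' s') * \<theta> (P r'' s'') ^ 2)"
    for r r' r'' s s' s''
    unfolding ee[symmetric] by (simp add: kf P power_mult_distrib)
  have 1: "(e r1 s1 * e r2 s2 * e r3 s3) ^ 2 = X" "(e r2 s2 * e r3 s3 * e r1 s1) ^ 2 = X" "(e r3 s3 * e r1 s1 * e r2 s2) ^ 2 = X"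
    by (simp_all add: X_def power_mult_distrib)
  show ?thesis
    unfolding t 1 using jtheta_three_term[OF assms, of "P r1 s1" "P r2 s2" "P r3 s3"]
    by (simp add: \<theta>_def flip: distrib_left)
qed

section \<open>Klein forms with characteristics in fourteenths\<close>

text \<open>Denominator 14 accommodates both sevenths and halves: index 2k stands for k / 7, and a
  second index 7 is the half-period 1/2. The argument 7 * \<tau> matches the exponents of
  \<open>theta7\<close>.\<close>

definition kk :: "int \<Rightarrow> int \<Rightarrow> complex \<Rightarrow> complex" where
  "kk i i' \<tau> = kf (of_int i / 14) (of_int i' / 14) (7 * \<tau>)"

lemma kk_shift:
  "kk (i + 14 * m) (i' + 14 * n) \<tau> = (-1) powi (m + n + m * n) * exp (pi * \<i> * of_int (i * n - m * i') / 14) * kk i i' \<tau>"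
proof -
  have "real_of_int (i + 14 * m) / 14 = of_int i / 14 + of_int m" "real_of_int (i' + 14 * n) / 14 = of_int i' / 14 + of_int n"
    by simp_all
  hence "kk (i + 14 * m) (i' + 14 * n) \<tau> = (-1) powi (m + n + m * n) *
     exp (pi * \<i> * complex_of_real (of_int i / 14 * of_int n - of_int m * (of_int i' / 14))) * kk i i' \<tau>"
    unfolding kk_def by (simp only: kf_shift of_real_diff of_real_mult of_real_of_int_eq)
  thus ?thesis by (simp add: field_simps)
qed

lemma kk_uminus: "kk (- i) (- i') \<tau> = - kk i i' \<tau>"
  unfolding kk_def using kf_uminus[of "of_int i / 14" "of_int i' / 14" "7 * \<tau>"] by simp

lemma norm_kk_shift: "norm (kk (i + 14 * m) (i' + 14 * n) \<tau>) = norm (kk i i' \<tau>)"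
proof -
  have "norm (exp (pi * \<i> * of_int (i * n - m * i') / 14)) = 1" by (simp add: norm_exp_eq_Re)
  thus ?thesis unfolding kk_shift norm_mult by simp
qed

lemma kk_nz:
  assumes "\<tau> \<in> uhp" "\<not> (14 dvd i \<and> 14 dvd i')"
  shows "kk i i' \<tau> \<noteq> 0"
proof -
  have dv: "of_int i / 14 \<in> (\<int> :: real set) \<longleftrightarrow> 14 dvd i" for i :: int
  proof
    assume "of_int i / 14 \<in> (\<int> :: real set)"
    then obtain k :: int where "of_int i / 14 = (of_int k :: real)" by (elim Ints_cases)
    hence "real_of_int i = of_int (14 * k)" by simp
    hence "i = 14 * k" by (simp only: of_int_eq_iff)
    thus "14 dvd i" by simp
  qed auto
  have "Im (7 * \<tau>) > 0" using assms by (simp add: uhp_iff)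
  thus ?thesis unfolding kk_def using kf_zero_iff dv assms(2) by blast
qed

lemma kk_holomorphic: "kk i i' holomorphic_on uhp"
proof -
  obtain h g where h: "h > 0" "g holomorphic_on ball 0 1"
    and eq: "\<And>\<tau>. kf (of_int i / of_nat 14) (of_int i' / 14) ((of_nat 7 * \<tau> + of_int 0) / of_nat 1) = g (qpar h \<tau>)"
    by (rule kf_q_expansion[of 14 7 1 i "of_int i' / 14" 0]) auto
  have "(\<lambda>\<tau>. g (qpar h \<tau>)) holomorphic_on uhp"
  proof (rule holomorphic_on_compose_gen[of _ _ g "ball 0 1", unfolded o_def])
    show "qpar h holomorphic_on uhp" unfolding qpar_def by (intro holomorphic_intros) (use h in auto)
    show "qpar h ` uhp \<subseteq> ball 0 1" using qpar_in_ball[OF h(1)] by (auto simp: uhp_iff simp del: mem_ball)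
  qed (use h in auto)
  thus ?thesis by (rule holomorphic_transform) (use eq in \<open>simp add: kk_def\<close>)
qed

text \<open>Conjugation by diag(7, 1), which stays integral because 7 divides the lower left
  entry.\<close>

lemma seven_act_dvd:
  assumes A: "A \<in> SL2Z" and c: "A$2$1 = 7 * c'"
  shows "mk (A$1$1) (7 * A$1$2) c' (A$2$2) \<in> SL2Z"
    and "7 * act A \<tau> = act (mk (A$1$1) (7 * A$1$2) c' (A$2$2)) (7 * \<tau>)"
  using SL2Z_det[OF A] by (simp_all add: c act_eq autf_def algebra_simps)

lemma kk_transform_dvd:
  assumes A: "A \<in> SL2Z" and c: "A$2$1 = 7 * c'" and \<tau>: "\<tau> \<in> uhp"
  obtains \<kappa> where "\<kappa> \<noteq> 0" "\<And>i i'. kk i i' (act A \<tau>) = \<kappa> * kk (i * A$1$1 + i' * c') (7 * i * A$1$2 + i' * A$2$2) \<tau>"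
proof -
  have "Im (7 * \<tau>) > 0" using \<tau> by (simp add: uhp_iff)
  from kf_transform[OF seven_act_dvd(1)[OF A c] this] obtain \<kappa> where "\<kappa> \<noteq> 0" and
    "\<And>r s. kf r s (7 * act A \<tau>) = \<kappa> * kf (r * of_int (A$1$1) + s * of_int c') (r * of_int (7 * A$1$2) + s * of_int (A$2$2)) (7 * \<tau>)"
    unfolding seven_act_dvd(2)[OF A c, symmetric] by auto
  thus ?thesis
    by (intro that[of \<kappa>]) (simp_all add: kk_def add_divide_distrib mult_ac)
qed

lemma seven_act_ndvd:
  assumes A: "A \<in> SL2Z" and c: "\<not> 7 dvd A$2$1"
  obtains s e where "mk (7 * A$1$1) (A$1$2 - A$1$1 * s) (A$2$1) e \<in> SL2Z"
    "\<And>\<tau>. 7 * act A \<tau> = act (mk (7 * A$1$1) (A$1$2 - A$1$1 * s) (A$2$1) e) ((\<tau> + of_int s) / 7)"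
proof -
  have "coprime (A$2$1) 7"
    using c prime_imp_coprime[of "7::int" "A$2$1"] by (simp add: coprime_commute)
  then obtain x where "[A$2$1 * x = 1] (mod 7)" using cong_solve_coprime_int by blast
  hence "[A$2$1 * x * A$2$2 = 1 * A$2$2] (mod 7)" by (rule cong_scalar_right)
  hence "7 dvd A$2$2 - A$2$1 * (x * A$2$2)"
    by (simp add: cong_iff_dvd_diff mult.assoc dvd_diff_commute)
  then obtain e where e: "A$2$2 - A$2$1 * (x * A$2$2) = 7 * e" by (elim dvdE)
  define s where "s = x * A$2$2"
  have d: "A$2$2 = 7 * e + A$2$1 * s" using e by (simp add: s_def)
  show ?thesis
  proof (rule that[of s e])
    show "mk (7 * A$1$1) (A$1$2 - A$1$1 * s) (A$2$1) e \<in> SL2Z"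
      using SL2Z_det[OF A] d by (simp add: algebra_simps)
    fix \<tau>
    have "act (mk (7 * A$1$1) (A$1$2 - A$1$1 * s) (A$2$1) e) ((\<tau> + of_int s) / 7) =
        (of_int (A$1$1) * \<tau> + of_int (A$1$2)) / ((of_int (A$2$1) * \<tau> + of_int (A$2$2)) / 7)"
      unfolding act_eq autf_def d by (intro arg_cong2[of _ _ _ _ "(/)"]) (simp_all add: field_simps)
    also have "\<dots> = 7 * act A \<tau>" by (simp add: act_eq autf_def)
    finally show "7 * act A \<tau> = act (mk (7 * A$1$1) (A$1$2 - A$1$1 * s) (A$2$1) e) ((\<tau> + of_int s) / 7)" ..
  qed
qed

text \<open>Both factorisations in one statement. Only \<kappa> varies with \<tau>; the
  characteristics and the affine argument depend on A alone, so ratios have an expansion at every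
  cusp.\<close>

lemma kk_transform_general:
  assumes A: "A \<in> SL2Z"
  obtains p l :: nat and m :: int and I I' :: "int \<Rightarrow> int \<Rightarrow> int" where "p > 0" "l > 0"
    "\<And>\<tau>. \<tau> \<in> uhp \<Longrightarrow> \<exists>\<kappa>. \<kappa> \<noteq> 0 \<and> (\<forall>i i'. kk i i' (act A \<tau>) =
        \<kappa> * kf (of_int (I i i') / 14) (of_int (I' i i') / 14) ((of_nat p * \<tau> + of_int m) / of_nat l))"
proof (cases "7 dvd A$2$1")
  case True
  then obtain c' where c': "A$2$1 = 7 * c'" by (elim dvdE)
  show ?thesis
  proof (rule that[of 7 1 "\<lambda>i i'. i * A$1$1 + i' * c'" "\<lambda>i i'. 7 * i * A$1$2 + i' * A$2$2" 0])
    fix \<tau> assume "\<tau> \<in> uhp"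
    then obtain \<kappa> where "\<kappa> \<noteq> 0" "\<And>i i'. kk i i' (act A \<tau>) = \<kappa> * kk (i * A$1$1 + i' * c') (7 * i * A$1$2 + i' * A$2$2) \<tau>"
      using kk_transform_dvd[OF A c'] by blast
    thus "\<exists>\<kappa>. \<kappa> \<noteq> 0 \<and> (\<forall>i i'. kk i i' (act A \<tau>) = \<kappa> * kf (of_int (i * A$1$1 + i' * c') / 14)
        (of_int (7 * i * A$1$2 + i' * A$2$2) / 14) ((of_nat 7 * \<tau> + of_int 0) / of_nat 1))"
      by (intro exI[of _ \<kappa>]) (simp add: kk_def)
  qed auto
next
  case False
  obtain s e where B: "mk (7 * A$1$1) (A$1$2 - A$1$1 * s) (A$2$1) e \<in> SL2Z" (is "?B \<in> _")
    "\<And>\<tau>. 7 * act A \<tau> = act (mk (7 * A$1$1) (A$1$2 - A$1$1 * s) (A$2$1) e) ((\<tau> + of_int s) / 7)"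
    using seven_act_ndvd[OF A False] by blast
  show ?thesis
  proof (rule that[of 1 7 "\<lambda>i i'. i * (7 * A$1$1) + i' * A$2$1" "\<lambda>i i'. i * (A$1$2 - A$1$1 * s) + i' * e" s])
    fix \<tau> assume "\<tau> \<in> uhp"
    hence "Im ((\<tau> + of_int s) / 7) > 0" by (simp add: uhp_iff)
    from kf_transform[OF B(1) this] obtain \<kappa> where "\<kappa> \<noteq> 0" "\<And>r s'. kf r s' (7 * act A \<tau>) =
       \<kappa> * kf (r * of_int (7 * A$1$1) + s' * of_int (A$2$1)) (r * of_int (A$1$2 - A$1$1 * s) + s' * of_int e) ((\<tau> + of_int s) / 7)"
      unfolding B(2)[symmetric] by auto
    thus "\<exists>\<kappa>. \<kappa> \<noteq> 0 \<and> (\<forall>i i'. kk i i' (act A \<tau>) = \<kappa> * kf (of_int (i * (7 * A$1$1) + i' * A$2$1) / 14)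
        (of_int (i * (A$1$2 - A$1$1 * s) + i' * e) / 14) ((of_nat 1 * \<tau> + of_int s) / of_nat 7))"
      by (intro exI[of _ \<kappa>]) (simp add: kk_def add_divide_distrib mult_ac)
  qed auto
qed

lemma kk_ratio_mero_inf:
  assumes A: "A \<in> SL2Z"
  shows "meromorphic_at_i_infinity (\<lambda>\<tau>. kk i i' (act A \<tau>) / kk j j' (act A \<tau>))"
proof (rule kk_transform_general[OF A])
  fix p l :: nat and m :: int and I I' :: "int \<Rightarrow> int \<Rightarrow> int"
  assume pl: "p > 0" "l > 0" and
    tr: "\<And>\<tau>. \<tau> \<in> uhp \<Longrightarrow> \<exists>\<kappa>. \<kappa> \<noteq> 0 \<and> (\<forall>i i'. kk i i' (act A \<tau>) =
        \<kappa> * kf (of_int (I i i') / 14) (of_int (I' i i') / 14) ((of_nat p * \<tau> + of_int m) / of_nat l))"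
  have m: "meromorphic_at_i_infinity (\<lambda>\<tau>. kf (of_int (I i i') / 14) (of_int (I' i i') / 14) ((of_nat p * \<tau> + of_int m) / of_nat l))" for i i'
  proof -
    obtain h g where h: "h > 0" "g holomorphic_on ball 0 1" and
      eq: "\<And>\<tau>. kf (of_int (I i i') / of_nat 14) (of_int (I' i i') / 14) ((of_nat p * \<tau> + of_int m) / of_nat l) = g (qpar h \<tau>)"
      using kf_q_expansion[of 14 p l "I i i'" "of_int (I' i i') / 14" m] pl by auto
    have "g analytic_on {0}" using h(2) by (meson analytic_at centre_in_ball open_ball zero_less_one)
    hence "g meromorphic_on {0}" by (rule analytic_on_imp_meromorphic_on)
    thus ?thesis by (rule mero_infI[OF h(1)]) (use eq in simp)
  qed
  show ?thesis
  proof (rule mero_inf_cong[OF mero_inf_divide[OF m[of i i'] m[of j j']]])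
    show "eventually (\<lambda>\<tau>. kf (of_int (I i i') / 14) (of_int (I' i i') / 14) ((of_nat p * \<tau> + of_int m) / of_nat l) /
       kf (of_int (I j j') / 14) (of_int (I' j j') / 14) ((of_nat p * \<tau> + of_int m) / of_nat l) =
       kk i i' (act A \<tau>) / kk j j' (act A \<tau>)) at_ii_inf"
      using eventually_uhp_at_ii_inf
    proof eventually_elim
      case (elim \<tau>)
      from tr[OF this] show ?case by auto
    qed
  qed
qed

text \<open>Up to the sign (-1)^k, \<open>kk (2 * k) 0\<close> is a_k, and all signs cancel,
  including the minus in \<psi>. The factors are grouped into ratios of two \<open>kk\<close>, the
  units in which \<kappa> cancels.\<close>

definition psi0 :: "complex \<Rightarrow> complex" where
  "psi0 \<tau> = (kk 4 0 \<tau> / kk 2 0 \<tau>) * (kk 6 0 \<tau> / kk 2 0 \<tau>)"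

definition ups0 :: "complex \<Rightarrow> complex" where
  "ups0 \<tau> = (kk 4 0 \<tau> / kk 2 0 \<tau>) ^ 2 * (kk 6 0 \<tau> / kk 2 0 \<tau>)"

text \<open>Up to a constant this is \<open>a\<^sub>1 b\<^sub>1 / (a\<^sub>3 b\<^sub>0)\<close>, where \<open>b\<^sub>k\<close> is \<open>a\<^sub>k\<close> with the argument of the theta
  function shifted by the half-period 1/2 (second argument 7 of \<open>kk\<close>).\<close>

definition tee :: "complex \<Rightarrow> complex" where
  "tee \<tau> = exp (- pi * \<i> / 14) * (kk 2 0 \<tau> / kk 6 0 \<tau>) * (kk 2 7 \<tau> / kk 0 7 \<tau>)"

text \<open>Since 14 n + 7 - 2 k = 14 (n + 1/2 - k / 7), the sum is the series of \<open>kf\<close>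
  with r = - k / 7; oddness turns this into k / 7.\<close>

lemma theta7_eq_kk: "theta7 k \<tau> = (-1) ^ k * kk (2 * int k) 0 \<tau>"
proof -
  have "theta7 k \<tau> = (\<Sum>\<^sub>\<infinity>n. (-1) ^ (k + 1) * ((-1) powi n * exp (pi * \<i> * (7 * \<tau>) * (of_int n + 1/2 + - (of_nat k / 7))\<^sup>2)))"
    unfolding theta7_def
  proof (rule infsum_cong)
    fix n :: int
    have "(complex_of_int (14 * n + 7 - 2 * int k))\<^sup>2 = 196 * (of_int n + 1/2 + - (of_nat k / 7))\<^sup>2"
      by (simp add: power2_eq_square field_simps)
    hence "2 * of_real pi * \<i> * \<tau> * (of_int (14 * n + 7 - 2 * int k))\<^sup>2 / 56 = pi * \<i> * (7 * \<tau>) * (of_int n + 1/2 + - (of_nat k / 7))\<^sup>2"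
      by simp
    moreover have "(-1 :: complex) powi (n + int k + 1) = (-1) ^ (k + 1) * (-1) powi n"
      by (simp add: power_int_add)
    ultimately show "(-1) powi (n + int k + 1) * exp (2 * of_real pi * \<i> * \<tau> * (of_int (14 * n + 7 - 2 * int k))\<^sup>2 / 56)
       = (-1) ^ (k + 1) * ((-1) powi n * exp (pi * \<i> * (7 * \<tau>) * (of_int n + 1/2 + - (of_nat k / 7))\<^sup>2))"
      by (simp only: mult.assoc)
  qed
  also have "\<dots> = (-1) ^ (k + 1) * kf (- (of_nat k / 7)) 0 (7 * \<tau>)"
    unfolding infsum_cmult_right' kf_series by simp
  also have "kf (- (of_nat k / 7)) 0 (7 * \<tau>) = - kf (of_nat k / 7) 0 (7 * \<tau>)"
    using kf_uminus[of "of_nat k / 7" 0 "7 * \<tau>"] by simp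
  finally show ?thesis by (simp add: kk_def)
qed

lemma ratio_holomorphic:
  assumes "\<not> (14 dvd j \<and> 14 dvd j')"
  shows "(\<lambda>\<tau>. kk i i' \<tau> / kk j j' \<tau>) holomorphic_on uhp"
  by (intro holomorphic_on_divide kk_holomorphic) (use kk_nz assms in auto)

lemma psi0_holomorphic: "psi0 holomorphic_on uhp"
  and ups0_holomorphic: "ups0 holomorphic_on uhp"
  and tee_holomorphic: "tee holomorphic_on uhp"
  unfolding psi0_def ups0_def tee_def
  by (intro holomorphic_intros ratio_holomorphic; simp)+

lemma functions_nz:
  assumes "\<tau> \<in> uhp"
  shows "psi0 \<tau> \<noteq> 0" "ups0 \<tau> \<noteq> 0" "tee \<tau> \<noteq> 0"
  using assms by (simp_all add: psi0_def ups0_def tee_def kk_nz)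

lemma psi_eq: "\<tau> \<in> uhp \<Longrightarrow> psi \<tau> = psi0 \<tau>"
  and ups_eq: "\<tau> \<in> uhp \<Longrightarrow> upsilon \<tau> = ups0 \<tau>"
proof -
  have 1: "- theta7 2 \<tau> * theta7 3 \<tau> / (theta7 1 \<tau>)\<^sup>2 = psi0 \<tau>"
     and 2: "(theta7 2 \<tau>)\<^sup>2 * theta7 3 \<tau> / (theta7 1 \<tau>) ^ 3 = ups0 \<tau>" for \<tau>
    by (simp_all add: theta7_eq_kk psi0_def ups0_def power2_eq_square power3_eq_cube)
  assume \<tau>: "\<tau> \<in> uhp"
  have "psi0 analytic_on {\<tau>}" "ups0 analytic_on {\<tau>}"
    using psi0_holomorphic ups0_holomorphic open_uhp \<tau> analytic_at by blast+
  thus "psi \<tau> = psi0 \<tau>" "upsilon \<tau> = ups0 \<tau>"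
    unfolding psi_def upsilon_def uhp_normal_def 1 2 using \<tau> by simp_all
qed

lemma functions_mero_inf:
  assumes "A \<in> SL2Z"
  shows "meromorphic_at_i_infinity (\<lambda>\<tau>. psi0 (act A \<tau>))" "meromorphic_at_i_infinity (\<lambda>\<tau>. ups0 (act A \<tau>))"
    "meromorphic_at_i_infinity (\<lambda>\<tau>. tee (act A \<tau>))"
  unfolding psi0_def ups0_def tee_def
  by (intro mero_inf_mult mero_inf_power mero_inf_const kk_ratio_mero_inf assms)+

section \<open>Klein's quartic and the two equations\<close>

lemma kk_three_term:
  assumes "\<tau> \<in> uhp"
  shows "kk (i1 + i2) (j1 + j2) \<tau> * kk (i1 - i2) (j1 - j2) \<tau> * kk i3 j3 \<tau> ^ 2
       + kk (i2 + i3) (j2 + j3) \<tau> * kk (i2 - i3) (j2 - j3) \<tau> * kk i1 j1 \<tau> ^ 2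
       + kk (i3 + i1) (j3 + j1) \<tau> * kk (i3 - i1) (j3 - j1) \<tau> * kk i2 j2 \<tau> ^ 2 = 0"
  using kf_three_term[of "7 * \<tau>" "i1 / 14" "i2 / 14" "j1 / 14" "j2 / 14" "i3 / 14" "j3 / 14"] assms
  by (simp add: kk_def uhp_iff add_divide_distrib diff_divide_distrib)

text \<open>The three-term identity for the indices 6, 4, 2, where oddness and the shift by 14 fold
  index 10 to 4 and index 8 to 6. Up to the sign of one variable this is Klein's quartic.\<close>

lemma klein_quartic:
  assumes "\<tau> \<in> uhp"
  shows "kk 6 0 \<tau> * kk 4 0 \<tau> ^ 3 = kk 2 0 \<tau> ^ 3 * kk 4 0 \<tau> + kk 2 0 \<tau> * kk 6 0 \<tau> ^ 3"
proof -
  have e: "kk 10 0 \<tau> = kk 4 0 \<tau>" "kk 8 0 \<tau> = kk 6 0 \<tau>" "kk (-4) 0 \<tau> = - kk 4 0 \<tau>"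
    using kk_shift[of "-4" 1 0 0 \<tau>] kk_shift[of "-6" 1 0 0 \<tau>] kk_uminus[of 4 0 \<tau>] kk_uminus[of 6 0 \<tau>] by simp_all
  from kk_three_term[OF assms, of 6 4 0 0 2 0] show ?thesis
    by (simp add: e power2_eq_square power3_eq_cube algebra_simps)
qed

text \<open>Divided by x^3 y, the quartic says \<upsilon> - 1 = z^3 / (x^2 y). Both sides of the
  relation are then the same monomial in x, y, z.\<close>

lemma psi_ups_relation:
  assumes \<tau>: "\<tau> \<in> uhp"
  shows "psi0 \<tau> ^ 7 = ups0 \<tau> ^ 4 * (ups0 \<tau> - 1)"
proof -
  define x y z where "x = kk 2 0 \<tau>" and "y = kk 4 0 \<tau>" and "z = kk 6 0 \<tau>"
  have nz: "x \<noteq> 0" "y \<noteq> 0" "z \<noteq> 0" using \<tau> by (simp_all add: x_def y_def z_def kk_nz)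
  have k: "z * y ^ 3 = x ^ 3 * y + x * z ^ 3" using klein_quartic[OF \<tau>] by (simp add: x_def y_def z_def)
  have h1: "ups0 \<tau> - 1 = (y ^ 2 * z - x ^ 3) / x ^ 3"
    using nz by (simp add: ups0_def x_def y_def z_def field_simps power2_eq_square power3_eq_cube)
  have h2: "y ^ 2 * z - x ^ 3 = x * z ^ 3 / y"
    using k nz by (simp add: field_simps power2_eq_square power3_eq_cube)
  have h3: "ups0 \<tau> - 1 = z ^ 3 / (x ^ 2 * y)"
    unfolding h1 h2 using nz by (simp add: field_simps eval_nat_numeral)
  show ?thesis unfolding h3 using nz
    by (simp add: psi0_def ups0_def field_simps eval_nat_numeral flip: x_def y_def z_def)
qed

text \<open>Three instances of the three-term identity, each involving the half-period, link the
  ratios B, U, V of the \<open>b k\<close>. Two of them give the squares of U and V, the third is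
  linear in U, and squaring it eliminates both. The terms in B^4 cancel, which leaves a cubic in B,
  and t is x B / z.\<close>

lemma tee_cubic:
  assumes \<tau>: "\<tau> \<in> uhp"
  defines "u \<equiv> ups0 \<tau>" and "t \<equiv> tee \<tau>"
  shows "2 * u * (u - 1) * t ^ 3 - (u\<^sup>2 - u - 1) * t\<^sup>2 - 2 * u * t + u = 0"
proof -
  define x y z where "x = kk 2 0 \<tau>" and "y = kk 4 0 \<tau>" and "z = kk 6 0 \<tau>"
  define w where "w = exp (- pi * \<i> / 14)"
  \<comment> \<open>The power of w cancels the constant exp (pi i r s) in the exponential of
    \<open>kf\<close> for r = k / 7 and s = 1/2, so that indices 2k and -2k give the same value. It
    accounts for the root of unity in \<open>tee\<close>.\<close>
  define b where "b = (\<lambda>k::nat. w ^ k * kk (2 * int k) 7 \<tau>)"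
  have nz: "x \<noteq> 0" "y \<noteq> 0" "z \<noteq> 0" "w \<noteq> 0" using \<tau> by (simp_all add: x_def y_def z_def w_def kk_nz)
  have w_pow: "exp (- (pi * \<i> * of_nat k / 14)) = w ^ k" for k
    unfolding w_def by (simp add: field_simps flip: exp_of_nat_mult)
  have w7: "w ^ 7 = - \<i>"
    unfolding w_pow[of 7, symmetric] by (simp add: exp_eq_polar exp_minus flip: cis_conv_exp) 
       (simp add: cis_minus_pi_half flip: minus_divide_left)?
  have kkm: "kk (2 * int k) (-7) \<tau> = - (w ^ (2 * k)) * kk (2 * int k) 7 \<tau>" for k
  proof -
    have "kk (2 * int k + 14 * 0) (-7 + 14 * 1) \<tau> = - exp (pi * \<i> * of_nat (2 * k) / 14) * kk (2 * int k) (-7) \<tau>"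
      unfolding kk_shift by simp
    also have "exp (pi * \<i> * of_nat (2 * k) / 14) = inverse (w ^ (2 * k))"
      unfolding w_pow[symmetric] by (simp add: exp_minus)
    finally show ?thesis using nz(4) by (simp add: field_simps)
  qed
  have kkn: "kk (- (2 * int k)) 7 \<tau> = w ^ (2 * k) * kk (2 * int k) 7 \<tau>" for k
    using kk_uminus[of "2 * int k" "-7" \<tau>] kkm[of k] by simp
  have bsq: "w ^ (2 * k) * kk (2 * int k) 7 \<tau> ^ 2 = b k ^ 2" for k
    by (simp add: b_def power_mult_distrib mult.commute flip: power_mult)
  have e: "kk 10 0 \<tau> = y" "kk 8 0 \<tau> = z"
    using kk_shift[of "-4" 1 0 0 \<tau>] kk_shift[of "-6" 1 0 0 \<tau>] kk_uminus[of 4 0 \<tau>] kk_uminus[of 6 0 \<tau>]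
    by (simp_all add: y_def z_def)
  have m: "kk 2 (-7) \<tau> = - (w ^ 2) * kk 2 7 \<tau>" "kk (-4) 7 \<tau> = w ^ 4 * kk 4 7 \<tau>" "kk (-6) 7 \<tau> = w ^ 6 * kk 6 7 \<tau>"
     "kk (-2) 7 \<tau> = w ^ 2 * kk 2 7 \<tau>"
    using kkm[of 1] kkn[of 1] kkn[of 2] kkn[of 3] by simp_all
  have b: "b 0 = kk 0 7 \<tau>" "b 1 = w * kk 2 7 \<tau>" "b 2 = w ^ 2 * kk 4 7 \<tau>" "b 3 = w ^ 3 * kk 6 7 \<tau>"
    by (simp_all add: b_def)
  have R1: "z * x * b 0 ^ 2 - b 1 ^ 2 * y ^ 2 + b 2 ^ 2 * x ^ 2 = 0"
    unfolding b using kk_three_term[OF \<tau>, of 4 2 0 0 0 7]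
    by (simp add: m x_def y_def z_def power2_eq_square algebra_simps eval_nat_numeral)
  have R2: "z * y * b 0 ^ 2 - b 1 ^ 2 * z ^ 2 + b 3 ^ 2 * x ^ 2 = 0"
    unfolding b using kk_three_term[OF \<tau>, of 6 2 0 0 0 7]
    by (simp add: m e x_def y_def z_def power2_eq_square algebra_simps eval_nat_numeral)
  \<comment> \<open>Here the half-period is attached to one of the first two arguments, so it enters
    their sum and their difference; folding back the indices 12 and 10 costs a factor \<i>.\<close>
  have R3: "b 1 * b 0 * y ^ 2 + y * x * b 3 ^ 2 - b 2 * b 1 * z ^ 2 = 0"
  proof -
    have s: "exp (- (\<i> * complex_of_real pi / 2)) = - \<i>"
      using w7 w_pow[of 7] by simp
    have k12: "kk 12 7 \<tau> = \<i> * (w ^ 2 * kk 2 7 \<tau>)" "kk 10 7 \<tau> = \<i> * (w ^ 4 * kk 4 7 \<tau>)"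
      using kk_shift[of "-2" 1 7 0 \<tau>] kk_shift[of "-4" 1 7 0 \<tau>] by (simp_all add: m s)
    have km: "kk (-2) (-7) \<tau> = - kk 2 7 \<tau>" using kk_uminus[of 2 7 \<tau>] by simp
    have "\<i> * (w ^ 2 * kk 2 7 \<tau>) * kk 0 7 \<tau> * y ^ 2 + y * x * kk 6 7 \<tau> ^ 2 - \<i> * (w ^ 4 * kk 4 7 \<tau>) * kk 2 7 \<tau> * z ^ 2 = 0"
      using kk_three_term[OF \<tau>, of 6 6 7 0 4 0] by (simp add: k12 km e x_def y_def z_def)
    hence "w ^ 6 * (\<i> * (w ^ 2 * kk 2 7 \<tau>) * kk 0 7 \<tau> * y ^ 2 + y * x * kk 6 7 \<tau> ^ 2 - \<i> * (w ^ 4 * kk 4 7 \<tau>) * kk 2 7 \<tau> * z ^ 2) = 0" by simp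
    also have "w ^ 6 * (\<i> * (w ^ 2 * kk 2 7 \<tau>) * kk 0 7 \<tau> * y ^ 2 + y * x * kk 6 7 \<tau> ^ 2 - \<i> * (w ^ 4 * kk 4 7 \<tau>) * kk 2 7 \<tau> * z ^ 2) =
       (\<i> * w ^ 7) * (b 1 * b 0 * y ^ 2) + y * x * b 3 ^ 2 - (\<i> * w ^ 7) * (b 2 * b 1 * z ^ 2)"
      unfolding b by (simp add: algebra_simps eval_nat_numeral)
    finally show ?thesis by (simp add: w7)
  qed
  have b0: "b 0 \<noteq> 0" using \<tau> by (simp add: b_def kk_nz)
  define B U V where "B = b 1 / b 0" and "U = b 2 / b 0" and "V = b 3 / b 0"
  have bs: "b 1 = B * b 0" "b 2 = U * b 0" "b 3 = V * b 0" using b0 by (simp_all add: B_def U_def V_def)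
  have "b 0 ^ 2 * (z * x - B ^ 2 * y ^ 2 + U ^ 2 * x ^ 2) = 0" using R1 unfolding bs by (simp add: algebra_simps power_mult_distrib)
  hence "z * x - B ^ 2 * y ^ 2 + U ^ 2 * x ^ 2 = 0" using b0 by simp
  hence r1: "U ^ 2 * x ^ 2 = B ^ 2 * y ^ 2 - z * x" by (simp add: algebra_simps)
  have "b 0 ^ 2 * (z * y - B ^ 2 * z ^ 2 + V ^ 2 * x ^ 2) = 0" using R2 unfolding bs by (simp add: algebra_simps power_mult_distrib)
  hence "z * y - B ^ 2 * z ^ 2 + V ^ 2 * x ^ 2 = 0" using b0 by simp
  hence r2: "V ^ 2 * x ^ 2 = B ^ 2 * z ^ 2 - z * y" by (simp add: algebra_simps)
  have "b 0 ^ 2 * (B * y ^ 2 + y * x * V ^ 2 - U * B * z ^ 2) = 0"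
    using R3 unfolding bs by (simp add: algebra_simps power2_eq_square)
  hence r3: "U * B * z ^ 2 = B * y ^ 2 + y * x * V ^ 2" using b0 by simp
  have "U * B * z ^ 2 * x = x * B * y ^ 2 + y * (V ^ 2 * x ^ 2)"
    unfolding r3 by (simp add: algebra_simps power2_eq_square)
  hence "(U * B * z ^ 2 * x) ^ 2 = (x * B * y ^ 2 + y * (B ^ 2 * z ^ 2 - z * y)) ^ 2" unfolding r2 by simp
  moreover have "(U * B * z ^ 2 * x) ^ 2 = (B ^ 2 * y ^ 2 - z * x) * B ^ 2 * z ^ 4"
    unfolding r1[symmetric] by (simp add: power_mult_distrib flip: power_mult)
  ultimately have quart: "(B ^ 2 * y ^ 2 - z * x) * B ^ 2 * z ^ 4 = (x * B * y ^ 2 + y * (B ^ 2 * z ^ 2 - z * y)) ^ 2" by simp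
  have tB: "t = x * B / z" unfolding B_def b by (simp add: t_def tee_def x_def z_def w_def mult_ac)
  have Bt: "B = t * z / x" using nz tB by (simp add: field_simps)
  have k: "z * y ^ 3 = x ^ 3 * y + x * z ^ 3" using klein_quartic[OF \<tau>] by (simp add: x_def y_def z_def)
  have u: "u = y ^ 2 * z / x ^ 3" by (simp add: u_def ups0_def x_def y_def z_def power2_eq_square power3_eq_cube)
  have z3: "x * z ^ 3 = y * x ^ 3 * (u - 1)" using k nz by (simp add: u field_simps eval_nat_numeral)
  have yz: "y ^ 2 * z = u * x ^ 3" using nz by (simp add: u)
  have poly: "2 * x * y ^ 3 * z ^ 2 * B ^ 3 + (x ^ 2 * y ^ 4 - 2 * y ^ 3 * z ^ 3 + x * z ^ 5) * B ^ 2 - 2 * x * y ^ 4 * z * B + y ^ 4 * z ^ 2 = 0"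
    using quart by (simp add: algebra_simps eval_nat_numeral)
  have "x ^ 2 * (2 * x * y ^ 3 * z ^ 2 * B ^ 3 + (x ^ 2 * y ^ 4 - 2 * y ^ 3 * z ^ 3 + x * z ^ 5) * B ^ 2 - 2 * x * y ^ 4 * z * B + y ^ 4 * z ^ 2)
     = 2 * y ^ 3 * z ^ 5 * t ^ 3 + (x ^ 2 * y ^ 4 * z ^ 2 - 2 * y ^ 3 * z ^ 5 + x * z ^ 7) * t ^ 2 - 2 * x ^ 2 * y ^ 4 * z ^ 2 * t + x ^ 2 * y ^ 4 * z ^ 2"
    unfolding Bt using nz by (simp add: field_simps eval_nat_numeral)
  hence star: "2 * y ^ 3 * z ^ 5 * t ^ 3 + (x ^ 2 * y ^ 4 * z ^ 2 - 2 * y ^ 3 * z ^ 5 + x * z ^ 7) * t ^ 2 - 2 * x ^ 2 * y ^ 4 * z ^ 2 * t + x ^ 2 * y ^ 4 * z ^ 2 = 0"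
    using poly by simp
  \<comment> \<open>Multiplied by u, the coefficients that still contain x, y, z become polynomials
    in u times one common monomial: the quartic replaces x z^3 by y x^3 (u - 1), and y^2 z is u
    x^3.\<close>
  have c3: "u * (y ^ 3 * z ^ 5) = x ^ 2 * y ^ 4 * z ^ 2 * (u * (u - 1))"
  proof -
    have "x * (u * (y ^ 3 * z ^ 5)) = u * y ^ 3 * z ^ 2 * (x * z ^ 3)" by (simp add: eval_nat_numeral)
    also have "\<dots> = x * (x ^ 2 * y ^ 4 * z ^ 2 * (u * (u - 1)))" unfolding z3 by (simp add: eval_nat_numeral)
    finally show ?thesis using nz by simp
  qed
  have c2: "u * (x * z ^ 7) = x ^ 2 * y ^ 4 * z ^ 2 * (u - 1) ^ 2"
  proof -
    have "x * x ^ 3 * (u * (x * z ^ 7)) = (u * x ^ 3) * z * (x * z ^ 3) * (x * z ^ 3)" by (simp add: eval_nat_numeral)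
    also have "\<dots> = (y ^ 2 * z) * z * (y * x ^ 3 * (u - 1)) * (y * x ^ 3 * (u - 1))" by (simp only: yz z3)
    also have "\<dots> = x * x ^ 3 * (x ^ 2 * y ^ 4 * z ^ 2 * (u - 1) ^ 2)" by (simp add: eval_nat_numeral)
    finally show ?thesis using nz by simp
  qed
  have "x ^ 2 * y ^ 4 * z ^ 2 * (2 * u * (u - 1) * t ^ 3 - (u\<^sup>2 - u - 1) * t\<^sup>2 - 2 * u * t + u)
    = 2 * (x ^ 2 * y ^ 4 * z ^ 2 * (u * (u - 1))) * t ^ 3 + (u * (x ^ 2 * y ^ 4 * z ^ 2) - 2 * (x ^ 2 * y ^ 4 * z ^ 2 * (u * (u - 1)))
       + x ^ 2 * y ^ 4 * z ^ 2 * (u - 1) ^ 2) * t ^ 2 - u * (2 * x ^ 2 * y ^ 4 * z ^ 2 * t) + u * (x ^ 2 * y ^ 4 * z ^ 2)"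
    by (simp add: algebra_simps power2_eq_square)
  also have "\<dots> = u * (2 * y ^ 3 * z ^ 5 * t ^ 3 + (x ^ 2 * y ^ 4 * z ^ 2 - 2 * y ^ 3 * z ^ 5 + x * z ^ 7) * t ^ 2 - 2 * x ^ 2 * y ^ 4 * z ^ 2 * t + x ^ 2 * y ^ 4 * z ^ 2)"
    unfolding c3[symmetric] c2[symmetric] by (simp add: algebra_simps)
  also have "\<dots> = 0" unfolding star by simp
  finally show ?thesis using nz by simp
qed

subsection \<open>Invariance and cusp values\<close>

text \<open>The congruence for the lower right entry follows from the determinant.\<close>

definition Gamma1_7 :: "(int^2^2) set" where
  "Gamma1_7 = {A \<in> SL2Z. [A$1$1 = 1] (mod 7) \<and> [A$2$1 = 0] (mod 7)}"

definition Gamma_2_7 :: "(int^2^2) set" where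
  "Gamma_2_7 = Gamma0 2 \<inter> principal_Gamma 7"

lemma Gamma_inclusions:
  "principal_Gamma 7 \<subseteq> Gamma1_7" "Gamma1_7 \<subseteq> SL2Z" "Gamma_2_7 \<subseteq> principal_Gamma 7" "Gamma_2_7 \<subseteq> SL2Z"
  "principal_Gamma 14 \<subseteq> Gamma_2_7"
proof -
  have c: "[x = y] (mod 7)" "[x = y] (mod 2)" if "[x = y] (mod 14)" for x y :: int
    using that cong_dvd_modulus[of x y 14 7] cong_dvd_modulus[of x y 14 2] by auto
  show "principal_Gamma 14 \<subseteq> Gamma_2_7"
    unfolding Gamma_2_7_def Gamma0_def principal_Gamma_def using c by blast
qed (auto simp: principal_Gamma_def Gamma1_7_def Gamma_2_7_def)

lemma Gamma1_7_E:
  assumes "A \<in> Gamma1_7"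
  obtains a' c' where "A \<in> SL2Z" "A$1$1 = 1 + 7 * a'" "A$2$1 = 7 * c'"
proof -
  have A: "A \<in> SL2Z" "7 dvd A$1$1 - 1" "7 dvd A$2$1"
    using assms by (auto simp: Gamma1_7_def cong_iff_dvd_diff cong_0_iff)
  then obtain a' c' where "A$1$1 - 1 = 7 * a'" "A$2$1 = 7 * c'" by (auto elim!: dvdE)
  thus ?thesis using A(1) by (intro that[of a' c']) auto
qed

lemma Gamma7_E:
  assumes "A \<in> principal_Gamma 7"
  obtains a' b' c' d' where "A \<in> SL2Z" "A$1$1 = 1 + 7 * a'" "A$1$2 = 7 * b'" "A$2$1 = 7 * c'" "A$2$2 = 1 + 7 * d'"
proof -
  have A: "A \<in> SL2Z" "7 dvd A$1$1 - 1" "7 dvd A$1$2" "7 dvd A$2$1" "7 dvd A$2$2 - 1"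
    using assms by (auto simp: principal_Gamma_def cong_iff_dvd_diff cong_0_iff)
  then obtain a' b' c' d' where "A$1$1 - 1 = 7 * a'" "A$1$2 = 7 * b'" "A$2$1 = 7 * c'" "A$2$2 - 1 = 7 * d'"
    by (auto elim!: dvdE)
  thus ?thesis using A(1) by (intro that[of a' b' c' d']) auto
qed

text \<open>Index 2k is shifted by 14 k a' and 14 k b. By \<open>kk_shift\<close> this multiplies by
  E^(k^2) and, for odd k, by the sign s; hence the exponents 1, 4, 9.\<close>

lemma kk_Gamma1_7:
  assumes A: "A \<in> SL2Z" "A$1$1 = 1 + 7 * a'" "A$2$1 = 7 * c'" and \<tau>: "\<tau> \<in> uhp"
  defines "b \<equiv> A$1$2"
  defines "s \<equiv> (-1) powi (a' + b + a' * b) :: complex" and "E \<equiv> exp (pi * \<i> * of_int b / 7)"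
  obtains \<kappa> where "\<kappa> \<noteq> 0" "kk 2 0 (act A \<tau>) = \<kappa> * (s * E * kk 2 0 \<tau>)"
    "kk 4 0 (act A \<tau>) = \<kappa> * (E ^ 4 * kk 4 0 \<tau>)" "kk 6 0 (act A \<tau>) = \<kappa> * (s * E ^ 9 * kk 6 0 \<tau>)"
proof -
  obtain \<kappa> where \<kappa>: "\<kappa> \<noteq> 0" and
    tr: "\<And>i i'. kk i i' (act A \<tau>) = \<kappa> * kk (i * A$1$1 + i' * c') (7 * i * A$1$2 + i' * A$2$2) \<tau>"
    using kk_transform_dvd[OF A(1,3) \<tau>] by blast
  have *: "kk (2 * k * A$1$1 + 0 * c') (7 * (2 * k) * A$1$2 + 0 * A$2$2) \<tau> =
      (-1) powi (k * a' + k * b + (k * a') * (k * b)) * exp (pi * \<i> * of_int (k * k * b) / 7) * kk (2 * k) 0 \<tau>" for k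
  proof -
    have "kk (2 * k * A$1$1 + 0 * c') (7 * (2 * k) * A$1$2 + 0 * A$2$2) \<tau> = kk (2 * k + 14 * (k * a')) (0 + 14 * (k * b)) \<tau>"
      by (simp add: A(2) b_def algebra_simps)
    also have "\<dots> = (-1) powi (k * a' + k * b + (k * a') * (k * b)) * exp (pi * \<i> * of_int (2 * k * (k * b) - (k * a') * 0) / 14) * kk (2 * k) 0 \<tau>"
      by (rule kk_shift)
    also have "pi * \<i> * of_int (2 * k * (k * b) - (k * a') * 0) / 14 = pi * \<i> * of_int (k * k * b) / 7" by simp
    finally show ?thesis .
  qed
  have Ek: "exp (pi * \<i> * of_int (int k * b) / 7) = E ^ k" for k
    unfolding E_def by (simp add: field_simps flip: exp_of_nat_mult)
  show ?thesis
  proof (rule that[OF \<kappa>])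
    show "kk 2 0 (act A \<tau>) = \<kappa> * (s * E * kk 2 0 \<tau>)"
      using tr[of 2 0] *[of 1] by (simp add: s_def E_def)
    show "kk 4 0 (act A \<tau>) = \<kappa> * (E ^ 4 * kk 4 0 \<tau>)"
      using tr[of 4 0] *[of 2] Ek[of 4] by (simp add: power_int_minus_left)
    have "(-1 :: complex) powi (3 * a' + 3 * b + 3 * a' * (3 * b)) = s"
      unfolding s_def by (auto simp: power_int_minus_left)
    thus "kk 6 0 (act A \<tau>) = \<kappa> * (s * E ^ 9 * kk 6 0 \<tau>)"
      using tr[of 6 0] *[of 3] Ek[of 9] by simp
  qed
qed

text \<open>The exponents of E add up to 2 * 4 + 9 - 3 * 1 = 14, where E^14 = 1, and the signs leave
  the square of s.\<close>

lemma ups0_Gamma1_7: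
  assumes A: "A \<in> Gamma1_7" and \<tau>: "\<tau> \<in> uhp"
  shows "ups0 (act A \<tau>) = ups0 \<tau>"
proof -
  obtain a' c' where A': "A \<in> SL2Z" "A$1$1 = 1 + 7 * a'" "A$2$1 = 7 * c'" by (rule Gamma1_7_E[OF A])
  define b where "b = A$1$2"
  define s where "s = ((-1) powi (a' + b + a' * b) :: complex)"
  define E where "E = exp (pi * \<i> * of_int b / 7)"
  obtain \<kappa> where \<kappa>: "\<kappa> \<noteq> 0" "kk 2 0 (act A \<tau>) = \<kappa> * (s * E * kk 2 0 \<tau>)"
    "kk 4 0 (act A \<tau>) = \<kappa> * (E ^ 4 * kk 4 0 \<tau>)" "kk 6 0 (act A \<tau>) = \<kappa> * (s * E ^ 9 * kk 6 0 \<tau>)"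
    using kk_Gamma1_7[OF A' \<tau>] unfolding s_def E_def b_def by blast
  have s: "s \<noteq> 0" "s * s = 1" by (auto simp: s_def)
  have E: "E \<noteq> 0" by (simp add: E_def)
  have E14: "E ^ 14 = 1"
    using exp_pi_i_int[of "2 * b"] by (simp add: E_def field_simps flip: exp_of_nat_mult)
  have nz: "kk 2 0 \<tau> \<noteq> 0" using \<tau> by (simp add: kk_nz)
  have "ups0 (act A \<tau>) = (E ^ 14 / (s * s)) * ups0 \<tau>"
    unfolding ups0_def \<kappa>(2-4) using \<kappa>(1) s(1) E nz by (simp add: field_simps eval_nat_numeral)
  thus ?thesis by (simp add: E14 s)
qed

text \<open>Here the exponents add up to 4 + 9 - 2 * 1 = 11, so a root of unity survives; it makes
  \<open>psi0\<close> an eigenfunction of translation.\<close>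

lemma psi0_Gamma1_7:
  assumes A: "A \<in> SL2Z" "A$1$1 = 1 + 7 * a'" "A$2$1 = 7 * c'" and \<tau>: "\<tau> \<in> uhp"
  shows "psi0 (act A \<tau>) = (-1) powi (a' + A$1$2 + a' * A$1$2) * exp (pi * \<i> * of_int (11 * A$1$2) / 7) * psi0 \<tau>"
proof -
  define b where "b = A$1$2"
  define s where "s = ((-1) powi (a' + b + a' * b) :: complex)"
  define E where "E = exp (pi * \<i> * of_int b / 7)"
  obtain \<kappa> where \<kappa>: "\<kappa> \<noteq> 0" "kk 2 0 (act A \<tau>) = \<kappa> * (s * E * kk 2 0 \<tau>)"
    "kk 4 0 (act A \<tau>) = \<kappa> * (E ^ 4 * kk 4 0 \<tau>)" "kk 6 0 (act A \<tau>) = \<kappa> * (s * E ^ 9 * kk 6 0 \<tau>)"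
    using kk_Gamma1_7[OF A \<tau>] unfolding s_def E_def b_def by blast
  have s: "s \<noteq> 0" "s * s = 1" by (auto simp: s_def)
  have E: "E \<noteq> 0" by (simp add: E_def)
  have E11: "E ^ 11 = exp (pi * \<i> * of_int (11 * b) / 7)"
    by (simp add: E_def field_simps flip: exp_of_nat_mult)
  have nz: "kk 2 0 \<tau> \<noteq> 0" using \<tau> by (simp add: kk_nz)
  have "psi0 (act A \<tau>) * (s * s) = s * E ^ 11 * psi0 \<tau>"
    unfolding psi0_def \<kappa>(2-4) using \<kappa>(1) s(1) E nz by (simp add: field_simps eval_nat_numeral)
  thus ?thesis by (simp add: s(2) E11) (simp add: s_def b_def)
qed

lemma psi0_Gamma7:
  assumes A: "A \<in> principal_Gamma 7" and \<tau>: "\<tau> \<in> uhp"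
  shows "psi0 (act A \<tau>) = psi0 \<tau>"
proof -
  obtain a' b' c' d' where A': "A \<in> SL2Z" "A$1$1 = 1 + 7 * a'" "A$1$2 = 7 * b'" "A$2$1 = 7 * c'" "A$2$2 = 1 + 7 * d'"
    by (rule Gamma7_E[OF A])
  \<comment> \<open>Determinant 1 does not let the whole first row be even; this parity settles the
    remaining sign.\<close>
  have "odd (A$1$1) \<or> odd (A$1$2)" using SL2Z_det[OF A'(1)] by (metis dvd_diff dvd_mult2 odd_one)
  hence par: "even a' \<or> odd b'" by (simp add: A')
  have "pi * \<i> * of_int (11 * A$1$2) / 7 = pi * \<i> * of_int (11 * b')" by (simp add: A')
  hence "exp (pi * \<i> * of_int (11 * A$1$2) / 7) = (-1) powi (11 * b')" by (simp only: exp_pi_i_int)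
  moreover have "(-1) powi (a' + A$1$2 + a' * A$1$2) * (-1) powi (11 * b') = (1::complex)"
    using par by (auto simp: A' power_int_minus_left)
  ultimately show ?thesis using psi0_Gamma1_7[OF A'(1,2,4) \<tau>] by simp
qed

lemma psi0_translate: "\<tau> \<in> uhp \<Longrightarrow> psi0 (\<tau> + 1) = exp (4 * pi * \<i> / 7) * psi0 \<tau>"
proof -
  assume \<tau>: "\<tau> \<in> uhp"
  have "psi0 (\<tau> + 1) = - exp (11 * pi * \<i> / 7) * psi0 \<tau>"
    using psi0_Gamma1_7[of "mk 1 1 0 1" 0 0 \<tau>] \<tau> act_translation[of 1 \<tau>] by (simp add: mult_ac)
  also have "11 * pi * \<i> / 7 = 4 * pi * \<i> / 7 + pi * \<i>" by simp
  also have "- exp (4 * pi * \<i> / 7 + pi * \<i>) = exp (4 * pi * \<i> / 7)" by (simp only: exp_add) simp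
  finally show ?thesis .
qed

lemma ups0_translate: "\<tau> \<in> uhp \<Longrightarrow> ups0 (\<tau> + 1) = ups0 \<tau>"
  using ups0_Gamma1_7[of "mk 1 1 0 1" \<tau>] act_translation[of 1 \<tau>] by (simp add: Gamma1_7_def)

lemma ups0_hol_modular: "hol_modular Gamma1_7 ups0"
  unfolding hol_modular_def using ups0_holomorphic ups0_Gamma1_7 functions_mero_inf by blast

lemma psi0_hol_modular: "hol_modular (principal_Gamma 7) psi0"
  unfolding hol_modular_def using psi0_holomorphic psi0_Gamma7 functions_mero_inf by blast

section \<open>Growth at the cusps\<close>

lemma filterlim_affine_ii_inf:
  assumes "p > 0" "l > 0"
  shows "filterlim (\<lambda>\<tau>. (of_nat p * \<tau> + of_int m) / of_nat l) at_ii_inf at_ii_inf"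
  unfolding filterlim_filtercomap_iff
proof -
  have "filterlim (\<lambda>\<tau>. real p / real l * Im \<tau>) at_top at_ii_inf"
    by (intro filterlim_tendsto_pos_mult_at_top[OF tendsto_const] filterlim_Im_at_ii_inf) (use assms in auto)
  thus "filterlim (Im \<circ> (\<lambda>\<tau>. (of_nat p * \<tau> + of_int m) / of_nat l)) at_top at_ii_inf"
    by (simp add: o_def Im_divide_of_nat)
qed

text \<open>This is |q|^(-1/56) for q = exp (2 pi i \<tau>), the unit in which the leading exponents
  of \<open>kk\<close> are integer squares.\<close>

definition qX :: "complex \<Rightarrow> real" where "qX \<tau> = exp (pi * Im \<tau> / 28)"

lemma qX_pos [simp]: "qX \<tau> > 0" "qX \<tau> \<noteq> 0" "qX \<tau> \<ge> 0" by (simp_all add: qX_def)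

text \<open>At 7 * \<tau> the dominant exponent for r = i / 14 is (7 - |i|)^2 in this unit: 25, 9, 1
  for i = 2, 4, 6 and 49 for i = 0.\<close>

lemma kk_asymp:
  assumes "\<bar>i\<bar> \<le> 7"
  shows "((\<lambda>\<tau>. norm (kk i i' \<tau>) * qX \<tau> ^ (nat (7 - \<bar>i\<bar>))\<^sup>2) \<longlongrightarrow> (if i = 0 then 2 * \<bar>sin (pi * (i' / 14))\<bar> else 1)) at_ii_inf"
proof -
  define e where "e = real_of_int (7 - \<bar>i\<bar>)"
  have e: "real (nat (7 - \<bar>i\<bar>)) = e" using assms by (simp add: e_def)
  have lim: "filterlim (\<lambda>\<tau>. 7 * \<tau>) at_ii_inf at_ii_inf" using filterlim_affine_ii_inf[of 7 1 0] by simp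
  have "2 * \<bar>i\<bar> \<le> int 14" using assms by simp
  from filterlim_compose[OF kf_leading_term[OF _ this, of "i' / 14"] lim]
  have "((\<lambda>\<tau>. norm (kk i i' \<tau>) * exp (pi * (1/2 - \<bar>i / 14\<bar>)\<^sup>2 * Im (7 * \<tau>))) \<longlongrightarrow> (if i = 0 then 2 * \<bar>sin (pi * (i' / 14))\<bar> else 1)) at_ii_inf"
    by (simp add: kk_def)
  moreover have "exp (pi * (1/2 - \<bar>i / 14\<bar>)\<^sup>2 * Im (7 * \<tau>)) = qX \<tau> ^ (nat (7 - \<bar>i\<bar>))\<^sup>2" for \<tau>
  proof -
    have h: "1/2 - \<bar>i / 14\<bar> = e / 14" by (simp add: e_def)
    have "pi * (1/2 - \<bar>i / 14\<bar>)\<^sup>2 * Im (7 * \<tau>) = real ((nat (7 - \<bar>i\<bar>))\<^sup>2) * (pi * Im \<tau> / 28)"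
      unfolding h of_nat_power e by (simp add: power_divide)
    thus ?thesis unfolding qX_def by (simp only: exp_of_nat_mult)
  qed
  ultimately show ?thesis by simp
qed

lemma qX_at_top: "filterlim qX at_top at_ii_inf"
proof -
  have "filterlim (\<lambda>y. exp (pi * y / 28)) at_top at_top" by real_asymp
  thus ?thesis unfolding qX_def[abs_def] by (rule filterlim_compose[OF _ filterlim_Im_at_ii_inf])
qed

lemma qX_power_ge_1: "eventually (\<lambda>\<tau>. qX \<tau> ^ n \<ge> 1) at_ii_inf"
  using eventually_uhp_at_ii_inf by eventually_elim (auto simp: qX_def uhp_iff intro!: one_le_power)

lemma kk_asymps:
  "((\<lambda>\<tau>. norm (kk 2 0 \<tau>) * qX \<tau> ^ 25) \<longlongrightarrow> 1) at_ii_inf"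
  "((\<lambda>\<tau>. norm (kk 4 0 \<tau>) * qX \<tau> ^ 9) \<longlongrightarrow> 1) at_ii_inf"
  "((\<lambda>\<tau>. norm (kk 6 0 \<tau>) * qX \<tau>) \<longlongrightarrow> 1) at_ii_inf"
  using kk_asymp[of 2 0] kk_asymp[of 4 0] kk_asymp[of 6 0] by simp_all

text \<open>The orders combine to 3 * 25 - 2 * 9 - 1 = 56, exactly one power of 1 / q: a simple
  pole.\<close>

lemma ups0_growth: "((\<lambda>\<tau>. norm (ups0 \<tau>) / qX \<tau> ^ 56) \<longlongrightarrow> 1) at_ii_inf"
proof -
  have "((\<lambda>\<tau>. (norm (kk 4 0 \<tau>) * qX \<tau> ^ 9) ^ 2 * (norm (kk 6 0 \<tau>) * qX \<tau>) / (norm (kk 2 0 \<tau>) * qX \<tau> ^ 25) ^ 3)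
     \<longlongrightarrow> 1 ^ 2 * 1 / 1 ^ 3) at_ii_inf"
    by (intro tendsto_intros kk_asymps) auto
  moreover have "(norm (kk 4 0 \<tau>) * qX \<tau> ^ 9) ^ 2 * (norm (kk 6 0 \<tau>) * qX \<tau>) / (norm (kk 2 0 \<tau>) * qX \<tau> ^ 25) ^ 3 = norm (ups0 \<tau>) / qX \<tau> ^ 56" for \<tau>
  proof -
    have h: "qX \<tau> ^ 75 = qX \<tau> ^ 56 * (qX \<tau> ^ 18 * qX \<tau>)"
      by (simp only: power_add[symmetric] power_Suc2[symmetric]) simp
    have "(norm (kk 4 0 \<tau>) * qX \<tau> ^ 9) ^ 2 * (norm (kk 6 0 \<tau>) * qX \<tau>) / (norm (kk 2 0 \<tau>) * qX \<tau> ^ 25) ^ 3 =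
        (norm (kk 4 0 \<tau>) ^ 2 * norm (kk 6 0 \<tau>) / norm (kk 2 0 \<tau>) ^ 3) * (qX \<tau> ^ 18 * qX \<tau> / qX \<tau> ^ 75)"
      by (simp add: power_mult_distrib flip: power_mult)
    also have "qX \<tau> ^ 18 * qX \<tau> / qX \<tau> ^ 75 = 1 / qX \<tau> ^ 56"
      unfolding h by (rule nonzero_divide_mult_cancel_right) simp
    finally show ?thesis
      by (simp add: ups0_def norm_mult norm_divide norm_power power2_eq_square power3_eq_cube)
  qed
  ultimately show ?thesis by simp
qed

lemma ups0_at_infinity: "filterlim ups0 at_infinity at_ii_inf"
proof -
  have "filterlim (\<lambda>\<tau>. norm (ups0 \<tau>) / qX \<tau> ^ 56 * qX \<tau> ^ 56) at_top at_ii_inf"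
    by (rule filterlim_tendsto_pos_mult_at_top[OF ups0_growth])
       (auto intro!: filterlim_pow_at_top qX_at_top)
  thus ?thesis by (simp add: filterlim_at_infinity_conv_norm_at_top)
qed

lemma act_uminus: "act (- A) \<tau> = act A \<tau>"
proof -
  have "act (- A) \<tau> = (- (of_int (A$1$1) * \<tau> + of_int (A$1$2))) / (- autf A \<tau>)"
    unfolding act_eq autf_def by (intro arg_cong2[of _ _ _ _ "(/)"]) simp_all
  also have "\<dots> = act A \<tau>" unfolding act_eq by (simp only: divide_minus_left divide_minus_right minus_minus)
  finally show ?thesis .
qed

lemma bounded_of_tendsto:
  fixes f :: "complex \<Rightarrow> real"
  assumes "(f \<longlongrightarrow> L) F"
  shows "eventually (\<lambda>\<tau>. f \<tau> \<le> L + 1) F"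
  using order_tendstoD(2)[OF assms, of "L + 1"] by (auto elim: eventually_mono)

text \<open>If 7 divides the lower left entry, A multiplies the indices by its upper left entry r
  modulo 7 and so permutes 2, 4, 6 up to sign and period. For r = 2 or 5 the orders become 2 * 1 +
  25 - 3 * 9 = 0, for r = 3 or 4 they become 2 * 25 + 9 - 3 * 1 = 56, a zero; the pole belongs to r
  = 1 or 6, which is excluded. If 7 does not divide it, all first characteristics are integers and
  the leading powers cancel.\<close>

lemma ups0_cusp:
  assumes A: "A \<in> SL2Z" "A \<notin> Gamma1_7" "- A \<notin> Gamma1_7"
  shows "\<exists>B. eventually (\<lambda>\<tau>. norm (ups0 (act A \<tau>)) \<le> B) at_ii_inf"
proof (cases "7 dvd A$2$1")
  case True
  then obtain c' where c': "A$2$1 = 7 * c'" by (elim dvdE)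
  define n where "n = (\<lambda>i \<tau>. norm (kk i 0 \<tau>))"
  define r where "r = A$1$1 mod 7"
  define m where "m = A$1$1 div 7"
  have a: "A$1$1 = r + 7 * m" by (simp add: r_def m_def)
  have nshift: "n (i + 14 * k) \<tau> = n i \<tau>" for i k \<tau>
    unfolding n_def using norm_kk_shift[of i k 0 0 \<tau>] by simp
  have nneg: "n (- i) \<tau> = n i \<tau>" for i \<tau>
    unfolding n_def using kk_uminus[of i 0 \<tau>] by simp
  have eq: "norm (ups0 (act A \<tau>)) = n (4 * r) \<tau> ^ 2 * n (6 * r) \<tau> / n (2 * r) \<tau> ^ 3" if \<tau>: "\<tau> \<in> uhp" for \<tau>
  proof -
    obtain \<kappa> where \<kappa>: "\<kappa> \<noteq> 0" and
      tr: "\<And>i i'. kk i i' (act A \<tau>) = \<kappa> * kk (i * A$1$1 + i' * c') (7 * i * A$1$2 + i' * A$2$2) \<tau>"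
      using kk_transform_dvd[OF A(1) c' \<tau>] by blast
    have "norm (kk (2 * k) 0 (act A \<tau>)) = norm \<kappa> * n (2 * k * r) \<tau>" for k
    proof -
      have "kk (2 * k) 0 (act A \<tau>) = \<kappa> * kk (2 * k * r + 14 * (k * m)) (0 + 14 * (k * A$1$2)) \<tau>"
        unfolding tr by (simp add: a algebra_simps)
      thus ?thesis by (simp only: norm_mult norm_kk_shift n_def)
    qed
    from this[of 1] this[of 2] this[of 3] show ?thesis
      using \<kappa> by (simp add: ups0_def norm_mult norm_divide norm_power field_simps power2_eq_square power3_eq_cube)
  qed
  have nk: "((\<lambda>\<tau>. n 2 \<tau> * qX \<tau> ^ 25) \<longlongrightarrow> 1) at_ii_inf" "((\<lambda>\<tau>. n 4 \<tau> * qX \<tau> ^ 9) \<longlongrightarrow> 1) at_ii_inf"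
    "((\<lambda>\<tau>. n 6 \<tau> * qX \<tau>) \<longlongrightarrow> 1) at_ii_inf" using kk_asymps by (simp_all add: n_def)
  have "r \<noteq> 0" 
  proof
    assume "r = 0"
    hence "7 dvd A$1$1" by (simp add: r_def mod_eq_0_iff_dvd)
    hence "7 dvd A$1$1 * A$2$2 - A$1$2 * A$2$1" using True by (intro dvd_diff dvd_mult2 dvd_mult) auto
    thus False using SL2Z_det[OF A(1)] by simp
  qed
  moreover have "r \<noteq> 1"
    using A True by (auto simp: Gamma1_7_def r_def cong_def cong_0_iff mod_eq_0_iff_dvd)
  moreover have "r \<noteq> 6"
  proof
    assume "r = 6"
    hence "[- (A$1$1) = 1] (mod 7)"
      unfolding a cong_iff_dvd_diff by simp
    moreover have "- A \<in> SL2Z" using A(1) SL2Z_det[OF A(1)] by (simp add: SL2Z_def det_2)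
    ultimately show False using A(3) True by (simp add: Gamma1_7_def cong_0_iff)
  qed
  moreover have "0 \<le> r" "r < 7" by (auto simp: r_def)
  ultimately have "r = 2 \<or> r = 3 \<or> r = 4 \<or> r = 5" by presburger
  hence "(\<forall>\<tau>\<in>uhp. norm (ups0 (act A \<tau>)) = n 6 \<tau> ^ 2 * n 2 \<tau> / n 4 \<tau> ^ 3) \<or>
         (\<forall>\<tau>\<in>uhp. norm (ups0 (act A \<tau>)) = n 2 \<tau> ^ 2 * n 4 \<tau> / n 6 \<tau> ^ 3)"
  proof (elim disjE)
    assume "r = 2"
    moreover have "n 8 \<tau> = n 6 \<tau>" "n 12 \<tau> = n 2 \<tau>" for \<tau>
      using nshift[of "-6" 1 \<tau>] nshift[of "-2" 1 \<tau>] nneg[of 6 \<tau>] nneg[of 2 \<tau>] by simp_all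
    ultimately show ?thesis using eq by simp
  next
    assume "r = 3"
    moreover have "n 12 \<tau> = n 2 \<tau>" "n 18 \<tau> = n 4 \<tau>" for \<tau>
      using nshift[of "-2" 1 \<tau>] nshift[of "4" 1 \<tau>] nneg[of 2 \<tau>] by simp_all
    ultimately show ?thesis using eq by simp
  next
    assume "r = 4"
    moreover have "n 16 \<tau> = n 2 \<tau>" "n 24 \<tau> = n 4 \<tau>" "n 8 \<tau> = n 6 \<tau>" for \<tau>
      using nshift[of "2" 1 \<tau>] nshift[of "-4" 2 \<tau>] nshift[of "-6" 1 \<tau>] nneg[of 4 \<tau>] nneg[of 6 \<tau>] by simp_all
    ultimately show ?thesis using eq by simp
  next
    assume "r = 5"
    moreover have "n 20 \<tau> = n 6 \<tau>" "n 30 \<tau> = n 2 \<tau>" "n 10 \<tau> = n 4 \<tau>" for \<tau>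
      using nshift[of "6" 1 \<tau>] nshift[of "2" 2 \<tau>] nshift[of "-4" 1 \<tau>] nneg[of 4 \<tau>] by simp_all
    ultimately show ?thesis using eq by simp
  qed
  thus ?thesis
  proof
    assume eq: "\<forall>\<tau>\<in>uhp. norm (ups0 (act A \<tau>)) = n 6 \<tau> ^ 2 * n 2 \<tau> / n 4 \<tau> ^ 3"
    have "((\<lambda>\<tau>. (n 6 \<tau> * qX \<tau>) ^ 2 * (n 2 \<tau> * qX \<tau> ^ 25) / (n 4 \<tau> * qX \<tau> ^ 9) ^ 3) \<longlongrightarrow> 1 ^ 2 * 1 / 1 ^ 3) at_ii_inf"
      by (intro tendsto_intros nk) auto
    moreover have "(n 6 \<tau> * qX \<tau>) ^ 2 * (n 2 \<tau> * qX \<tau> ^ 25) / (n 4 \<tau> * qX \<tau> ^ 9) ^ 3 = n 6 \<tau> ^ 2 * n 2 \<tau> / n 4 \<tau> ^ 3" for \<tau>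
    proof -
      have h: "qX \<tau> ^ 27 = qX \<tau> ^ 2 * qX \<tau> ^ 25" by (simp flip: power_add)
      have p9: "(qX \<tau> ^ 9) ^ 3 = qX \<tau> ^ 27" by (simp flip: power_mult)
      have "(n 6 \<tau> * qX \<tau>) ^ 2 * (n 2 \<tau> * qX \<tau> ^ 25) / (n 4 \<tau> * qX \<tau> ^ 9) ^ 3 =
          (n 6 \<tau> ^ 2 * n 2 \<tau> / n 4 \<tau> ^ 3) * (qX \<tau> ^ 2 * qX \<tau> ^ 25 / qX \<tau> ^ 27)"
        unfolding power_mult_distrib p9 by (simp only: divide_inverse inverse_mult_distrib mult_ac)
      also have "qX \<tau> ^ 2 * qX \<tau> ^ 25 / qX \<tau> ^ 27 = 1" unfolding h by (rule divide_self) simp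
      finally show ?thesis by simp
    qed
    ultimately have "eventually (\<lambda>\<tau>. n 6 \<tau> ^ 2 * n 2 \<tau> / n 4 \<tau> ^ 3 \<le> 2) at_ii_inf"
      using bounded_of_tendsto by fastforce
    with eventually_uhp_at_ii_inf have "eventually (\<lambda>\<tau>. norm (ups0 (act A \<tau>)) \<le> 2) at_ii_inf"
      by eventually_elim (simp add: eq)
    thus ?thesis by blast
  next
    assume eq: "\<forall>\<tau>\<in>uhp. norm (ups0 (act A \<tau>)) = n 2 \<tau> ^ 2 * n 4 \<tau> / n 6 \<tau> ^ 3"
    have "((\<lambda>\<tau>. (n 2 \<tau> * qX \<tau> ^ 25) ^ 2 * (n 4 \<tau> * qX \<tau> ^ 9) / (n 6 \<tau> * qX \<tau>) ^ 3) \<longlongrightarrow> 1 ^ 2 * 1 / 1 ^ 3) at_ii_inf"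
      by (intro tendsto_intros nk) auto
    moreover have "(n 2 \<tau> * qX \<tau> ^ 25) ^ 2 * (n 4 \<tau> * qX \<tau> ^ 9) / (n 6 \<tau> * qX \<tau>) ^ 3 = n 2 \<tau> ^ 2 * n 4 \<tau> / n 6 \<tau> ^ 3 * qX \<tau> ^ 56" for \<tau>
    proof -
      have h: "qX \<tau> ^ 50 * qX \<tau> ^ 9 = qX \<tau> ^ 56 * qX \<tau> ^ 3" by (simp flip: power_add)
      have p25: "(qX \<tau> ^ 25) ^ 2 = qX \<tau> ^ 50" by (simp flip: power_mult)
      have "(n 2 \<tau> * qX \<tau> ^ 25) ^ 2 * (n 4 \<tau> * qX \<tau> ^ 9) / (n 6 \<tau> * qX \<tau>) ^ 3 =
          n 2 \<tau> ^ 2 * n 4 \<tau> / n 6 \<tau> ^ 3 * (qX \<tau> ^ 50 * qX \<tau> ^ 9 / qX \<tau> ^ 3)"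
        unfolding power_mult_distrib p25 by (simp only: divide_inverse inverse_mult_distrib mult_ac)
      also have "qX \<tau> ^ 50 * qX \<tau> ^ 9 / qX \<tau> ^ 3 = qX \<tau> ^ 56"
        unfolding h by (rule nonzero_mult_div_cancel_right) simp
      finally show ?thesis .
    qed
    ultimately have "eventually (\<lambda>\<tau>. n 2 \<tau> ^ 2 * n 4 \<tau> / n 6 \<tau> ^ 3 * qX \<tau> ^ 56 \<le> 2) at_ii_inf"
      using bounded_of_tendsto by fastforce
    with eventually_uhp_at_ii_inf qX_power_ge_1[of 56] have "eventually (\<lambda>\<tau>. norm (ups0 (act A \<tau>)) \<le> 2) at_ii_inf"
    proof eventually_elim
      case (elim \<tau>)
      have "n 2 \<tau> ^ 2 * n 4 \<tau> / n 6 \<tau> ^ 3 * 1 \<le> n 2 \<tau> ^ 2 * n 4 \<tau> / n 6 \<tau> ^ 3 * qX \<tau> ^ 56"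
        using elim by (intro mult_left_mono) (auto simp: n_def)
      thus ?case using elim eq by simp
    qed
    thus ?thesis by blast
  qed
next
  case False
  obtain s e where B: "mk (7 * A$1$1) (A$1$2 - A$1$1 * s) (A$2$1) e \<in> SL2Z"
    "\<And>\<tau>. 7 * act A \<tau> = act (mk (7 * A$1$1) (A$1$2 - A$1$1 * s) (A$2$1) e) ((\<tau> + of_int s) / 7)"
    using seven_act_ndvd[OF A(1) False] by blast
  define \<beta> where "\<beta> = A$1$2 - A$1$1 * s"
  define T where "T = (\<lambda>\<tau>. (of_nat 1 * \<tau> + of_int s) / of_nat 7 :: complex)"
  \<comment> \<open>Otherwise 7 would divide the determinant. This keeps the sine in the denominator
    from vanishing.\<close>
  have \<beta>: "\<not> 7 dvd \<beta>"
  proof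
    assume "7 dvd \<beta>"
    hence "7 dvd 7 * A$1$1 * e - \<beta> * A$2$1" by (intro dvd_diff dvd_mult2) auto
    thus False using B(1) by (simp add: \<beta>_def)
  qed
  define n where "n = (\<lambda>k::int. \<lambda>\<tau>. norm (kf 0 (of_int (k * \<beta>) / 7) (T \<tau>)))"
  have eq: "norm (ups0 (act A \<tau>)) = n 2 \<tau> ^ 2 * n 3 \<tau> / n 1 \<tau> ^ 3" if \<tau>: "\<tau> \<in> uhp" for \<tau>
  proof -
    have "Im ((\<tau> + of_int s) / 7) > 0" using \<tau> by (simp add: uhp_iff)
    from kf_transform[OF B(1) this] obtain \<kappa> where \<kappa>: "\<kappa> \<noteq> 0" and
      tr: "\<And>r s'. kf r s' (7 * act A \<tau>) = \<kappa> * kf (r * of_int (7 * A$1$1) + s' * of_int (A$2$1)) (r * of_int \<beta> + s' * of_int e) ((\<tau> + of_int s) / 7)"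
      unfolding B(2)[symmetric] by (auto simp: \<beta>_def)
    have "norm (kk (2 * k) 0 (act A \<tau>)) = norm \<kappa> * n k \<tau>" for k
    proof -
      \<comment> \<open>The first characteristic is the integer \<open>k * A$1$1\<close>; it is
        shifted to 0, where the leading coefficient is a sine.\<close>
      have "kk (2 * k) 0 (act A \<tau>) = \<kappa> * kf (0 + of_int (k * A$1$1)) (of_int (k * \<beta>) / 7 + of_int 0) (T \<tau>)"
        unfolding kk_def tr T_def by simp
      thus ?thesis by (simp only: norm_mult norm_kf_shift n_def)
    qed
    from this[of 1] this[of 2] this[of 3] show ?thesis
      using \<kappa> by (simp add: ups0_def norm_mult norm_divide norm_power field_simps power2_eq_square power3_eq_cube)
  qed
  define Y where "Y = (\<lambda>\<tau>. exp (pi * (1/2)\<^sup>2 * Im (T \<tau>)))"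
  have lim: "((\<lambda>\<tau>. n k \<tau> * Y \<tau>) \<longlongrightarrow> 2 * \<bar>sin (pi * (of_int (k * \<beta>) / 7))\<bar>) at_ii_inf" for k
  proof -
    have "filterlim T at_ii_inf at_ii_inf" unfolding T_def by (rule filterlim_affine_ii_inf) auto
    from filterlim_compose[OF kf_leading_term[of 1 0 "of_int (k * \<beta>) / 7"] this] show ?thesis
      by (simp add: n_def Y_def)
  qed
  have s1: "sin (pi * (of_int (1 * \<beta>) / 7)) \<noteq> 0"
  proof
    assume "sin (pi * (of_int (1 * \<beta>) / 7)) = 0"
    then obtain i :: int where "pi * (of_int (1 * \<beta>) / 7) = of_int i * pi" by (auto simp: sin_zero_iff_int2)
    hence "real_of_int \<beta> = of_int (7 * i)" by simp
    hence "\<beta> = 7 * i" by (simp only: of_int_eq_iff)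
    thus False using \<beta> by simp
  qed
  define L where "L = (\<lambda>k::int. 2 * \<bar>sin (pi * (real_of_int (k * \<beta>) / 7))\<bar>)"
  have "((\<lambda>\<tau>. (n 2 \<tau> * Y \<tau>) ^ 2 * (n 3 \<tau> * Y \<tau>) / (n 1 \<tau> * Y \<tau>) ^ 3) \<longlongrightarrow> L 2 ^ 2 * L 3 / L 1 ^ 3) at_ii_inf"
    unfolding L_def by (intro tendsto_intros lim) (use s1 in auto)
  moreover have "(n 2 \<tau> * Y \<tau>) ^ 2 * (n 3 \<tau> * Y \<tau>) / (n 1 \<tau> * Y \<tau>) ^ 3 = n 2 \<tau> ^ 2 * n 3 \<tau> / n 1 \<tau> ^ 3" for \<tau>
  proof -
    have "Y \<tau> \<noteq> 0" by (simp add: Y_def)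
    thus ?thesis by (simp add: power2_eq_square power3_eq_cube)
  qed
  ultimately have "eventually (\<lambda>\<tau>. n 2 \<tau> ^ 2 * n 3 \<tau> / n 1 \<tau> ^ 3 \<le> L 2 ^ 2 * L 3 / L 1 ^ 3 + 1) at_ii_inf"
    using bounded_of_tendsto by fastforce
  with eventually_uhp_at_ii_inf have "eventually (\<lambda>\<tau>. norm (ups0 (act A \<tau>)) \<le> L 2 ^ 2 * L 3 / L 1 ^ 3 + 1) at_ii_inf"
    by eventually_elim (simp add: eq)
  thus ?thesis by blast
qed

section \<open>Limits and invariance of the third coordinate\<close>

text \<open>The powers balance, 25 + 25 = 1 + 49, and the 2 in the limit is the leading coefficient
  2 |sin (pi / 2)| of \<open>kk 0 7\<close>.\<close>

lemma norm_tee_limit: "((\<lambda>\<tau>. norm (tee \<tau>)) \<longlongrightarrow> 1/2) at_ii_inf"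
proof -
  have "((\<lambda>\<tau>. (norm (kk 2 0 \<tau>) * qX \<tau> ^ 25) * (norm (kk 2 7 \<tau>) * qX \<tau> ^ 25) /
        ((norm (kk 6 0 \<tau>) * qX \<tau>) * (norm (kk 0 7 \<tau>) * qX \<tau> ^ 49))) \<longlongrightarrow> 1 * 1 / (1 * 2)) at_ii_inf"
    using kk_asymp[of 2 7] kk_asymp[of 0 7] by (intro tendsto_intros kk_asymps) simp_all
  moreover have "(norm (kk 2 0 \<tau>) * qX \<tau> ^ 25) * (norm (kk 2 7 \<tau>) * qX \<tau> ^ 25) /
        ((norm (kk 6 0 \<tau>) * qX \<tau>) * (norm (kk 0 7 \<tau>) * qX \<tau> ^ 49)) = norm (tee \<tau>)" for \<tau>
  proof -
    have "qX \<tau> ^ 25 * qX \<tau> ^ 25 = qX \<tau> * qX \<tau> ^ 49" by (simp flip: power_add power_Suc)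
    moreover have "norm (exp (- (pi * \<i> / 14))) = 1" by (simp add: norm_exp_eq_Re)
    ultimately show ?thesis by (simp add: tee_def norm_mult norm_divide field_simps)
  qed
  ultimately show ?thesis by simp
qed

text \<open>Divided by u^2, the cubic tends to t^2 (2 t - 1) = 0, and the limiting modulus 1/2
  excludes the double root 0. The functions u and t are arbitrary so that the lemma also applies to
  a constant multiple of \<open>tee\<close>.\<close>

lemma root_limit:
  fixes u t :: "complex \<Rightarrow> complex"
  assumes u: "filterlim u at_infinity F" and t: "((\<lambda>x. norm (t x)) \<longlongrightarrow> 1/2) F"
    and eq: "eventually (\<lambda>x. 2 * u x * (u x - 1) * t x ^ 3 - ((u x)\<^sup>2 - u x - 1) * (t x)\<^sup>2 - 2 * u x * t x + u x = 0) F"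
  shows "(t \<longlongrightarrow> 1/2) F"
proof -
  define v where "v = (\<lambda>x. norm (inverse (u x)))"
  have "((\<lambda>x. inverse (u x)) \<longlongrightarrow> 0) F" by (rule filterlim_compose[OF tendsto_inverse_0 u])
  hence v: "(v \<longlongrightarrow> 0) F" unfolding v_def by (rule tendsto_norm_zero)
  have "((\<lambda>x. 2 * t x - 1) \<longlongrightarrow> 0) F"
  proof (rule Lim_null_comparison)
    \<comment> \<open>The 6 bounds the modulus of (2 z - 1)(z^2 + 1) for |z| < 1, and 16 is the
      inverse square of the lower bound 1/4 for |z|.\<close>
    have "((\<lambda>x. 16 * (6 * v x + v x ^ 2)) \<longlongrightarrow> 16 * (6 * 0 + 0 ^ 2)) F" by (intro tendsto_intros v)
    thus "((\<lambda>x. 16 * (6 * v x + v x ^ 2)) \<longlongrightarrow> 0) F" by simp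
    have "eventually (\<lambda>x. u x \<noteq> 0) F"
      using filterlim_at_infinity_imp_eventually_ne[OF u] .
    moreover have "eventually (\<lambda>x. norm (t x) < 1) F" using order_tendstoD(2)[OF t, of 1] by simp
    moreover have "eventually (\<lambda>x. norm (t x) > 1/4) F" using order_tendstoD(1)[OF t, of "1/4"] by simp
    ultimately show "eventually (\<lambda>x. norm (2 * t x - 1) \<le> 16 * (6 * v x + v x ^ 2)) F"
      using eq
    proof eventually_elim
      case (elim x)
      define z w where "z = t x" and "w = inverse (u x)"
      have w: "u x * w = 1" using elim by (simp add: w_def)
      have F0: "2 * u x * (u x - 1) * z ^ 3 - ((u x)\<^sup>2 - u x - 1) * z\<^sup>2 - 2 * u x * z + u x = 0"
        using elim by (simp add: z_def)
      have "w\<^sup>2 * (2 * u x * (u x - 1) * z ^ 3 - ((u x)\<^sup>2 - u x - 1) * z\<^sup>2 - 2 * u x * z + u x) =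
          (u x * w)\<^sup>2 * (2 * z ^ 3 - z\<^sup>2) - (u x * w) * w * (2 * z ^ 3 - z\<^sup>2 + 2 * z - 1) + w\<^sup>2 * z\<^sup>2"
        by (simp add: algebra_simps power2_eq_square)
      hence "2 * z ^ 3 - z\<^sup>2 - w * (2 * z ^ 3 - z\<^sup>2 + 2 * z - 1) + w\<^sup>2 * z\<^sup>2 = 0"
        unfolding w F0 by simp
      hence "z\<^sup>2 * (2 * z - 1) = w * ((2 * z - 1) * (z\<^sup>2 + 1)) - w\<^sup>2 * z\<^sup>2"
        by (simp add: algebra_simps power2_eq_square power3_eq_cube)
      hence "norm (z\<^sup>2 * (2 * z - 1)) \<le> norm (w * ((2 * z - 1) * (z\<^sup>2 + 1))) + norm (w\<^sup>2 * z\<^sup>2)"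
        by (metis norm_triangle_ineq4)
      also have "\<dots> \<le> norm w * 6 + norm w ^ 2 * 1"
      proof (intro add_mono)
        have n2: "norm (z\<^sup>2) \<le> 1" using elim by (simp add: norm_power power_le_one z_def)
        have "norm (2 * z - 1) \<le> 3" using norm_triangle_ineq4[of "2 * z" 1] elim by (simp add: norm_mult z_def)
        moreover have "norm (z\<^sup>2 + 1) \<le> 2" using norm_triangle_ineq[of "z\<^sup>2" 1] n2 by simp
        ultimately have "norm (2 * z - 1) * norm (z\<^sup>2 + 1) \<le> 3 * 2" by (intro mult_mono) auto
        thus "norm (w * ((2 * z - 1) * (z\<^sup>2 + 1))) \<le> norm w * 6"
          unfolding norm_mult by (intro mult_left_mono) auto
        show "norm (w\<^sup>2 * z\<^sup>2) \<le> norm w ^ 2 * 1"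
          unfolding norm_mult using n2 by (intro mult_mono) (auto simp: norm_power)
      qed
      finally have *: "norm z ^ 2 * norm (2 * z - 1) \<le> 6 * v x + v x ^ 2"
        by (simp add: norm_mult norm_power v_def w_def)
      have "(1/4)\<^sup>2 \<le> (norm z)\<^sup>2" using elim by (intro power_mono) (auto simp: z_def)
      hence "(1/4)\<^sup>2 * norm (2 * z - 1) \<le> norm z ^ 2 * norm (2 * z - 1)" by (intro mult_right_mono) auto
      with * show ?case by (simp add: power2_eq_square z_def)
    qed
  qed
  hence "((\<lambda>x. ((2 * t x - 1) + 1) / 2) \<longlongrightarrow> (0 + 1) / 2) F" by (intro tendsto_intros) auto
  thus ?thesis by simp
qed

lemma tee_limit: "(tee \<longlongrightarrow> 1/2) at_ii_inf"
  by (rule root_limit[OF ups0_at_infinity norm_tee_limit])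
     (rule eventually_mono[OF eventually_uhp_at_ii_inf], rule tee_cubic)

text \<open>\<open>root_limit\<close> applies to \<open>\<epsilon> * tee\<close> as well as to
  \<open>tee\<close>; the common limit 1/2 forces \<epsilon> = 1.\<close>

lemma tee_Gamma_2_7:
  assumes A: "A \<in> Gamma_2_7" and \<tau>: "\<tau> \<in> uhp"
  shows "tee (act A \<tau>) = tee \<tau>"
proof -
  have "A \<in> principal_Gamma 7" using A by (simp add: Gamma_2_7_def)
  then obtain a' b' c' d' where A': "A \<in> SL2Z" "A$1$1 = 1 + 7 * a'" "A$1$2 = 7 * b'" "A$2$1 = 7 * c'" "A$2$2 = 1 + 7 * d'"
    by (rule Gamma7_E)
  have "even (A$2$1)" using A by (simp add: Gamma_2_7_def Gamma0_def cong_0_iff)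
  \<comment> \<open>For even c the first index of the half-period moves by \<open>7 * c'\<close>, a
    multiple of 14, so (0, 7) returns to itself up to periods.\<close>
  then obtain c'' where c'': "c' = 2 * c''" using A'(4) by auto
  have "odd (A$2$2)" using SL2Z_det[OF A'(1)] \<open>even (A$2$1)\<close> by (metis dvd_diff dvd_mult odd_one)
  then obtain d'' where d'': "A$2$2 = 1 + 2 * d''" by (auto elim: oddE)
  define \<epsilon>a where "\<epsilon>a = (\<lambda>k::int. (-1 :: complex) powi (k * a' + k * A$1$2 + (k * a') * (k * A$1$2)) * exp (pi * \<i> * of_int (2 * k * (k * A$1$2) - (k * a') * 0) / 14))"
  define mm nn where "mm = (\<lambda>k. k * a' + c'')" and "nn = (\<lambda>k. k * A$1$2 + d'')"
  define \<epsilon>b where "\<epsilon>b = (\<lambda>k::int. (-1 :: complex) powi (mm k + nn k + mm k * nn k) * exp (pi * \<i> * of_int (2 * k * nn k - mm k * 7) / 14))"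
  have ne: "norm (exp (pi * \<i> * of_int m / 14)) = 1" for m by (simp add: norm_exp_eq_Re)
  have n\<epsilon>: "norm (\<epsilon>a k) = 1" "norm (\<epsilon>b k) = 1" for k
    unfolding \<epsilon>a_def \<epsilon>b_def norm_mult ne by simp_all
  define \<epsilon> where "\<epsilon> = (\<epsilon>a 1 / \<epsilon>a 3) * (\<epsilon>b 1 / \<epsilon>b 0)"
  have eps: "tee (act A \<tau>) = \<epsilon> * tee \<tau>" if \<tau>: "\<tau> \<in> uhp" for \<tau>
  proof -
    obtain \<kappa> where \<kappa>: "\<kappa> \<noteq> 0" and
      tr: "\<And>i i'. kk i i' (act A \<tau>) = \<kappa> * kk (i * A$1$1 + i' * c') (7 * i * A$1$2 + i' * A$2$2) \<tau>"
      using kk_transform_dvd[OF A'(1,4) \<tau>] by blast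
    have ta: "kk (2 * k) 0 (act A \<tau>) = \<kappa> * (\<epsilon>a k * kk (2 * k) 0 \<tau>)" for k
    proof -
      have "kk (2 * k) 0 (act A \<tau>) = \<kappa> * kk (2 * k + 14 * (k * a')) (0 + 14 * (k * A$1$2)) \<tau>"
        unfolding tr by (simp add: A'(2) algebra_simps)
      thus ?thesis unfolding kk_shift \<epsilon>a_def .
    qed
    have tb: "kk (2 * k) 7 (act A \<tau>) = \<kappa> * (\<epsilon>b k * kk (2 * k) 7 \<tau>)" for k
    proof -
      have "kk (2 * k) 7 (act A \<tau>) = \<kappa> * kk (2 * k + 14 * mm k) (7 + 14 * nn k) \<tau>"
        unfolding tr mm_def nn_def d'' c'' by (simp add: A'(2) algebra_simps)
      thus ?thesis unfolding kk_shift \<epsilon>b_def .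
    qed
    have "\<epsilon>a k \<noteq> 0" "\<epsilon>b k \<noteq> 0" for k using n\<epsilon>[of k] by auto
    thus ?thesis
      using ta[of 1] ta[of 3] tb[of 1] tb[of 0] \<kappa> by (simp add: tee_def \<epsilon>_def mult_ac)
  qed
  have "((\<lambda>\<tau>. \<epsilon> * tee \<tau>) \<longlongrightarrow> 1/2) at_ii_inf"
  proof (rule root_limit[OF ups0_at_infinity])
    show "((\<lambda>\<tau>. norm (\<epsilon> * tee \<tau>)) \<longlongrightarrow> 1/2) at_ii_inf"
      using norm_tee_limit by (simp add: norm_mult \<epsilon>_def norm_divide n\<epsilon>)
    have "eventually (\<lambda>\<tau>. \<tau> \<in> uhp) at_ii_inf" by (rule eventually_uhp_at_ii_inf)
    thus "eventually (\<lambda>x. 2 * ups0 x * (ups0 x - 1) * (\<epsilon> * tee x) ^ 3 - ((ups0 x)\<^sup>2 - ups0 x - 1) * (\<epsilon> * tee x)\<^sup>2 - 2 * ups0 x * (\<epsilon> * tee x) + ups0 x = 0) at_ii_inf"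
    proof eventually_elim
      case (elim \<tau>)
      have "A \<in> Gamma1_7" using A Gamma_inclusions by blast
      hence "ups0 (act A \<tau>) = ups0 \<tau>" using elim by (rule ups0_Gamma1_7)
      thus ?case using tee_cubic[OF act_in_uhp[OF A'(1) elim]] eps[OF elim] by simp
    qed
  qed
  moreover have "((\<lambda>\<tau>. \<epsilon> * tee \<tau>) \<longlongrightarrow> \<epsilon> * (1/2)) at_ii_inf" by (intro tendsto_intros tee_limit)
  ultimately have "\<epsilon> * (1/2) = 1/2" by (rule tendsto_unique[OF at_ii_inf_neq_bot, rotated])
  thus ?thesis using eps[OF \<tau>] by simp
qed

lemma tee_hol_modular: "hol_modular Gamma_2_7 tee"
  unfolding hol_modular_def using tee_holomorphic tee_Gamma_2_7 functions_mero_inf by blast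

text \<open>An odd lower left entry moves the first index of the half-period by 7 modulo 14. The
  indices 2 and 0 become -5 and -7, of orders 4 and 0, and 25 + 4 - 1 - 0 = 28 gives a zero.\<close>

lemma tee_odd_limit:
  assumes A: "A \<in> principal_Gamma 7" and odd: "odd (A$2$1)"
  shows "((\<lambda>\<tau>. tee (act A \<tau>)) \<longlongrightarrow> 0) at_ii_inf"
proof -
  obtain a' b' c' d' where A': "A \<in> SL2Z" "A$1$1 = 1 + 7 * a'" "A$1$2 = 7 * b'" "A$2$1 = 7 * c'" "A$2$2 = 1 + 7 * d'"
    by (rule Gamma7_E[OF A])
  obtain c'' where c'': "c' = 2 * c'' + 1" using odd A'(4) by (auto elim!: oddE)
  define s where "s = (\<lambda>k. 7 * (2 * k) * A$1$2 + 7 * A$2$2)"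
  have eq: "norm (tee (act A \<tau>)) = norm (kk 2 0 \<tau>) * norm (kk (-5) (s 1) \<tau>) / (norm (kk 6 0 \<tau>) * norm (kk (-7) (s 0) \<tau>))"
    if \<tau>: "\<tau> \<in> uhp" for \<tau>
  proof -
    obtain \<kappa> where \<kappa>: "\<kappa> \<noteq> 0" and
      tr: "\<And>i i'. kk i i' (act A \<tau>) = \<kappa> * kk (i * A$1$1 + i' * c') (7 * i * A$1$2 + i' * A$2$2) \<tau>"
      using kk_transform_dvd[OF A'(1,4) \<tau>] by blast
    have ta: "norm (kk (2 * k) 0 (act A \<tau>)) = norm \<kappa> * norm (kk (2 * k) 0 \<tau>)" for k
    proof -
      have "kk (2 * k) 0 (act A \<tau>) = \<kappa> * kk (2 * k + 14 * (k * a')) (0 + 14 * (k * A$1$2)) \<tau>"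
        unfolding tr by (simp add: A'(2) algebra_simps)
      thus ?thesis by (simp only: norm_mult norm_kk_shift)
    qed
    have tb: "norm (kk (2 * k) 7 (act A \<tau>)) = norm \<kappa> * norm (kk (2 * k - 7) (s k) \<tau>)" for k
    proof -
      have "kk (2 * k) 7 (act A \<tau>) = \<kappa> * kk ((2 * k - 7) + 14 * (k * a' + c'' + 1)) (s k + 14 * 0) \<tau>"
        unfolding tr s_def by (simp add: A'(2) c'' algebra_simps)
      thus ?thesis by (simp only: norm_mult norm_kk_shift)
    qed
    have "norm (exp (- (pi * \<i> / 14))) = 1" by (simp add: norm_exp_eq_Re)
    thus ?thesis
      using ta[of 1] ta[of 3] tb[of 1] tb[of 0] \<kappa> by (simp add: tee_def norm_mult norm_divide)
  qed
  have inv: "((\<lambda>\<tau>. inverse (qX \<tau> ^ 28)) \<longlongrightarrow> 0) at_ii_inf"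
    by (intro tendsto_inverse_0_at_top filterlim_pow_at_top qX_at_top) simp
  have "((\<lambda>\<tau>. (norm (kk 2 0 \<tau>) * qX \<tau> ^ 25) * (norm (kk (-5) (s 1) \<tau>) * qX \<tau> ^ 4) /
        ((norm (kk 6 0 \<tau>) * qX \<tau>) * norm (kk (-7) (s 0) \<tau>)) * inverse (qX \<tau> ^ 28)) \<longlongrightarrow> 1 * 1 / (1 * 1) * 0) at_ii_inf"
    using kk_asymp[of "-5" "s 1"] kk_asymp[of "-7" "s 0"]
    by (intro tendsto_mult tendsto_divide kk_asymps inv) simp_all
  moreover have "(norm (kk 2 0 \<tau>) * qX \<tau> ^ 25) * (norm (kk (-5) (s 1) \<tau>) * qX \<tau> ^ 4) /
        ((norm (kk 6 0 \<tau>) * qX \<tau>) * norm (kk (-7) (s 0) \<tau>)) * inverse (qX \<tau> ^ 28) =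
        norm (kk 2 0 \<tau>) * norm (kk (-5) (s 1) \<tau>) / (norm (kk 6 0 \<tau>) * norm (kk (-7) (s 0) \<tau>))" for \<tau>
  proof -
    have h: "qX \<tau> ^ 25 * qX \<tau> ^ 4 = qX \<tau> * qX \<tau> ^ 28"
      by (simp only: power_add[symmetric] power_Suc[symmetric]) simp
    have "(norm (kk 2 0 \<tau>) * qX \<tau> ^ 25) * (norm (kk (-5) (s 1) \<tau>) * qX \<tau> ^ 4) /
        ((norm (kk 6 0 \<tau>) * qX \<tau>) * norm (kk (-7) (s 0) \<tau>)) * inverse (qX \<tau> ^ 28) =
        norm (kk 2 0 \<tau>) * norm (kk (-5) (s 1) \<tau>) / (norm (kk 6 0 \<tau>) * norm (kk (-7) (s 0) \<tau>)) *
        ((qX \<tau> ^ 25 * qX \<tau> ^ 4) / (qX \<tau> * qX \<tau> ^ 28))"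
      by (simp add: divide_inverse mult_ac)
    also have "(qX \<tau> ^ 25 * qX \<tau> ^ 4) / (qX \<tau> * qX \<tau> ^ 28) = 1"
      unfolding h by (rule divide_self) simp
    finally show ?thesis by simp
  qed
  ultimately have "((\<lambda>\<tau>. norm (kk 2 0 \<tau>) * norm (kk (-5) (s 1) \<tau>) / (norm (kk 6 0 \<tau>) * norm (kk (-7) (s 0) \<tau>))) \<longlongrightarrow> 0) at_ii_inf"
    by simp
  moreover have "eventually (\<lambda>\<tau>. norm (kk 2 0 \<tau>) * norm (kk (-5) (s 1) \<tau>) / (norm (kk 6 0 \<tau>) * norm (kk (-7) (s 0) \<tau>)) = norm (tee (act A \<tau>))) at_ii_inf"
    using eventually_uhp_at_ii_inf by eventually_elim (use eq in simp)
  ultimately have "((\<lambda>\<tau>. norm (tee (act A \<tau>))) \<longlongrightarrow> 0) at_ii_inf" by (rule Lim_transform_eventually)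
  thus ?thesis by (simp add: tendsto_norm_zero_iff)
qed

subsection \<open>Modular functions for the three groups\<close>

lemma analytic_norm_bound_at_0:
  assumes "u analytic_on {0}" "h > 0"
  shows "eventually (\<lambda>\<tau>. norm (u (qpar h \<tau>)) \<le> norm (u 0) + 1) at_ii_inf"
proof -
  have "(u \<longlongrightarrow> u 0) (at 0)" using analytic_at_imp_isCont[OF assms(1)] by (simp add: isCont_def)
  hence "((\<lambda>\<tau>. norm (u (qpar h \<tau>))) \<longlongrightarrow> norm (u 0)) at_ii_inf"
    by (intro tendsto_norm) (rule filterlim_compose[OF _ filterlim_qpar_0[OF assms(2)]])
  thus ?thesis by (rule bounded_of_tendsto)
qed

lemma norm_qpar_powi: "norm (qpar h \<tau> powi k) = exp (- (2 * pi * of_int k / h) * Im \<tau>)"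
proof -
  have "norm (qpar h \<tau> powi k) = exp (- 2 * pi * Im \<tau> / h) powi k" by (simp add: norm_power_int norm_qpar)
  also have "\<dots> = exp (of_int k * (- 2 * pi * Im \<tau> / h))" by (rule exp_power_int)
  finally show ?thesis by (simp add: mult_ac)
qed

lemma mero_inf_growth:
  assumes "meromorphic_at_i_infinity f"
  shows "\<exists>c C. C \<ge> 0 \<and> eventually (\<lambda>\<tau>. norm (f \<tau>) \<le> C * exp (c * Im \<tau>)) at_ii_inf"
proof (cases "eventually (\<lambda>\<tau>. f \<tau> = 0) at_ii_inf")
  case True
  hence "eventually (\<lambda>\<tau>. norm (f \<tau>) \<le> 0 * exp (0 * Im \<tau>)) at_ii_inf" by eventually_elim simp
  thus ?thesis by (metis order_refl)
next
  case False
  then obtain h k u where h: "h > 0" and u: "u analytic_on {0}"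
    and ev: "eventually (\<lambda>\<tau>. f \<tau> = qpar h \<tau> powi k * u (qpar h \<tau>)) at_ii_inf"
    using mero_inf_normal_form[OF assms(1)] by blast
  have "eventually (\<lambda>\<tau>. norm (f \<tau>) \<le> (norm (u 0) + 1) * exp (- (2 * pi * of_int k / h) * Im \<tau>)) at_ii_inf"
    using ev analytic_norm_bound_at_0[OF u h]
  proof eventually_elim
    case (elim \<tau>)
    have "norm (f \<tau>) = norm (u (qpar h \<tau>)) * exp (- (2 * pi * of_int k / h) * Im \<tau>)"
      unfolding elim(1) norm_mult norm_qpar_powi by (rule mult.commute)
    also have "\<dots> \<le> (norm (u 0) + 1) * exp (- (2 * pi * of_int k / h) * Im \<tau>)"
      using elim(2) by (intro mult_right_mono) auto
    finally show ?case .
  qed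
  moreover have "norm (u 0) + 1 \<ge> 0" by (simp add: add_nonneg_nonneg)
  ultimately show ?thesis by blast
qed

text \<open>On the upper half-plane \<open>qpar\<close> has modulus below 1, so a nonpositive power
  of it has modulus at least 1 and the function could not tend to 0.\<close>

lemma null_normal_form:
  assumes f: "meromorphic_at_i_infinity f" "(f \<longlongrightarrow> 0) at_ii_inf" and nz: "\<not> eventually (\<lambda>\<tau>. f \<tau> = 0) at_ii_inf"
  obtains h k u where "h > 0" "k > 0" "u analytic_on {0}" "u 0 \<noteq> 0"
    "eventually (\<lambda>\<tau>. f \<tau> = qpar h \<tau> powi k * u (qpar h \<tau>)) at_ii_inf"
proof -
  obtain h k u where h: "h > 0" and u: "u analytic_on {0}" "u 0 \<noteq> 0"
    and ev: "eventually (\<lambda>\<tau>. f \<tau> = qpar h \<tau> powi k * u (qpar h \<tau>)) at_ii_inf"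
    using mero_inf_normal_form[OF f(1)] nz by blast
  have "k > 0"
  proof (rule ccontr)
    assume "\<not> k > 0"
    have "(u \<longlongrightarrow> u 0) (at 0)" using analytic_at_imp_isCont[OF u(1)] by (simp add: isCont_def)
    hence "((\<lambda>\<tau>. norm (u (qpar h \<tau>))) \<longlongrightarrow> norm (u 0)) at_ii_inf"
      by (intro tendsto_norm) (rule filterlim_compose[OF _ filterlim_qpar_0[OF h]])
    hence e1: "eventually (\<lambda>\<tau>. norm (u (qpar h \<tau>)) > norm (u 0) / 2) at_ii_inf"
      by (rule order_tendstoD) (use u in auto)
    have e2: "eventually (\<lambda>\<tau>. norm (f \<tau>) < norm (u 0) / 2) at_ii_inf"
      using order_tendstoD(2)[OF tendsto_norm[OF f(2)], of "norm (u 0) / 2"] u by simp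
    have "eventually (\<lambda>\<tau>. False) at_ii_inf"
      using ev e1 e2 eventually_uhp_at_ii_inf
    proof eventually_elim
      case (elim \<tau>)
      have "- (2 * pi * of_int k / h) * Im \<tau> \<ge> 0"
      proof (rule mult_nonneg_nonneg)
        have "real_of_int k \<le> 0" using \<open>\<not> k > 0\<close> by simp
        thus "- (2 * pi * of_int k / h) \<ge> 0" by (simp add: divide_nonpos_nonneg mult_nonneg_nonpos)
      qed (use elim(4) in \<open>simp add: uhp_iff\<close>)
      hence "1 \<le> norm (qpar h \<tau> powi k)" unfolding norm_qpar_powi by simp
      hence "1 * norm (u (qpar h \<tau>)) \<le> norm (f \<tau>)" unfolding elim(1) norm_mult by (intro mult_right_mono) auto
      thus False using elim by linarith
    qed
    thus False by simp
  qed
  with h u ev show ?thesis using that by blast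
qed

lemma mero_inf_decay:
  assumes f: "meromorphic_at_i_infinity f" "(f \<longlongrightarrow> 0) at_ii_inf"
  shows "\<exists>c C. c > 0 \<and> C \<ge> 0 \<and> eventually (\<lambda>\<tau>. norm (f \<tau>) \<le> C * exp (- c * Im \<tau>)) at_ii_inf"
proof (cases "eventually (\<lambda>\<tau>. f \<tau> = 0) at_ii_inf")
  case True
  hence "eventually (\<lambda>\<tau>. norm (f \<tau>) \<le> 0 * exp (- 1 * Im \<tau>)) at_ii_inf" by eventually_elim simp
  thus ?thesis by (metis order_refl zero_less_one)
next
  case False
  obtain h k u where h: "h > 0" "k > 0" and u: "u analytic_on {0}" "u 0 \<noteq> 0"
    and ev: "eventually (\<lambda>\<tau>. f \<tau> = qpar h \<tau> powi k * u (qpar h \<tau>)) at_ii_inf"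
    by (rule null_normal_form[OF f False])
  have "eventually (\<lambda>\<tau>. norm (f \<tau>) \<le> (norm (u 0) + 1) * exp (- (2 * pi * of_int k / h) * Im \<tau>)) at_ii_inf"
    using ev analytic_norm_bound_at_0[OF u(1) h(1)]
  proof eventually_elim
    case (elim \<tau>)
    have "norm (f \<tau>) = norm (u (qpar h \<tau>)) * exp (- (2 * pi * of_int k / h) * Im \<tau>)"
      unfolding elim(1) norm_mult norm_qpar_powi by (rule mult.commute)
    also have "\<dots> \<le> (norm (u 0) + 1) * exp (- (2 * pi * of_int k / h) * Im \<tau>)"
      using elim(2) by (intro mult_right_mono) auto
    finally show ?case .
  qed
  moreover have "2 * pi * of_int k / h > 0" using h by simp
  moreover have "norm (u 0) + 1 \<ge> 0" by (simp add: add_nonneg_nonneg)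
  ultimately show ?thesis by blast
qed

text \<open>In Im \<tau>, f grows at most and g decays at least exponentially; with rates c and d,
  any n \<ge> c / d will do.\<close>

lemma zero_kills_pole:
  assumes f: "meromorphic_at_i_infinity f" and g: "meromorphic_at_i_infinity g" "(g \<longlongrightarrow> 0) at_ii_inf"
  shows "\<exists>n B. eventually (\<lambda>\<tau>. norm (g \<tau> ^ n * f \<tau>) \<le> B) at_ii_inf"
proof -
  obtain c C where C: "C \<ge> 0" and fC: "eventually (\<lambda>\<tau>. norm (f \<tau>) \<le> C * exp (c * Im \<tau>)) at_ii_inf"
    using mero_inf_growth[OF f] by blast
  obtain d D where d: "d > 0" and D: "D \<ge> 0" and gD: "eventually (\<lambda>\<tau>. norm (g \<tau>) \<le> D * exp (- d * Im \<tau>)) at_ii_inf"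
    using mero_inf_decay[OF g] by blast
  obtain n :: nat where n: "c / d \<le> n" using real_arch_simple by blast
  have "eventually (\<lambda>\<tau>. norm (g \<tau> ^ n * f \<tau>) \<le> D ^ n * C) at_ii_inf"
    using fC gD eventually_uhp_at_ii_inf
  proof eventually_elim
    case (elim \<tau>)
    have "norm (g \<tau> ^ n * f \<tau>) \<le> (D * exp (- d * Im \<tau>)) ^ n * (C * exp (c * Im \<tau>))"
      unfolding norm_mult norm_power using elim C D by (intro mult_mono power_mono) auto
    also have "\<dots> = D ^ n * C * exp ((c - n * d) * Im \<tau>)"
      by (simp add: power_mult_distrib left_diff_distrib exp_diff mult_ac exp_minus field_simps flip: exp_of_nat_mult)
    also have "\<dots> \<le> D ^ n * C * 1"
      using n d elim(3) C D by (intro mult_left_mono) (auto simp: uhp_iff field_simps mult_nonpos_nonneg)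
    finally show ?case by simp
  qed
  thus ?thesis by blast
qed

text \<open>Translation by 1 forces the leading exponent of f - L in an expansion in powers of
  q^(1/h) to be integral. Beyond its limit the function is therefore O(q), a gain of a full power of
  q.\<close>

lemma periodic_bounded_expansion:
  assumes f: "meromorphic_at_i_infinity f" and bd: "eventually (\<lambda>\<tau>. norm (f \<tau>) \<le> B) at_ii_inf"
    and per: "\<And>\<tau>. \<tau> \<in> uhp \<Longrightarrow> f (\<tau> + 1) = f \<tau>"
  shows "\<exists>L C. (f \<longlongrightarrow> L) at_ii_inf \<and> C \<ge> 0 \<and> eventually (\<lambda>\<tau>. norm (f \<tau> - L) \<le> C * exp (- 2 * pi * Im \<tau>)) at_ii_inf"
proof -
  obtain h u where h: "h > 0" "u analytic_on {0}" and ev: "eventually (\<lambda>\<tau>. f \<tau> = u (qpar h \<tau>)) at_ii_inf"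
    by (rule mero_inf_bounded_analytic[OF f bd])
  define L where "L = u 0"
  have "(u \<longlongrightarrow> L) (at 0)" using analytic_at_imp_isCont[OF h(2)] by (simp add: isCont_def L_def)
  hence "((\<lambda>\<tau>. u (qpar h \<tau>)) \<longlongrightarrow> L) at_ii_inf" by (rule filterlim_compose[OF _ filterlim_qpar_0[OF h(1)]])
  hence lim: "(f \<longlongrightarrow> L) at_ii_inf" by (rule Lim_transform_eventually) (use ev in eventually_elim, simp)
  define g where "g = (\<lambda>\<tau>. f \<tau> - L)"
  have g: "meromorphic_at_i_infinity g"
    using mero_inf_add[OF f mero_inf_const[of "- L"]] by (simp add: g_def)
  have g0: "(g \<longlongrightarrow> 0) at_ii_inf" using lim by (simp add: g_def LIM_zero)
  show ?thesis
  proof (cases "eventually (\<lambda>\<tau>. g \<tau> = 0) at_ii_inf")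
    case True
    hence "eventually (\<lambda>\<tau>. norm (f \<tau> - L) \<le> 0 * exp (- 2 * pi * Im \<tau>)) at_ii_inf"
      by eventually_elim (simp add: g_def)
    thus ?thesis using lim by (metis order_refl)
  next
    case False
    obtain h k u where h: "h > 0" "k > 0" and u: "u analytic_on {0}" "u 0 \<noteq> 0"
      and ev: "eventually (\<lambda>\<tau>. g \<tau> = qpar h \<tau> powi k * u (qpar h \<tau>)) at_ii_inf"
      by (rule null_normal_form[OF g g0 False])
    define w where "w = qpar h 1"
    have w0: "w \<noteq> 0" by (simp add: w_def)
    have qs: "qpar h (\<tau> + 1) = w * qpar h \<tau>" for \<tau>
      by (simp add: qpar_def w_def ring_distribs add_divide_distrib exp_add)
    have shift: "filterlim (\<lambda>\<tau>. \<tau> + 1) at_ii_inf at_ii_inf"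
      using filterlim_affine_ii_inf[of 1 1 1] by simp
    have uq: "((\<lambda>\<tau>. u (qpar h \<tau>)) \<longlongrightarrow> u 0) at_ii_inf"
      using analytic_at_imp_isCont[OF u(1)] filterlim_compose[OF _ filterlim_qpar_0[OF h(1)], of u]
      by (simp add: isCont_def)
    have uq1: "((\<lambda>\<tau>. w powi k * u (qpar h (\<tau> + 1))) \<longlongrightarrow> w powi k * u 0) at_ii_inf"
      by (intro tendsto_intros filterlim_compose[OF uq shift])
    have ev1: "eventually (\<lambda>\<tau>. g (\<tau> + 1) = qpar h (\<tau> + 1) powi k * u (qpar h (\<tau> + 1))) at_ii_inf"
      using shift ev unfolding filterlim_iff by blast
    \<comment> \<open>Translation multiplies the local parameter by w; comparing leading
      coefficients gives w^k = 1, so h divides k.\<close>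
    have "eventually (\<lambda>\<tau>. w powi k * u (qpar h (\<tau> + 1)) = u (qpar h \<tau>)) at_ii_inf"
      using ev ev1 eventually_uhp_at_ii_inf
    proof eventually_elim
      case (elim \<tau>)
      have "g (\<tau> + 1) = g \<tau>" using per[OF elim(3)] by (simp add: g_def)
      hence "qpar h \<tau> powi k * (w powi k * u (qpar h (\<tau> + 1))) = qpar h \<tau> powi k * u (qpar h \<tau>)"
        using elim(1,2) unfolding qs power_int_mult_distrib by (simp add: mult_ac)
      thus ?case by simp
    qed
    hence "((\<lambda>\<tau>. u (qpar h \<tau>)) \<longlongrightarrow> w powi k * u 0) at_ii_inf" by (rule Lim_transform_eventually[OF uq1])
    with uq have "w powi k * u 0 = u 0" using tendsto_unique[OF at_ii_inf_neq_bot] by blast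
    hence "w powi k = 1" using u(2) by simp
    hence "exp (2 * pi * \<i> * of_int k / of_nat h) = 1"
      by (simp add: w_def qpar_def exp_power_int mult_ac)
    then obtain n :: int where "2 * pi * of_int k / h = of_int (2 * n) * pi"
      unfolding exp_eq_1 by auto
    hence "real_of_int k = of_int (n * int h)" using h(1) by (simp add: field_simps)
    hence kn: "k = n * int h" by (simp only: of_int_eq_iff)
    hence "n \<ge> 1" using h by (metis mult_le_0_iff not_le of_nat_0_le_iff order_less_le_trans zero_less_one int_one_le_iff_zero_less)
    hence kh: "real_of_int k / h \<ge> 1" using h(1) by (simp add: kn)
    have "eventually (\<lambda>\<tau>. norm (f \<tau> - L) \<le> (norm (u 0) + 1) * exp (- 2 * pi * Im \<tau>)) at_ii_inf"
      using ev analytic_norm_bound_at_0[OF u(1) h(1)] eventually_uhp_at_ii_inf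
    proof eventually_elim
      case (elim \<tau>)
      have "norm (f \<tau> - L) = norm (u (qpar h \<tau>)) * exp (- (2 * pi * of_int k / h) * Im \<tau>)"
        using elim(1) unfolding g_def by (simp add: norm_mult norm_qpar_powi)
      also have "\<dots> \<le> (norm (u 0) + 1) * exp (- 2 * pi * Im \<tau>)"
      proof (intro mult_mono)
        have "2 * pi * Im \<tau> * 1 \<le> 2 * pi * Im \<tau> * (of_int k / h)" using kh elim(3) by (intro mult_left_mono) (auto simp: uhp_iff)
        thus "exp (- (2 * pi * of_int k / h) * Im \<tau>) \<le> exp (- 2 * pi * Im \<tau>)" by (simp add: mult_ac)
      qed (use elim in auto)
      finally show ?case .
    qed
    moreover have "norm (u 0) + 1 \<ge> 0" by (simp add: add_nonneg_nonneg)
    ultimately show ?thesis using lim by blast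
  qed
qed

lemma qpar_1_periodic: "qpar 1 (\<tau> + 1) = qpar 1 \<tau>"
  by (simp add: qpar_def ring_distribs exp_add)

lemma mero_inf_qpar: "meromorphic_at_i_infinity (qpar 1)"
  by (rule mero_infI[of 1 "\<lambda>w. w"]) (auto intro!: meromorphic_intros)

lemma qX_56: "qX \<tau> ^ 56 = exp (2 * pi * Im \<tau>)"
  unfolding qX_def by (simp flip: exp_of_nat_mult)

lemma act_id: "act (mk 1 0 0 1) \<tau> = \<tau>"
  using act_translation[of 0 \<tau>] by simp

section \<open>Functions for the group \<open>Gamma1_7\<close>\<close>

text \<open>To subtract leading terms, the limit itself is wanted and not only its modulus.
  Periodicity supplies it, and \<open>ups0_growth\<close> gives it modulus 1.\<close>

lemma ups0_residue:
  obtains M where "M \<noteq> 0" "((\<lambda>\<tau>. ups0 \<tau> * qpar 1 \<tau>) \<longlongrightarrow> M) at_ii_inf"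
proof -
  define g where "g = (\<lambda>\<tau>. ups0 \<tau> * qpar 1 \<tau>)"
  have nq: "norm (qpar 1 \<tau>) = 1 / qX \<tau> ^ 56" for \<tau>
    unfolding norm_qpar qX_56 by (simp add: exp_minus field_simps)
  have lim: "((\<lambda>\<tau>. norm (g \<tau>)) \<longlongrightarrow> 1) at_ii_inf"
    using ups0_growth unfolding g_def norm_mult nq by simp
  have "meromorphic_at_i_infinity ups0"
    using functions_mero_inf(2)[of "mk 1 0 0 1"] by (simp add: act_id)
  hence "meromorphic_at_i_infinity g" unfolding g_def by (intro mero_inf_mult mero_inf_qpar)
  moreover have "g (\<tau> + 1) = g \<tau>" if "\<tau> \<in> uhp" for \<tau>
    unfolding g_def qpar_1_periodic ups0_translate[OF that] ..
  ultimately obtain M where M: "(g \<longlongrightarrow> M) at_ii_inf"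
    using periodic_bounded_expansion[OF _ bounded_of_tendsto[OF lim]] by blast
  have "norm M = 1" using tendsto_unique[OF at_ii_inf_neq_bot tendsto_norm[OF M] lim] .
  hence "M \<noteq> 0" by auto
  thus ?thesis using that M unfolding g_def by blast
qed

lemma Gamma1_7_mult:
  assumes "A \<in> Gamma1_7" "B \<in> Gamma1_7"
  shows "A ** B \<in> Gamma1_7"
proof -
  have "[A$1$1 * B$1$1 + A$1$2 * B$2$1 = 1 * 1 + A$1$2 * 0] (mod 7)"
       "[A$2$1 * B$1$1 + A$2$2 * B$2$1 = 0 * B$1$1 + A$2$2 * 0] (mod 7)"
    by (intro cong_add cong_mult cong_refl; use assms in \<open>simp add: Gamma1_7_def\<close>)+
  thus ?thesis using assms by (simp add: Gamma1_7_def mult_entries SL2Z_mult)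
qed

text \<open>Finitely many \<rho> represent all cusps. If neither \<rho> nor its negative lies in
  \<open>Gamma1_7\<close>, then \<upsilon> is bounded there and has a limit; otherwise the cusp is
  equivalent to \<infinity>.\<close>

lemma cusp_values:
  obtains C where "finite C" "\<And>A. A \<in> SL2Z \<Longrightarrow> (\<exists>v\<in>C. ((\<lambda>\<tau>. ups0 (act A \<tau>)) \<longlongrightarrow> v) at_ii_inf) \<or>
     (\<forall>\<tau>\<in>uhp. \<exists>\<gamma>\<in>Gamma1_7. act A \<tau> = act \<gamma> \<tau>)"
proof -
  obtain R where R: "finite R" "R \<subseteq> SL2Z"
    "\<And>A. A \<in> SL2Z \<Longrightarrow> \<exists>\<rho>\<in>R. \<exists>\<gamma>\<in>principal_Gamma 7. \<forall>\<tau>\<in>uhp. act A \<tau> = act \<gamma> (act \<rho> \<tau>)"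
    using coset_representatives[of 7] by auto
  \<comment> \<open>For representatives equivalent to \<infinity> there is no limit and the choice
    is an arbitrary number, which merely enlarges the finite set.\<close>
  define C where "C = (\<lambda>\<rho>. SOME v. ((\<lambda>\<tau>. ups0 (act \<rho> \<tau>)) \<longlongrightarrow> v) at_ii_inf) ` R"
  show ?thesis
  proof (rule that[of C])
    show "finite C" using R(1) by (simp add: C_def)
    fix A assume A: "A \<in> SL2Z"
    obtain \<rho> \<gamma> where \<rho>: "\<rho> \<in> R" "\<gamma> \<in> principal_Gamma 7" "\<And>\<tau>. \<tau> \<in> uhp \<Longrightarrow> act A \<tau> = act \<gamma> (act \<rho> \<tau>)"
      using R(3)[OF A] by blast
    have \<rho>': "\<rho> \<in> SL2Z" using \<rho>(1) R(2) by blast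
    have \<gamma>: "\<gamma> \<in> Gamma1_7" using \<rho>(2) Gamma_inclusions by blast
    show "(\<exists>v\<in>C. ((\<lambda>\<tau>. ups0 (act A \<tau>)) \<longlongrightarrow> v) at_ii_inf) \<or> (\<forall>\<tau>\<in>uhp. \<exists>\<gamma>\<in>Gamma1_7. act A \<tau> = act \<gamma> \<tau>)"
    proof (cases "\<rho> \<in> Gamma1_7 \<or> - \<rho> \<in> Gamma1_7")
      case True
      then obtain \<rho>1 where \<rho>1: "\<rho>1 \<in> Gamma1_7" "\<And>\<tau>. act \<rho> \<tau> = act \<rho>1 \<tau>" using act_uminus by metis
      have "\<exists>\<gamma>\<in>Gamma1_7. act A \<tau> = act \<gamma> \<tau>" if "\<tau> \<in> uhp" for \<tau>
      proof (rule bexI)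
        have "\<rho>1 \<in> SL2Z" using \<rho>1(1) Gamma_inclusions(2) by blast
        from act_mult[OF this that, of \<gamma>] show "act A \<tau> = act (\<gamma> ** \<rho>1) \<tau>"
          using \<rho>(3)[OF that] \<rho>1(2) by simp
      qed (rule Gamma1_7_mult[OF \<gamma> \<rho>1(1)])
      thus ?thesis by blast
    next
      case False
      then obtain B where B: "eventually (\<lambda>\<tau>. norm (ups0 (act \<rho> \<tau>)) \<le> B) at_ii_inf"
        using ups0_cusp[OF \<rho>'] by blast
      obtain h u where h: "h > 0" "u analytic_on {0}" and ev: "eventually (\<lambda>\<tau>. ups0 (act \<rho> \<tau>) = u (qpar h \<tau>)) at_ii_inf"
        by (rule mero_inf_bounded_analytic[OF functions_mero_inf(2)[OF \<rho>'] B])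
      have "(u \<longlongrightarrow> u 0) (at 0)" using analytic_at_imp_isCont[OF h(2)] by (simp add: isCont_def)
      hence "((\<lambda>\<tau>. u (qpar h \<tau>)) \<longlongrightarrow> u 0) at_ii_inf" by (rule filterlim_compose[OF _ filterlim_qpar_0[OF h(1)]])
      hence "((\<lambda>\<tau>. ups0 (act \<rho> \<tau>)) \<longlongrightarrow> u 0) at_ii_inf" by (rule Lim_transform_eventually) (use ev in eventually_elim, simp)
      hence "((\<lambda>\<tau>. ups0 (act \<rho> \<tau>)) \<longlongrightarrow> (SOME v. ((\<lambda>\<tau>. ups0 (act \<rho> \<tau>)) \<longlongrightarrow> v) at_ii_inf)) at_ii_inf"
        by (rule someI)
      moreover have "eventually (\<lambda>\<tau>. ups0 (act \<rho> \<tau>) = ups0 (act A \<tau>)) at_ii_inf"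
        using eventually_uhp_at_ii_inf
        by eventually_elim (use \<rho>(3) ups0_Gamma1_7[OF \<gamma>] act_in_uhp[OF \<rho>'] in simp)
      ultimately have "((\<lambda>\<tau>. ups0 (act A \<tau>)) \<longlongrightarrow> (SOME v. ((\<lambda>\<tau>. ups0 (act \<rho> \<tau>)) \<longlongrightarrow> v) at_ii_inf)) at_ii_inf"
        by (rule Lim_transform_eventually)
      thus ?thesis using \<rho>(1) unfolding C_def by blast
    qed
  qed
qed

text \<open>Induction on the order of the pole in q. Subtracting a multiple of \<upsilon>^(n + 1)
  removes the leading term, and \<open>periodic_bounded_expansion\<close> turns this into a drop by
  a full power of q.\<close>

lemma Gamma1_7_polar_part:
  assumes "hol_modular Gamma1_7 f" "eventually (\<lambda>\<tau>. norm (f \<tau>) \<le> C * exp (2 * pi * of_nat n * Im \<tau>)) at_ii_inf"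
  shows "\<exists>Q. ((\<lambda>\<tau>. f \<tau> - poly Q (ups0 \<tau>)) \<longlongrightarrow> 0) at_ii_inf"
  using assms
proof (induction n arbitrary: f C)
  have per: "f (\<tau> + 1) = f \<tau>" if "hol_modular Gamma1_7 f" "\<tau> \<in> uhp" for f \<tau>
    using hol_modularD(2)[OF that(1), of "mk 1 1 0 1" \<tau>] that(2) act_translation[of 1 \<tau>] by (simp add: Gamma1_7_def)
  have mero: "meromorphic_at_i_infinity f" if "hol_modular Gamma1_7 f" for f
    using hol_modularD(3)[OF that, of "mk 1 0 0 1"] by (simp add: act_id)
  {
    case 0
    hence bd: "eventually (\<lambda>\<tau>. norm (f \<tau>) \<le> C) at_ii_inf" by simp
    obtain L where "(f \<longlongrightarrow> L) at_ii_inf"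
      using periodic_bounded_expansion[OF mero bd per] 0(1) by blast
    hence "((\<lambda>\<tau>. f \<tau> - poly [:L:] (ups0 \<tau>)) \<longlongrightarrow> 0) at_ii_inf" by (simp add: LIM_zero)
    thus ?case by blast
  next
    case (Suc n)
    obtain M where M: "M \<noteq> 0" "((\<lambda>\<tau>. ups0 \<tau> * qpar 1 \<tau>) \<longlongrightarrow> M) at_ii_inf" by (rule ups0_residue)
    have nq: "norm (qpar 1 \<tau> ^ k) = exp (- (2 * pi * of_nat k * Im \<tau>))" for \<tau> k
      by (simp add: norm_power norm_qpar mult_ac flip: exp_of_nat_mult)
    define g where "g = (\<lambda>\<tau>. f \<tau> * qpar 1 \<tau> ^ Suc n)"
    have "eventually (\<lambda>\<tau>. norm (g \<tau>) \<le> C) at_ii_inf"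
      using Suc.prems(2)
    proof eventually_elim
      case (elim \<tau>)
      have "norm (g \<tau>) = norm (f \<tau>) * exp (- (2 * pi * of_nat (Suc n) * Im \<tau>))"
        unfolding g_def norm_mult nq ..
      also have "\<dots> \<le> (C * exp (2 * pi * of_nat (Suc n) * Im \<tau>)) * exp (- (2 * pi * of_nat (Suc n) * Im \<tau>))"
        by (intro mult_right_mono elim) auto
      also have "\<dots> = C" by (simp add: mult.assoc flip: exp_add)
      finally show ?case .
    qed
    moreover have "meromorphic_at_i_infinity g"
      unfolding g_def by (intro mero_inf_mult mero_inf_power mero_inf_qpar mero Suc.prems)
    moreover have "g (\<tau> + 1) = g \<tau>" if "\<tau> \<in> uhp" for \<tau>
      unfolding g_def qpar_1_periodic per[OF Suc.prems(1) that] ..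
    ultimately obtain L where L: "(g \<longlongrightarrow> L) at_ii_inf" using periodic_bounded_expansion by blast
    \<comment> \<open>Matches the leading coefficients, since
      \<open>ups0 \<tau> * qpar 1 \<tau>\<close> tends to M.\<close>
    define a where "a = L / M ^ Suc n"
    define f' where "f' = (\<lambda>\<tau>. f \<tau> - a * ups0 \<tau> ^ Suc n)"
    have f': "hol_modular Gamma1_7 f'"
      unfolding f'_def by (intro hol_modular_diff Suc.prems hol_modular_mult hol_modular_const hol_modular_power ups0_hol_modular)
    define g' where "g' = (\<lambda>\<tau>. f' \<tau> * qpar 1 \<tau> ^ Suc n)"
    have "((\<lambda>\<tau>. g \<tau> - a * (ups0 \<tau> * qpar 1 \<tau>) ^ Suc n) \<longlongrightarrow> L - a * M ^ Suc n) at_ii_inf"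
      by (intro tendsto_intros L M(2))
    moreover have "g \<tau> - a * (ups0 \<tau> * qpar 1 \<tau>) ^ Suc n = g' \<tau>" for \<tau>
      unfolding g_def g'_def f'_def power_mult_distrib by (simp only: left_diff_distrib mult.assoc)
    moreover have "L - a * M ^ Suc n = 0" using M(1) by (simp add: a_def)
    ultimately have g'0: "(g' \<longlongrightarrow> 0) at_ii_inf" by simp
    have g'm: "meromorphic_at_i_infinity g'"
      unfolding g'_def by (intro mero_inf_mult mero_inf_power mero_inf_qpar mero f')
    have g'p: "g' (\<tau> + 1) = g' \<tau>" if "\<tau> \<in> uhp" for \<tau>
      unfolding g'_def qpar_1_periodic per[OF f' that] ..
    obtain L' C' where L': "(g' \<longlongrightarrow> L') at_ii_inf" and
      C': "eventually (\<lambda>\<tau>. norm (g' \<tau> - L') \<le> C' * exp (- 2 * pi * Im \<tau>)) at_ii_inf"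
      using periodic_bounded_expansion[OF g'm bounded_of_tendsto[OF tendsto_norm[OF g'0]] g'p] by blast
    have "L' = 0" using tendsto_unique[OF at_ii_inf_neq_bot L' g'0] .
    have "eventually (\<lambda>\<tau>. norm (f' \<tau>) \<le> C' * exp (2 * pi * of_nat n * Im \<tau>)) at_ii_inf"
      using C'
    proof eventually_elim
      case (elim \<tau>)
      have "norm (f' \<tau>) = norm (g' \<tau>) * exp (2 * pi * of_nat (Suc n) * Im \<tau>)"
        unfolding g'_def norm_mult nq by (simp add: mult.assoc flip: exp_add)
      also have "\<dots> \<le> (C' * exp (- 2 * pi * Im \<tau>)) * exp (2 * pi * of_nat (Suc n) * Im \<tau>)"
        using elim by (intro mult_right_mono) (auto simp: \<open>L' = 0\<close>)
      also have "\<dots> = C' * exp (2 * pi * of_nat n * Im \<tau>)"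
        by (simp add: mult.assoc flip: exp_add) (simp add: algebra_simps)
      finally show ?case .
    qed
    from Suc.IH[OF f' this] obtain Q where Q: "((\<lambda>\<tau>. f' \<tau> - poly Q (ups0 \<tau>)) \<longlongrightarrow> 0) at_ii_inf" by blast
    have "f' \<tau> - poly Q (ups0 \<tau>) = f \<tau> - poly (Q + monom a (Suc n)) (ups0 \<tau>)" for \<tau>
      by (simp add: f'_def poly_monom)
    with Q show ?case by (intro exI[of _ "Q + monom a (Suc n)"]) simp
  }
qed

text \<open>At a cusp where \<upsilon> has a finite limit v, a power of \<upsilon> - v cancels the
  pole of f; D collects these factors. The pole left at \<infinity> is removed by a polynomial in
  \<upsilon>, and the difference is constant and tends to 0.\<close>

theorem Gamma1_7_rational:
  assumes f: "hol_modular Gamma1_7 f"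
  obtains D Q where "D \<noteq> 0" "\<And>\<tau>. \<tau> \<in> uhp \<Longrightarrow> poly D (ups0 \<tau>) * f \<tau> = poly Q (ups0 \<tau>)"
proof -
  obtain R where R: "finite R" "R \<subseteq> SL2Z"
    "\<And>A. A \<in> SL2Z \<Longrightarrow> \<exists>\<rho>\<in>R. \<exists>\<gamma>\<in>principal_Gamma 7. \<forall>\<tau>\<in>uhp. act A \<tau> = act \<gamma> (act \<rho> \<tau>)"
    using coset_representatives[of 7] by auto
  obtain C where C: "finite C" "\<And>A. A \<in> SL2Z \<Longrightarrow> (\<exists>v\<in>C. ((\<lambda>\<tau>. ups0 (act A \<tau>)) \<longlongrightarrow> v) at_ii_inf) \<or>
     (\<forall>\<tau>\<in>uhp. \<exists>\<gamma>\<in>Gamma1_7. act A \<tau> = act \<gamma> \<tau>)"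
    using cusp_values by blast
  define R' where "R' = {\<rho>\<in>R. \<exists>v. ((\<lambda>\<tau>. ups0 (act \<rho> \<tau>)) \<longlongrightarrow> v) at_ii_inf}"
  have "\<exists>v n B. ((\<lambda>\<tau>. ups0 (act \<rho> \<tau>)) \<longlongrightarrow> v) at_ii_inf \<and>
      eventually (\<lambda>\<tau>. norm ((ups0 (act \<rho> \<tau>) - v) ^ n * f (act \<rho> \<tau>)) \<le> B) at_ii_inf" if \<rho>: "\<rho> \<in> R'" for \<rho>
  proof -
    obtain v where v: "((\<lambda>\<tau>. ups0 (act \<rho> \<tau>)) \<longlongrightarrow> v) at_ii_inf" using \<rho> by (auto simp: R'_def)
    have \<rho>': "\<rho> \<in> SL2Z" using \<rho> R(2) by (auto simp: R'_def)
    have "meromorphic_at_i_infinity (\<lambda>\<tau>. ups0 (act \<rho> \<tau>) - v)"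
      using mero_inf_add[OF functions_mero_inf(2)[OF \<rho>'] mero_inf_const[of "- v"]] by simp
    moreover have "((\<lambda>\<tau>. ups0 (act \<rho> \<tau>) - v) \<longlongrightarrow> 0) at_ii_inf" using v by (simp add: LIM_zero)
    ultimately show ?thesis using zero_kills_pole[OF hol_modularD(3)[OF f \<rho>']] v by blast
  qed
  hence "\<forall>\<rho>\<in>R'. \<exists>v n B. ((\<lambda>\<tau>. ups0 (act \<rho> \<tau>)) \<longlongrightarrow> v) at_ii_inf \<and>
      eventually (\<lambda>\<tau>. norm ((ups0 (act \<rho> \<tau>) - v) ^ n * f (act \<rho> \<tau>)) \<le> B) at_ii_inf" by blast
  from bchoice[OF this] obtain v where "\<forall>\<rho>\<in>R'. \<exists>n B. ((\<lambda>\<tau>. ups0 (act \<rho> \<tau>)) \<longlongrightarrow> v \<rho>) at_ii_inf \<and>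
      eventually (\<lambda>\<tau>. norm ((ups0 (act \<rho> \<tau>) - v \<rho>) ^ n * f (act \<rho> \<tau>)) \<le> B) at_ii_inf" ..
  from bchoice[OF this] obtain n where "\<forall>\<rho>\<in>R'. \<exists>B. ((\<lambda>\<tau>. ups0 (act \<rho> \<tau>)) \<longlongrightarrow> v \<rho>) at_ii_inf \<and>
      eventually (\<lambda>\<tau>. norm ((ups0 (act \<rho> \<tau>) - v \<rho>) ^ n \<rho> * f (act \<rho> \<tau>)) \<le> B) at_ii_inf" ..
  from bchoice[OF this] obtain B where vnB0: "\<forall>\<rho>\<in>R'. ((\<lambda>\<tau>. ups0 (act \<rho> \<tau>)) \<longlongrightarrow> v \<rho>) at_ii_inf \<and>
      eventually (\<lambda>\<tau>. norm ((ups0 (act \<rho> \<tau>) - v \<rho>) ^ n \<rho> * f (act \<rho> \<tau>)) \<le> B \<rho>) at_ii_inf" ..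
  have vnB: "\<And>\<rho>. \<rho> \<in> R' \<Longrightarrow> ((\<lambda>\<tau>. ups0 (act \<rho> \<tau>)) \<longlongrightarrow> v \<rho>) at_ii_inf"
      "\<And>\<rho>. \<rho> \<in> R' \<Longrightarrow> eventually (\<lambda>\<tau>. norm ((ups0 (act \<rho> \<tau>) - v \<rho>) ^ n \<rho> * f (act \<rho> \<tau>)) \<le> B \<rho>) at_ii_inf"
    using vnB0 by simp_all
  have fR': "finite R'" using R(1) by (simp add: R'_def)
  define D where "D = (\<Prod>\<rho>\<in>R'. [:- v \<rho>, 1:] ^ n \<rho>)"
  have D0: "D \<noteq> 0" unfolding D_def using fR' by simp
  define f2 where "f2 = (\<lambda>\<tau>. poly D (ups0 \<tau>) * f \<tau>)"
  have f2: "hol_modular Gamma1_7 f2"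
    unfolding f2_def by (intro hol_modular_mult hol_modular_poly ups0_hol_modular f)
  have bdR: "\<exists>B. eventually (\<lambda>\<tau>. norm (f2 (act \<rho> \<tau>)) \<le> B) at_ii_inf" if \<rho>: "\<rho> \<in> R'" for \<rho>
  proof -
    define P where "P = (\<Prod>\<sigma>\<in>R' - {\<rho>}. [:- v \<sigma>, 1:] ^ n \<sigma>)"
    have "D = [:- v \<rho>, 1:] ^ n \<rho> * P" unfolding D_def P_def using fR' \<rho> by (rule prod.remove)
    hence eq: "f2 (act \<rho> \<tau>) = poly P (ups0 (act \<rho> \<tau>)) * ((ups0 (act \<rho> \<tau>) - v \<rho>) ^ n \<rho> * f (act \<rho> \<tau>))" for \<tau>
      by (simp add: f2_def mult_ac)
    have "((\<lambda>\<tau>. norm (poly P (ups0 (act \<rho> \<tau>)))) \<longlongrightarrow> norm (poly P (v \<rho>))) at_ii_inf"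
      by (intro tendsto_intros vnB \<rho>)
    from bounded_of_tendsto[OF this] vnB(2)[OF \<rho>]
    have "eventually (\<lambda>\<tau>. norm (f2 (act \<rho> \<tau>)) \<le> (norm (poly P (v \<rho>)) + 1) * B \<rho>) at_ii_inf"
      by eventually_elim (simp only: eq norm_mult[of "poly P _"], intro mult_mono, auto simp: add_nonneg_nonneg)
    thus ?thesis by blast
  qed
  obtain c K where K: "K \<ge> 0" "eventually (\<lambda>\<tau>. norm (f2 \<tau>) \<le> K * exp (c * Im \<tau>)) at_ii_inf"
    using mero_inf_growth[OF hol_modularD(3)[OF f2, of "mk 1 0 0 1"]] by (auto simp: act_id)
  obtain m :: nat where m: "c / (2 * pi) \<le> m" using real_arch_simple by blast
  have "eventually (\<lambda>\<tau>. norm (f2 \<tau>) \<le> K * exp (2 * pi * of_nat m * Im \<tau>)) at_ii_inf"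
    using K(2) eventually_uhp_at_ii_inf
  proof eventually_elim
    case (elim \<tau>)
    have "c * Im \<tau> \<le> 2 * pi * of_nat m * Im \<tau>" using m elim(2) by (intro mult_right_mono) (auto simp: uhp_iff field_simps)
    hence "K * exp (c * Im \<tau>) \<le> K * exp (2 * pi * of_nat m * Im \<tau>)" using K(1) by (intro mult_left_mono) auto
    thus ?case using elim(1) by linarith
  qed
  from Gamma1_7_polar_part[OF f2 this] obtain Q where Q: "((\<lambda>\<tau>. f2 \<tau> - poly Q (ups0 \<tau>)) \<longlongrightarrow> 0) at_ii_inf" by blast
  define F where "F = (\<lambda>\<tau>. f2 \<tau> - poly Q (ups0 \<tau>))"
  have F: "hol_modular Gamma1_7 F"
    unfolding F_def by (intro hol_modular_diff hol_modular_poly ups0_hol_modular f2)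
  have F0: "(F \<longlongrightarrow> 0) at_ii_inf" using Q by (simp add: F_def)
  have "\<exists>c. \<forall>\<tau>\<in>uhp. F \<tau> = c"
  proof (rule modular_Liouville[of 7 Gamma1_7])
    fix A assume A: "A \<in> SL2Z"
    obtain \<rho> \<gamma> where \<rho>: "\<rho> \<in> R" "\<gamma> \<in> principal_Gamma 7" "\<And>\<tau>. \<tau> \<in> uhp \<Longrightarrow> act A \<tau> = act \<gamma> (act \<rho> \<tau>)"
      using R(3)[OF A] by blast
    have \<rho>': "\<rho> \<in> SL2Z" using \<rho>(1) R(2) by blast
    have \<gamma>: "\<gamma> \<in> Gamma1_7" using \<rho>(2) Gamma_inclusions by blast
    have eqA: "eventually (\<lambda>\<tau>. F (act A \<tau>) = F (act \<rho> \<tau>)) at_ii_inf"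
      using eventually_uhp_at_ii_inf
      by eventually_elim (use \<rho>(3) hol_modularD(2)[OF F \<gamma>] act_in_uhp[OF \<rho>'] in simp)
    have "\<exists>B. eventually (\<lambda>\<tau>. norm (F (act \<rho> \<tau>)) \<le> B) at_ii_inf"
    proof (cases "\<rho> \<in> R'")
      case True
      obtain B1 where B1: "eventually (\<lambda>\<tau>. norm (f2 (act \<rho> \<tau>)) \<le> B1) at_ii_inf" using bdR[OF True] by blast
      have "((\<lambda>\<tau>. norm (poly Q (ups0 (act \<rho> \<tau>)))) \<longlongrightarrow> norm (poly Q (v \<rho>))) at_ii_inf"
        by (intro tendsto_intros vnB True)
      from bounded_of_tendsto[OF this] B1
      have "eventually (\<lambda>\<tau>. norm (F (act \<rho> \<tau>)) \<le> B1 + (norm (poly Q (v \<rho>)) + 1)) at_ii_inf"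
      proof eventually_elim
        case (elim \<tau>)
        thus ?case unfolding F_def using norm_triangle_ineq4[of "f2 (act \<rho> \<tau>)" "poly Q (ups0 (act \<rho> \<tau>))"] by linarith
      qed
      thus ?thesis by blast
    next
      case False
      \<comment> \<open>Without a finite limit, \<rho> acts like elements of
        \<open>Gamma1_7\<close>, so the bound at \<infinity> applies.\<close>
      hence inf: "\<forall>\<tau>\<in>uhp. \<exists>\<gamma>\<in>Gamma1_7. act \<rho> \<tau> = act \<gamma> \<tau>" using C(2)[OF \<rho>'] \<rho>(1) by (auto simp: R'_def)
      have "eventually (\<lambda>\<tau>. norm (F \<tau>) \<le> 1) at_ii_inf"
        using bounded_of_tendsto[OF tendsto_norm[OF F0]] by simp
      hence "eventually (\<lambda>\<tau>. norm (F (act \<rho> \<tau>)) \<le> 1) at_ii_inf"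
        using eventually_uhp_at_ii_inf by eventually_elim (use inf hol_modularD(2)[OF F] in metis)
      thus ?thesis by blast
    qed
    then obtain B where "eventually (\<lambda>\<tau>. norm (F (act \<rho> \<tau>)) \<le> B) at_ii_inf" by blast
    with eqA have "eventually (\<lambda>\<tau>. norm (F (act A \<tau>)) \<le> B) at_ii_inf" by eventually_elim simp
    thus "\<exists>B. eventually (\<lambda>\<tau>. norm (F (act A \<tau>)) \<le> B) at_ii_inf" by blast
  qed (use Gamma_inclusions F in auto)
  then obtain c where c: "\<And>\<tau>. \<tau> \<in> uhp \<Longrightarrow> F \<tau> = c" by blast
  have "(F \<longlongrightarrow> c) at_ii_inf"
    by (rule Lim_transform_eventually[OF tendsto_const]) (use eventually_uhp_at_ii_inf in eventually_elim, simp add: c)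
  hence "c = 0" using tendsto_unique[OF at_ii_inf_neq_bot _ F0] by blast
  hence "poly D (ups0 \<tau>) * f \<tau> = poly Q (ups0 \<tau>)" if "\<tau> \<in> uhp" for \<tau>
    using c[OF that] by (simp add: F_def f2_def)
  thus ?thesis using that D0 by blast
qed

text \<open>If y is neither attained nor a limit at a cusp, then 1 / (\<upsilon> - y) is holomorphic
  and bounded at all cusps, hence constant, and its limit at \<infinity> is 0.\<close>

lemma ups0_omits_cusp_values_only:
  obtains C where "finite C" "\<And>y. y \<notin> C \<Longrightarrow> \<exists>\<tau>\<in>uhp. ups0 \<tau> = y"
proof -
  obtain C where C: "finite C" "\<And>A. A \<in> SL2Z \<Longrightarrow> (\<exists>v\<in>C. ((\<lambda>\<tau>. ups0 (act A \<tau>)) \<longlongrightarrow> v) at_ii_inf) \<or>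
     (\<forall>\<tau>\<in>uhp. \<exists>\<gamma>\<in>Gamma1_7. act A \<tau> = act \<gamma> \<tau>)"
    using cusp_values by blast
  show ?thesis
  proof (rule that[OF C(1)], rule ccontr)
    fix y assume y: "y \<notin> C" "\<not> (\<exists>\<tau>\<in>uhp. ups0 \<tau> = y)"
    define F where "F = (\<lambda>\<tau>. 1 / (ups0 \<tau> - y))"
    have F: "hol_modular Gamma1_7 F"
      unfolding F_def using y(2) by (intro hol_modular_divide hol_modular_diff hol_modular_const ups0_hol_modular) auto
    have "filterlim (\<lambda>\<tau>. - y + ups0 \<tau>) at_infinity at_ii_inf"
      by (rule tendsto_add_filterlim_at_infinity[OF tendsto_const ups0_at_infinity])
    from filterlim_compose[OF tendsto_inverse_0 this]
    have F0: "(F \<longlongrightarrow> 0) at_ii_inf" by (simp add: F_def inverse_eq_divide)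
    have "\<exists>c. \<forall>\<tau>\<in>uhp. F \<tau> = c"
    proof (rule modular_Liouville[of 7 Gamma1_7])
      fix A assume A: "A \<in> SL2Z"
      from C(2)[OF A] show "\<exists>B. eventually (\<lambda>\<tau>. norm (F (act A \<tau>)) \<le> B) at_ii_inf"
      proof
        assume "\<exists>v\<in>C. ((\<lambda>\<tau>. ups0 (act A \<tau>)) \<longlongrightarrow> v) at_ii_inf"
        then obtain v where v: "v \<in> C" "((\<lambda>\<tau>. ups0 (act A \<tau>)) \<longlongrightarrow> v) at_ii_inf" by blast
        have "v - y \<noteq> 0" using v(1) y(1) by auto
        hence "((\<lambda>\<tau>. norm (F (act A \<tau>))) \<longlongrightarrow> norm (1 / (v - y))) at_ii_inf"
          unfolding F_def by (intro tendsto_intros v(2))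
        thus ?thesis using bounded_of_tendsto by blast
      next
        assume inf: "\<forall>\<tau>\<in>uhp. \<exists>\<gamma>\<in>Gamma1_7. act A \<tau> = act \<gamma> \<tau>"
        have "eventually (\<lambda>\<tau>. norm (F \<tau>) \<le> 1) at_ii_inf"
          using bounded_of_tendsto[OF tendsto_norm[OF F0]] by simp
        hence "eventually (\<lambda>\<tau>. norm (F (act A \<tau>)) \<le> 1) at_ii_inf"
          using eventually_uhp_at_ii_inf by eventually_elim (use inf hol_modularD(2)[OF F] in metis)
        thus ?thesis by blast
      qed
    qed (use Gamma_inclusions F in auto)
    then obtain c where c: "\<And>\<tau>. \<tau> \<in> uhp \<Longrightarrow> F \<tau> = c" by blast
    have "(F \<longlongrightarrow> c) at_ii_inf"
      by (rule Lim_transform_eventually[OF tendsto_const]) (use eventually_uhp_at_ii_inf in eventually_elim, simp add: c)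
    hence "c = 0" using tendsto_unique[OF at_ii_inf_neq_bot _ F0] by blast
    hence "F \<i> = 0" using c[of \<i>] by (simp add: uhp_iff)
    \<comment> \<open>A reciprocal with value 0 is a division by zero, so y would be attained after
      all.\<close>
    hence "ups0 \<i> = y" by (simp add: F_def)
    thus False using y(2) by (auto simp: uhp_iff)
  qed
qed

section \<open>Rational functions of the three coordinates\<close>

definition Psi :: "complex \<Rightarrow> complex^3" where
  "Psi \<tau> = vector [psi0 \<tau>, ups0 \<tau>, tee \<tau>]"

lemma Psi_components [simp]: "Psi \<tau> $ 1 = psi0 \<tau>" "Psi \<tau> $ 2 = ups0 \<tau>" "Psi \<tau> $ 3 = tee \<tau>"
  by (simp_all add: Psi_def)

lemma polyfun_diff: "polyfun p \<Longrightarrow> polyfun q \<Longrightarrow> polyfun (\<lambda>x. p x - q x)"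
  using polyfun.add[of p "\<lambda>x. (-1) * q x"] polyfun.mult[OF polyfun.const[of "-1"], of q] by simp

lemma polyfun_power: "polyfun p \<Longrightarrow> polyfun (\<lambda>x. p x ^ n)"
  by (induction n) (auto intro: polyfun.intros)

lemma polyfun_poly: "polyfun p \<Longrightarrow> polyfun (\<lambda>x. poly Q (p x))"
  by (induction Q) (auto intro: polyfun.intros)

lemma hol_modular_Gamma_2_7: "hol_modular Gamma_2_7 psi0" "hol_modular Gamma_2_7 ups0" "hol_modular Gamma_2_7 tee"
  using psi0_hol_modular ups0_hol_modular tee_hol_modular Gamma_inclusions
  by (meson hol_modular_subgroup order_trans)+

lemma hol_modular_polyfun: "polyfun p \<Longrightarrow> hol_modular Gamma_2_7 (\<lambda>\<tau>. p (Psi \<tau>))"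
proof (induction p rule: polyfun.induct)
  case (coord i)
  show ?case using exhaust_3[of i] hol_modular_Gamma_2_7 by auto
qed (auto intro: hol_modular_add hol_modular_mult)

text \<open>The set where g is nonzero is open and not empty, and f vanishes on it, so the identity
  theorem applies. This absence of zero divisors lets denominators and differences of conjugates be
  cancelled.\<close>

lemma hol_mult_eq_0:
  assumes f: "f holomorphic_on uhp" and g: "g holomorphic_on uhp"
    and fg: "\<And>\<tau>. \<tau> \<in> uhp \<Longrightarrow> f \<tau> * g \<tau> = 0" and nz: "\<exists>\<tau>\<in>uhp. g \<tau> \<noteq> 0"
    and \<tau>: "\<tau> \<in> uhp"
  shows "f \<tau> = 0"
proof -
  obtain \<tau>0 where \<tau>0: "\<tau>0 \<in> uhp" "g \<tau>0 \<noteq> 0" using nz by blast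
  define U where "U = {\<tau> \<in> uhp. g \<tau> \<noteq> 0}"
  have "U = uhp \<inter> g -` (- {0})" by (auto simp: U_def)
  hence "open U"
    using continuous_open_preimage[OF holomorphic_on_imp_continuous_on[OF g] open_uhp, of "- {0}"] by auto
  show ?thesis
  proof (rule analytic_continuation_open[of U uhp f "\<lambda>_. 0"])
    show "U \<noteq> {}" using \<tau>0 by (auto simp: U_def)
    show "f z = 0" if "z \<in> U" for z using fg[of z] that by (auto simp: U_def)
  qed (use \<open>open U\<close> open_uhp connected_uhp f \<tau> in \<open>auto simp: U_def\<close>)
qed

lemma hol_mult_nonzero:
  assumes "f holomorphic_on uhp" "g holomorphic_on uhp" "\<exists>\<tau>\<in>uhp. f \<tau> \<noteq> 0" "\<exists>\<tau>\<in>uhp. g \<tau> \<noteq> 0"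
  shows "\<exists>\<tau>\<in>uhp. f \<tau> * g \<tau> \<noteq> 0"
  using hol_mult_eq_0[OF assms(1,2) _ assms(4)] assms(3) by blast

text \<open>The relation is multiplied out so that it holds at every point, also at zeros of the
  denominator; the denominator only has to be nonzero somewhere.\<close>

definition rat :: "(complex \<Rightarrow> complex) \<Rightarrow> bool" where
  "rat f \<longleftrightarrow> (\<exists>P Q. polyfun P \<and> polyfun Q \<and> (\<exists>\<tau>\<in>uhp. Q (Psi \<tau>) \<noteq> 0) \<and>
     (\<forall>\<tau>\<in>uhp. f \<tau> * Q (Psi \<tau>) = P (Psi \<tau>)))"

lemma polyfun_hol: "polyfun p \<Longrightarrow> (\<lambda>\<tau>. p (Psi \<tau>)) holomorphic_on uhp"
  using hol_modular_polyfun hol_modularD(1) by blast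

lemma i_in_uhp [simp]: "\<i> \<in> uhp" by (simp add: uhp_iff)

lemma rat_polyfun: "polyfun P \<Longrightarrow> (\<And>\<tau>. \<tau> \<in> uhp \<Longrightarrow> f \<tau> = P (Psi \<tau>)) \<Longrightarrow> rat f"
  unfolding rat_def by (rule exI[of _ P], rule exI[of _ "\<lambda>_. 1"]) (auto intro: polyfun.intros exI[of _ \<i>])

lemma rat_coords: "rat psi0" "rat ups0" "rat tee"
  using rat_polyfun[OF polyfun.coord[of 1], of psi0] rat_polyfun[OF polyfun.coord[of 2], of ups0]
    rat_polyfun[OF polyfun.coord[of 3], of tee] by auto

lemma rat_const: "rat (\<lambda>_. c)"
  by (rule rat_polyfun[OF polyfun.const[of c]]) simp

lemma rat_mult:
  assumes "rat f" "rat g" shows "rat (\<lambda>\<tau>. f \<tau> * g \<tau>)"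
proof -
  obtain P Q where 1: "polyfun P" "polyfun Q" "\<exists>\<tau>\<in>uhp. Q (Psi \<tau>) \<noteq> 0" "\<And>\<tau>. \<tau> \<in> uhp \<Longrightarrow> f \<tau> * Q (Psi \<tau>) = P (Psi \<tau>)"
    using assms(1) unfolding rat_def by blast
  obtain P' Q' where 2: "polyfun P'" "polyfun Q'" "\<exists>\<tau>\<in>uhp. Q' (Psi \<tau>) \<noteq> 0" "\<And>\<tau>. \<tau> \<in> uhp \<Longrightarrow> g \<tau> * Q' (Psi \<tau>) = P' (Psi \<tau>)"
    using assms(2) unfolding rat_def by blast
  have "f \<tau> * g \<tau> * (Q (Psi \<tau>) * Q' (Psi \<tau>)) = P (Psi \<tau>) * P' (Psi \<tau>)" if "\<tau> \<in> uhp" for \<tau>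
    unfolding 1(4)[OF that, symmetric] 2(4)[OF that, symmetric] by simp
  moreover have "\<exists>\<tau>\<in>uhp. Q (Psi \<tau>) * Q' (Psi \<tau>) \<noteq> 0"
    by (intro hol_mult_nonzero polyfun_hol 1 2)
  ultimately show ?thesis
    unfolding rat_def using polyfun.mult[OF 1(1) 2(1)] polyfun.mult[OF 1(2) 2(2)] by (metis (no_types, lifting))
qed

lemma rat_add:
  assumes "rat f" "rat g" shows "rat (\<lambda>\<tau>. f \<tau> + g \<tau>)"
proof -
  obtain P Q where 1: "polyfun P" "polyfun Q" "\<exists>\<tau>\<in>uhp. Q (Psi \<tau>) \<noteq> 0" "\<And>\<tau>. \<tau> \<in> uhp \<Longrightarrow> f \<tau> * Q (Psi \<tau>) = P (Psi \<tau>)"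
    using assms(1) unfolding rat_def by blast
  obtain P' Q' where 2: "polyfun P'" "polyfun Q'" "\<exists>\<tau>\<in>uhp. Q' (Psi \<tau>) \<noteq> 0" "\<And>\<tau>. \<tau> \<in> uhp \<Longrightarrow> g \<tau> * Q' (Psi \<tau>) = P' (Psi \<tau>)"
    using assms(2) unfolding rat_def by blast
  have "(f \<tau> + g \<tau>) * (Q (Psi \<tau>) * Q' (Psi \<tau>)) = P (Psi \<tau>) * Q' (Psi \<tau>) + P' (Psi \<tau>) * Q (Psi \<tau>)" if "\<tau> \<in> uhp" for \<tau>
    unfolding 1(4)[OF that, symmetric] 2(4)[OF that, symmetric] by (simp add: algebra_simps)
  moreover have "\<exists>\<tau>\<in>uhp. Q (Psi \<tau>) * Q' (Psi \<tau>) \<noteq> 0"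
    by (intro hol_mult_nonzero polyfun_hol 1 2)
  ultimately show ?thesis
    unfolding rat_def using polyfun.add[OF polyfun.mult[OF 1(1) 2(2)] polyfun.mult[OF 2(1) 1(2)]] polyfun.mult[OF 1(2) 2(2)]
    by (metis (no_types, lifting))
qed

lemma rat_cancel:
  assumes fh: "rat (\<lambda>\<tau>. f \<tau> * h \<tau>)" and h: "rat h" "h holomorphic_on uhp" "\<exists>\<tau>\<in>uhp. h \<tau> \<noteq> 0"
  shows "rat f"
proof -
  obtain P Q where 1: "polyfun P" "polyfun Q" "\<exists>\<tau>\<in>uhp. Q (Psi \<tau>) \<noteq> 0" "\<And>\<tau>. \<tau> \<in> uhp \<Longrightarrow> f \<tau> * h \<tau> * Q (Psi \<tau>) = P (Psi \<tau>)"
    using fh unfolding rat_def by blast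
  obtain P' Q' where 2: "polyfun P'" "polyfun Q'" "\<exists>\<tau>\<in>uhp. Q' (Psi \<tau>) \<noteq> 0" "\<And>\<tau>. \<tau> \<in> uhp \<Longrightarrow> h \<tau> * Q' (Psi \<tau>) = P' (Psi \<tau>)"
    using h(1) unfolding rat_def by blast
  have "f \<tau> * (P' (Psi \<tau>) * Q (Psi \<tau>)) = P (Psi \<tau>) * Q' (Psi \<tau>)" if "\<tau> \<in> uhp" for \<tau>
    unfolding 1(4)[OF that, symmetric] 2(4)[OF that, symmetric] by simp
  moreover have "\<exists>\<tau>\<in>uhp. h \<tau> * Q' (Psi \<tau>) \<noteq> 0" by (intro hol_mult_nonzero polyfun_hol h 2)
  hence "\<exists>\<tau>\<in>uhp. P' (Psi \<tau>) \<noteq> 0" using 2(4) by metis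
  hence "\<exists>\<tau>\<in>uhp. P' (Psi \<tau>) * Q (Psi \<tau>) \<noteq> 0" by (intro hol_mult_nonzero polyfun_hol 1 2)
  ultimately show ?thesis
    unfolding rat_def using polyfun.mult[OF 1(1) 2(2)] polyfun.mult[OF 2(1) 1(2)] by (metis (no_types, lifting))
qed

lemma rat_cong: "rat f \<Longrightarrow> (\<And>\<tau>. \<tau> \<in> uhp \<Longrightarrow> f \<tau> = g \<tau>) \<Longrightarrow> rat g"
  unfolding rat_def by simp

lemma rat_power: "rat f \<Longrightarrow> rat (\<lambda>\<tau>. f \<tau> ^ n)"
  by (induction n) (auto intro: rat_mult rat_const)

lemma rat_sum: "(\<And>i. i \<in> I \<Longrightarrow> rat (f i)) \<Longrightarrow> rat (\<lambda>\<tau>. \<Sum>i\<in>I. f i \<tau>)"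
  by (induction I rule: infinite_finite_induct) (auto intro: rat_add rat_const)

text \<open>\<upsilon> takes all but finitely many values, and D has finitely many roots.\<close>

lemma poly_ups0_nonzero:
  assumes "D \<noteq> 0"
  shows "\<exists>\<tau>\<in>uhp. poly D (ups0 \<tau>) \<noteq> 0"
proof -
  obtain C where C: "finite C" "\<And>y. y \<notin> C \<Longrightarrow> \<exists>\<tau>\<in>uhp. ups0 \<tau> = y" using ups0_omits_cusp_values_only by blast
  have "finite (C \<union> {y. poly D y = 0})" using C(1) poly_roots_finite[OF assms] by simp
  then obtain y where "y \<notin> C \<union> {y. poly D y = 0}" using ex_new_if_finite[OF infinite_UNIV_char_0] by blast
  thus ?thesis using C(2)[of y] by auto
qed

lemma rat_Gamma1_7:
  assumes "hol_modular Gamma1_7 f"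
  shows "rat f"
proof -
  obtain D Q where D: "D \<noteq> 0" "\<And>\<tau>. \<tau> \<in> uhp \<Longrightarrow> poly D (ups0 \<tau>) * f \<tau> = poly Q (ups0 \<tau>)"
    using Gamma1_7_rational[OF assms] by blast
  show ?thesis
    unfolding rat_def
  proof (rule exI[of _ "\<lambda>x. poly Q (x $ 2)"], rule exI[of _ "\<lambda>x. poly D (x $ 2)"], intro conjI)
    show "polyfun (\<lambda>x::complex^3. poly Q (x $ 2))" "polyfun (\<lambda>x::complex^3. poly D (x $ 2))"
      by (intro polyfun_poly polyfun.coord)+
    show "\<exists>\<tau>\<in>uhp. poly D (Psi \<tau> $ 2) \<noteq> 0" using poly_ups0_nonzero[OF D(1)] by simp
    show "\<forall>\<tau>\<in>uhp. f \<tau> * poly D (Psi \<tau> $ 2) = poly Q (Psi \<tau> $ 2)" using D(2) by (simp add: mult.commute)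
  qed
qed

section \<open>Descent from \<open>principal_Gamma 7\<close> to \<open>Gamma1_7\<close>\<close>

lemma Gamma7_mult:
  assumes "A \<in> principal_Gamma 7" "B \<in> principal_Gamma 7"
  shows "A ** B \<in> principal_Gamma 7"
proof -
  have "[A$1$1 * B$1$1 + A$1$2 * B$2$1 = 1 * 1 + 0 * 0] (mod 7)" "[A$1$1 * B$1$2 + A$1$2 * B$2$2 = 1 * 0 + 0 * 1] (mod 7)"
    "[A$2$1 * B$1$1 + A$2$2 * B$2$1 = 0 * 1 + 1 * 0] (mod 7)" "[A$2$1 * B$1$2 + A$2$2 * B$2$2 = 0 * 0 + 1 * 1] (mod 7)"
    by (intro cong_add cong_mult; use assms in \<open>simp add: principal_Gamma_def\<close>)+
  thus ?thesis using assms by (simp add: principal_Gamma_def mult_entries SL2Z_mult)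
qed

lemma Gamma7_minv:
  assumes "A \<in> principal_Gamma 7"
  shows "minv A \<in> principal_Gamma 7"
  using assms cong_minus_minus_iff[of "A$1$2" 0 7] cong_minus_minus_iff[of "A$2$1" 0 7]
  by (simp add: principal_Gamma_def) (simp add: minv_def)

lemma Gamma7_conj_translation:
  assumes A: "A \<in> principal_Gamma 7"
  shows "mk 1 m 0 1 ** A ** mk 1 (- m) 0 1 \<in> principal_Gamma 7"
proof -
  obtain a' b' c' d' where A': "A \<in> SL2Z" "A$1$1 = 1 + 7 * a'" "A$1$2 = 7 * b'" "A$2$1 = 7 * c'" "A$2$2 = 1 + 7 * d'"
    by (rule Gamma7_E[OF A])
  let ?B = "mk 1 m 0 1 ** A ** mk 1 (- m) 0 1"
  have "?B \<in> SL2Z" by (intro SL2Z_mult A'(1)) auto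
  moreover have "?B$1$1 - 1 = 7 * (a' + m * c')" "?B$1$2 = 7 * (b' + m * d' - m * (a' + m * c'))"
     "?B$2$1 = 7 * c'" "?B$2$2 - 1 = 7 * (d' - m * c')"
    by (simp_all add: mult_entries A' algebra_simps)
  ultimately show ?thesis by (simp add: principal_Gamma_def cong_iff_dvd_diff)
qed

text \<open>\<open>Gamma1_7\<close> is generated by \<open>principal_Gamma 7\<close> and the
  translations, so invariance under the former and period 1 are enough.\<close>

lemma Gamma1_7_factor:
  assumes A: "A \<in> Gamma1_7"
  shows "mk 1 (- (A$1$2)) 0 1 ** A \<in> principal_Gamma 7"
proof -
  obtain a' c' where A': "A \<in> SL2Z" "A$1$1 = 1 + 7 * a'" "A$2$1 = 7 * c'" by (rule Gamma1_7_E[OF A])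
  let ?B = "mk 1 (- (A$1$2)) 0 1 ** A"
  have "?B \<in> SL2Z" by (intro SL2Z_mult A'(1)) auto
  moreover define k where "k = A$1$2 * c' - a' * A$2$2"
  have d: "A$2$2 - 1 = 7 * k"
    using SL2Z_det[OF A'(1)] by (simp add: A' k_def algebra_simps)
  have "?B$1$1 - 1 = 7 * (a' - A$1$2 * c')" "?B$2$1 = 7 * c'" "?B$2$2 - 1 = 7 * k"
    by (simp_all add: mult_entries A' d)
  moreover have "?B$1$2 = A$1$2 * (- (A$2$2 - 1))" by (simp add: mult_entries algebra_simps)
  hence "?B$1$2 = 7 * (- (A$1$2 * k))" unfolding d by simp
  ultimately show ?thesis by (simp add: principal_Gamma_def cong_iff_dvd_diff)
qed

text \<open>The multiplier of \<open>psi0\<close> under translation by 1, a primitive seventh root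
  of unity.\<close>

definition \<omega>7 :: complex where "\<omega>7 = exp (4 * pi * \<i> / 7)"

lemma \<omega>7_nz [simp]: "\<omega>7 \<noteq> 0" by (simp add: \<omega>7_def)

lemma \<omega>7_pow7: "\<omega>7 ^ 7 = 1"
  using exp_pi_i_int[of 4] by (simp add: \<omega>7_def mult_ac flip: exp_of_nat_mult)

lemma \<omega>7_pow_neq_1:
  assumes "0 < m" "m < 7"
  shows "\<omega>7 ^ m \<noteq> 1"
proof
  assume "\<omega>7 ^ m = 1"
  hence "exp (of_nat m * (4 * pi * \<i> / 7)) = 1" by (simp only: \<omega>7_def exp_of_nat_mult)
  then obtain n :: int where "real m * (4 * pi / 7) = of_int (2 * n) * pi" unfolding exp_eq_1 by auto
  hence "real_of_int (2 * int m) = of_int (7 * n)" by (simp add: field_simps)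
  hence "2 * int m = 7 * n" by (simp only: of_int_eq_iff)
  thus False using assms by presburger
qed

lemma \<omega>7_sum:
  assumes "m < 7"
  shows "(\<Sum>j<7. inverse \<omega>7 ^ (j * m)) = (if m = 0 then 7 else 0)"
proof (cases "m = 0")
  case False
  define z where "z = inverse \<omega>7 ^ m"
  have "z \<noteq> 1" using \<omega>7_pow_neq_1[of m] False assms by (simp add: z_def power_inverse inverse_eq_1_iff)
  moreover have "z ^ 7 = 1"
    unfolding z_def by (simp only: power_mult[symmetric] mult.commute[of m]) (simp add: power_mult power_inverse \<omega>7_pow7)
  ultimately have "(\<Sum>j<7. z ^ j) = 0" by (simp add: geometric_sum)
  moreover have "inverse \<omega>7 ^ (j * m) = z ^ j" for j by (simp add: z_def mult.commute flip: power_mult)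
  ultimately show ?thesis using False by simp
qed auto

lemma psi0_translate_nat: "\<tau> \<in> uhp \<Longrightarrow> psi0 (\<tau> + of_nat m) = \<omega>7 ^ m * psi0 \<tau>"
proof (induction m)
  case (Suc m)
  have "psi0 ((\<tau> + of_nat m) + 1) = \<omega>7 * psi0 (\<tau> + of_nat m)"
    unfolding \<omega>7_def by (rule psi0_translate) (use Suc in \<open>simp add: uhp_iff\<close>)
  thus ?case using Suc by (simp add: algebra_simps)
qed auto

lemma rat_Gamma7:
  assumes f: "hol_modular (principal_Gamma 7) f"
  shows "rat f"
proof -
  \<comment> \<open>Discrete Fourier projections along the translations; \<open>fj j\<close> and
    \<open>psi0 ^ j\<close> have the same eigenvalue \<open>\<omega>7 ^ j\<close>, so
    \<open>gj j\<close> has period 1.\<close>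
  define fj where "fj = (\<lambda>j \<tau>. \<Sum>m<7. inverse \<omega>7 ^ (j * m) * f (\<tau> + of_nat m))"
  define gj where "gj = (\<lambda>j \<tau>. fj j \<tau> / psi0 \<tau> ^ j)"
  have Tm: "act (mk 1 (int m) 0 1) \<tau> = \<tau> + of_nat m" for m \<tau> using act_translation[of "int m" \<tau>] by simp
  have Tmem: "mk 1 m 0 1 \<in> SL2Z" for m by simp
  have f7: "f (\<tau> + 7) = f \<tau>" if "\<tau> \<in> uhp" for \<tau>
    using hol_modularD(2)[OF f, of "mk 1 7 0 1" \<tau>] that act_translation[of 7 \<tau>]
    by (simp add: principal_Gamma_def cong_0_iff)
  have fm: "hol_modular (principal_Gamma 7) (\<lambda>\<tau>. f (\<tau> + of_nat m))" for m
    unfolding hol_modular_def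
  proof (intro conjI ballI)
    show "(\<lambda>\<tau>. f (\<tau> + of_nat m)) holomorphic_on uhp"
      using holomorphic_compose_act[OF Tmem hol_modularD(1)[OF f], of "int m"] by (simp only: Tm)
    fix A assume A: "A \<in> SL2Z"
    have "meromorphic_at_i_infinity (\<lambda>\<tau>. f (act (mk 1 (int m) 0 1 ** A) \<tau>))"
      by (rule hol_modularD(3)[OF f]) (intro SL2Z_mult A Tmem)
    thus "meromorphic_at_i_infinity (\<lambda>\<tau>. f (act A \<tau> + of_nat m))"
    proof (rule mero_inf_cong)
      show "eventually (\<lambda>\<tau>. f (act (mk 1 (int m) 0 1 ** A) \<tau>) = f (act A \<tau> + of_nat m)) at_ii_inf"
        using eventually_uhp_at_ii_inf by eventually_elim (simp add: act_mult A Tm)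
    qed
  next
    fix A \<tau> assume A: "A \<in> principal_Gamma 7" and \<tau>: "\<tau> \<in> uhp"
    have A': "A \<in> SL2Z" using A principal_Gamma_subset by blast
    define B where "B = mk 1 (int m) 0 1 ** A ** mk 1 (- int m) 0 1"
    define \<sigma> where "\<sigma> = \<tau> + of_nat m"
    have \<sigma>: "\<sigma> \<in> uhp" using \<tau> by (simp add: \<sigma>_def uhp_iff)
    have "act B \<sigma> = act (mk 1 (int m) 0 1 ** A) (act (mk 1 (- int m) 0 1) \<sigma>)"
      unfolding B_def by (rule act_mult[OF Tmem \<sigma>])
    also have "act (mk 1 (- int m) 0 1) \<sigma> = \<tau>" using act_translation[of "- int m" \<sigma>] by (simp add: \<sigma>_def)
    also have "act (mk 1 (int m) 0 1 ** A) \<tau> = act A \<tau> + of_nat m" using act_mult[OF A' \<tau>] Tm by simp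
    finally have "f (act A \<tau> + of_nat m) = f (act B \<sigma>)" by simp
    also have "\<dots> = f \<sigma>" unfolding B_def by (rule hol_modularD(2)[OF f Gamma7_conj_translation[OF A] \<sigma>])
    finally show "f (act A \<tau> + of_nat m) = f (\<tau> + of_nat m)" by (simp add: \<sigma>_def)
  qed
  have fj: "hol_modular (principal_Gamma 7) (fj j)" for j
    unfolding fj_def by (intro hol_modular_sum hol_modular_mult hol_modular_const fm)
  have gj: "hol_modular (principal_Gamma 7) (gj j)" for j
    unfolding gj_def by (intro hol_modular_divide fj hol_modular_power psi0_hol_modular) (simp add: functions_nz)
  have fj1: "fj j (\<tau> + 1) = \<omega>7 ^ j * fj j \<tau>" if \<tau>: "\<tau> \<in> uhp" for j \<tau>
  proof -
    define c where "c = (\<lambda>m. inverse \<omega>7 ^ (j * m) * f (\<tau> + of_nat m))"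
    have eq: "\<tau> + 1 + of_nat m = \<tau> + of_nat (Suc m)" for m by simp
    have "fj j (\<tau> + 1) = (\<Sum>m<7. inverse \<omega>7 ^ (j * m) * f (\<tau> + of_nat (Suc m)))" unfolding fj_def eq ..
    also have "\<dots> = (\<Sum>m<7. \<omega>7 ^ j * c (Suc m))"
      by (intro sum.cong refl) (simp add: c_def power_add power_inverse)
    also have "\<dots> = \<omega>7 ^ j * (\<Sum>m<7. c (Suc m))" by (simp add: sum_distrib_left)
    \<comment> \<open>The sum is cyclic: its new last term equals the old first one because f has
      period 7.\<close>
    also have "(\<Sum>m<7. c (Suc m)) = (\<Sum>m<Suc 7. c m) - c 0" by (subst sum.lessThan_Suc_shift) simp
    also have "\<dots> = (\<Sum>m<7. c m) + (c 7 - c 0)" by (subst sum.lessThan_Suc) simp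
    also have "c 7 = c 0"
      using f7[OF \<tau>] by (simp add: c_def mult.commute[of j] power_mult power_inverse \<omega>7_pow7)
    finally show ?thesis by (simp add: fj_def c_def)
  qed
  have gj1: "gj j (\<tau> + 1) = gj j \<tau>" if "\<tau> \<in> uhp" for j \<tau>
    using fj1[OF that] psi0_translate[OF that, folded \<omega>7_def] by (simp add: gj_def power_mult_distrib)
  have gjn: "gj j (\<tau> + of_nat n) = gj j \<tau>" if "\<tau> \<in> uhp" for j n \<tau>
  proof (induction n)
    case (Suc n)
    have "gj j ((\<tau> + of_nat n) + 1) = gj j (\<tau> + of_nat n)" by (rule gj1) (use that in \<open>simp add: uhp_iff\<close>)
    thus ?case using Suc by (simp add: algebra_simps)
  qed auto
  have gji: "gj j (\<tau> + of_int n) = gj j \<tau>" if "\<tau> \<in> uhp" for j n \<tau>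
  proof (cases "n \<ge> 0")
    case True
    thus ?thesis using gjn[OF that, of j "nat n"] by simp
  next
    case False
    have "gj j ((\<tau> + of_int n) + of_nat (nat (- n))) = gj j (\<tau> + of_int n)"
      by (rule gjn) (use that in \<open>simp add: uhp_iff\<close>)
    thus ?thesis using False by simp
  qed
  have "hol_modular Gamma1_7 (gj j)" for j
    unfolding hol_modular_def
  proof (intro conjI ballI hol_modularD(1)[OF gj] hol_modularD(3)[OF gj])
    fix A \<tau> assume A: "A \<in> Gamma1_7" and \<tau>: "\<tau> \<in> uhp"
    define B where "B = mk 1 (- (A$1$2)) 0 1 ** A"
    have A': "A \<in> SL2Z" using A Gamma_inclusions by blast
    have B: "B \<in> principal_Gamma 7" unfolding B_def by (rule Gamma1_7_factor[OF A])
    have "act B \<tau> = act A \<tau> - of_int (A$1$2)"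
      unfolding B_def using act_mult[OF A' \<tau>] act_translation[of "- (A$1$2)"] by simp
    hence "gj j (act A \<tau>) = gj j (act B \<tau> + of_int (A$1$2))" by simp
    also have "\<dots> = gj j (act B \<tau>)" by (rule gji) (use B \<tau> act_in_uhp principal_Gamma_subset in blast)
    also have "\<dots> = gj j \<tau>" by (rule hol_modularD(2)[OF gj B \<tau>])
    finally show "gj j (act A \<tau>) = gj j \<tau>" .
  qed
  hence "rat (gj j)" for j by (rule rat_Gamma1_7)
  hence "rat (\<lambda>\<tau>. (1/7) * (\<Sum>j<7. gj j \<tau> * psi0 \<tau> ^ j))"
    by (intro rat_mult rat_sum rat_const rat_power rat_coords)
  thus ?thesis
  proof (rule rat_cong)
    fix \<tau> assume \<tau>: "\<tau> \<in> uhp"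
    \<comment> \<open>Summing over j recovers 7 f by orthogonality of the seventh roots of
      unity.\<close>
    have "(\<Sum>j<7. gj j \<tau> * psi0 \<tau> ^ j) = (\<Sum>j<7. fj j \<tau>)"
      by (intro sum.cong refl) (simp add: gj_def functions_nz[OF \<tau>])
    also have "\<dots> = (\<Sum>m<7. \<Sum>j<7. inverse \<omega>7 ^ (j * m) * f (\<tau> + of_nat m))"
      unfolding fj_def by (rule sum.swap)
    also have "\<dots> = (\<Sum>m<7. (if m = 0 then 7 else 0) * f (\<tau> + of_nat m))"
      by (intro sum.cong refl) (simp add: \<omega>7_sum flip: sum_distrib_right)
    also have "\<dots> = (\<Sum>m<(7::nat). if m = 0 then 7 * f \<tau> else 0)" by (intro sum.cong refl) simp
    also have "\<dots> = 7 * f \<tau>" by (simp add: sum.delta)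
    finally show "(1/7) * (\<Sum>j<7. gj j \<tau> * psi0 \<tau> ^ j) = f \<tau>" by simp
  qed
qed

section \<open>The three cosets and the conjugates of \<open>tee\<close>\<close>

text \<open>Cosets of \<open>Gamma_2_7\<close> in \<open>principal_Gamma 7\<close> are told apart by
  the lower row modulo 2: (0, 1) for the identity, (1, 1) for \<open>g2\<close>, (1, 0) for
  \<open>g3\<close>. In \<open>g3\<close> the entry 50 is even, congruent to 1 modulo 7, and gives
  50 - 7 * 7 = 1.\<close>

definition g2 :: "int^2^2" where "g2 = mk 1 0 7 1"
definition g3 :: "int^2^2" where "g3 = mk 1 7 7 50"

lemma g23: "g2 \<in> principal_Gamma 7" "g3 \<in> principal_Gamma 7"
  by (auto simp: g2_def g3_def principal_Gamma_def cong_iff_dvd_diff)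

text \<open>The even number is the lower left entry of X times the inverse of Y, so that this
  product lies in \<open>Gamma_2_7\<close>.\<close>

lemma Gamma_2_7_coset:
  assumes X: "X \<in> principal_Gamma 7" and Y: "Y \<in> principal_Gamma 7"
    and even: "even (X$2$1 * Y$2$2 - X$2$2 * Y$2$1)"
    and u: "\<And>A \<tau>. A \<in> Gamma_2_7 \<Longrightarrow> \<tau> \<in> uhp \<Longrightarrow> u (act A \<tau>) = u \<tau>" and \<tau>: "\<tau> \<in> uhp"
  shows "u (act X \<tau>) = u (act Y \<tau>)"
proof -
  have X': "X \<in> SL2Z" and Y': "Y \<in> SL2Z" using X Y principal_Gamma_subset by blast+
  define B where "B = X ** minv Y"
  have "B \<in> principal_Gamma 7" unfolding B_def by (intro Gamma7_mult Gamma7_minv X Y)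
  moreover have "B$2$1 = X$2$1 * Y$2$2 - X$2$2 * Y$2$1" by (simp add: B_def mult_entries minv_def)
  ultimately have B: "B \<in> Gamma_2_7" using even principal_Gamma_subset by (auto simp: Gamma_2_7_def Gamma0_def cong_0_iff)
  have "act B (act Y \<tau>) = act X \<tau>"
    unfolding B_def using act_mult[of "minv Y" "act Y \<tau>" X] Y' \<tau> by (simp add: act_in_uhp act_minv)
  thus ?thesis using u[OF B act_in_uhp[OF Y' \<tau>]] by simp
qed

text \<open>Right multiplication by A permutes the three cosets, hence the three summands.\<close>

lemma trace_Gamma7:
  assumes u: "hol_modular Gamma_2_7 u"
  shows "hol_modular (principal_Gamma 7) (\<lambda>\<tau>. u \<tau> + u (act g2 \<tau>) + u (act g3 \<tau>))"
  unfolding hol_modular_def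
proof (intro conjI ballI)
  have g: "g2 \<in> SL2Z" "g3 \<in> SL2Z" using g23 principal_Gamma_subset by blast+
  show "(\<lambda>\<tau>. u \<tau> + u (act g2 \<tau>) + u (act g3 \<tau>)) holomorphic_on uhp"
    by (intro holomorphic_intros holomorphic_compose_act g hol_modularD(1)[OF u])
  fix A assume A: "A \<in> SL2Z"
  have "meromorphic_at_i_infinity (\<lambda>\<tau>. u (act A \<tau>) + u (act (g2 ** A) \<tau>) + u (act (g3 ** A) \<tau>))"
    by (intro mero_inf_add hol_modularD(3)[OF u] SL2Z_mult g A)
  thus "meromorphic_at_i_infinity (\<lambda>\<tau>. u (act A \<tau>) + u (act g2 (act A \<tau>)) + u (act g3 (act A \<tau>)))"
  proof (rule mero_inf_cong)
    show "eventually (\<lambda>\<tau>. u (act A \<tau>) + u (act (g2 ** A) \<tau>) + u (act (g3 ** A) \<tau>) =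
       u (act A \<tau>) + u (act g2 (act A \<tau>)) + u (act g3 (act A \<tau>))) at_ii_inf"
      using eventually_uhp_at_ii_inf by eventually_elim (simp add: act_mult A)
  qed
next
  fix A \<tau> assume A: "A \<in> principal_Gamma 7" and \<tau>: "\<tau> \<in> uhp"
  have A': "A \<in> SL2Z" using A principal_Gamma_subset by blast
  have I: "mk 1 0 0 1 \<in> principal_Gamma 7" by (simp add: principal_Gamma_def)
  have val: "u (act X \<tau>) = (if even (X$2$1) then u \<tau> else if even (X$2$2) then u (act g3 \<tau>) else u (act g2 \<tau>))"
    if X: "X \<in> principal_Gamma 7" for X
  proof -
    note c = Gamma_2_7_coset[OF X _ _ hol_modularD(2)[OF u] \<tau>]
    show ?thesis using c[OF I] c[OF g23(1)] c[OF g23(2)] by (auto simp: g2_def g3_def act_id)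
  qed
  have e: "u (act g2 (act A \<tau>)) = u (act (g2 ** A) \<tau>)" "u (act g3 (act A \<tau>)) = u (act (g3 ** A) \<tau>)"
    using act_mult[OF A' \<tau>] by simp_all
  have "odd (A$1$1 * A$2$2 - A$1$2 * A$2$1)" using SL2Z_det[OF A'] by simp
  thus "u (act A \<tau>) + u (act g2 (act A \<tau>)) + u (act g3 (act A \<tau>)) = u \<tau> + u (act g2 \<tau>) + u (act g3 \<tau>)"
    unfolding e val[OF A] val[OF Gamma7_mult[OF g23(1) A]] val[OF Gamma7_mult[OF g23(2) A]]
    by (auto simp: mult_entries g2_def g3_def)
qed

text \<open>If the two functions agreed, \<open>tee\<close> would be invariant under X times the
  inverse of Y, whose lower left entry is odd; but the limits at \<infinity> are 0 and 1/2.\<close>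

lemma tee_conjugates_differ:
  assumes X: "X \<in> principal_Gamma 7" and Y: "Y \<in> principal_Gamma 7"
    and odd: "odd (X$2$1 * Y$2$2 - X$2$2 * Y$2$1)"
  shows "\<exists>\<tau>\<in>uhp. tee (act X \<tau>) - tee (act Y \<tau>) \<noteq> 0"
proof (rule ccontr)
  assume neg: "\<not> ?thesis"
  have X': "X \<in> SL2Z" and Y': "Y \<in> SL2Z" using X Y principal_Gamma_subset by blast+
  define B where "B = X ** minv Y"
  have B: "B \<in> principal_Gamma 7" unfolding B_def by (intro Gamma7_mult Gamma7_minv X Y)
  have "B$2$1 = X$2$1 * Y$2$2 - X$2$2 * Y$2$1" by (simp add: B_def mult_entries minv_def)
  hence "((\<lambda>\<tau>. tee (act B \<tau>)) \<longlongrightarrow> 0) at_ii_inf" using tee_odd_limit[OF B] odd by simp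
  moreover have "eventually (\<lambda>\<tau>. tee (act B \<tau>) = tee \<tau>) at_ii_inf"
    using eventually_uhp_at_ii_inf
  proof eventually_elim
    case (elim \<tau>)
    have m: "act (minv Y) \<tau> \<in> uhp" by (intro act_in_uhp elim minv_SL2Z Y')
    have "act B \<tau> = act X (act (minv Y) \<tau>)" unfolding B_def by (rule act_mult[OF minv_SL2Z[OF Y'] elim])
    moreover have "act Y (act (minv Y) \<tau>) = \<tau>" by (rule act_minv'[OF Y' elim])
    ultimately show ?case using neg m by force
  qed
  ultimately have "(tee \<longlongrightarrow> 0) at_ii_inf" by (rule Lim_transform_eventually)
  from tendsto_unique[OF at_ii_inf_neq_bot this tee_limit] show False by simp
qed

definition cub :: "complex \<Rightarrow> complex \<Rightarrow> complex" where
  "cub y z = 2 * y * (y - 1) * z ^ 3 - (y\<^sup>2 - y - 1) * z\<^sup>2 - 2 * y * z + y"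

text \<open>The divided difference of \<open>cub y\<close> at X and s. It vanishes when X and s are
  distinct roots and is the derivative when X = s: the kernel of Lagrange interpolation.\<close>

definition cubq :: "complex \<Rightarrow> complex \<Rightarrow> complex \<Rightarrow> complex" where
  "cubq y s X = 2 * y * (y - 1) * X\<^sup>2 + (2 * y * (y - 1) * s - (y\<^sup>2 - y - 1)) * X
     + (2 * y * (y - 1) * s\<^sup>2 - (y\<^sup>2 - y - 1) * s - 2 * y)"

lemma cubq: "(X - s) * cubq y s X = cub y X - cub y s"
  by (simp add: cub_def cubq_def algebra_simps power2_eq_square power3_eq_cube)

lemma cub_tee:
  assumes "A \<in> principal_Gamma 7" "\<tau> \<in> uhp"
  shows "cub (ups0 \<tau>) (tee (act A \<tau>)) = 0"
proof -
  have "act A \<tau> \<in> uhp" using assms act_in_uhp principal_Gamma_subset by blast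
  from tee_cubic[OF this] show ?thesis
    using ups0_Gamma1_7[of A \<tau>] assms Gamma_inclusions by (auto simp: cub_def)
qed

text \<open>Both conjugates are roots, so the product with their difference vanishes, and the
  difference is not identically zero. The conclusion thus holds also at points where the two values
  coincide.\<close>

lemma cubq_conjugate:
  assumes X: "X \<in> principal_Gamma 7" and Y: "Y \<in> principal_Gamma 7"
    and odd: "odd (X$2$1 * Y$2$2 - X$2$2 * Y$2$1)" and \<tau>: "\<tau> \<in> uhp"
  shows "cubq (ups0 \<tau>) (tee (act Y \<tau>)) (tee (act X \<tau>)) = 0"
proof (rule hol_mult_eq_0[of "\<lambda>\<tau>. cubq (ups0 \<tau>) (tee (act Y \<tau>)) (tee (act X \<tau>))" "\<lambda>\<tau>. tee (act X \<tau>) - tee (act Y \<tau>)"])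
  have X': "X \<in> SL2Z" and Y': "Y \<in> SL2Z" using X Y principal_Gamma_subset by blast+
  show "(\<lambda>\<tau>. cubq (ups0 \<tau>) (tee (act Y \<tau>)) (tee (act X \<tau>))) holomorphic_on uhp"
    unfolding cubq_def by (intro holomorphic_intros holomorphic_compose_act ups0_holomorphic tee_holomorphic X' Y')
  show "(\<lambda>\<tau>. tee (act X \<tau>) - tee (act Y \<tau>)) holomorphic_on uhp"
    by (intro holomorphic_intros holomorphic_compose_act tee_holomorphic X' Y')
  show "cubq (ups0 \<tau>) (tee (act Y \<tau>)) (tee (act X \<tau>)) * (tee (act X \<tau>) - tee (act Y \<tau>)) = 0" if "\<tau> \<in> uhp" for \<tau>
    using cubq[of "tee (act X \<tau>)" "tee (act Y \<tau>)" "ups0 \<tau>"] cub_tee[OF X that] cub_tee[OF Y that]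
    by (simp add: mult.commute)
  show "\<exists>\<tau>\<in>uhp. tee (act X \<tau>) - tee (act Y \<tau>) \<noteq> 0" by (rule tee_conjugates_differ[OF X Y odd])
qed (rule \<tau>)

text \<open>This is the derivative of the cubic at \<open>tee\<close>. Divided by \<upsilon>^2 it
  tends to 6 * (1/2)^2 - 2 * (1/2) = 1/2 at \<infinity>.\<close>

lemma cubq_tee_nonzero: "\<exists>\<tau>\<in>uhp. cubq (ups0 \<tau>) (tee \<tau>) (tee \<tau>) \<noteq> 0"
proof -
  define w where "w = (\<lambda>\<tau>. inverse (ups0 \<tau>))"
  have w: "(w \<longlongrightarrow> 0) at_ii_inf" unfolding w_def by (rule filterlim_compose[OF tendsto_inverse_0 ups0_at_infinity])
  have "((\<lambda>\<tau>. 6 * (1 - w \<tau>) * tee \<tau> ^ 2 - 2 * (1 - w \<tau> - w \<tau> ^ 2) * tee \<tau> - 2 * w \<tau>) \<longlongrightarrow>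
      6 * (1 - 0) * (1/2) ^ 2 - 2 * (1 - 0 - 0 ^ 2) * (1/2) - 2 * 0) at_ii_inf"
    by (intro tendsto_intros w tee_limit)
  hence "((\<lambda>\<tau>. 6 * (1 - w \<tau>) * tee \<tau> ^ 2 - 2 * (1 - w \<tau> - w \<tau> ^ 2) * tee \<tau> - 2 * w \<tau>) \<longlongrightarrow> 1/2) at_ii_inf"
    by (simp add: power2_eq_square)
  from tendsto_imp_eventually_ne[OF this, of 0]
  have "eventually (\<lambda>\<tau>. 6 * (1 - w \<tau>) * tee \<tau> ^ 2 - 2 * (1 - w \<tau> - w \<tau> ^ 2) * tee \<tau> - 2 * w \<tau> \<noteq> 0) at_ii_inf" by simp
  hence "eventually (\<lambda>\<tau>. \<tau> \<in> uhp \<and> cubq (ups0 \<tau>) (tee \<tau>) (tee \<tau>) \<noteq> 0) at_ii_inf"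
    using eventually_uhp_at_ii_inf
  proof eventually_elim
    case (elim \<tau>)
    have u: "ups0 \<tau> \<noteq> 0" using functions_nz[OF elim(2)] by simp
    have "w \<tau> ^ 2 * cubq (ups0 \<tau>) (tee \<tau>) (tee \<tau>) = 6 * (1 - w \<tau>) * tee \<tau> ^ 2 - 2 * (1 - w \<tau> - w \<tau> ^ 2) * tee \<tau> - 2 * w \<tau>"
      using u unfolding cubq_def w_def by (simp add: field_simps power2_eq_square)
    thus ?case using elim by auto
  qed
  from eventually_happens'[OF at_ii_inf_neq_bot this] show ?thesis by blast
qed

text \<open>Lagrange interpolation: f times the kernel, summed over the conjugates in the second
  argument of \<open>cubq\<close>, keeps only f times the derivative. Expanded in powers of the
  third argument, the sum has the traces of \<open>u0\<close>, \<open>u1\<close>, \<open>u2\<close>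
  as coefficients.\<close>

theorem rat_Gamma_2_7:
  assumes f: "hol_modular Gamma_2_7 f"
  shows "rat f"
proof -
  define L M N where "L = (\<lambda>\<tau>. 2 * ups0 \<tau> * (ups0 \<tau> - 1))" and "M = (\<lambda>\<tau>. (-1) * (ups0 \<tau> ^ 2 - ups0 \<tau> - 1))" and "N = (\<lambda>\<tau>. (-2) * ups0 \<tau>)"
  have LMN: "hol_modular Gamma_2_7 L" "hol_modular Gamma_2_7 M" "hol_modular Gamma_2_7 N"
    unfolding L_def M_def N_def
    by (intro hol_modular_mult hol_modular_diff hol_modular_const hol_modular_power hol_modular_Gamma_2_7)+
  define u0 u1 u2 where "u0 = (\<lambda>\<tau>. f \<tau> * (L \<tau> * tee \<tau> ^ 2 + M \<tau> * tee \<tau> + N \<tau>))"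
    and "u1 = (\<lambda>\<tau>. f \<tau> * (L \<tau> * tee \<tau> + M \<tau>))" and "u2 = (\<lambda>\<tau>. f \<tau> * L \<tau>)"
  have "hol_modular Gamma_2_7 u0" "hol_modular Gamma_2_7 u1" "hol_modular Gamma_2_7 u2"
    unfolding u0_def u1_def u2_def
    by (intro hol_modular_mult hol_modular_add hol_modular_power hol_modular_Gamma_2_7 f LMN)+
  note tr = this[THEN trace_Gamma7, THEN rat_Gamma7]
  have "rat (\<lambda>\<tau>. ((u0 \<tau> + u0 (act g2 \<tau>) + u0 (act g3 \<tau>)) + (u1 \<tau> + u1 (act g2 \<tau>) + u1 (act g3 \<tau>)) * tee \<tau>)
          + (u2 \<tau> + u2 (act g2 \<tau>) + u2 (act g3 \<tau>)) * tee \<tau> ^ 2)"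
    by (intro rat_add rat_mult rat_power rat_coords tr)
  hence "rat (\<lambda>\<tau>. f \<tau> * cubq (ups0 \<tau>) (tee \<tau>) (tee \<tau>))"
  proof (rule rat_cong)
    fix \<tau> assume \<tau>: "\<tau> \<in> uhp"
    have I: "mk 1 0 0 1 \<in> principal_Gamma 7" by (simp add: principal_Gamma_def)
    have g: "g2 \<in> Gamma1_7" "g3 \<in> Gamma1_7" using g23 Gamma_inclusions by blast+
    have q2: "cubq (ups0 \<tau>) (tee (act g2 \<tau>)) (tee \<tau>) = 0"
      using cubq_conjugate[OF I g23(1) _ \<tau>] by (simp add: act_id g2_def)
    have q3: "cubq (ups0 \<tau>) (tee (act g3 \<tau>)) (tee \<tau>) = 0"
      using cubq_conjugate[OF I g23(2) _ \<tau>] by (simp add: act_id g3_def)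
    have uu: "u0 \<sigma> + u1 \<sigma> * tee \<tau> + u2 \<sigma> * tee \<tau> ^ 2 = f \<sigma> * cubq (ups0 \<sigma>) (tee \<sigma>) (tee \<tau>)" for \<sigma>
      by (simp add: u0_def u1_def u2_def L_def M_def N_def cubq_def algebra_simps)
    have "((u0 \<tau> + u0 (act g2 \<tau>) + u0 (act g3 \<tau>)) + (u1 \<tau> + u1 (act g2 \<tau>) + u1 (act g3 \<tau>)) * tee \<tau>)
          + (u2 \<tau> + u2 (act g2 \<tau>) + u2 (act g3 \<tau>)) * tee \<tau> ^ 2 =
        (u0 \<tau> + u1 \<tau> * tee \<tau> + u2 \<tau> * tee \<tau> ^ 2) +
        (u0 (act g2 \<tau>) + u1 (act g2 \<tau>) * tee \<tau> + u2 (act g2 \<tau>) * tee \<tau> ^ 2) +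
        (u0 (act g3 \<tau>) + u1 (act g3 \<tau>) * tee \<tau> + u2 (act g3 \<tau>) * tee \<tau> ^ 2)" by (simp add: algebra_simps)
    also have "\<dots> = f \<tau> * cubq (ups0 \<tau>) (tee \<tau>) (tee \<tau>)"
      unfolding uu using q2 q3 ups0_Gamma1_7[OF g(1) \<tau>] ups0_Gamma1_7[OF g(2) \<tau>] by simp
    finally show "((u0 \<tau> + u0 (act g2 \<tau>) + u0 (act g3 \<tau>)) + (u1 \<tau> + u1 (act g2 \<tau>) + u1 (act g3 \<tau>)) * tee \<tau>)
          + (u2 \<tau> + u2 (act g2 \<tau>) + u2 (act g3 \<tau>)) * tee \<tau> ^ 2 = f \<tau> * cubq (ups0 \<tau>) (tee \<tau>) (tee \<tau>)" .
  qed
  moreover have "rat (\<lambda>\<tau>. cubq (ups0 \<tau>) (tee \<tau>) (tee \<tau>))"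
  proof (rule rat_polyfun[of "\<lambda>x. cubq (x$2) (x$3) (x$3)"])
    show "polyfun (\<lambda>x::complex^3. cubq (x$2) (x$3) (x$3))"
      unfolding cubq_def by (intro polyfun.add polyfun.mult polyfun_diff polyfun_power polyfun.coord polyfun.const)
  qed simp
  moreover have "(\<lambda>\<tau>. cubq (ups0 \<tau>) (tee \<tau>) (tee \<tau>)) holomorphic_on uhp"
    unfolding cubq_def by (intro holomorphic_intros ups0_holomorphic tee_holomorphic)
  ultimately show ?thesis using cubq_tee_nonzero by (rule rat_cancel)
qed

text \<open>Two divided differences leave a linear factor, and S is its defect, Vieta's formula for
  the sum of the roots. S vanishes after cancelling the difference of two conjugates, so the
  factorisation holds at every point, with multiplicities.\<close>

lemma cub_factors:
  assumes \<tau>: "\<tau> \<in> uhp"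
  defines "y \<equiv> ups0 \<tau>" and "t1 \<equiv> tee \<tau>" and "t2 \<equiv> tee (act g2 \<tau>)" and "t3 \<equiv> tee (act g3 \<tau>)"
  shows "cub y z = 2 * y * (y - 1) * (z - t1) * (z - t2) * (z - t3)"
proof -
  have I: "mk 1 0 0 1 \<in> principal_Gamma 7" by (simp add: principal_Gamma_def)
  define S where "S = (\<lambda>\<tau>. 2 * ups0 \<tau> * (ups0 \<tau> - 1) * (tee \<tau> + tee (act g2 \<tau>) + tee (act g3 \<tau>)) - (ups0 \<tau> ^ 2 - ups0 \<tau> - 1))"
  have g: "g2 \<in> SL2Z" "g3 \<in> SL2Z" using g23 principal_Gamma_subset by blast+
  have q2: "cubq (ups0 \<tau>) (tee \<tau>) (tee (act g2 \<tau>)) = 0" and q3: "cubq (ups0 \<tau>) (tee \<tau>) (tee (act g3 \<tau>)) = 0"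
    if "\<tau> \<in> uhp" for \<tau>
    using cubq_conjugate[OF g23(1) I _ that] cubq_conjugate[OF g23(2) I _ that] by (simp_all add: act_id g2_def g3_def)
  have "S \<tau> = 0"
  proof (rule hol_mult_eq_0[of S "\<lambda>\<tau>. tee (act g2 \<tau>) - tee (act g3 \<tau>)"])
    show "S holomorphic_on uhp" "(\<lambda>\<tau>. tee (act g2 \<tau>) - tee (act g3 \<tau>)) holomorphic_on uhp"
      unfolding S_def by (intro holomorphic_intros holomorphic_compose_act ups0_holomorphic tee_holomorphic g)+
    show "\<exists>\<tau>\<in>uhp. tee (act g2 \<tau>) - tee (act g3 \<tau>) \<noteq> 0"
      by (rule tee_conjugates_differ[OF g23]) (simp add: g2_def g3_def)
    fix \<tau> assume "\<tau> \<in> uhp"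
    have "S \<tau> * (tee (act g2 \<tau>) - tee (act g3 \<tau>)) = cubq (ups0 \<tau>) (tee \<tau>) (tee (act g2 \<tau>)) - cubq (ups0 \<tau>) (tee \<tau>) (tee (act g3 \<tau>))"
      by (simp add: S_def cubq_def algebra_simps power2_eq_square)
    thus "S \<tau> * (tee (act g2 \<tau>) - tee (act g3 \<tau>)) = 0" using q2 q3 \<open>\<tau> \<in> uhp\<close> by simp
  qed (rule \<tau>)
  have "cub y z = (z - t1) * cubq y t1 z"
    using cubq[of z t1 y] cub_tee[OF I \<tau>] by (simp add: y_def t1_def act_id)
  also have "cubq y t1 z = cubq y t1 z - cubq y t1 t2" using q2[OF \<tau>] by (simp add: y_def t1_def t2_def)
  also have "\<dots> = (z - t2) * (2 * y * (y - 1) * (z - t3) + S \<tau>)"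
    by (simp add: S_def cubq_def y_def t1_def t2_def t3_def algebra_simps power2_eq_square)
  finally show ?thesis using \<open>S \<tau> = 0\<close> by (simp add: mult_ac)
qed

subsection \<open>The curve\<close>

definition model_curve :: "(complex^3) set" where
  "model_curve = {v. cub (v$2) (v$3) = 0 \<and> (v$1) ^ 7 = (v$2) ^ 4 * (v$2 - 1)}"

lemma Psi_in_model_curve: "\<tau> \<in> uhp \<Longrightarrow> Psi \<tau> \<in> model_curve"
  using tee_cubic[of \<tau>] psi_ups_relation[of \<tau>] by (simp add: model_curve_def cub_def)

lemma vec3_eqI: "v$1 = w$1 \<Longrightarrow> v$2 = w$2 \<Longrightarrow> v$3 = w$3 \<Longrightarrow> v = (w :: complex^3)"
  by (simp add: vec_eq_iff forall_3)

lemma finite_fibre: "finite {v \<in> model_curve. v$2 = y}"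
proof -
  define P where "P = [:y, - 2 * y, - (y\<^sup>2 - y - 1), 2 * y * (y - 1):]"
  \<comment> \<open>The constant term is y, and for y = 0 the quadratic coefficient is 1.\<close>
  have "P \<noteq> 0" by (auto simp: P_def)
  hence fz: "finite {z. poly P z = 0}" by (rule poly_roots_finite)
  have "monom 1 7 - [:y ^ 4 * (y - 1):] \<noteq> (0 :: complex poly)"
  proof
    assume "monom 1 7 - [:y ^ 4 * (y - 1):] = (0 :: complex poly)"
    hence "coeff (monom 1 7 - [:y ^ 4 * (y - 1):] :: complex poly) 7 = 0" by simp
    thus False by (simp add: coeff_pCons split: nat.splits)
  qed
  hence fx: "finite {x. poly (monom 1 7 - [:y ^ 4 * (y - 1):]) x = 0}" by (rule poly_roots_finite)
  have "{v \<in> model_curve. v$2 = y} \<subseteq> (\<lambda>(x, z). vector [x, y, z]) ` ({x. poly (monom 1 7 - [:y ^ 4 * (y - 1):]) x = 0} \<times> {z. poly P z = 0})"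
  proof
    fix v assume v: "v \<in> {v \<in> model_curve. v$2 = y}"
    show "v \<in> (\<lambda>(x, z). vector [x, y, z]) ` ({x. poly (monom 1 7 - [:y ^ 4 * (y - 1):]) x = 0} \<times> {z. poly P z = 0})"
    proof (rule image_eqI[of _ _ "(v$1, v$3)"])
      show "v = (\<lambda>(x, z). vector [x, y, z]) (v$1, v$3)" using v by (auto intro!: vec3_eqI)
      show "(v$1, v$3) \<in> {x. poly (monom 1 7 - [:y ^ 4 * (y - 1):]) x = 0} \<times> {z. poly P z = 0}"
      proof -
        have "cub y (v$3) = 0" "(v$1) ^ 7 = y ^ 4 * (y - 1)" using v by (auto simp: model_curve_def)
        moreover have "poly P z = cub y z" for z
          by (simp add: P_def cub_def algebra_simps power2_eq_square power3_eq_cube)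
        ultimately show ?thesis by (simp add: poly_monom)
      qed
    qed
  qed
  thus ?thesis using fx fz finite_subset by blast
qed

text \<open>Over a value y of \<upsilon>, translations multiply \<psi> by every seventh root of
  unity, and the three cosets run through the roots of the cubic, so the whole fibre is reached. The
  exceptional set is a union of finitely many finite fibres.\<close>

lemma Psi_image_cofinite:
  obtains E where "finite E" "model_curve - E \<subseteq> Psi ` uhp"
proof -
  obtain C where C: "finite C" "\<And>y. y \<notin> C \<Longrightarrow> \<exists>\<tau>\<in>uhp. ups0 \<tau> = y" using ups0_omits_cusp_values_only by blast
  define E where "E = (\<Union>y\<in>C. {v \<in> model_curve. v$2 = y})"
  show ?thesis
  proof (rule that[of E])
    show "finite E" unfolding E_def using C(1) finite_fibre by blast
    show "model_curve - E \<subseteq> Psi ` uhp"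
    proof
      fix v assume v: "v \<in> model_curve - E"
      hence "v$2 \<notin> C" by (auto simp: E_def)
      then obtain \<tau> where \<tau>: "\<tau> \<in> uhp" "ups0 \<tau> = v$2" using C(2) by blast
      have "(v$1) ^ 7 = psi0 \<tau> ^ 7" using psi_ups_relation[OF \<tau>(1)] v by (simp add: \<tau>(2) model_curve_def)
      hence "(v$1 / psi0 \<tau>) ^ 7 = 1" unfolding power_divide using functions_nz[OF \<tau>(1)] by simp
      hence "v$1 / psi0 \<tau> \<in> {z. z ^ 7 = 1}" by simp
      hence "v$1 / psi0 \<tau> \<in> {exp (2 * of_real pi * \<i> * of_nat j / of_nat 7) |j. j < 7}"
        by (subst (asm) complex_roots_unity) auto
      then obtain j :: nat where j: "v$1 / psi0 \<tau> = exp (2 * of_real pi * \<i> * of_nat j / of_nat 7)" by blast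
      \<comment> \<open>Since 4 j * (4 pi / 7) = 2 pi j / 7 + 2 pi j, the power 4 j of
        \<open>\<omega>7\<close> is the j-th power of exp (2 pi i / 7).\<close>
      define m where "m = 4 * j"
      have "\<omega>7 ^ m = exp (2 * of_real pi * \<i> * of_nat j / of_nat 7) * exp (pi * \<i> * of_int (2 * int j))"
        unfolding \<omega>7_def m_def exp_of_nat_mult[symmetric] exp_add[symmetric]
        by (rule arg_cong[of _ _ exp]) (simp add: field_simps)
      hence \<omega>m: "\<omega>7 ^ m = v$1 / psi0 \<tau>" unfolding exp_pi_i_int j by simp
      define \<sigma> where "\<sigma> = \<tau> + of_nat m"
      have \<sigma>: "\<sigma> \<in> uhp" using \<tau>(1) by (simp add: \<sigma>_def uhp_iff)
      have p: "psi0 \<sigma> = v$1" unfolding \<sigma>_def psi0_translate_nat[OF \<tau>(1)] \<omega>m using functions_nz[OF \<tau>(1)] by simp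
      have u: "ups0 \<sigma> = v$2"
        using ups0_Gamma1_7[of "mk 1 (int m) 0 1" \<tau>] \<tau> act_translation[of "int m" \<tau>]
        by (simp add: \<sigma>_def Gamma1_7_def)
      have "v$2 \<noteq> 0" using functions_nz[OF \<sigma>] u by simp
      moreover have "v$2 - 1 \<noteq> 0" using psi_ups_relation[OF \<sigma>] functions_nz[OF \<sigma>] u by auto
      moreover have "cub (v$2) (v$3) = 0" using v by (simp add: model_curve_def)
      moreover have I7: "mk 1 0 0 1 \<in> principal_Gamma 7" by (simp add: principal_Gamma_def)
      ultimately have "v$3 = tee \<sigma> \<or> v$3 = tee (act g2 \<sigma>) \<or> v$3 = tee (act g3 \<sigma>)"
        using cub_factors[OF \<sigma>, of "v$3"] u by auto
      then obtain A where A: "A \<in> principal_Gamma 7" "v$3 = tee (act A \<sigma>)"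
        using g23 act_id I7 by metis
      have A': "A \<in> SL2Z" "A \<in> Gamma1_7" using A(1) Gamma_inclusions by blast+
      have "Psi (act A \<sigma>) = v"
        using psi0_Gamma7[OF A(1) \<sigma>] ups0_Gamma1_7[OF A'(2) \<sigma>] p u A(2) by (intro vec3_eqI) auto
      thus "v \<in> Psi ` uhp" using act_in_uhp[OF A'(1) \<sigma>] by blast
    qed
  qed
qed

section \<open>Points of the curve near a given point\<close>

text \<open>The modulus of p at z0 is the product of the distances from z0 to the roots. If all were
  at least \<epsilon>, so would be the product compared with \<epsilon> ^ degree; the induction runs
  over sub-multisets of the roots.\<close>

lemma monic_root_near:
  fixes p :: "complex poly"
  assumes "lead_coeff p = 1" "degree p > 0" "norm (poly p z0) < \<epsilon> ^ degree p" "\<epsilon> > 0"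
  shows "\<exists>z. poly p z = 0 \<and> norm (z - z0) < \<epsilon>"
proof (rule ccontr)
  assume neg: "\<not> ?thesis"
  have "p \<noteq> 0" using assms(2) by auto
  obtain A where A: "size A = degree p" "p = smult (lead_coeff p) (\<Prod>x\<in>#A. [:-x, 1:])"
    using alg_closed_imp_factorization[OF \<open>p \<noteq> 0\<close>] by blast
  have p: "p = (\<Prod>x\<in>#A. [:-x, 1:])" using A(2) assms(1) by simp
  have root: "poly p x = 0" if "x \<in># A" for x
    unfolding p using that by (auto simp: poly_prod_mset image_iff)
  have "norm (poly (\<Prod>x\<in>#B. [:-x, 1:]) z0) \<ge> \<epsilon> ^ size B" if "B \<subseteq># A" for B
    using that
  proof (induction B)
    case (add x B)
    have "x \<in># A" using add.prems by (meson mset_subset_eqD union_single_eq_member)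
    hence "norm (x - z0) \<ge> \<epsilon>" using neg root by (meson not_le)
    moreover have "B \<subseteq># A" using add.prems by (meson mset_subset_eq_add_right add_mset_add_single subset_mset.order_trans diff_subset_eq_self mset_subset_eq_insertD subset_mset.less_imp_le)
    hence "norm (poly (\<Prod>x\<in>#B. [:-x, 1:]) z0) \<ge> \<epsilon> ^ size B" by (rule add.IH)
    ultimately have "\<epsilon> * \<epsilon> ^ size B \<le> norm (z0 - x) * norm (poly (\<Prod>x\<in>#B. [:-x, 1:]) z0)"
      using assms(4) by (intro mult_mono) (auto simp: norm_minus_commute)
    moreover have "poly (\<Prod>x\<in>#add_mset x B. [:-x, 1:]) z0 = (z0 - x) * poly (\<Prod>x\<in>#B. [:-x, 1:]) z0"
      by (simp add: algebra_simps)
    ultimately show ?case by (simp only: norm_mult size_add_mset power_Suc)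
  qed auto
  from this[of A] have "norm (poly p z0) \<ge> \<epsilon> ^ degree p" using p A(1) by simp
  thus False using assms(3) by linarith
qed

text \<open>Homogenised form for the substitutions z = 1 / (1 + T) and z = S / (1 + S): with w the
  denominator, z * w is simply 1 or S.\<close>

lemma cub_scale:
  "w ^ 3 * cub y z = 2 * y * (y - 1) * (z * w) ^ 3 - (y\<^sup>2 - y - 1) * (z * w)\<^sup>2 * w - 2 * y * (z * w) * w\<^sup>2 + y * w ^ 3"
  by (simp add: cub_def algebra_simps power2_eq_square power3_eq_cube)

text \<open>Division by 2 y (y - 1) gives a monic cubic away from 0 and 1. At y0 = 1 and y0 = 0 the
  only finite root is double, equal to 1 and 0 respectively; the coordinates T = 1 / z - 1 and S = 1
  / T give cubics that can be made monic there.\<close>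

lemma cub_root_near:
  assumes c0: "cub y0 z0 = 0" and \<epsilon>: "\<epsilon> > 0"
  shows "eventually (\<lambda>y. \<exists>z. cub y z = 0 \<and> norm (z - z0) < \<epsilon>) (at y0)"
proof -
  consider "y0 \<noteq> 0" "y0 \<noteq> 1" | "y0 = 1" | "y0 = 0" by blast
  thus ?thesis
  proof cases
    case 1
    define p where "p = (\<lambda>y::complex. let L = 2 * y * (y - 1) in [:y / L, - 2 * y / L, - (y\<^sup>2 - y - 1) / L, 1:])"
    have "((\<lambda>y. cub y z0 / (2 * y * (y - 1))) \<longlongrightarrow> cub y0 z0 / (2 * y0 * (y0 - 1))) (at y0)"
      unfolding cub_def using 1 by (intro tendsto_intros) auto
    hence "((\<lambda>y. norm (cub y z0 / (2 * y * (y - 1)))) \<longlongrightarrow> 0) (at y0)" using c0 by (simp add: tendsto_norm_zero)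
    hence "eventually (\<lambda>y. norm (cub y z0 / (2 * y * (y - 1))) < \<epsilon> ^ 3) (at y0)"
      by (rule order_tendstoD) (use \<epsilon> in simp)
    moreover have "eventually (\<lambda>y. y \<noteq> 0) (at y0)" "eventually (\<lambda>y. y \<noteq> 1) (at y0)"
      using 1 by (auto intro!: tendsto_imp_eventually_ne[OF tendsto_ident_at])
    ultimately show ?thesis
    proof eventually_elim
      case (elim y)
      have ev: "poly (p y) z = cub y z / (2 * y * (y - 1))" for z
      proof -
        define L where "L = 2 * y * (y - 1)"
        have L: "L \<noteq> 0" using elim by (simp add: L_def)
        have "poly (p y) z = (y + z * (- 2 * y + z * (- (y\<^sup>2 - y - 1) + z * L))) / L"
          unfolding p_def L_def[symmetric] Let_def using L by (simp add: field_simps)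
        also have "y + z * (- 2 * y + z * (- (y\<^sup>2 - y - 1) + z * L)) = cub y z"
          by (simp add: L_def cub_def algebra_simps power2_eq_square power3_eq_cube)
        finally show ?thesis by (simp add: L_def)
      qed
      have d: "degree (p y) = 3" "lead_coeff (p y) = 1" by (simp_all add: p_def Let_def)
      from monic_root_near[of "p y" z0 \<epsilon>] obtain z where "poly (p y) z = 0" "norm (z - z0) < \<epsilon>"
        using d elim \<epsilon> unfolding ev by auto
      thus ?case using elim unfolding ev by auto
    qed
  next
    case 2
    hence "(z0 - 1) ^ 2 = 0" using c0 by (simp add: cub_def power2_eq_square algebra_simps)
    hence z0: "z0 = 1" by simp
    \<comment> \<open>The 1/2 keeps 1 + T away from 0, and \<epsilon> / 4 leaves room for the factor
      2 in passing from T to z.\<close>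
    define \<delta> where "\<delta> = min (1/2) (\<epsilon> / 4)"
    have \<delta>: "\<delta> > 0" "\<delta> \<le> 1/2" "\<delta> \<le> \<epsilon> / 4" using \<epsilon> by (auto simp: \<delta>_def)
    have "((\<lambda>y::complex. norm ((y - 1)\<^sup>2 / y)) \<longlongrightarrow> norm ((1 - 1)\<^sup>2 / 1 :: complex)) (at 1)"
      by (intro tendsto_intros) auto
    hence "eventually (\<lambda>y. norm ((y - 1)\<^sup>2 / y) < \<delta> ^ 3) (at (1::complex))"
      by (rule order_tendstoD) (use \<delta> in simp)
    moreover have "eventually (\<lambda>y. y \<noteq> 0) (at (1::complex))"
      by (auto intro!: tendsto_imp_eventually_ne[OF tendsto_ident_at])
    ultimately show ?thesis unfolding 2
    proof eventually_elim
      case (elim y)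
      \<comment> \<open>The cubic in T of the statement; its constant term tends to 0 as y tends to
        1, so it has a root near 0.\<close>
      define p where "p = [:(y - 1)\<^sup>2 / y, - (y\<^sup>2 - 1) / y, 1, 1:]"
      from monic_root_near[of p 0 \<delta>] obtain T where T: "poly p T = 0" "norm (T - 0) < \<delta>"
        using elim \<delta> by (auto simp: p_def power3_eq_cube)
      have T1: "norm (1 + T) \<ge> 1/2" using norm_triangle_ineq4[of "1 + T" T] T(2) \<delta> by simp
      hence T1': "1 + T \<noteq> 0" by auto
      define z where "z = 1 / (1 + T)"
      have "(1 + T) ^ 3 * cub y z = 2 * y * (y - 1) - (y\<^sup>2 - y - 1) * (1 + T) - 2 * y * (1 + T)\<^sup>2 + y * (1 + T) ^ 3"
        unfolding cub_scale[of "1 + T"] z_def using T1' by simp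
      also have "\<dots> = y * T ^ 3 + y * T\<^sup>2 - (y\<^sup>2 - 1) * T + (y - 1)\<^sup>2"
        by (simp add: algebra_simps power2_eq_square power3_eq_cube)
      also have "\<dots> = y * poly p T"
        using elim(2) unfolding p_def by (simp add: field_simps power2_eq_square power3_eq_cube)
      finally have "cub y z = 0" using T(1) T1' by simp
      moreover have "norm (z - z0) < \<epsilon>"
      proof -
        have "z - z0 = - T / (1 + T)" using T1' by (simp add: z_def z0 field_simps)
        hence "norm (z - z0) = norm T / norm (1 + T)" by (simp add: norm_divide)
        also have "\<dots> \<le> norm T / (1/2)" using T1 by (intro divide_left_mono mult_pos_pos) auto
        also have "\<dots> < \<epsilon>" using T(2) \<delta> \<epsilon> by simp
        finally show ?thesis .
      qed
      ultimately show ?case by blast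
    qed
  next
    case 3
    hence z0: "z0 = 0" using c0 by (simp add: cub_def)
    define \<delta> where "\<delta> = min (1/2) (\<epsilon> / 4)"
    have \<delta>: "\<delta> > 0" "\<delta> \<le> 1/2" "\<delta> \<le> \<epsilon> / 4" using \<epsilon> by (auto simp: \<delta>_def)
    have "((\<lambda>y::complex. norm (y / (y - 1)\<^sup>2)) \<longlongrightarrow> norm (0 / (0 - 1)\<^sup>2 :: complex)) (at 0)"
      by (intro tendsto_intros) auto
    hence "eventually (\<lambda>y. norm (y / (y - 1)\<^sup>2) < \<delta> ^ 3) (at (0::complex))"
      by (rule order_tendstoD) (use \<delta> in simp)
    moreover have "eventually (\<lambda>y. y \<noteq> 1) (at (0::complex))"
      by (auto intro!: tendsto_imp_eventually_ne[OF tendsto_ident_at])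
    moreover have "eventually (\<lambda>y. y \<noteq> 0) (at (0::complex))" by (simp add: eventually_neq_at_within)
    ultimately show ?thesis unfolding 3
    proof eventually_elim
      case (elim y)
      have y1: "y - 1 \<noteq> 0" using elim by simp
      \<comment> \<open>The cubic in T with its coefficients reversed, divided by (y - 1)^2 / y to
        become monic; its constant term tends to 0 with y.\<close>
      define p where "p = [:y / (y - 1)\<^sup>2, y / (y - 1)\<^sup>2, - (y\<^sup>2 - 1) / (y - 1)\<^sup>2, 1:]"
      from monic_root_near[of p 0 \<delta>] obtain S where S: "poly p S = 0" "norm (S - 0) < \<delta>"
        using elim \<delta> by (auto simp: p_def power3_eq_cube)
      have S1: "norm (1 + S) \<ge> 1/2" using norm_triangle_ineq4[of "1 + S" S] S(2) \<delta> by simp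
      hence S1': "1 + S \<noteq> 0" by auto
      define z where "z = S / (1 + S)"
      have "(1 + S) ^ 3 * cub y z = 2 * y * (y - 1) * S ^ 3 - (y\<^sup>2 - y - 1) * S\<^sup>2 * (1 + S) - 2 * y * S * (1 + S)\<^sup>2 + y * (1 + S) ^ 3"
        unfolding cub_scale[of "1 + S"] z_def using S1' by simp
      also have "\<dots> = (y - 1)\<^sup>2 * S ^ 3 - (y\<^sup>2 - 1) * S\<^sup>2 + y * S + y"
        by (simp add: algebra_simps power2_eq_square power3_eq_cube)
      also have "\<dots> = (y - 1)\<^sup>2 * poly p S"
      proof -
        define d where "d = (y - 1)\<^sup>2"
        have "d \<noteq> 0" using y1 by (simp add: d_def)
        thus ?thesis unfolding p_def d_def[symmetric] by (simp add: field_simps power2_eq_square power3_eq_cube)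
      qed
      finally have "cub y z = 0" using S(1) S1' by simp
      moreover have "norm (z - z0) < \<epsilon>"
      proof -
        have "norm (z - z0) = norm S / norm (1 + S)" by (simp add: z_def z0 norm_divide)
        also have "\<dots> \<le> norm S / (1/2)" using S1 by (intro divide_left_mono mult_pos_pos) auto
        also have "\<dots> < \<epsilon>" using S(2) \<delta> \<epsilon> by simp
        finally show ?thesis .
      qed
      ultimately show ?case by blast
    qed
  qed
qed

lemma seventh_root_near:
  assumes x0: "x0 ^ 7 = y0 ^ 4 * (y0 - 1)" and \<epsilon>: "\<epsilon> > 0"
  shows "eventually (\<lambda>y. \<exists>x. x ^ 7 = y ^ 4 * (y - 1) \<and> norm (x - x0) < \<epsilon>) (at (y0::complex))"
proof -
  have "((\<lambda>y. norm (x0 ^ 7 - y ^ 4 * (y - 1))) \<longlongrightarrow> norm (x0 ^ 7 - y0 ^ 4 * (y0 - 1))) (at y0)"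
    by (intro tendsto_intros)
  hence "eventually (\<lambda>y. norm (x0 ^ 7 - y ^ 4 * (y - 1)) < \<epsilon> ^ 7) (at y0)"
    by (rule order_tendstoD) (use \<epsilon> x0 in simp)
  thus ?thesis
  proof eventually_elim
    case (elim y)
    define p where "p = monom 1 7 + [:- (y ^ 4 * (y - 1)):]"
    have p: "degree p = 7"
      unfolding p_def by (subst degree_add_eq_left) (auto simp: degree_monom_eq)
    have "lead_coeff p = 1" unfolding p unfolding p_def by (simp add: coeff_pCons split: nat.splits)
    from monic_root_near[OF this, of x0 \<epsilon>] p elim \<epsilon> obtain x where "poly p x = 0" "norm (x - x0) < \<epsilon>"
      by (auto simp: p_def poly_monom)
    thus ?case by (intro exI[of _ x]) (simp add: p_def poly_monom)
  qed
qed

text \<open>Every y near the second coordinate of v carries a point of the curve near v, and such y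
  can avoid the finitely many second coordinates that occur in E.\<close>

lemma model_curve_no_isolated_points:
  assumes v: "v \<in> model_curve" and E: "finite E"
  shows "v \<in> closure (model_curve - E)"
  unfolding closure_approachable
proof (intro allI impI)
  fix e :: real assume e: "e > 0"
  define \<epsilon> where "\<epsilon> = e / 3"
  have \<epsilon>: "\<epsilon> > 0" using e by (simp add: \<epsilon>_def)
  define Y where "Y = (\<lambda>w. w$2) ` E"
  have "eventually (\<lambda>y. \<exists>z. cub y z = 0 \<and> norm (z - v$3) < \<epsilon>) (at (v$2))"
    by (rule cub_root_near[OF _ \<epsilon>]) (use v in \<open>simp add: model_curve_def\<close>)
  moreover have "eventually (\<lambda>y. \<exists>x. x ^ 7 = y ^ 4 * (y - 1) \<and> norm (x - v$1) < \<epsilon>) (at (v$2))"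
    by (rule seventh_root_near[OF _ \<epsilon>]) (use v in \<open>simp add: model_curve_def\<close>)
  moreover have "eventually (\<lambda>y. norm (y - v$2) < \<epsilon>) (at (v$2))"
    using \<epsilon> by (auto simp: eventually_at dist_norm intro!: exI[of _ \<epsilon>])
  moreover have "eventually (\<lambda>y. y \<notin> Y) (at (v$2))"
  proof -
    have "finite (Y - {v$2})" using E by (simp add: Y_def)
    hence "open (- (Y - {v$2}))" by (intro open_Compl finite_imp_closed)
    hence "eventually (\<lambda>y. y \<in> - (Y - {v$2})) (at (v$2))"
      by (rule eventually_at_in_open') simp
    moreover have "eventually (\<lambda>y. y \<noteq> v$2) (at (v$2))" by (simp add: eventually_neq_at_within)
    ultimately show ?thesis by eventually_elim auto
  qed
  ultimately have "eventually (\<lambda>y. \<exists>w\<in>model_curve - E. dist w v < e) (at (v$2))"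
  proof eventually_elim
    case (elim y)
    obtain z x where z: "cub y z = 0" "norm (z - v$3) < \<epsilon>" and x: "x ^ 7 = y ^ 4 * (y - 1)" "norm (x - v$1) < \<epsilon>"
      using elim by blast
    define w :: "complex^3" where "w = vector [x, y, z]"
    have w: "w$1 = x" "w$2 = y" "w$3 = z" by (simp_all add: w_def)
    have "w \<in> model_curve - E" using z x elim(4) w by (auto simp: model_curve_def Y_def)
    moreover have "dist w v < e"
    proof -
      have "dist w v \<le> (\<Sum>i\<in>UNIV. norm ((w - v) $ i))"
        unfolding dist_norm norm_vec_def by (rule L2_set_le_sum) simp
      also have "\<dots> = norm (x - v$1) + norm (y - v$2) + norm (z - v$3)" by (simp add: sum_3 w)
      also have "\<dots> < e" using z x elim(3) by (simp add: \<epsilon>_def)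
      finally show ?thesis .
    qed
    ultimately show ?case by blast
  qed
  from eventually_happens'[OF _ this] show "\<exists>w\<in>model_curve - E. dist w v < e" by (simp add: trivial_limit_at)
qed

lemma polyfun_continuous: "polyfun p \<Longrightarrow> continuous_on UNIV p"
  by (induction p rule: polyfun.induct) (auto intro!: continuous_intros)

lemma polyfun_vanishes_on_model_curve:
  assumes p: "polyfun p" and z: "\<And>\<tau>. \<tau> \<in> uhp \<Longrightarrow> p (Psi \<tau>) = 0" and v: "v \<in> model_curve"
  shows "p v = 0"
proof -
  obtain E where E: "finite E" "model_curve - E \<subseteq> Psi ` uhp" using Psi_image_cofinite by blast
  have "closed (p -` {0})"
    using continuous_closed_vimage[of "{0}" p] polyfun_continuous[OF p] by (simp add: continuous_on_eq_continuous_at)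
  moreover have "model_curve - E \<subseteq> p -` {0}" using E(2) z by auto
  ultimately have "closure (model_curve - E) \<subseteq> p -` {0}" by (rule closure_minimal[rotated])
  thus ?thesis using model_curve_no_isolated_points[OF v E(1)] by auto
qed

lemma hol_modular_eventually_nz:
  assumes f: "hol_modular G f" and nz: "\<exists>\<tau>\<in>uhp. f \<tau> \<noteq> 0" and A: "A \<in> SL2Z"
  shows "eventually (\<lambda>\<tau>. f (act A \<tau>) \<noteq> 0) at_ii_inf"
proof -
  have "\<not> eventually (\<lambda>\<tau>. f (act A \<tau>) = 0) at_ii_inf"
  proof
    assume ev: "eventually (\<lambda>\<tau>. f (act A \<tau>) = 0) at_ii_inf"
    obtain \<tau> where \<tau>: "\<tau> \<in> uhp" "f \<tau> \<noteq> 0" using nz by blast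
    have "f (act A (act (minv A) \<tau>)) = 0"
      by (rule hol_eventually_const_imp_const[OF holomorphic_compose_act[OF A hol_modularD(1)[OF f]] ev])
         (intro act_in_uhp minv_SL2Z A \<tau>)
    thus False using \<tau> act_minv'[OF A \<tau>(1)] by simp
  qed
  then obtain h k u where h: "h > 0" and u: "u analytic_on {0}" "u 0 \<noteq> 0"
    and ev: "eventually (\<lambda>\<tau>. f (act A \<tau>) = qpar h \<tau> powi k * u (qpar h \<tau>)) at_ii_inf"
    using mero_inf_normal_form[OF hol_modularD(3)[OF f A]] by blast
  have "(u \<longlongrightarrow> u 0) (at 0)" using analytic_at_imp_isCont[OF u(1)] by (simp add: isCont_def)
  from eventually_qpar_at_0[OF h tendsto_imp_eventually_ne[OF this u(2)]] ev
  show ?thesis by eventually_elim simp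
qed

text \<open>Zeros do not accumulate at a cusp, where the leading term governs the function, nor in a
  compact set.\<close>

lemma hol_modular_zeros_finite:
  assumes f: "hol_modular Gamma_2_7 f" and nz: "\<exists>\<tau>\<in>uhp. f \<tau> \<noteq> 0"
  obtains Z where "finite Z" "Z \<subseteq> uhp" "\<And>\<tau>. \<tau> \<in> uhp \<Longrightarrow> f \<tau> = 0 \<Longrightarrow> \<exists>z\<in>Z. \<exists>\<gamma>\<in>principal_Gamma 14. \<tau> = act \<gamma> z"
proof -
  define S where "S = {\<tau>\<in>uhp. f \<tau> = 0}"
  have hol: "f holomorphic_on uhp" by (rule hol_modularD(1)[OF f])
  obtain Z where Z: "finite Z" "Z \<subseteq> S" "\<And>\<tau>. \<tau> \<in> S \<Longrightarrow> \<exists>z\<in>Z. \<exists>\<gamma>\<in>principal_Gamma 14. \<tau> = act \<gamma> z"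
  proof (rule finite_orbits[of 14 S])
    show "\<tau> \<in> S" if "\<gamma> \<in> principal_Gamma 14" "\<tau> \<in> uhp" "act \<gamma> \<tau> \<in> S" for \<gamma> \<tau>
      using that hol_modularD(2)[OF f, of \<gamma> \<tau>] Gamma_inclusions by (auto simp: S_def)
    show "eventually (\<lambda>\<tau>. act A \<tau> \<notin> S) at_ii_inf" if A: "A \<in> SL2Z" for A
      by (rule eventually_mono[OF hol_modular_eventually_nz[OF f nz A]]) (simp add: S_def)
    show "finite (K \<inter> S)" if K: "compact K" "K \<subseteq> uhp" for K
    proof (cases "f constant_on uhp")
      case True
      hence "S = {}" using nz by (auto simp: constant_on_def S_def)
      thus ?thesis by simp
    next
      case False
      have "finite {z\<in>K. f z = 0}" by (rule holomorphic_compact_finite_zeros[OF hol open_uhp connected_uhp K False])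
      moreover have "K \<inter> S = {z\<in>K. f z = 0}" using K by (auto simp: S_def)
      ultimately show ?thesis by simp
    qed
  qed (auto simp: S_def)
  show ?thesis by (rule that[of Z]) (use Z in \<open>auto simp: S_def\<close>)
qed

subsection \<open>Poles in the upper half-plane\<close>

text \<open>The action has the continuous inverse \<open>act (minv A)\<close>; limits and poles can
  therefore be moved along orbits.\<close>

lemma filtermap_act:
  assumes A: "A \<in> SL2Z" and \<tau>: "\<tau> \<in> uhp"
  shows "filtermap (act A) (at \<tau>) = at (act A \<tau>)"
proof (rule filtermap_fun_inverse)
  have *: "filterlim (act B) (at (act B \<sigma>)) (at \<sigma>)" if B: "B \<in> SL2Z" and \<sigma>: "\<sigma> \<in> uhp" for B \<sigma>
  proof -
    have "act B \<midarrow>\<sigma>\<rightarrow> act B \<sigma>"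
      using act_holomorphic[OF B] \<sigma> open_uhp holomorphic_on_imp_continuous_on continuous_on_eq_continuous_at isContD by metis
    moreover have "eventually (\<lambda>w. act B w \<noteq> act B \<sigma>) (at \<sigma>)"
    proof -
      have "eventually (\<lambda>w. w \<in> uhp - {\<sigma>}) (at \<sigma>)" by (rule eventually_at_in_open[OF open_uhp \<sigma>])
      thus ?thesis by eventually_elim (use act_minv[OF B] \<sigma> in \<open>metis DiffE singletonI\<close>)
    qed
    ultimately show ?thesis unfolding filterlim_at by auto
  qed
  show "filterlim (act (minv A)) (at \<tau>) (at (act A \<tau>))"
    using *[of "minv A" "act A \<tau>"] A \<tau> act_in_uhp act_minv by simp
  show "filterlim (act A) (at (act A \<tau>)) (at \<tau>)" by (rule *[OF A \<tau>])
  have "eventually (\<lambda>w. w \<in> uhp - {act A \<tau>}) (at (act A \<tau>))" by (rule eventually_at_in_open[OF open_uhp act_in_uhp[OF A \<tau>]])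
  thus "eventually (\<lambda>w. act A (act (minv A) w) = w) (at (act A \<tau>))"
    by eventually_elim (use act_minv'[OF A] in auto)
qed

lemma is_pole_act:
  assumes "A \<in> SL2Z" "\<tau> \<in> uhp" "\<And>w. w \<in> uhp \<Longrightarrow> f (act A w) = f w"
  shows "is_pole f (act A \<tau>) \<longleftrightarrow> is_pole f \<tau>"
proof -
  have "is_pole f (act A \<tau>) \<longleftrightarrow> is_pole (\<lambda>w. f (act A w)) \<tau>"
    unfolding is_pole_def filtermap_act[OF assms(1,2), symmetric] filterlim_filtermap ..
  also have "eventually (\<lambda>w. w \<in> uhp) (at \<tau>)" by (rule eventually_at_in_open'[OF open_uhp assms(2)])
  hence "eventually (\<lambda>w. f (act A w) = f w) (at \<tau>)" by eventually_elim (rule assms(3))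
  hence "is_pole (\<lambda>w. f (act A w)) \<tau> \<longleftrightarrow> is_pole f \<tau>" by (intro is_pole_cong) auto
  finally show ?thesis .
qed

lemma qpar_analytic: "h > 0 \<Longrightarrow> qpar h analytic_on S"
  unfolding qpar_def by (intro analytic_intros) auto

lemma mero_inf_analytic:
  assumes "meromorphic_at_i_infinity f"
  shows "eventually (\<lambda>\<tau>. f analytic_on {\<tau>}) at_ii_inf"
proof -
  obtain h g where h: "h > 0" and g: "g meromorphic_on {0}"
    and ev: "eventually (\<lambda>\<tau>. f \<tau> = g (qpar h \<tau>)) at_ii_inf"
    using assms unfolding mero_inf_altdef by blast
  have "isolated_singularity_at g 0" using g by (simp add: meromorphic_at_iff)
  then obtain r where r: "r > 0" "g analytic_on ball 0 r - {0}" by (auto simp: isolated_singularity_at_def)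
  have "eventually (\<lambda>w. w \<in> ball 0 r - {0}) (at (0::complex))"
    using r by (intro eventually_at_in_open) auto
  from eventually_conj[OF eventually_qpar_at_0[OF h this] ev]
  obtain c where c: "\<And>\<tau>. Im \<tau> > c \<Longrightarrow> qpar h \<tau> \<in> ball 0 r - {0} \<and> f \<tau> = g (qpar h \<tau>)"
    unfolding eventually_at_ii_inf by blast
  have "f analytic_on {\<tau>}" if \<tau>: "Im \<tau> > c" for \<tau>
  proof -
    have "(g \<circ> qpar h) analytic_on {\<tau>}"
      using c[OF \<tau>] by (intro analytic_on_compose qpar_analytic[OF h] analytic_on_subset[OF r(2)]) auto
    moreover have "eventually (\<lambda>w. w \<in> {w. Im w > c}) (nhds \<tau>)"
      using \<tau> by (intro eventually_nhds_in_open open_halfspace_Im_gt) auto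
    hence "eventually (\<lambda>w. (g \<circ> qpar h) w = f w) (nhds \<tau>)" by eventually_elim (use c in auto)
    ultimately show ?thesis using analytic_at_cong by blast
  qed
  thus ?thesis unfolding eventually_at_ii_inf by blast
qed

text \<open>A meromorphic expansion is analytic in a punctured disc about the cusp, so there are no
  poles near cusps and \<open>uhp_normal\<close> changes nothing there.\<close>

lemma mero_inf_act_analytic:
  assumes A: "A \<in> SL2Z" and f: "meromorphic_at_i_infinity (\<lambda>\<tau>. f (act A \<tau>))"
  shows "eventually (\<lambda>\<tau>. f analytic_on {act A \<tau>}) at_ii_inf"
  using mero_inf_analytic[OF f] eventually_uhp_at_ii_inf
proof eventually_elim
  case (elim \<tau>)
  have "((\<lambda>\<tau>. f (act A \<tau>)) \<circ> act (minv A)) analytic_on {act A \<tau>}"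
  proof (rule analytic_on_compose)
    show "act (minv A) analytic_on {act A \<tau>}"
      using act_holomorphic[OF minv_SL2Z[OF A]] open_uhp act_in_uhp[OF A elim(2)] holomorphic_on_imp_analytic_at by blast
    show "(\<lambda>\<tau>. f (act A \<tau>)) analytic_on act (minv A) ` {act A \<tau>}"
      using elim act_minv[OF A] by simp
  qed
  moreover have "eventually (\<lambda>w. w \<in> uhp) (nhds (act A \<tau>))"
    using open_uhp act_in_uhp[OF A elim(2)] by (rule eventually_nhds_in_open)
  hence "eventually (\<lambda>w. ((\<lambda>\<tau>. f (act A \<tau>)) \<circ> act (minv A)) w = f w) (nhds (act A \<tau>))"
    by eventually_elim (use act_minv'[OF A] in auto)
  ultimately show ?case using analytic_at_cong by blast
qed

lemma uhp_normal_in_modular_functions: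
  assumes G: "G \<subseteq> SL2Z" and mero: "f meromorphic_on uhp"
    and inv: "\<And>A \<tau>. A \<in> G \<Longrightarrow> \<tau> \<in> uhp \<Longrightarrow> f (act A \<tau>) = f \<tau>"
    and cusp: "\<And>A. A \<in> SL2Z \<Longrightarrow> meromorphic_at_i_infinity (\<lambda>\<tau>. f (act A \<tau>))"
  shows "uhp_normal f \<in> modular_functions G"
  unfolding modular_functions_def
proof (intro CollectI conjI allI impI ballI)
  have "remove_sings f nicely_meromorphic_on uhp" by (rule remove_sings_nicely_meromorphic[OF mero])
  moreover have ev: "eventually (\<lambda>w. remove_sings f w = uhp_normal f w) (at z)" if "z \<in> uhp" for z
    using eventually_at_in_open'[OF open_uhp that] by eventually_elim (simp add: uhp_normal_def)
  ultimately show "uhp_normal f nicely_meromorphic_on uhp"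
    unfolding nicely_meromorphic_on_def
    using meromorphic_on_cong[of uhp "remove_sings f" "uhp_normal f" uhp] is_pole_cong[OF ev] tendsto_cong[OF ev]
    by (auto simp: uhp_normal_def)
  show "uhp_normal f \<tau> = 0" if "\<tau> \<notin> uhp" for \<tau> using that by (simp add: uhp_normal_def)
  show "uhp_normal f (act A \<tau>) = uhp_normal f \<tau>" if "A \<in> G" "\<tau> \<in> uhp" for A \<tau>
  proof -
    have A: "A \<in> SL2Z" using that G by blast
    have "remove_sings f (act A \<tau>) = remove_sings (f \<circ> act A) \<tau>"
      by (rule remove_sings_compose[OF filtermap_act[OF A that(2)], symmetric])
    also have "\<dots> = remove_sings f \<tau>"
      by (rule remove_sings_cong[OF eventually_mono[OF eventually_at_in_open'[OF open_uhp that(2)]]])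
         (use inv that in auto)
    finally show ?thesis using that A act_in_uhp by (simp add: uhp_normal_def)
  qed
  fix A assume A: "A \<in> SL2Z"
  have "eventually (\<lambda>\<tau>. f (act A \<tau>) = uhp_normal f (act A \<tau>)) at_ii_inf"
    using mero_inf_act_analytic[OF A cusp[OF A]] eventually_uhp_at_ii_inf
    by eventually_elim (use A act_in_uhp in \<open>simp add: uhp_normal_def\<close>)
  thus "meromorphic_at_i_infinity (\<lambda>\<tau>. uhp_normal f (act A \<tau>))"
    by (rule mero_inf_cong[OF cusp[OF A]])
qed

lemma modular_functionsD:
  assumes "f \<in> modular_functions G"
  shows "f nicely_meromorphic_on uhp" "f meromorphic_on uhp" "\<And>\<tau>. \<tau> \<notin> uhp \<Longrightarrow> f \<tau> = 0"
    "\<And>A \<tau>. A \<in> G \<Longrightarrow> \<tau> \<in> uhp \<Longrightarrow> f (act A \<tau>) = f \<tau>"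
    "\<And>A. A \<in> SL2Z \<Longrightarrow> meromorphic_at_i_infinity (\<lambda>\<tau>. f (act A \<tau>))"
  using assms by (auto simp: modular_functions_def nicely_meromorphic_on_def)

lemma hol_modular_if_no_poles:
  assumes "f \<in> modular_functions G" "\<And>\<tau>. \<tau> \<in> uhp \<Longrightarrow> \<not> is_pole f \<tau>"
  shows "hol_modular G f"
proof -
  have "f analytic_on uhp"
    by (rule nicely_meromorphic_without_singularities[OF modular_functionsD(1)[OF assms(1)]]) (use assms(2) in auto)
  thus ?thesis
    unfolding hol_modular_def using modular_functionsD(4,5)[OF assms(1)] analytic_imp_holomorphic by blast
qed

lemma modular_function_poles:
  assumes f: "f \<in> modular_functions Gamma_2_7"
  obtains Z where "finite Z" "Z \<subseteq> uhp"
    "\<And>\<tau>. \<tau> \<in> uhp \<Longrightarrow> is_pole f \<tau> \<Longrightarrow> \<exists>z\<in>Z. \<exists>\<gamma>\<in>principal_Gamma 14. \<tau> = act \<gamma> z"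
proof -
  define S where "S = {\<tau>\<in>uhp. is_pole f \<tau>}"
  obtain Z where Z: "finite Z" "Z \<subseteq> S" "\<And>\<tau>. \<tau> \<in> S \<Longrightarrow> \<exists>z\<in>Z. \<exists>\<gamma>\<in>principal_Gamma 14. \<tau> = act \<gamma> z"
  proof (rule finite_orbits[of 14 S])
    show "\<tau> \<in> S" if "\<gamma> \<in> principal_Gamma 14" "\<tau> \<in> uhp" "act \<gamma> \<tau> \<in> S" for \<gamma> \<tau>
    proof -
      have "\<gamma> \<in> Gamma_2_7" "\<gamma> \<in> SL2Z" using that(1) Gamma_inclusions by blast+
      thus ?thesis using is_pole_act[of \<gamma> \<tau> f] modular_functionsD(4)[OF f] that by (auto simp: S_def)
    qed
    show "eventually (\<lambda>\<tau>. act A \<tau> \<notin> S) at_ii_inf" if A: "A \<in> SL2Z" for A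
      using mero_inf_act_analytic[OF A modular_functionsD(5)[OF f A]]
      by eventually_elim (auto simp: S_def dest: analytic_at_imp_no_pole)
    show "finite (K \<inter> S)" if K: "compact K" "K \<subseteq> uhp" for K
    proof -
      have "{w. \<not> f analytic_on {w}} sparse_in K"
        using sparse_in_subset[OF meromorphic_on_imp_sparse_singularities[OF modular_functionsD(2)[OF f]] K(2)] .
      hence "finite (K \<inter> {w. \<not> f analytic_on {w}})" using K(1) by (rule sparse_in_compact_finite)
      moreover have "K \<inter> S \<subseteq> K \<inter> {w. \<not> f analytic_on {w}}" by (auto simp: S_def dest: analytic_at_imp_no_pole)
      ultimately show ?thesis by (rule finite_subset[rotated])
    qed
  qed (auto simp: S_def)
  show ?thesis by (rule that[of Z]) (use Z in \<open>auto simp: S_def\<close>)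
qed

lemma hol_meromorphic: "f holomorphic_on uhp \<Longrightarrow> f meromorphic_on uhp"
  using open_uhp analytic_on_open analytic_on_imp_meromorphic_on by blast

lemma hol_nonzero_cosparse:
  assumes "f holomorphic_on uhp" "\<exists>\<tau>\<in>uhp. f \<tau> \<noteq> 0"
  shows "\<forall>\<^sub>\<approx>\<tau>\<in>uhp. f \<tau> \<noteq> 0"
proof -
  have "f nicely_meromorphic_on uhp"
    using assms(1) open_uhp by (intro analytic_on_imp_nicely_meromorphic_on) (simp add: analytic_on_open)
  from nicely_meromorphic_imp_constant_or_avoid[OF this open_uhp connected_uhp, of 0] show ?thesis
    using assms(2) by blast
qed

text \<open>The difference g w - g z vanishes at z at least to first order, so as many factors as
  the order of the pole cancel it.\<close>

lemma pole_times_power_limit: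
  assumes f: "f meromorphic_on {z}" and g: "g field_differentiable (at z)"
  shows "\<exists>n l. (\<lambda>w. f w * (g w - g z) ^ n) \<midarrow>z\<rightarrow> l"
proof (cases "is_pole f z")
  case False
  hence "\<exists>l. f \<midarrow>z\<rightarrow> l" using f by (auto simp: meromorphic_at_iff not_essential_def)
  hence "\<exists>l. (\<lambda>w. f w * (g w - g z) ^ 0) \<midarrow>z\<rightarrow> l" by simp
  thus ?thesis by blast
next
  case True
  have iso: "isolated_singularity_at f z" "not_essential f z" using f by (auto simp: meromorphic_at_iff)
  have nz: "\<exists>\<^sub>F w in at z. f w \<noteq> 0"
    using non_zero_neighbour_pole[OF True] by (intro eventually_frequently) auto
  define k where "k = zorder f z"
  define h where "h = zor_poly f z"
  obtain r where r: "r > 0" "h holomorphic_on cball z r" "\<And>w. w \<in> cball z r - {z} \<Longrightarrow> f w = h w * (w - z) powi k"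
    using zorder_exist[OF iso nz] unfolding k_def h_def by blast
  define n where "n = nat (- k)"
  define m where "m = nat (int n + k)"
  have m: "int m = int n + k" by (simp add: m_def n_def)
  have "h holomorphic_on ball z r" using r(2) by (rule holomorphic_on_subset) auto
  hence "isCont h z"
    using holomorphic_on_imp_continuous_on continuous_on_eq_continuous_at[OF open_ball] r(1) by (metis centre_in_ball)
  hence h: "h \<midarrow>z\<rightarrow> h z" by (simp add: isCont_def)
  obtain d where "(g has_field_derivative d) (at z)" using g by (auto simp: field_differentiable_def)
  hence q: "(\<lambda>w. (g w - g z) / (w - z)) \<midarrow>z\<rightarrow> d" by (simp add: has_field_derivative_iff)
  have lim: "(\<lambda>w. h w * (w - z) ^ m * ((g w - g z) / (w - z)) ^ n) \<midarrow>z\<rightarrow> h z * (z - z) ^ m * d ^ n"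
    by (intro tendsto_intros h q)
  have "eventually (\<lambda>w. h w * (w - z) ^ m * ((g w - g z) / (w - z)) ^ n = f w * (g w - g z) ^ n) (at z)"
  proof -
    have "eventually (\<lambda>w. w \<in> ball z r - {z}) (at z)" using r(1) by (intro eventually_at_in_open) auto
    thus ?thesis
    proof eventually_elim
      case (elim w)
      have wz: "w - z \<noteq> 0" using elim by auto
      have "(w - z) powi int m = (w - z) powi k * (w - z) powi int n"
        unfolding m add.commute[of "int n"] using wz by (intro power_int_add) auto
      hence "(w - z) ^ m = (w - z) powi k * (w - z) ^ n" by simp
      thus ?case using r(3)[of w] elim wz by (simp add: power_divide)
    qed
  qed
  from Lim_transform_eventually[OF lim this] show ?thesis by blast
qed

text \<open>D vanishes at the \<upsilon>-values of representatives of all poles. As \<upsilon> and f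
  are constant on orbits, clearing the pole at a representative clears it on the whole orbit. The
  equality is claimed off a sparse set because the quotient takes default values at zeros of its
  denominator.\<close>

lemma modular_function_is_quotient:
  assumes f: "f \<in> modular_functions Gamma_2_7"
  obtains P Q where "polyfun P" "polyfun Q" "\<exists>\<tau>\<in>uhp. Q (Psi \<tau>) \<noteq> 0"
    "\<forall>\<^sub>\<approx>\<tau>\<in>uhp. f \<tau> = P (Psi \<tau>) / Q (Psi \<tau>)"
proof -
  obtain Z where Z: "finite Z" "Z \<subseteq> uhp"
    "\<And>\<tau>. \<tau> \<in> uhp \<Longrightarrow> is_pole f \<tau> \<Longrightarrow> \<exists>z\<in>Z. \<exists>\<gamma>\<in>principal_Gamma 14. \<tau> = act \<gamma> z"
    using modular_function_poles[OF f] by blast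
  have fd: "ups0 field_differentiable (at z)" if "z \<in> uhp" for z
    using ups0_holomorphic open_uhp that holomorphic_on_imp_differentiable_at by blast
  have "\<forall>z\<in>Z. \<exists>n. \<exists>l. (\<lambda>w. f w * (ups0 w - ups0 z) ^ n) \<midarrow>z\<rightarrow> l"
    using pole_times_power_limit[OF meromorphic_on_subset[OF modular_functionsD(2)[OF f]] fd] Z(2) by (meson empty_subsetI insert_subset subsetD)
  then obtain n where n: "\<And>z. z \<in> Z \<Longrightarrow> \<exists>l. (\<lambda>w. f w * (ups0 w - ups0 z) ^ n z) \<midarrow>z\<rightarrow> l"
    using bchoice[of Z "\<lambda>z n. \<exists>l. (\<lambda>w. f w * (ups0 w - ups0 z) ^ n) \<midarrow>z\<rightarrow> l"] by blast
  define D where "D = (\<Prod>z\<in>Z. [:- ups0 z, 1:] ^ n z)"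
  have D0: "D \<noteq> 0" using Z(1) by (simp add: D_def)
  have Dnz: "\<exists>\<tau>\<in>uhp. poly D (ups0 \<tau>) \<noteq> 0" by (rule poly_ups0_nonzero[OF D0])
  define F where "F = (\<lambda>\<tau>. f \<tau> * poly D (ups0 \<tau>))"
  have DD: "hol_modular Gamma_2_7 (\<lambda>\<tau>. poly D (ups0 \<tau>))" by (rule hol_modular_poly[OF hol_modular_Gamma_2_7(2)])
  have Dmero: "(\<lambda>\<tau>. poly D (ups0 \<tau>)) meromorphic_on uhp"
    by (rule hol_meromorphic[OF hol_modularD(1)[OF DD]])
  have F: "F meromorphic_on uhp"
    unfolding F_def by (intro meromorphic_intros Dmero modular_functionsD(2)[OF f])
  have Finv: "F (act A \<tau>) = F \<tau>" if "A \<in> Gamma_2_7" "\<tau> \<in> uhp" for A \<tau>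
    unfolding F_def using modular_functionsD(4)[OF f that] hol_modularD(2)[OF DD that] by simp
  have Fmod: "uhp_normal F \<in> modular_functions Gamma_2_7"
  proof (rule uhp_normal_in_modular_functions[OF _ F Finv])
    show "Gamma_2_7 \<subseteq> SL2Z" using Gamma_inclusions by blast
    show "meromorphic_at_i_infinity (\<lambda>\<tau>. F (act A \<tau>))" if "A \<in> SL2Z" for A
      unfolding F_def by (intro mero_inf_mult modular_functionsD(5)[OF f that] hol_modularD(3)[OF DD that])
  qed
  have lim: "\<exists>l. F \<midarrow>z\<rightarrow> l" if z: "z \<in> Z" for z
  proof -
    obtain l where l: "(\<lambda>w. f w * (ups0 w - ups0 z) ^ n z) \<midarrow>z\<rightarrow> l" using n[OF z] by blast
    have u: "ups0 \<midarrow>z\<rightarrow> ups0 z"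
      using fd z Z(2) field_differentiable_imp_continuous_at isCont_def by blast
    have "(\<lambda>w. (f w * (ups0 w - ups0 z) ^ n z) * poly (\<Prod>y\<in>Z-{z}. [:- ups0 y, 1:] ^ n y) (ups0 w)) \<midarrow>z\<rightarrow>
        l * poly (\<Prod>y\<in>Z-{z}. [:- ups0 y, 1:] ^ n y) (ups0 z)"
      by (intro tendsto_mult l tendsto_poly u)
    moreover have "(\<lambda>w. (f w * (ups0 w - ups0 z) ^ n z) * poly (\<Prod>y\<in>Z-{z}. [:- ups0 y, 1:] ^ n y) (ups0 w)) = F"
      unfolding F_def D_def using prod.remove[OF Z(1) z, of "\<lambda>z. [:- ups0 z, 1:] ^ n z"] by (simp add: fun_eq_iff)
    ultimately show ?thesis by auto
  qed
  have nopole: "\<not> is_pole F \<tau>" if \<tau>: "\<tau> \<in> uhp" for \<tau>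
  proof (cases "is_pole f \<tau>")
    case True
    then obtain z \<gamma> where z: "z \<in> Z" "\<gamma> \<in> principal_Gamma 14" "\<tau> = act \<gamma> z" using Z(3) \<tau> by blast
    have \<gamma>: "\<gamma> \<in> Gamma_2_7" "\<gamma> \<in> SL2Z" using z(2) Gamma_inclusions by blast+
    have "\<not> is_pole F z"
      using lim[OF z(1)] by (meson at_neq_bot is_pole_def not_tendsto_and_filterlim_at_infinity)
    thus ?thesis unfolding z(3) using is_pole_act[of \<gamma> z F] \<gamma> z(1) Z(2) Finv by blast
  next
    case False
    have "f analytic_on {\<tau>}" by (rule nicely_meromorphic_on_imp_analytic_at[OF modular_functionsD(1)[OF f] \<tau> False])
    moreover have "(\<lambda>\<tau>. poly D (ups0 \<tau>)) analytic_on {\<tau>}"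
      using hol_modularD(1)[OF DD] open_uhp \<tau> holomorphic_on_imp_analytic_at by blast
    ultimately have "F analytic_on {\<tau>}" unfolding F_def by (rule analytic_on_mult)
    thus ?thesis by (rule analytic_at_imp_no_pole)
  qed
  have "hol_modular Gamma_2_7 (uhp_normal F)"
  proof (rule hol_modular_if_no_poles[OF Fmod])
    fix \<tau> assume \<tau>: "\<tau> \<in> uhp"
    have "eventually (\<lambda>w. uhp_normal F w = remove_sings F w) (at \<tau>)"
      using eventually_at_in_open'[OF open_uhp \<tau>] by eventually_elim (simp add: uhp_normal_def)
    hence "is_pole (uhp_normal F) \<tau> \<longleftrightarrow> is_pole (remove_sings F) \<tau>" by (intro is_pole_cong) auto
    also have "\<dots> \<longleftrightarrow> is_pole F \<tau>"
      using meromorphic_on_isolated_singularity[OF meromorphic_on_subset[OF F]] \<tau> by simp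
    finally show "\<not> is_pole (uhp_normal F) \<tau>" using nopole[OF \<tau>] by blast
  qed
  from rat_Gamma_2_7[OF this] obtain P Q where PQ: "polyfun P" "polyfun Q" "\<exists>\<tau>\<in>uhp. Q (Psi \<tau>) \<noteq> 0"
    "\<And>\<tau>. \<tau> \<in> uhp \<Longrightarrow> uhp_normal F \<tau> * Q (Psi \<tau>) = P (Psi \<tau>)" unfolding rat_def by blast
  define Q' where "Q' = (\<lambda>v. poly D (v $ 2) * Q v)"
  have Q': "polyfun Q'" unfolding Q'_def by (intro polyfun.mult polyfun_poly polyfun.coord PQ)
  have Q'nz: "\<exists>\<tau>\<in>uhp. Q' (Psi \<tau>) \<noteq> 0"
    unfolding Q'_def Psi_components by (intro hol_mult_nonzero Dnz PQ polyfun_hol hol_modularD(1)[OF DD])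
  show ?thesis
  proof (rule that[OF PQ(1) Q' Q'nz])
    have "\<forall>\<^sub>\<approx>\<tau>\<in>uhp. Q' (Psi \<tau>) \<noteq> 0" by (rule hol_nonzero_cosparse[OF polyfun_hol[OF Q'] Q'nz])
    thus "\<forall>\<^sub>\<approx>\<tau>\<in>uhp. f \<tau> = P (Psi \<tau>) / Q' (Psi \<tau>)"
      using eventually_remove_sings_eq[OF F] eventually_in_cosparse[OF order_refl open_uhp]
    proof eventually_elim
      case (elim \<tau>)
      have "f \<tau> * poly D (ups0 \<tau>) * Q (Psi \<tau>) = P (Psi \<tau>)"
        using PQ(4)[OF elim(3)] elim(2,3) by (simp add: uhp_normal_def F_def)
      thus ?case using elim(1) by (simp add: Q'_def field_simps)
    qed
  qed
qed

subsection \<open>The function field\<close>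

text \<open>Removing singularities looks only at punctured neighbourhoods, so equality off a sparse
  set suffices.\<close>

lemma uhp_normal_cong:
  assumes "\<forall>\<^sub>\<approx>\<tau>\<in>uhp. f \<tau> = g \<tau>"
  shows "uhp_normal f = uhp_normal g"
  using assms unfolding uhp_normal_def eventually_cosparse_open_eq[OF open_uhp]
  by (auto intro!: ext remove_sings_cong)

lemma eventually_uhp_normal_eq:
  assumes "f meromorphic_on uhp"
  shows "\<forall>\<^sub>\<approx>\<tau>\<in>uhp. uhp_normal f \<tau> = f \<tau>"
  using eventually_remove_sings_eq[OF assms] eventually_in_cosparse[OF order_refl open_uhp]
  by eventually_elim (simp add: uhp_normal_def)

lemma uhp_normal_hol: "f holomorphic_on uhp \<Longrightarrow> \<tau> \<in> uhp \<Longrightarrow> uhp_normal f \<tau> = f \<tau>"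
  using holomorphic_on_imp_analytic_at[OF _ open_uhp] by (simp add: uhp_normal_def)

lemma modular_function_uhp_normal:
  assumes "f \<in> modular_functions G"
  shows "uhp_normal f = f"
proof
  fix \<tau>
  show "uhp_normal f \<tau> = f \<tau>"
    using modular_functionsD(1)[OF assms] modular_functionsD(3)[OF assms, of \<tau>] remove_sings_eqI[of f \<tau> "f \<tau>"]
    by (auto simp: uhp_normal_def nicely_meromorphic_on_def)
qed

lemma cosparse_hol_eq:
  assumes "f holomorphic_on uhp" "g holomorphic_on uhp" "\<forall>\<^sub>\<approx>\<tau>\<in>uhp. f \<tau> = g \<tau>" "\<tau> \<in> uhp"
  shows "f \<tau> = g \<tau>"
proof -
  have "uhp_normal f \<tau> = uhp_normal g \<tau>" using uhp_normal_cong[OF assms(3)] by simp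
  thus ?thesis using uhp_normal_hol assms by simp
qed

definition frac_value :: "(complex^3 \<Rightarrow> complex) \<times> (complex^3 \<Rightarrow> complex) \<Rightarrow> complex \<Rightarrow> complex" where
  "frac_value x = uhp_normal (\<lambda>\<tau>. fst x (Psi \<tau>) / snd x (Psi \<tau>))"

abbreviation "model_ring \<equiv> coordinate_ring model_curve"

lemma model_ring_simps [simp]:
  "mult model_ring f g = (\<lambda>x\<in>model_curve. f x * g x)" "add model_ring f g = (\<lambda>x\<in>model_curve. f x + g x)"
  "one model_ring = (\<lambda>x\<in>model_curve. 1)" "zero model_ring = (\<lambda>x\<in>model_curve. 0)"
  by (simp_all add: coordinate_ring_def)

lemma carrier_model_ring_iff: "a \<in> carrier model_ring \<longleftrightarrow> (\<exists>p. polyfun p \<and> a = restrict p model_curve)"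
  by (auto simp: coordinate_ring_def)

lemma model_ring_closed:
  assumes "a \<in> carrier model_ring" "b \<in> carrier model_ring"
  shows "a \<otimes>\<^bsub>model_ring\<^esub> b \<in> carrier model_ring" "a \<oplus>\<^bsub>model_ring\<^esub> b \<in> carrier model_ring"
proof -
  obtain p q where pq: "polyfun p" "polyfun q" "a = restrict p model_curve" "b = restrict q model_curve"
    using assms by (auto simp: carrier_model_ring_iff)
  have "a \<otimes>\<^bsub>model_ring\<^esub> b = restrict (\<lambda>x. p x * q x) model_curve" "a \<oplus>\<^bsub>model_ring\<^esub> b = restrict (\<lambda>x. p x + q x) model_curve"
    using pq by (auto simp: fun_eq_iff)
  thus "a \<otimes>\<^bsub>model_ring\<^esub> b \<in> carrier model_ring" "a \<oplus>\<^bsub>model_ring\<^esub> b \<in> carrier model_ring"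
    unfolding carrier_model_ring_iff using pq polyfun.mult polyfun.add by blast+
qed

lemma model_ring_const: "(\<lambda>x\<in>model_curve. c) \<in> carrier model_ring"
  unfolding carrier_model_ring_iff using polyfun.const[of c] by blast

lemma model_ring_hol:
  assumes "a \<in> carrier model_ring"
  shows "(\<lambda>\<tau>. a (Psi \<tau>)) holomorphic_on uhp"
proof -
  obtain p where p: "polyfun p" "a = restrict p model_curve" using assms by (auto simp: carrier_model_ring_iff)
  show ?thesis
    by (rule holomorphic_transform[OF polyfun_hol[OF p(1)]]) (simp add: p Psi_in_model_curve)
qed

lemma model_ring_eqI:
  assumes "a \<in> carrier model_ring" "b \<in> carrier model_ring" "\<And>\<tau>. \<tau> \<in> uhp \<Longrightarrow> a (Psi \<tau>) = b (Psi \<tau>)"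
  shows "a = b"
proof -
  obtain p q where pq: "polyfun p" "polyfun q" "a = restrict p model_curve" "b = restrict q model_curve"
    using assms by (auto simp: carrier_model_ring_iff)
  have "p v - q v = 0" if "v \<in> model_curve" for v
    using polyfun_vanishes_on_model_curve[OF polyfun_diff[OF pq(1,2)] _ that] assms(3) pq(3,4) Psi_in_model_curve by simp
  thus ?thesis using pq(3,4) by (auto simp: fun_eq_iff restrict_def)
qed

text \<open>An element of the coordinate ring is determined by its pullback along
  \<open>Psi\<close>, so a denominator is nonzero when its pullback is not identically zero.\<close>

lemma frac_carrier_model_ring:
  "(a, b) \<in> frac_carrier model_ring \<longleftrightarrow> a \<in> carrier model_ring \<and> b \<in> carrier model_ring \<and> (\<exists>\<tau>\<in>uhp. b (Psi \<tau>) \<noteq> 0)"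
proof -
  have "b = \<zero>\<^bsub>model_ring\<^esub> \<longleftrightarrow> (\<forall>\<tau>\<in>uhp. b (Psi \<tau>) = 0)" if "b \<in> carrier model_ring"
    using model_ring_eqI[OF that, of "\<zero>\<^bsub>model_ring\<^esub>"] model_ring_const[of 0] Psi_in_model_curve by auto
  thus ?thesis unfolding frac_carrier_def by blast
qed

lemma frac_carrier_closed:
  assumes "(a, b) \<in> frac_carrier model_ring" "(c, d) \<in> frac_carrier model_ring"
  shows "(a \<otimes>\<^bsub>model_ring\<^esub> c, b \<otimes>\<^bsub>model_ring\<^esub> d) \<in> frac_carrier model_ring"
    "(a \<otimes>\<^bsub>model_ring\<^esub> d \<oplus>\<^bsub>model_ring\<^esub> c \<otimes>\<^bsub>model_ring\<^esub> b, b \<otimes>\<^bsub>model_ring\<^esub> d) \<in> frac_carrier model_ring"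
proof -
  have c: "a \<in> carrier model_ring" "b \<in> carrier model_ring" "c \<in> carrier model_ring" "d \<in> carrier model_ring"
    using assms by (auto simp: frac_carrier_model_ring)
  have "\<exists>\<tau>\<in>uhp. b (Psi \<tau>) * d (Psi \<tau>) \<noteq> 0"
    using assms by (intro hol_mult_nonzero model_ring_hol) (auto simp: frac_carrier_model_ring)
  hence "\<exists>\<tau>\<in>uhp. (b \<otimes>\<^bsub>model_ring\<^esub> d) (Psi \<tau>) \<noteq> 0" by (auto simp: Psi_in_model_curve)
  thus "(a \<otimes>\<^bsub>model_ring\<^esub> c, b \<otimes>\<^bsub>model_ring\<^esub> d) \<in> frac_carrier model_ring"
    "(a \<otimes>\<^bsub>model_ring\<^esub> d \<oplus>\<^bsub>model_ring\<^esub> c \<otimes>\<^bsub>model_ring\<^esub> b, b \<otimes>\<^bsub>model_ring\<^esub> d) \<in> frac_carrier model_ring"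
    unfolding frac_carrier_model_ring using c model_ring_closed by blast+
qed

lemma frac_value_meromorphic:
  assumes "(a, b) \<in> frac_carrier model_ring"
  shows "(\<lambda>\<tau>. a (Psi \<tau>) / b (Psi \<tau>)) meromorphic_on uhp"
  using assms by (intro meromorphic_on_divide hol_meromorphic model_ring_hol) (auto simp: frac_carrier_model_ring)

lemma eventually_frac_value:
  assumes "(a, b) \<in> frac_carrier model_ring"
  shows "\<forall>\<^sub>\<approx>\<tau>\<in>uhp. \<tau> \<in> uhp \<and> b (Psi \<tau>) \<noteq> 0 \<and> frac_value (a, b) \<tau> = a (Psi \<tau>) / b (Psi \<tau>)"
proof -
  have "\<forall>\<^sub>\<approx>\<tau>\<in>uhp. b (Psi \<tau>) \<noteq> 0"
    using assms by (intro hol_nonzero_cosparse model_ring_hol) (auto simp: frac_carrier_model_ring)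
  thus ?thesis
    using eventually_uhp_normal_eq[OF frac_value_meromorphic[OF assms]] eventually_in_cosparse[OF order_refl open_uhp]
    by eventually_elim (simp add: frac_value_def)
qed

text \<open>From right to left this makes the value of a class well defined; from left to right it
  makes the comparison map injective.\<close>

lemma frac_value_eq_iff:
  assumes ab: "(a, b) \<in> frac_carrier model_ring" and cd: "(c, d) \<in> frac_carrier model_ring"
  shows "frac_value (a, b) = frac_value (c, d) \<longleftrightarrow> a \<otimes>\<^bsub>model_ring\<^esub> d = c \<otimes>\<^bsub>model_ring\<^esub> b"
proof
  have cl: "a \<in> carrier model_ring" "b \<in> carrier model_ring" "c \<in> carrier model_ring" "d \<in> carrier model_ring"
    using assms by (auto simp: frac_carrier_model_ring)
  assume eq: "frac_value (a, b) = frac_value (c, d)"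
  have "\<forall>\<^sub>\<approx>\<tau>\<in>uhp. a (Psi \<tau>) * d (Psi \<tau>) = c (Psi \<tau>) * b (Psi \<tau>)"
    using eventually_frac_value[OF ab] eventually_frac_value[OF cd] by eventually_elim (simp add: eq field_simps)
  hence "a (Psi \<tau>) * d (Psi \<tau>) = c (Psi \<tau>) * b (Psi \<tau>)" if "\<tau> \<in> uhp" for \<tau>
    by (rule cosparse_hol_eq[rotated 2]) (intro holomorphic_intros model_ring_hol cl that)+
  thus "a \<otimes>\<^bsub>model_ring\<^esub> d = c \<otimes>\<^bsub>model_ring\<^esub> b"
    using cl Psi_in_model_curve by (intro model_ring_eqI model_ring_closed) auto
next
  assume eq: "a \<otimes>\<^bsub>model_ring\<^esub> d = c \<otimes>\<^bsub>model_ring\<^esub> b"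
  have eq': "a (Psi \<tau>) * d (Psi \<tau>) = c (Psi \<tau>) * b (Psi \<tau>)" if "\<tau> \<in> uhp" for \<tau>
    using fun_cong[OF eq, of "Psi \<tau>"] Psi_in_model_curve[OF that] by simp
  have "\<forall>\<^sub>\<approx>\<tau>\<in>uhp. a (Psi \<tau>) / b (Psi \<tau>) = c (Psi \<tau>) / d (Psi \<tau>)"
    using eventually_frac_value[OF ab] eventually_frac_value[OF cd] by eventually_elim (use eq' in \<open>simp add: frac_eq_eq\<close>)
  thus "frac_value (a, b) = frac_value (c, d)" unfolding frac_value_def fst_conv snd_conv by (rule uhp_normal_cong)
qed

lemma frac_value_mult:
  assumes ab: "(a, b) \<in> frac_carrier model_ring" and cd: "(c, d) \<in> frac_carrier model_ring"
  shows "frac_value (a \<otimes>\<^bsub>model_ring\<^esub> c, b \<otimes>\<^bsub>model_ring\<^esub> d) = uhp_normal (\<lambda>\<tau>. frac_value (a, b) \<tau> * frac_value (c, d) \<tau>)"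
proof -
  have "\<forall>\<^sub>\<approx>\<tau>\<in>uhp. (a \<otimes>\<^bsub>model_ring\<^esub> c) (Psi \<tau>) / (b \<otimes>\<^bsub>model_ring\<^esub> d) (Psi \<tau>) = frac_value (a, b) \<tau> * frac_value (c, d) \<tau>"
    using eventually_frac_value[OF ab] eventually_frac_value[OF cd] by eventually_elim (simp add: Psi_in_model_curve)
  thus ?thesis unfolding frac_value_def[of "(a \<otimes>\<^bsub>model_ring\<^esub> c, b \<otimes>\<^bsub>model_ring\<^esub> d)"] fst_conv snd_conv by (rule uhp_normal_cong)
qed

lemma frac_value_add:
  assumes ab: "(a, b) \<in> frac_carrier model_ring" and cd: "(c, d) \<in> frac_carrier model_ring"
  shows "frac_value (a \<otimes>\<^bsub>model_ring\<^esub> d \<oplus>\<^bsub>model_ring\<^esub> c \<otimes>\<^bsub>model_ring\<^esub> b, b \<otimes>\<^bsub>model_ring\<^esub> d) = uhp_normal (\<lambda>\<tau>. frac_value (a, b) \<tau> + frac_value (c, d) \<tau>)"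
proof -
  have "\<forall>\<^sub>\<approx>\<tau>\<in>uhp. (a \<otimes>\<^bsub>model_ring\<^esub> d \<oplus>\<^bsub>model_ring\<^esub> c \<otimes>\<^bsub>model_ring\<^esub> b) (Psi \<tau>) / (b \<otimes>\<^bsub>model_ring\<^esub> d) (Psi \<tau>) = frac_value (a, b) \<tau> + frac_value (c, d) \<tau>"
    using eventually_frac_value[OF ab] eventually_frac_value[OF cd] by eventually_elim (simp add: Psi_in_model_curve field_simps)
  thus ?thesis unfolding frac_value_def[of "(a \<otimes>\<^bsub>model_ring\<^esub> d \<oplus>\<^bsub>model_ring\<^esub> c \<otimes>\<^bsub>model_ring\<^esub> b, b \<otimes>\<^bsub>model_ring\<^esub> d)"] fst_conv snd_conv
    by (rule uhp_normal_cong)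
qed

lemma frac_value_modular:
  assumes "(a, b) \<in> frac_carrier model_ring"
  shows "frac_value (a, b) \<in> modular_functions Gamma_2_7"
  unfolding frac_value_def fst_conv snd_conv
proof (rule uhp_normal_in_modular_functions[OF _ frac_value_meromorphic[OF assms]])
  show GS: "Gamma_2_7 \<subseteq> SL2Z" using Gamma_inclusions by blast
  have hm: "hol_modular Gamma_2_7 (\<lambda>\<tau>. e (Psi \<tau>))" if e: "e \<in> carrier model_ring" for e
  proof -
    obtain p where p: "polyfun p" "e = restrict p model_curve" using e by (auto simp: carrier_model_ring_iff)
    show ?thesis by (rule hol_modular_cong[OF hol_modular_polyfun[OF p(1)] GS]) (simp add: p Psi_in_model_curve)
  qed
  have a: "hol_modular Gamma_2_7 (\<lambda>\<tau>. a (Psi \<tau>))" and b: "hol_modular Gamma_2_7 (\<lambda>\<tau>. b (Psi \<tau>))"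
    using assms by (auto simp: frac_carrier_model_ring intro!: hm)
  show "a (Psi (act A \<tau>)) / b (Psi (act A \<tau>)) = a (Psi \<tau>) / b (Psi \<tau>)" if "A \<in> Gamma_2_7" "\<tau> \<in> uhp" for A \<tau>
    using hol_modularD(2)[OF a that] hol_modularD(2)[OF b that] by simp
  show "meromorphic_at_i_infinity (\<lambda>\<tau>. a (Psi (act A \<tau>)) / b (Psi (act A \<tau>)))" if "A \<in> SL2Z" for A
    by (intro mero_inf_divide hol_modularD(3)[OF a that] hol_modularD(3)[OF b that])
qed

lemma frac_value_surj:
  assumes "f \<in> modular_functions Gamma_2_7"
  obtains a b where "(a, b) \<in> frac_carrier model_ring" "frac_value (a, b) = f"
proof -
  obtain P Q where PQ: "polyfun P" "polyfun Q" "\<exists>\<tau>\<in>uhp. Q (Psi \<tau>) \<noteq> 0"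
    and eq: "\<forall>\<^sub>\<approx>\<tau>\<in>uhp. f \<tau> = P (Psi \<tau>) / Q (Psi \<tau>)"
    using modular_function_is_quotient[OF assms] by blast
  have c: "(restrict P model_curve, restrict Q model_curve) \<in> frac_carrier model_ring"
    unfolding frac_carrier_model_ring carrier_model_ring_iff using PQ Psi_in_model_curve by auto
  have "\<forall>\<^sub>\<approx>\<tau>\<in>uhp. restrict P model_curve (Psi \<tau>) / restrict Q model_curve (Psi \<tau>) = f \<tau>"
    using eq eventually_in_cosparse[OF order_refl open_uhp] by eventually_elim (simp add: Psi_in_model_curve)
  hence "frac_value (restrict P model_curve, restrict Q model_curve) = uhp_normal f"
    unfolding frac_value_def fst_conv snd_conv by (rule uhp_normal_cong)
  thus ?thesis using that[OF c] modular_function_uhp_normal[OF assms] by simp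
qed

text \<open>Turns \<open>frac_rel\<close> into equality of modular functions, so that independence
  of representatives follows from the rules for \<open>frac_value\<close>.\<close>

lemma frac_class_model_ring:
  assumes "(a, b) \<in> frac_carrier model_ring"
  shows "frac_class model_ring a b = {x \<in> frac_carrier model_ring. frac_value x = frac_value (a, b)}"
proof (intro Set.set_eqI)
  fix x :: "(complex^3 \<Rightarrow> complex) \<times> (complex^3 \<Rightarrow> complex)"
  obtain c d where x: "x = (c, d)" by (cases x)
  have "x \<in> frac_class model_ring a b \<longleftrightarrow> (c, d) \<in> frac_carrier model_ring \<and> a \<otimes>\<^bsub>model_ring\<^esub> d = c \<otimes>\<^bsub>model_ring\<^esub> b"
    using assms unfolding frac_class_def frac_rel_def x by auto
  also have "\<dots> \<longleftrightarrow> x \<in> {x \<in> frac_carrier model_ring. frac_value x = frac_value (a, b)}"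
    using frac_value_eq_iff[OF assms, of c d] unfolding x by (auto simp del: model_ring_simps)
  finally show "x \<in> frac_class model_ring a b \<longleftrightarrow> x \<in> {x \<in> frac_carrier model_ring. frac_value x = frac_value (a, b)}" .
qed

definition model_iso :: "((complex^3 \<Rightarrow> complex) \<times> (complex^3 \<Rightarrow> complex)) set \<Rightarrow> complex \<Rightarrow> complex" where
  "model_iso X = frac_value (SOME x. x \<in> X)"

lemma model_iso_frac_class:
  assumes "(a, b) \<in> frac_carrier model_ring"
  shows "model_iso (frac_class model_ring a b) = frac_value (a, b)"
proof -
  have "(a, b) \<in> frac_class model_ring a b" using assms by (simp add: frac_class_model_ring)
  hence "(SOME x. x \<in> frac_class model_ring a b) \<in> frac_class model_ring a b" by (rule someI)
  thus ?thesis unfolding model_iso_def frac_class_model_ring[OF assms] by simp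
qed

text \<open>Sums and products in \<open>fraction_field\<close> are unions over all pairs of
  representatives; as each pair gives the same class, the union collapses to it.\<close>

lemma UN_pairs_const:
  assumes "(a, b) \<in> X" "(c, d) \<in> Y"
    "\<And>a b c d. (a, b) \<in> X \<Longrightarrow> (c, d) \<in> Y \<Longrightarrow> F a b c d = K"
  shows "(\<Union>(a, b)\<in>X. \<Union>(c, d)\<in>Y. F a b c d) = K"
  by (intro SUP_eq_const) (use assms in \<open>auto split: prod.splits intro!: SUP_eq_const\<close>)

lemma frac_class_mult_add:
  assumes ab: "(a, b) \<in> frac_carrier model_ring" and cd: "(c, d) \<in> frac_carrier model_ring"
  shows "frac_class model_ring a b \<otimes>\<^bsub>function_field model_curve\<^esub> frac_class model_ring c d = frac_class model_ring (a \<otimes>\<^bsub>model_ring\<^esub> c) (b \<otimes>\<^bsub>model_ring\<^esub> d)"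
    "frac_class model_ring a b \<oplus>\<^bsub>function_field model_curve\<^esub> frac_class model_ring c d = frac_class model_ring (a \<otimes>\<^bsub>model_ring\<^esub> d \<oplus>\<^bsub>model_ring\<^esub> c \<otimes>\<^bsub>model_ring\<^esub> b) (b \<otimes>\<^bsub>model_ring\<^esub> d)"
proof -
  have ne: "(a, b) \<in> frac_class model_ring a b" "(c, d) \<in> frac_class model_ring c d"
    using assms by (simp_all add: frac_class_model_ring)
  have 1: "frac_class model_ring (a' \<otimes>\<^bsub>model_ring\<^esub> c') (b' \<otimes>\<^bsub>model_ring\<^esub> d') = frac_class model_ring (a \<otimes>\<^bsub>model_ring\<^esub> c) (b \<otimes>\<^bsub>model_ring\<^esub> d) \<and>
      frac_class model_ring (a' \<otimes>\<^bsub>model_ring\<^esub> d' \<oplus>\<^bsub>model_ring\<^esub> c' \<otimes>\<^bsub>model_ring\<^esub> b') (b' \<otimes>\<^bsub>model_ring\<^esub> d') = frac_class model_ring (a \<otimes>\<^bsub>model_ring\<^esub> d \<oplus>\<^bsub>model_ring\<^esub> c \<otimes>\<^bsub>model_ring\<^esub> b) (b \<otimes>\<^bsub>model_ring\<^esub> d)"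
    if "(a', b') \<in> frac_class model_ring a b" "(c', d') \<in> frac_class model_ring c d" for a' b' c' d'
  proof -
    have ab': "(a', b') \<in> frac_carrier model_ring" "frac_value (a', b') = frac_value (a, b)" using that(1) frac_class_model_ring[OF ab] by auto
    have cd': "(c', d') \<in> frac_carrier model_ring" "frac_value (c', d') = frac_value (c, d)" using that(2) frac_class_model_ring[OF cd] by auto
    show ?thesis
      unfolding frac_class_model_ring[OF frac_carrier_closed(1)[OF ab'(1) cd'(1)]] frac_class_model_ring[OF frac_carrier_closed(1)[OF ab cd]]
        frac_class_model_ring[OF frac_carrier_closed(2)[OF ab'(1) cd'(1)]] frac_class_model_ring[OF frac_carrier_closed(2)[OF ab cd]]
        frac_value_mult[OF ab'(1) cd'(1)] frac_value_mult[OF ab cd] frac_value_add[OF ab'(1) cd'(1)] frac_value_add[OF ab cd] ab'(2) cd'(2) by blast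
  qed
  show "frac_class model_ring a b \<otimes>\<^bsub>function_field model_curve\<^esub> frac_class model_ring c d = frac_class model_ring (a \<otimes>\<^bsub>model_ring\<^esub> c) (b \<otimes>\<^bsub>model_ring\<^esub> d)"
    unfolding function_field_def fraction_field_def monoid.simps
    by (rule UN_pairs_const[OF ne]) (rule conjunct1[OF 1])
  show "frac_class model_ring a b \<oplus>\<^bsub>function_field model_curve\<^esub> frac_class model_ring c d = frac_class model_ring (a \<otimes>\<^bsub>model_ring\<^esub> d \<oplus>\<^bsub>model_ring\<^esub> c \<otimes>\<^bsub>model_ring\<^esub> b) (b \<otimes>\<^bsub>model_ring\<^esub> d)"
    unfolding function_field_def fraction_field_def ring.simps
    by (rule UN_pairs_const[OF ne]) (rule conjunct2[OF 1])
qed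

lemma function_field_carrierE:
  assumes "X \<in> carrier (function_field model_curve)"
  obtains a b where "(a, b) \<in> frac_carrier model_ring" "X = frac_class model_ring a b"
  using assms unfolding function_field_def fraction_field_def by (auto simp: quotient_def frac_class_def)

lemma frac_class_in_carrier:
  "(a, b) \<in> frac_carrier model_ring \<Longrightarrow> frac_class model_ring a b \<in> carrier (function_field model_curve)"
  unfolding function_field_def fraction_field_def by (auto simp: quotient_def frac_class_def)

lemma modular_function_field_simps:
  "carrier (modular_function_field G) = modular_functions G"
  "f \<otimes>\<^bsub>modular_function_field G\<^esub> g = uhp_normal (\<lambda>\<tau>. f \<tau> * g \<tau>)"
  "f \<oplus>\<^bsub>modular_function_field G\<^esub> g = uhp_normal (\<lambda>\<tau>. f \<tau> + g \<tau>)"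
  "\<one>\<^bsub>modular_function_field G\<^esub> = uhp_normal (\<lambda>_. 1)"
  by (simp_all add: modular_function_field_def)

lemma regular_frac_carrier: "polyfun p \<Longrightarrow> (restrict p model_curve, \<one>\<^bsub>model_ring\<^esub>) \<in> frac_carrier model_ring"
  unfolding frac_carrier_model_ring
  by (intro conjI bexI[of _ \<i>]) (use model_ring_const[of 1] Psi_in_model_curve in \<open>auto simp: carrier_model_ring_iff\<close>)

lemma model_iso_regular:
  assumes "polyfun p"
  shows "model_iso (regular_function model_curve p) = uhp_normal (\<lambda>\<tau>. p (Psi \<tau>))"
proof -
  have "model_iso (regular_function model_curve p) = frac_value (restrict p model_curve, \<one>\<^bsub>model_ring\<^esub>)"
    unfolding regular_function_def by (rule model_iso_frac_class[OF regular_frac_carrier[OF assms]])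
  also have "\<dots> = uhp_normal (\<lambda>\<tau>. p (Psi \<tau>))"
    unfolding frac_value_def
    by (intro uhp_normal_cong eventually_mono[OF eventually_in_cosparse[OF order_refl open_uhp]]) (simp add: Psi_in_model_curve)
  finally show ?thesis .
qed

lemma model_iso_ring_iso: "model_iso \<in> ring_iso (function_field model_curve) (modular_function_field Gamma_2_7)"
proof -
  have "model_iso \<in> ring_hom (function_field model_curve) (modular_function_field Gamma_2_7)"
  proof (rule ring_hom_memI)
    fix X assume "X \<in> carrier (function_field model_curve)"
    then obtain a b where "(a, b) \<in> frac_carrier model_ring" "X = frac_class model_ring a b" by (rule function_field_carrierE)
    thus "model_iso X \<in> carrier (modular_function_field Gamma_2_7)"
      unfolding modular_function_field_simps by (simp add: model_iso_frac_class frac_value_modular)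
  next
    fix X Y assume "X \<in> carrier (function_field model_curve)" "Y \<in> carrier (function_field model_curve)"
    then obtain a b c d where ab: "(a, b) \<in> frac_carrier model_ring" "X = frac_class model_ring a b"
      and cd: "(c, d) \<in> frac_carrier model_ring" "Y = frac_class model_ring c d" by (meson function_field_carrierE)
    show "model_iso (X \<otimes>\<^bsub>function_field model_curve\<^esub> Y) = model_iso X \<otimes>\<^bsub>modular_function_field Gamma_2_7\<^esub> model_iso Y"
      unfolding ab(2) cd(2) frac_class_mult_add[OF ab(1) cd(1)] modular_function_field_simps
        model_iso_frac_class[OF ab(1)] model_iso_frac_class[OF cd(1)] model_iso_frac_class[OF frac_carrier_closed(1)[OF ab(1) cd(1)]]
      by (rule frac_value_mult[OF ab(1) cd(1)])
    show "model_iso (X \<oplus>\<^bsub>function_field model_curve\<^esub> Y) = model_iso X \<oplus>\<^bsub>modular_function_field Gamma_2_7\<^esub> model_iso Y"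
      unfolding ab(2) cd(2) frac_class_mult_add[OF ab(1) cd(1)] modular_function_field_simps
        model_iso_frac_class[OF ab(1)] model_iso_frac_class[OF cd(1)] model_iso_frac_class[OF frac_carrier_closed(2)[OF ab(1) cd(1)]]
      by (rule frac_value_add[OF ab(1) cd(1)])
  next
    have "\<one>\<^bsub>function_field model_curve\<^esub> = regular_function model_curve (\<lambda>_. 1)"
      by (simp add: function_field_def fraction_field_def regular_function_def)
    thus "model_iso \<one>\<^bsub>function_field model_curve\<^esub> = \<one>\<^bsub>modular_function_field Gamma_2_7\<^esub>"
      using model_iso_regular[OF polyfun.const] by (simp add: modular_function_field_simps)
  qed
  moreover have "bij_betw model_iso (carrier (function_field model_curve)) (carrier (modular_function_field Gamma_2_7))"
    unfolding modular_function_field_simps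
  proof (rule bij_betw_imageI)
    show "inj_on model_iso (carrier (function_field model_curve))"
    proof (rule inj_onI)
      fix X Y assume "X \<in> carrier (function_field model_curve)" "Y \<in> carrier (function_field model_curve)" and eq: "model_iso X = model_iso Y"
      then obtain a b c d where ab: "(a, b) \<in> frac_carrier model_ring" "X = frac_class model_ring a b"
        and cd: "(c, d) \<in> frac_carrier model_ring" "Y = frac_class model_ring c d" by (meson function_field_carrierE)
      have "frac_value (a, b) = frac_value (c, d)" using eq ab cd by (simp add: model_iso_frac_class)
      thus "X = Y" unfolding ab(2) cd(2) frac_class_model_ring[OF ab(1)] frac_class_model_ring[OF cd(1)] by simp
    qed
    show "model_iso ` carrier (function_field model_curve) = modular_functions Gamma_2_7"
    proof (intro Set.set_eqI iffI)
      fix f assume "f \<in> model_iso ` carrier (function_field model_curve)"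
      then obtain a b where "(a, b) \<in> frac_carrier model_ring" "f = model_iso (frac_class model_ring a b)"
        using function_field_carrierE by (metis (no_types, lifting) imageE)
      thus "f \<in> modular_functions Gamma_2_7" by (simp add: model_iso_frac_class frac_value_modular)
    next
      fix f assume "f \<in> modular_functions Gamma_2_7"
      then obtain a b where "(a, b) \<in> frac_carrier model_ring" "frac_value (a, b) = f" by (rule frac_value_surj)
      thus "f \<in> model_iso ` carrier (function_field model_curve)"
        using model_iso_frac_class frac_class_in_carrier by (metis imageI)
    qed
  qed
  ultimately show ?thesis by (simp add: ring_iso_def)
qed

section \<open>Irreducibility and dimension of the curve\<close>

lemma algebraic_set_Un:
  assumes "algebraic_set A" "algebraic_set B"
  shows "algebraic_set (A \<union> B)"
proof -
  obtain S T where S: "\<forall>p\<in>S. polyfun p" "A = {x. \<forall>p\<in>S. p x = 0}" and T: "\<forall>p\<in>T. polyfun p" "B = {x. \<forall>p\<in>T. p x = 0}"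
    using assms unfolding algebraic_set_def by blast
  show ?thesis
    unfolding algebraic_set_def
  proof (intro exI conjI ballI)
    show "polyfun r" if "r \<in> (\<lambda>(p, q) x. p x * q x) ` (S \<times> T)" for r
      using that S(1) T(1) by (auto intro!: polyfun.mult)
    show "A \<union> B = {x. \<forall>r\<in>(\<lambda>(p, q) x. p x * q x) ` (S \<times> T). r x = 0}"
      unfolding S(2) T(2) by auto
  qed
qed

lemma algebraic_set_singleton: "algebraic_set {v}"
  unfolding algebraic_set_def
proof (intro exI conjI ballI)
  show "polyfun p" if "p \<in> range (\<lambda>i x. x $ i - v $ i)" for p
    using that by (auto intro!: polyfun_diff polyfun.intros)
  show "{v} = {x. \<forall>p\<in>range (\<lambda>i x. x $ i - v $ i). p x = 0}" by (auto simp: vec_eq_iff)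
qed

lemma algebraic_set_finite: "finite W \<Longrightarrow> algebraic_set W"
proof (induction rule: finite_induct)
  case empty
  show ?case unfolding algebraic_set_def by (rule exI[of _ "{\<lambda>_. 1}"]) (auto intro: polyfun.const)
next
  case (insert v W)
  thus ?case using algebraic_set_Un[OF algebraic_set_singleton[of v] insert.IH] by simp
qed

lemma affine_variety_singleton: "affine_variety {v}"
  unfolding affine_variety_def using algebraic_set_singleton by blast

text \<open>Splitting off a point writes a finite set as a union of two algebraic sets, and
  irreducibility leaves only the point.\<close>

lemma finite_affine_variety:
  assumes "affine_variety W" "finite W"
  obtains v where "W = {v}"
proof -
  obtain v where v: "v \<in> W" using assms(1) unfolding affine_variety_def by blast
  have "W = {v} \<union> (W - {v})" using v by blast
  moreover have "algebraic_set {v}" "algebraic_set (W - {v})" using assms(2) by (auto intro!: algebraic_set_finite)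
  ultimately have "W = {v} \<or> W = W - {v}" using assms(1) unfolding affine_variety_def by blast
  thus ?thesis using that v by blast
qed

lemma algebraic_set_model_curve: "algebraic_set model_curve"
  unfolding algebraic_set_def
proof (intro exI conjI)
  let ?S = "{\<lambda>v::complex^3. cub (v$2) (v$3), \<lambda>v. (v$1) ^ 7 - (v$2) ^ 4 * (v$2 - 1)}"
  show "\<forall>p\<in>?S. polyfun p"
    unfolding cub_def by (auto intro!: polyfun_diff polyfun_power polyfun.intros)
  show "model_curve = {x. \<forall>p\<in>?S. p x = 0}" by (auto simp: model_curve_def)
qed

lemma algebraic_set_separating:
  assumes "algebraic_set A" "A \<subset> model_curve"
  obtains p where "polyfun p" "\<And>v. v \<in> A \<Longrightarrow> p v = 0" "\<exists>\<tau>\<in>uhp. p (Psi \<tau>) \<noteq> 0"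
proof -
  obtain S where S: "\<forall>p\<in>S. polyfun p" "A = {x. \<forall>p\<in>S. p x = 0}" using assms(1) unfolding algebraic_set_def by blast
  obtain v where v: "v \<in> model_curve" "v \<notin> A" using assms(2) by blast
  then obtain p where p: "p \<in> S" "p v \<noteq> 0" using S(2) by blast
  show ?thesis
    by (rule that[of p]) (use S p v polyfun_vanishes_on_model_curve[of p v] in auto)
qed

text \<open>Two proper closed subsets lie in the zero sets of polynomials p and q that do not vanish
  identically along \<open>Psi\<close>. If the subsets covered the curve, p q would vanish along
  \<open>Psi\<close>, against the absence of zero divisors.\<close>

lemma affine_variety_model_curve: "affine_variety model_curve"
  unfolding affine_variety_def
proof (intro conjI allI impI)
  show "algebraic_set model_curve" by (rule algebraic_set_model_curve)
  show "model_curve \<noteq> {}" using Psi_in_model_curve[OF i_in_uhp] by blast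
  fix A B assume AB: "algebraic_set A \<and> algebraic_set B \<and> model_curve = A \<union> B"
  show "model_curve = A \<or> model_curve = B"
  proof (rule ccontr)
    assume "\<not> ?thesis"
    hence "A \<subset> model_curve" "B \<subset> model_curve" using AB by auto
    obtain p where p: "polyfun p" "\<And>v. v \<in> A \<Longrightarrow> p v = 0" "\<exists>\<tau>\<in>uhp. p (Psi \<tau>) \<noteq> 0"
      using algebraic_set_separating[of A] AB \<open>A \<subset> model_curve\<close> by blast
    obtain q where q: "polyfun q" "\<And>v. v \<in> B \<Longrightarrow> q v = 0" "\<exists>\<tau>\<in>uhp. q (Psi \<tau>) \<noteq> 0"
      using algebraic_set_separating[of B] AB \<open>B \<subset> model_curve\<close> by blast
    have "\<exists>\<tau>\<in>uhp. p (Psi \<tau>) * q (Psi \<tau>) \<noteq> 0" by (intro hol_mult_nonzero polyfun_hol p q)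
    thus False using p(2) q(2) AB Psi_in_model_curve by (metis UnE mult_eq_0_iff)
  qed
qed

text \<open>A polynomial that vanishes on W but not along all of \<open>Psi\<close> has its zeros in
  finitely many orbits, and \<open>Psi\<close> sends each orbit to one point.\<close>

lemma proper_algebraic_subset_finite:
  assumes "algebraic_set W" "W \<subset> model_curve"
  shows "finite W"
proof -
  obtain p where p: "polyfun p" "\<And>v. v \<in> W \<Longrightarrow> p v = 0" "\<exists>\<tau>\<in>uhp. p (Psi \<tau>) \<noteq> 0"
    using algebraic_set_separating[OF assms] by blast
  obtain Z where Z: "finite Z" "Z \<subseteq> uhp"
    "\<And>\<tau>. \<tau> \<in> uhp \<Longrightarrow> p (Psi \<tau>) = 0 \<Longrightarrow> \<exists>z\<in>Z. \<exists>\<gamma>\<in>principal_Gamma 14. \<tau> = act \<gamma> z"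
    using hol_modular_zeros_finite[OF hol_modular_polyfun[OF p(1)] p(3)] by blast
  obtain E where E: "finite E" "model_curve - E \<subseteq> Psi ` uhp" using Psi_image_cofinite by blast
  have "W \<subseteq> E \<union> Psi ` Z"
  proof
    fix w assume w: "w \<in> W"
    show "w \<in> E \<union> Psi ` Z"
    proof (cases "w \<in> E")
      case False
      then obtain \<tau> where \<tau>: "\<tau> \<in> uhp" "w = Psi \<tau>" using E(2) w assms(2) by blast
      then obtain z \<gamma> where z: "z \<in> Z" "\<gamma> \<in> principal_Gamma 14" "\<tau> = act \<gamma> z" using Z(3)[of \<tau>] p(2)[OF w] by blast
      have "\<gamma> \<in> Gamma_2_7" "z \<in> uhp" using z Z(2) Gamma_inclusions by blast+
      hence "Psi \<tau> = Psi z"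
        unfolding z(3) by (intro vec3_eqI) (simp_all add: hol_modularD(2)[OF hol_modular_Gamma_2_7(1)]
          hol_modularD(2)[OF hol_modular_Gamma_2_7(2)] hol_modularD(2)[OF hol_modular_Gamma_2_7(3)])
      thus ?thesis using \<tau>(2) z(1) by blast
    qed simp
  qed
  thus ?thesis using E(1) Z(1) finite_subset by blast
qed

text \<open>Proper subvarieties are finite, hence points, which bounds the length of chains; a point
  is a proper subvariety because no point of the curve is isolated.\<close>

lemma affine_curve_model_curve: "affine_curve model_curve"
  unfolding affine_curve_def
proof (intro conjI notI)
  show "affine_variety model_curve" by (rule affine_variety_model_curve)
  have v: "Psi \<i> \<in> model_curve" by (rule Psi_in_model_curve) simp
  have "Psi \<i> \<in> closure (model_curve - {Psi \<i>})" by (rule model_curve_no_isolated_points[OF v]) simp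
  hence "model_curve - {Psi \<i>} \<noteq> {}" by (metis closure_empty empty_iff)
  thus "\<exists>W. affine_variety W \<and> W \<subset> model_curve"
    by (intro exI[of _ "{Psi \<i>}"]) (use v affine_variety_singleton in blast)
  assume "\<exists>W\<^sub>0 W\<^sub>1. affine_variety W\<^sub>0 \<and> affine_variety W\<^sub>1 \<and> W\<^sub>0 \<subset> W\<^sub>1 \<and> W\<^sub>1 \<subset> model_curve"
  then obtain W\<^sub>0 W\<^sub>1 where W: "affine_variety W\<^sub>0" "affine_variety W\<^sub>1" "W\<^sub>0 \<subset> W\<^sub>1" "W\<^sub>1 \<subset> model_curve" by blast
  have "finite W\<^sub>1" using proper_algebraic_subset_finite[OF _ W(4)] W(2) unfolding affine_variety_def by blast
  then obtain v where "W\<^sub>1 = {v}" using finite_affine_variety[OF W(2)] by blast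
  hence "W\<^sub>0 = {}" using W(3) by blast
  thus False using W(1) unfolding affine_variety_def by blast
qed

theorem proposition4p1:
  shows "(\<exists>t. affine_model (Gamma0 2 \<inter> principal_Gamma 7)
           (\<lambda>i::3. if i = 1 then psi else if i = 2 then upsilon else t)
           {vector [x, y, z] |x y z.
              2 * y * (y - 1) * z ^ 3 - (y\<^sup>2 - y - 1) * z\<^sup>2 - 2 * y * z + y = 0 \<and>
              x ^ 7 = y ^ 4 * (y - 1)}) \<and>
         (\<forall>(y::complex) (z::complex) T. y \<noteq> 0 \<longrightarrow> z \<noteq> 0 \<longrightarrow> T = 1 / z - 1 \<longrightarrow>
           (2 * y * (y - 1) * z ^ 3 - (y\<^sup>2 - y - 1) * z\<^sup>2 - 2 * y * z + y = 0 \<longleftrightarrow>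
            T ^ 3 + T\<^sup>2 - (y\<^sup>2 - 1) / y * T + (y - 1)\<^sup>2 / y = 0))"
proof (intro conjI allI impI)
  have V: "{vector [x, y, z] |x y z.
              2 * y * (y - 1) * z ^ 3 - (y\<^sup>2 - y - 1) * z\<^sup>2 - 2 * y * z + y = 0 \<and>
              x ^ 7 = y ^ 4 * (y - 1)} = model_curve"
  proof (intro Set.set_eqI iffI)
    fix v :: "complex^3" assume "v \<in> model_curve"
    moreover have "v = vector [v$1, v$2, v$3]" by (intro vec3_eqI) simp_all
    ultimately show "v \<in> {vector [x, y, z] |x y z.
              2 * y * (y - 1) * z ^ 3 - (y\<^sup>2 - y - 1) * z\<^sup>2 - 2 * y * z + y = 0 \<and>
              x ^ 7 = y ^ 4 * (y - 1)}" unfolding model_curve_def cub_def by blast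
  qed (auto simp: model_curve_def cub_def)
  \<comment> \<open>Both sides agree with \<open>psi0\<close> and \<open>ups0\<close> on the upper
    half-plane and are 0 elsewhere.\<close>
  have coords: "psi = uhp_normal psi0" "upsilon = uhp_normal ups0"
    using psi_eq ups_eq uhp_normal_hol[OF psi0_holomorphic] uhp_normal_hol[OF ups0_holomorphic]
    by (auto simp: fun_eq_iff psi_def upsilon_def uhp_normal_def)
  have "model_iso (regular_function model_curve (\<lambda>x. x $ i)) =
      (if i = 1 then psi else if i = 2 then upsilon else uhp_normal tee)" for i :: 3
    unfolding model_iso_regular[OF polyfun.coord] coords using exhaust_3[of i] by auto
  thus "\<exists>t. affine_model (Gamma0 2 \<inter> principal_Gamma 7)
           (\<lambda>i::3. if i = 1 then psi else if i = 2 then upsilon else t)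
           {vector [x, y, z] |x y z.
              2 * y * (y - 1) * z ^ 3 - (y\<^sup>2 - y - 1) * z\<^sup>2 - 2 * y * z + y = 0 \<and>
              x ^ 7 = y ^ 4 * (y - 1)}"
    unfolding V Gamma_2_7_def[symmetric] affine_model_def
    using affine_curve_model_curve model_iso_ring_iso model_iso_regular[OF polyfun.const]
    by (intro exI[of _ "uhp_normal tee"] conjI bexI[of _ model_iso]) auto
next
  fix y z T :: complex assume y: "y \<noteq> 0" and z: "z \<noteq> 0" and T: "T = 1 / z - 1"
  define R where "R = T ^ 3 + T\<^sup>2 - (y\<^sup>2 - 1) / y * T + (y - 1)\<^sup>2 / y"
  \<comment> \<open>As z is the inverse of 1 + T, the cubic in z times (1 + T)^3 is y times the
    cubic in T.\<close>
  have zT: "z * (1 + T) = 1" using z by (simp add: T)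
  have "(1 + T) ^ 3 * cub y z = 2 * y * (y - 1) - (y\<^sup>2 - y - 1) * (1 + T) - 2 * y * (1 + T)\<^sup>2 + y * (1 + T) ^ 3"
    unfolding cub_scale[of "1 + T"] zT by simp
  also have "\<dots> = y * T ^ 3 + y * T\<^sup>2 - (y\<^sup>2 - 1) * T + (y - 1)\<^sup>2"
    by (simp add: algebra_simps power2_eq_square power3_eq_cube)
  also have "\<dots> = y * R" unfolding R_def using y by (simp add: field_simps power2_eq_square)
  finally have "(1 + T) ^ 3 * cub y z = y * R" .
  moreover have "1 + T \<noteq> 0" using zT by auto
  ultimately have "cub y z = 0 \<longleftrightarrow> R = 0" using y by (metis mult_eq_0_iff power_not_zero)
  thus "2 * y * (y - 1) * z ^ 3 - (y\<^sup>2 - y - 1) * z\<^sup>2 - 2 * y * z + y = 0 \<longleftrightarrow>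
            T ^ 3 + T\<^sup>2 - (y\<^sup>2 - 1) / y * T + (y - 1)\<^sup>2 / y = 0"
    unfolding cub_def R_def .
qed

end
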